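(* Let $k\in\mathbb C$, $k\neq-3$, $k\notin\mathbb Z_{\ge0}$, and $a,b\in\mathbb Z_{\ge0}$. Put $$x=\frac{b-a}{3},\qquad y=\frac{(b-a)^2-3(a+b)(2(k+1)-a-b)}{12(k+3)}-\frac{b-a}{6}.$$ Then: (i) $H_{f_{min}}\big(L_k^{\mathfrak{sl}_3}(a\omega_1+b\omega_2)\big)=L[x,y]$; (ii) $L_k^{\mathfrak{sl}_3}(a\omega_1+b\omega_2)$ is an $L_k(\mathfrak{sl}_3)$-module if and only if $L[x,y]$ is a $\mathcal W_k$-module.
   Context: $\omega_1,\omega_2$ are the fundamental weights of $\mathfrak{sl}_3$; $L_k^{\mathfrak{sl}_3}(\lambda)$ is the irreducible highest weight $\widehat{\mathfrak{sl}}_3$-module of level $k$ whose top component is the irreducible $\mathfrak{sl}_3$-module of highest weight $\lambda$; $L_k(\mathfrak{sl}_3)$ is the simple quotient of the universal affine vertex algebra $V^k(\mathfrak{sl}_3)$. $H_{f_{min}}$ is the (Kac-Roan-Wakimoto) quantum Hamiltonian reduction functor attached to a minimal nilpotent element of $\mathfrak{sl}_3$, sending $V^k(\mathfrak{sl}_3)$-modules to $\mathcal W^k$-modules, with $H_{f_{min}}(V^k(\mathfrak{sl}_3))=\mathcal W^k$ the universal Bershadsky-Polyakov algebra. For $k\neq-3$, $\mathcal W^k$ is freely and strongly generated by $J,G^\pm,L^{\rm BP}$ where $L^{\rm BP}$ is a Virasoro field of central charge $-\frac{(2k+3)(3k+1)}{k+3}$; $J$, $G^\pm$ are primary of weights $1$,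 $\frac32$; $J(z)J(w)\sim\frac{2k+3}{3(z-w)^2}$; $J(z)G^\pm(w)\sim\frac{\pm G^\pm(w)}{z-w}$; $G^\pm(z)G^\pm(w)\sim0$; and $$G^+(z)G^-(w)\sim\frac{(k+1)(2k+3)}{(z-w)^3}+\frac{3(k+1)J(w)}{(z-w)^2}+\frac{1}{z-w}\Big(3{:}J(w)^2{:}+\tfrac{3(k+1)}2\partial J(w)-(k+3)L^{\rm BP}(w)\Big).$$ $\mathcal W_k$ is its simple quotient. Put $\widetilde L=L^{\rm BP}+\frac12\partial J$ and $J(z)=\sum J(n)z^{-n-1}$, $\widetilde L(z)=\sum\widetilde L(n)z^{-n-2}$, $G^+(z)=\sum G^+(n)z^{-n-1}$, $G^-(z)=\sum G^-(n)z^{-n-2}$. $L[x,y]$ is the irreducible highest weight $\mathcal W^k$-module with highest weight vector $v$: $J(0)v=xv$, $\widetilde L(0)v=yv$, $G^+(n+1)v=G^-(n)v=J(n+1)v=\widetilde L(n+1)v=0$ for $n\ge0$. *)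

theory Defs
  imports
    "HOL-Analysis.Analysis"
    "HOL-Library.Poly_Mapping"
    "HOL-Library.Groups_Big_Fun"
begin

section \<open>Complex vector spaces\<close>

class complex_vector = ab_group_add +
  fixes scaleC :: "complex \<Rightarrow> 'a \<Rightarrow> 'a" (infixr \<open>*\<^sub>C\<close> 75)
  assumes scaleC_add_right: "c *\<^sub>C (x + y) = c *\<^sub>C x + c *\<^sub>C y"
    and scaleC_add_left: "(c + d) *\<^sub>C x = c *\<^sub>C x + d *\<^sub>C x"
    and scaleC_scaleC: "c *\<^sub>C d *\<^sub>C x = (c * d) *\<^sub>C x"
    and scaleC_one: "1 *\<^sub>C x = x"

interpretation cvs: vector_space "scaleC :: complex \<Rightarrow> 'a::complex_vector \<Rightarrow> 'a"
  by unfold_locales (simp_all add: scaleC_add_right scaleC_add_left scaleC_scaleC scaleC_one)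

instantiation complex :: complex_vector
begin
definition scaleC_complex :: "complex \<Rightarrow> complex \<Rightarrow> complex" where
  "scaleC_complex c z = c * z"
instance by standard (simp_all add: scaleC_complex_def algebra_simps)
end

instantiation vec :: (complex_vector, finite) complex_vector
begin
definition scaleC_vec :: "complex \<Rightarrow> ('a, 'b) vec \<Rightarrow> ('a, 'b) vec" where
  "scaleC_vec c A = (\<chi> i. c *\<^sub>C (A $ i))"
instance
  by standard (simp_all add: scaleC_vec_def vec_eq_iff scaleC_add_right scaleC_add_left
      scaleC_scaleC scaleC_one)
end

instantiation poly_mapping :: (type, complex_vector) complex_vector
begin
definition scaleC_poly_mapping :: "complex \<Rightarrow> ('a \<Rightarrow>\<^sub>0 'b) \<Rightarrow> ('a \<Rightarrow>\<^sub>0 'b)" where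
  "scaleC_poly_mapping c p = Poly_Mapping.map (scaleC c) p"
instance
proof
  have lk: "Poly_Mapping.lookup (c *\<^sub>C p) i = c *\<^sub>C Poly_Mapping.lookup p i"
    for c and p :: "'a \<Rightarrow>\<^sub>0 'b" and i
    by (auto simp: scaleC_poly_mapping_def Poly_Mapping.map.rep_eq when_def)
  fix c d :: complex and x y :: "'a \<Rightarrow>\<^sub>0 'b"
  show "c *\<^sub>C (x + y) = c *\<^sub>C x + c *\<^sub>C y"
    by (rule poly_mapping_eqI) (simp add: lk lookup_add scaleC_add_right)
  show "(c + d) *\<^sub>C x = c *\<^sub>C x + d *\<^sub>C x"
    by (rule poly_mapping_eqI) (simp add: lk lookup_add scaleC_add_left)
  show "c *\<^sub>C d *\<^sub>C x = (c * d) *\<^sub>C x"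
    by (rule poly_mapping_eqI) (simp add: lk scaleC_scaleC)
  show "1 *\<^sub>C x = x"
    by (rule poly_mapping_eqI) (simp add: lk scaleC_one)
qed
end

text \<open>Linearity on a subset; it is only applied to subspaces.\<close>
definition clinear_on :: "'a::complex_vector set \<Rightarrow> ('a \<Rightarrow> 'b::complex_vector) \<Rightarrow> bool" where
  "clinear_on S f \<longleftrightarrow> (\<forall>c. \<forall>x\<in>S. \<forall>y\<in>S. f (c *\<^sub>C x + y) = c *\<^sub>C f x + f y)"

text \<open>A vector space presented by generators \<open>g i\<close>, \<open>i \<in> I\<close>, and relations \<open>R\<close>: the map from
  the free vector space on \<open>I\<close> is onto, and its kernel is spanned by \<open>R\<close>.\<close>

definition lin_ext :: "('i \<Rightarrow> 'a::complex_vector) \<Rightarrow> ('i \<Rightarrow>\<^sub>0 complex) \<Rightarrow> 'a" where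
  "lin_ext g p = (\<Sum>i\<in>Poly_Mapping.keys p. Poly_Mapping.lookup p i *\<^sub>C g i)"

definition presented_by ::
    "'i set \<Rightarrow> ('i \<Rightarrow> 'a::complex_vector) \<Rightarrow> ('i \<Rightarrow>\<^sub>0 complex) set \<Rightarrow> bool" where
  "presented_by I g R \<longleftrightarrow>
     lin_ext g ` {p. Poly_Mapping.keys p \<subseteq> I} = UNIV \<and>
     {p. Poly_Mapping.keys p \<subseteq> I \<and> lin_ext g p = 0} = cvs.span R"

abbreviation free_gen :: "'i \<Rightarrow> ('i \<Rightarrow>\<^sub>0 complex)" where
  "free_gen i \<equiv> Poly_Mapping.single i 1"

definition tensor_relations :: "('a::complex_vector \<times> 'b::complex_vector \<Rightarrow>\<^sub>0 complex) set" where
  "tensor_relations =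
     {free_gen (c *\<^sub>C x + y, z) - c *\<^sub>C free_gen (x, z) - free_gen (y, z) | c x y z. True} \<union>
     {free_gen (x, c *\<^sub>C y + z) - c *\<^sub>C free_gen (x, y) - free_gen (x, z) | c x y z. True}"

text \<open>\<open>t\<close> exhibits its codomain as the tensor product of its two argument spaces.\<close>
definition tensor_product ::
    "('a::complex_vector \<Rightarrow> 'b::complex_vector \<Rightarrow> 'c::complex_vector) \<Rightarrow> bool" where
  "tensor_product t \<longleftrightarrow> presented_by UNIV (\<lambda>(x, y). t x y) tensor_relations"


section \<open>Vertex superalgebras and their modules\<close>

text \<open>\<open>mode V a n b\<close> is the \<open>n\<close>-th product $a_{(n)}b$, where
  $Y(a,z)=\sum_n a_{(n)}z^{-n-1}$.  \<open>par V False\<close> and \<open>par V True\<close> are the even and the odd part.\<close>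

record 'v vosa =
  vac :: 'v
  mode :: "'v \<Rightarrow> int \<Rightarrow> 'v \<Rightarrow> 'v"
  par :: "bool \<Rightarrow> 'v set"

text \<open>All sums in the Borcherds identity have finite support by truncation.\<close>
definition va_module ::
    "('v::complex_vector) vosa \<Rightarrow> ('v \<Rightarrow> int \<Rightarrow> 'm \<Rightarrow> 'm::complex_vector) \<Rightarrow> bool" where
  "va_module V Y \<longleftrightarrow>
     (\<forall>n m. clinear_on UNIV (\<lambda>a. Y a n m)) \<and>
     (\<forall>a n. clinear_on UNIV (Y a n)) \<and>
     (\<forall>n m. Y (vac V) n m = (if n = -1 then m else 0)) \<and>
     (\<forall>a m. \<exists>N. \<forall>n\<ge>N. Y a n m = 0) \<and>
     (\<forall>p q. \<forall>a\<in>par V p. \<forall>b\<in>par V q. \<forall>l m n. \<forall>c.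
        Sum_any (\<lambda>j::nat. (of_int m gchoose j) *\<^sub>C
                   Y (mode V a (l + int j) b) (m + n - int j) c)
        = Sum_any (\<lambda>j::nat. ((-1) ^ j * (of_int l gchoose j)) *\<^sub>C
                   Y a (m + l - int j) (Y b (n + int j) c))
          - ((-1) powi l * (if p \<and> q then -1 else 1)) *\<^sub>C
            Sum_any (\<lambda>j::nat. ((-1) ^ j * (of_int l gchoose j)) *\<^sub>C
                   Y b (n + l - int j) (Y a (m + int j) c)))"

definition vertex_superalgebra :: "('v::complex_vector) vosa \<Rightarrow> bool" where
  "vertex_superalgebra V \<longleftrightarrow>
     cvs.subspace (par V False) \<and> cvs.subspace (par V True) \<and>
     par V False \<inter> par V True = {0} \<and>
     (\<forall>v. \<exists>a\<in>par V False. \<exists>b\<in>par V True. v = a + b) \<and>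
     vac V \<in> par V False \<and>
     (\<forall>p q n. \<forall>a\<in>par V p. \<forall>b\<in>par V q. mode V a n b \<in> par V (p \<noteq> q)) \<and>
     va_module V (mode V) \<and>
     (\<forall>a. mode V a (-1) (vac V) = a \<and> (\<forall>n\<ge>0. mode V a n (vac V) = 0))"

definition vertex_algebra :: "('v::complex_vector) vosa \<Rightarrow> bool" where
  "vertex_algebra V \<longleftrightarrow> vertex_superalgebra V \<and> par V True = {0}"

abbreviation (input) normal_product :: "'v vosa \<Rightarrow> 'v \<Rightarrow> 'v \<Rightarrow> 'v" where
  "normal_product V a b \<equiv> mode V a (-1) b"

definition transl :: "'v vosa \<Rightarrow> 'v \<Rightarrow> 'v" where
  "transl V a = mode V a (-2) (vac V)"

text \<open>\<open>ope V a b [c\<^sub>0, c\<^sub>1, \<dots>]\<close> means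
  $a(z)b(w)\sim\sum_j c_j(w)\,(z-w)^{-j-1}$; the coefficients are listed by increasing pole order.\<close>
definition ope :: "('v::complex_vector) vosa \<Rightarrow> 'v \<Rightarrow> 'v \<Rightarrow> 'v list \<Rightarrow> bool" where
  "ope V a b cs \<longleftrightarrow> (\<forall>j::nat. mode V a (int j) b = (if j < length cs then cs ! j else 0))"

text \<open>The monomials $a^1_{(-n_1)}\cdots a^r_{(-n_r)}\mathbf 1$ with $a^i\in S$ and $n_i\ge1$
  span \<open>V\<close>.\<close>
definition strongly_generates :: "('v::complex_vector) vosa \<Rightarrow> 'v set \<Rightarrow> bool" where
  "strongly_generates V S \<longleftrightarrow>
     (\<forall>U. cvs.subspace U \<and> vac V \<in> U \<and> (\<forall>a\<in>S. \<forall>n<0. \<forall>u\<in>U. mode V a n u \<in> U) \<longrightarrow> U = UNIV)"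

definition va_ideal :: "('v::complex_vector) vosa \<Rightarrow> 'v set \<Rightarrow> bool" where
  "va_ideal V I \<longleftrightarrow> cvs.subspace I \<and>
     (\<forall>a\<in>par V False. \<forall>b\<in>par V True. a + b \<in> I \<longrightarrow> a \<in> I) \<and>
     (\<forall>a. \<forall>u\<in>I. \<forall>n. mode V a n u \<in> I \<and> mode V u n a \<in> I)"

definition va_simple :: "('v::complex_vector) vosa \<Rightarrow> bool" where
  "va_simple V \<longleftrightarrow> (\<exists>v::'v. v \<noteq> 0) \<and> (\<forall>I. va_ideal V I \<longrightarrow> I = {0} \<or> I = UNIV)"

text \<open>\<open>p\<close> exhibits \<open>Q\<close> as a simple quotient of \<open>V\<close>.\<close>
definition simple_quotient ::
    "('v::complex_vector) vosa \<Rightarrow> ('q::complex_vector) vosa \<Rightarrow> ('v \<Rightarrow> 'q) \<Rightarrow> bool" where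
  "simple_quotient V Q p \<longleftrightarrow>
     vertex_superalgebra Q \<and> va_simple Q \<and>
     clinear_on UNIV p \<and> surj p \<and> p (vac V) = vac Q \<and>
     (\<forall>u n v. p (mode V u n v) = mode Q (p u) n (p v)) \<and>
     (\<forall>r. p ` par V r = par Q r)"

text \<open>The \<open>V\<close>-module \<open>Y\<close> is a module over the quotient \<open>p : V \<rightarrow> Q\<close>.\<close>
definition quotient_module ::
    "('q::complex_vector) vosa \<Rightarrow> ('v \<Rightarrow> 'q) \<Rightarrow> ('v \<Rightarrow> int \<Rightarrow> 'm \<Rightarrow> 'm::complex_vector) \<Rightarrow> bool" where
  "quotient_module Q p Y \<longleftrightarrow> (\<exists>Y'. va_module Q Y' \<and> (\<forall>u n m. Y u n m = Y' (p u) n m))"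

definition irreducible_under :: "('m::complex_vector \<Rightarrow> 'm) set \<Rightarrow> bool" where
  "irreducible_under Ops \<longleftrightarrow> (\<exists>m::'m. m \<noteq> 0) \<and>
     (\<forall>U. cvs.subspace U \<and> (\<forall>T\<in>Ops. T ` U \<subseteq> U) \<longrightarrow> U = {0} \<or> U = UNIV)"


subsection \<open>Tensor products\<close>

text \<open>The first factor is purely even wherever these are used, so no signs occur.\<close>

definition tensor_va ::
    "('v::complex_vector) vosa \<Rightarrow> ('f::complex_vector) vosa \<Rightarrow> ('c::complex_vector) vosa \<Rightarrow>
     ('v \<Rightarrow> 'f \<Rightarrow> 'c) \<Rightarrow> bool" where
  "tensor_va V F C t \<longleftrightarrow>
     vertex_algebra V \<and> vertex_superalgebra F \<and> vertex_superalgebra C \<and>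
     tensor_product t \<and> t (vac V) (vac F) = vac C \<and>
     (\<forall>r. par C r = cvs.span {t v f | v f. f \<in> par F r}) \<and>
     (\<forall>u f n v g. mode C (t u f) n (t v g) =
        Sum_any (\<lambda>i::int. t (mode V u i v) (mode F f (n - 1 - i) g)))"

text \<open>\<open>YX\<close> is the module over \<open>C = V \<otimes> F\<close> on the tensor product \<open>s\<close> of the \<open>V\<close>-module \<open>YM\<close>
  with \<open>F\<close>.\<close>
definition tensor_module ::
    "('v::complex_vector) vosa \<Rightarrow> ('f::complex_vector) vosa \<Rightarrow> ('c::complex_vector) vosa \<Rightarrow>
     ('v \<Rightarrow> 'f \<Rightarrow> 'c) \<Rightarrow> ('v \<Rightarrow> int \<Rightarrow> 'm \<Rightarrow> 'm::complex_vector) \<Rightarrow>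
     ('m \<Rightarrow> 'f \<Rightarrow> 'x::complex_vector) \<Rightarrow> ('c \<Rightarrow> int \<Rightarrow> 'x \<Rightarrow> 'x) \<Rightarrow> bool" where
  "tensor_module V F C t YM s YX \<longleftrightarrow>
     va_module C YX \<and> tensor_product s \<and>
     (\<forall>u f n m g. YX (t u f) n (s m g) =
        Sum_any (\<lambda>i::int. s (YM u i m) (mode F f (n - 1 - i) g)))"


subsection \<open>Cohomology\<close>

text \<open>\<open>\<rho>\<close>, of which only the values on \<open>ker D\<close> matter, exhibits its codomain as
  \<open>ker D / im D\<close>.\<close>
definition cohomology_map ::
    "('x::complex_vector \<Rightarrow> 'x) \<Rightarrow> ('x \<Rightarrow> 'h::complex_vector) \<Rightarrow> bool" where
  "cohomology_map D \<rho> \<longleftrightarrow>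
     range D \<subseteq> {x. D x = 0} \<and> clinear_on {x. D x = 0} \<rho> \<and> \<rho> ` {x. D x = 0} = UNIV \<and>
     (\<forall>x. D x = 0 \<longrightarrow> (\<rho> x = 0 \<longleftrightarrow> x \<in> range D))"

text \<open>\<open>W\<close> is the vertex superalgebra \<open>H(C, d\<^sub>(\<^sub>0\<^sub>))\<close>.\<close>
definition va_cohomology ::
    "('c::complex_vector) vosa \<Rightarrow> 'c \<Rightarrow> ('w::complex_vector) vosa \<Rightarrow> ('c \<Rightarrow> 'w) \<Rightarrow> bool" where
  "va_cohomology C d W \<pi> \<longleftrightarrow>
     (let Z = {x. mode C d 0 x = 0} in
       vertex_superalgebra W \<and> cohomology_map (mode C d 0) \<pi> \<and>
       \<pi> (vac C) = vac W \<and> (\<forall>r. par W r = \<pi> ` (Z \<inter> par C r)) \<and>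
       (\<forall>u\<in>Z. \<forall>v\<in>Z. \<forall>n. \<pi> (mode C u n v) = mode W (\<pi> u) n (\<pi> v)))"

text \<open>\<open>YH\<close> is the \<open>H(C, d\<^sub>(\<^sub>0\<^sub>))\<close>-module \<open>H(X, d\<^sub>(\<^sub>0\<^sub>))\<close>.\<close>
definition module_cohomology ::
    "('c::complex_vector) vosa \<Rightarrow> 'c \<Rightarrow> ('w::complex_vector) vosa \<Rightarrow> ('c \<Rightarrow> 'w) \<Rightarrow>
     ('c \<Rightarrow> int \<Rightarrow> 'x \<Rightarrow> 'x::complex_vector) \<Rightarrow> ('x \<Rightarrow> 'h::complex_vector) \<Rightarrow>
     ('w \<Rightarrow> int \<Rightarrow> 'h \<Rightarrow> 'h) \<Rightarrow> bool" where
  "module_cohomology C d W \<pi> YX \<rho> YH \<longleftrightarrow>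
     va_module W YH \<and> cohomology_map (YX d 0) \<rho> \<and>
     (\<forall>u x n. mode C d 0 u = 0 \<and> YX d 0 x = 0 \<longrightarrow> \<rho> (YX u n x) = YH (\<pi> u) n (\<rho> x))"


section \<open>The affine Lie algebra of type \<open>A\<^sub>2\<^sup>(\<^sup>1\<^sup>)\<close>\<close>

type_synonym mat3 = "complex^3^3"

definition sl3 :: "mat3 set" where
  "sl3 = {A. trace A = 0}"

definition lie :: "mat3 \<Rightarrow> mat3 \<Rightarrow> mat3" where
  "lie A B = A ** B - B ** A"

definition munit :: "3 \<Rightarrow> 3 \<Rightarrow> mat3" where
  "munit i j = (\<chi> r s. if r = i \<and> s = j then 1 else 0)"

datatype posroot = Alpha1 | Alpha2 | Theta

fun root_vector :: "posroot \<Rightarrow> mat3" where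
  "root_vector Alpha1 = munit 1 2"
| "root_vector Alpha2 = munit 2 3"
| "root_vector Theta = munit 1 3"

definition diag3 :: "complex \<Rightarrow> complex \<Rightarrow> complex \<Rightarrow> mat3" where
  "diag3 p q r = p *\<^sub>C munit 1 1 + q *\<^sub>C munit 2 2 + r *\<^sub>C munit 3 3"

definition cartan :: "mat3 set" where
  "cartan = {diag3 p q r | p q r. p + q + r = 0}"

definition omega1 :: "mat3 \<Rightarrow> complex" where
  "omega1 H = H $ 1 $ 1"

definition omega2 :: "mat3 \<Rightarrow> complex" where
  "omega2 H = H $ 1 $ 1 + H $ 2 $ 2"

text \<open>\<open>X A n\<close> is the action of $A\otimes t^n$; the central element acts by \<open>k\<close>, the invariant
  form being the trace form.\<close>
definition affine_module ::
    "complex \<Rightarrow> (mat3 \<Rightarrow> int \<Rightarrow> 'm \<Rightarrow> 'm::complex_vector) \<Rightarrow> bool" where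
  "affine_module k X \<longleftrightarrow>
     (\<forall>n m. clinear_on sl3 (\<lambda>A. X A n m)) \<and>
     (\<forall>A\<in>sl3. \<forall>n. clinear_on UNIV (X A n)) \<and>
     (\<forall>A\<in>sl3. \<forall>B\<in>sl3. \<forall>m n v. X A m (X B n v) - X B n (X A m v) =
        X (lie A B) (m + n) v
        + (if m + n = 0 then of_int m * k * trace (A ** B) else 0) *\<^sub>C v)"

definition affine_irreducible_hw ::
    "complex \<Rightarrow> (mat3 \<Rightarrow> complex) \<Rightarrow> (mat3 \<Rightarrow> int \<Rightarrow> 'm \<Rightarrow> 'm::complex_vector) \<Rightarrow> bool" where
  "affine_irreducible_hw k lam X \<longleftrightarrow>
     affine_module k X \<and> irreducible_under {X A n | A n. A \<in> sl3} \<and>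
     (\<exists>v. v \<noteq> 0 \<and> (\<forall>A\<in>sl3. \<forall>n\<ge>1. X A n v = 0) \<and>
          (\<forall>\<alpha>. X (root_vector \<alpha>) 0 v = 0) \<and> (\<forall>H\<in>cartan. X H 0 v = lam H *\<^sub>C v))"

text \<open>The relations defining the vacuum module
  $U(\widehat{\mathfrak{sl}}_3)\otimes_{U(\mathfrak{sl}_3[t]\oplus\mathbb{C}K)}\mathbb{C}_k$ as a
  quotient of the free vector space on words in the letters $A\otimes t^n$.\<close>
definition vacuum_relations :: "complex \<Rightarrow> ((mat3 \<times> int) list \<Rightarrow>\<^sub>0 complex) set" where
  "vacuum_relations k =
     {free_gen (w @ [(c *\<^sub>C A + B, n)] @ w') - c *\<^sub>C free_gen (w @ [(A, n)] @ w')
        - free_gen (w @ [(B, n)] @ w')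
      | w w' c A B n. A \<in> sl3 \<and> B \<in> sl3 \<and> w \<in> lists (sl3 \<times> UNIV) \<and> w' \<in> lists (sl3 \<times> UNIV)} \<union>
     {free_gen (w @ [(A, m), (B, n)] @ w') - free_gen (w @ [(B, n), (A, m)] @ w')
        - free_gen (w @ [(lie A B, m + n)] @ w')
        - (if m + n = 0 then of_int m * k * trace (A ** B) else 0) *\<^sub>C free_gen (w @ w')
      | w w' A B m n. A \<in> sl3 \<and> B \<in> sl3 \<and> w \<in> lists (sl3 \<times> UNIV) \<and> w' \<in> lists (sl3 \<times> UNIV)} \<union>
     {free_gen (w @ [(A, n)]) | w A n. A \<in> sl3 \<and> n \<ge> 0 \<and> w \<in> lists (sl3 \<times> UNIV)}"

text \<open>\<open>V\<close> is $V^k(\mathfrak{sl}_3)$, with \<open>\<iota> A\<close> the state $A_{(-1)}\mathbf 1$.\<close>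
definition universal_affine ::
    "complex \<Rightarrow> ('v::complex_vector) vosa \<Rightarrow> (mat3 \<Rightarrow> 'v) \<Rightarrow> bool" where
  "universal_affine k V \<iota> \<longleftrightarrow>
     vertex_algebra V \<and> clinear_on sl3 \<iota> \<and>
     (\<forall>A\<in>sl3. \<forall>B\<in>sl3. ope V (\<iota> A) (\<iota> B) [\<iota> (lie A B), (k * trace (A ** B)) *\<^sub>C vac V]) \<and>
     presented_by (lists (sl3 \<times> UNIV))
       (\<lambda>w. foldr (\<lambda>(A, n). mode V (\<iota> A) n) w (vac V)) (vacuum_relations k)"


section \<open>Minimal quantum Hamiltonian reduction of \<open>\<ss>\<ll>\<^sub>3\<close>\<close>

text \<open>The Kac-Roan-Wakimoto data are $f=E_{31}$ and $x=\frac12\mathrm{diag}(1,0,-1)$, so that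
  $\mathfrak g_{1/2}=\langle E_{12},E_{23}\rangle$ and $\mathfrak g_1=\langle E_{13}\rangle$.

  \<open>F\<close> is $F^{ch}\otimes F^{ne}$: charged fermions $\varphi_\alpha,\varphi^\alpha$ (\<open>phi\<close>, \<open>psi\<close>)
  for the positive roots and neutral (here even) fields $\Phi_1,\Phi_2$ for $E_{12},E_{23}$, with
  pairing $(f|[E_{12},E_{23}])=1$.  Since the module over the mode algebra generated by a vacuum
  vector is irreducible, the relations and strong generation determine \<open>F\<close>.\<close>

record 'f ghosts =
  phi :: "posroot \<Rightarrow> 'f"
  psi :: "posroot \<Rightarrow> 'f"
  Phi1 :: 'f
  Phi2 :: 'f

definition ghost_system :: "('f::complex_vector) vosa \<Rightarrow> 'f ghosts \<Rightarrow> bool" where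
  "ghost_system F g \<longleftrightarrow>
     vertex_superalgebra F \<and> vac F \<noteq> 0 \<and>
     range (phi g) \<union> range (psi g) \<subseteq> par F True \<and> {Phi1 g, Phi2 g} \<subseteq> par F False \<and>
     (\<forall>\<alpha> \<beta>. ope F (phi g \<alpha>) (psi g \<beta>) (if \<alpha> = \<beta> then [vac F] else []) \<and>
            ope F (phi g \<alpha>) (phi g \<beta>) [] \<and> ope F (psi g \<alpha>) (psi g \<beta>) []) \<and>
     ope F (Phi1 g) (Phi2 g) [vac F] \<and> ope F (Phi1 g) (Phi1 g) [] \<and> ope F (Phi2 g) (Phi2 g) [] \<and>
     (\<forall>\<alpha>. \<forall>b\<in>{Phi1 g, Phi2 g}. ope F (phi g \<alpha>) b [] \<and> ope F (psi g \<alpha>) b []) \<and>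
     strongly_generates F (range (phi g) \<union> range (psi g) \<union> {Phi1 g, Phi2 g})"

text \<open>The Kac-Roan-Wakimoto element
  \[ d=\sum_\alpha u_\alpha\varphi^\alpha
     -\tfrac12\sum_{\alpha,\beta,\gamma}c_{\alpha\beta}^\gamma{:}\varphi_\gamma\varphi^\alpha\varphi^\beta{:}
     +\sum_\alpha(f|u_\alpha)\varphi^\alpha+\varphi^{\alpha_1}\Phi_1+\varphi^{\alpha_2}\Phi_2, \]
  where the only structure constants are given by $[E_{12},E_{23}]=E_{13}$, and
  $(f|u_\alpha)=\delta_{\alpha,\theta}$.\<close>
definition brst_element ::
    "('v::complex_vector) vosa \<Rightarrow> (mat3 \<Rightarrow> 'v) \<Rightarrow> ('f::complex_vector) vosa \<Rightarrow> 'f ghosts \<Rightarrow>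
     ('v \<Rightarrow> 'f \<Rightarrow> 'c::complex_vector) \<Rightarrow> 'c" where
  "brst_element V \<iota> F g t =
     (\<Sum>\<alpha>\<in>{Alpha1, Alpha2, Theta}. t (\<iota> (root_vector \<alpha>)) (psi g \<alpha>))
     + t (vac V)
        (- normal_product F (phi g Theta) (normal_product F (psi g Alpha1) (psi g Alpha2))
         + psi g Theta
         + normal_product F (psi g Alpha1) (Phi1 g)
         + normal_product F (psi g Alpha2) (Phi2 g))"

text \<open>The cocycle representing \<open>J\<close>: the current of
  $h=\frac13\mathrm{diag}(-1,2,-1)\in\mathfrak g^f$ plus its ghost corrections.
  The sign of \<open>J\<close>, which the operator product expansions leave open, is fixed by this choice.\<close>
definition J_cocycle ::
    "('v::complex_vector) vosa \<Rightarrow> (mat3 \<Rightarrow> 'v) \<Rightarrow> ('f::complex_vector) vosa \<Rightarrow> 'f ghosts \<Rightarrow>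
     ('v \<Rightarrow> 'f \<Rightarrow> 'c::complex_vector) \<Rightarrow> 'c" where
  "J_cocycle V \<iota> F g t =
     t (\<iota> (diag3 (-1/3) (2/3) (-1/3))) (vac F)
     + t (vac V)
        (- normal_product F (phi g Alpha1) (psi g Alpha1)
         + normal_product F (phi g Alpha2) (psi g Alpha2)
         + normal_product F (Phi1 g) (Phi2 g))"

text \<open>The Sugawara vector: $P(E_{ij})=E_{ij}-\frac13\delta_{ij}$ is the orthogonal projection of
  $\mathfrak{gl}_3$ onto $\mathfrak{sl}_3$, so $\sum_{i,j}P(E_{ij})\otimes P(E_{ji})$ is the Casimir
  tensor of the trace form.\<close>
definition sugawara :: "complex \<Rightarrow> ('v::complex_vector) vosa \<Rightarrow> (mat3 \<Rightarrow> 'v) \<Rightarrow> 'v" where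
  "sugawara k V \<iota> =
     (let P = (\<lambda>A::mat3. A - (trace A / 3) *\<^sub>C mat 1) in
      (1 / (2 * (k + 3))) *\<^sub>C
        (\<Sum>i\<in>UNIV. \<Sum>j\<in>UNIV. normal_product V (\<iota> (P (munit i j))) (\<iota> (P (munit j i)))))"

text \<open>The Kac-Roan-Wakimoto conformal vector
  $L^{\mathfrak g}+\partial x+L^{ch}+L^{ne}$; $\varphi_\alpha,\varphi^\alpha$ have weights
  $\frac12,\frac12$ for $\alpha=\alpha_1,\alpha_2$ and $0,1$ for $\alpha=\theta$.\<close>
definition L_cocycle ::
    "complex \<Rightarrow> ('v::complex_vector) vosa \<Rightarrow> (mat3 \<Rightarrow> 'v) \<Rightarrow> ('f::complex_vector) vosa \<Rightarrow>
     'f ghosts \<Rightarrow> ('v \<Rightarrow> 'f \<Rightarrow> 'c::complex_vector) \<Rightarrow> 'c" where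
  "L_cocycle k V \<iota> F g t =
     t (sugawara k V \<iota> + transl V (\<iota> (diag3 (1/2) 0 (-1/2)))) (vac F)
     + t (vac V)
        ((\<Sum>\<alpha>\<in>{Alpha1, Alpha2}. (1/2) *\<^sub>C
            (normal_product F (transl F (phi g \<alpha>)) (psi g \<alpha>)
             - normal_product F (phi g \<alpha>) (transl F (psi g \<alpha>))))
         + normal_product F (transl F (phi g Theta)) (psi g Theta)
         + (1/2) *\<^sub>C (normal_product F (transl F (Phi2 g)) (Phi1 g)
                     - normal_product F (Phi2 g) (transl F (Phi1 g))))"


section \<open>The Bershadsky-Polyakov algebra\<close>

definition bp_generators ::
    "complex \<Rightarrow> ('w::complex_vector) vosa \<Rightarrow> 'w \<Rightarrow> 'w \<Rightarrow> 'w \<Rightarrow> 'w \<Rightarrow> bool" where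
  "bp_generators k W J Gp Gm L \<longleftrightarrow>
     ope W L L [transl W L, 2 *\<^sub>C L, 0,
                (- ((2*k + 3) * (3*k + 1) / (k + 3)) / 2) *\<^sub>C vac W] \<and>
     ope W L J [transl W J, J] \<and>
     ope W L Gp [transl W Gp, (3/2) *\<^sub>C Gp] \<and>
     ope W L Gm [transl W Gm, (3/2) *\<^sub>C Gm] \<and>
     ope W J J [0, ((2*k + 3) / 3) *\<^sub>C vac W] \<and>
     ope W J Gp [Gp] \<and> ope W J Gm [- Gm] \<and>
     ope W Gp Gp [] \<and> ope W Gm Gm [] \<and>
     ope W Gp Gm
       [3 *\<^sub>C normal_product W J J + (3 * (k + 1) / 2) *\<^sub>C transl W J - (k + 3) *\<^sub>C L,
        (3 * (k + 1)) *\<^sub>C J,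
        ((k + 1) * (2*k + 3)) *\<^sub>C vac W] \<and>
     strongly_generates W {J, Gp, Gm, L}"

text \<open>\<open>YN\<close> is the irreducible highest weight module \<open>L[x, y]\<close>.  In terms of
  $a(z)=\sum_n a_{(n)}z^{-n-1}$ the modes are $J(n)=J_{(n)}$, $G^+(n)=G^+_{(n)}$,
  $G^-(n)=G^-_{(n+1)}$ and $\tilde L(n)=\tilde L_{(n+1)}$, with
  $\tilde L=L+\frac12\partial J$.\<close>
definition bp_irreducible_hw ::
    "('w::complex_vector) vosa \<Rightarrow> 'w \<Rightarrow> 'w \<Rightarrow> 'w \<Rightarrow> 'w \<Rightarrow> complex \<Rightarrow> complex \<Rightarrow>
     ('w \<Rightarrow> int \<Rightarrow> 'n \<Rightarrow> 'n::complex_vector) \<Rightarrow> bool" where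
  "bp_irreducible_hw W J Gp Gm L x y YN \<longleftrightarrow>
     va_module W YN \<and> irreducible_under {YN u n | u n. True} \<and>
     (let Lt = L + (1/2) *\<^sub>C transl W J in
      \<exists>v. v \<noteq> 0 \<and> YN J 0 v = x *\<^sub>C v \<and> YN Lt 1 v = y *\<^sub>C v \<and>
          (\<forall>n\<ge>0. YN Gp (n + 1) v = 0 \<and> YN Gm (n + 1) v = 0 \<and>
                 YN J (n + 1) v = 0 \<and> YN Lt (n + 2) v = 0))"

end

theory Submission
  imports Defs
begin

text \<open>The fields of the complex come in doublets \<open>(b, d b)\<close>, the first one being \<open>(\<phi>\<^sub>\<theta>, e + 1)\<close>.  A homotopy
  built from two doublets shows that every cocycle in \<open>M \<otimes> F\<close> is cohomologous to one killed by the
  non-negative modes of a doublet, and after all doublets have been treated to \<open>m \<otimes> 1\<close> with \<open>m\<close>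
  in the space \<open>\<Omega>\<close> of vectors killed by the non-negative modes of \<open>e = E\<^sub>1\<^sub>3\<close>, \<open>p = E\<^sub>1\<^sub>2\<close>, \<open>q = E\<^sub>2\<^sub>3\<close>.
  On cohomology \<open>e\<^sub>(\<^sub>-\<^sub>1\<^sub>)\<close> acts as \<open>-1\<close>.  The class of the highest weight vector \<open>v\<close> is non-zero because
  each \<open>e\<^sub>(\<^sub>-\<^sub>1\<^sub>)\<^sup>j v\<close> generates \<open>M\<close>, which is where \<open>k \<notin> \<nat>\<close> enters.

  A \<open>\<W>\<^sup>k\<close>-submodule of \<open>H(M)\<close> is thus given by vectors of \<open>\<Omega>\<close>.  Up to powers of \<open>e\<^sub>(\<^sub>-\<^sub>1\<^sub>)\<close>, the
  \<open>V\<^sup>k\<close>-submodule that they generate contains no further vectors of \<open>\<Omega>\<close>; so \<open>H(M)\<close> is irreducible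
  if \<open>M\<close> is, and the conformal weights identify its highest weight.  For \<open>M = V\<^sup>k\<close> the same argument
  shows that the kernel of \<open>\<W>\<^sup>k \<rightarrow> \<W>\<^sub>k\<close> consists of the classes \<open>u \<otimes> 1\<close> with \<open>u \<in> \<Omega>\<close> in the kernel
  of \<open>V\<^sup>k \<rightarrow> L\<^sub>k\<close>.  These act on \<open>m \<otimes> 1\<close> through \<open>u\<^sub>(\<^sub>n\<^sub>)m\<close>, and a submodule of \<open>V\<^sup>k\<close> or \<open>M\<close> is recovered
  from its intersection with \<open>\<Omega>\<close>; so one kernel acts by zero if and only if the other does.\<close>

section \<open>Linear maps\<close>

text \<open>The obstacle is that e_(-1) has weight 0 for L_0 - x_0, so that weight spaces are
  infinite-dimensional and a count of dimensions gives nothing. What replaces it is a counting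
  operator. The modes of one doublet are counted with the help of a second one whose contraction
  with the first is 1 or e up to sign, and in the latter case the count comes multiplied by e_(-1).
  Since e_(-1) is invertible only on cohomology, subspaces of V and M are compared up to its powers.
  The same algebra works inside M without ghosts: \<omega> is the partner of e because [\<omega>, e]
  = e, and p, q are partners because [p, q] = e. These eliminations commute only e, p, q, \<omega>
  and the states of V in the analogue of \<Omega>; stability under the other currents is a
  consequence. If the class of v were zero, the part of lowest weight would give v = (e_(-1) + 1) m
  with m a finite combination of the e_(-1)^j v, whereas the equation forces the infinite
  alternating series. No isomorphism between two copies of L[x, y] is constructed; only the action
  of an ideal on them is compared.\<close>

abbreviation clin :: "('a::complex_vector \<Rightarrow> 'b::complex_vector) \<Rightarrow> bool" where
  "clin f \<equiv> clinear_on UNIV f"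

lemma clin_add: "clin f \<Longrightarrow> f (x + y) = f x + f y"
  unfolding clinear_on_def by (metis UNIV_I cvs.scale_one)

lemma clin_zero: "clin f \<Longrightarrow> f 0 = 0"
  using clin_add[of f 0 0] by simp

lemma clin_scale: "clin f \<Longrightarrow> f (c *\<^sub>C x) = c *\<^sub>C f x"
  using clin_zero[of f] unfolding clinear_on_def by (metis UNIV_I add.right_neutral)

lemma clin_neg: "clin f \<Longrightarrow> f (- x) = - f x"
  using clin_scale[of f "-1" x] by (simp add: cvs.scale_minus_left)

lemma clin_diff: "clin f \<Longrightarrow> f (x - y) = f x - f y"
  using clin_add[of f x "- y"] by (simp add: clin_neg)

lemma clin_sum: "clin f \<Longrightarrow> f (sum g A) = (\<Sum>i\<in>A. f (g i))"
  by (induction A rule: infinite_finite_induct) (simp_all add: clin_zero clin_add)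

lemmas clin_simps = clin_add clin_zero clin_scale clin_neg clin_diff clin_sum

lemma clinI: "(\<And>c x y. f (c *\<^sub>C x + y) = c *\<^sub>C f x + f y) \<Longrightarrow> clin f"
  by (simp add: clinear_on_def)

lemma Sum_any_mem_subspace:
  "cvs.subspace U \<Longrightarrow> (\<And>j. f j \<in> U) \<Longrightarrow> Sum_any f \<in> U"
  by (simp add: Sum_any.expand_set cvs.subspace_sum)

lemma subspace_mult_mem:
  "cvs.subspace U \<Longrightarrow> c *\<^sub>C x \<in> U \<Longrightarrow> c \<noteq> 0 \<Longrightarrow> x \<in> U"
  using cvs.subspace_scale[of U "c *\<^sub>C x" "1/c"] by simp

lemma subspace_add_cancel:
  "cvs.subspace U \<Longrightarrow> x + y \<in> U \<Longrightarrow> y \<in> U \<Longrightarrow> x \<in> U"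
  using cvs.subspace_diff[of U "x + y" y] by simp

lemma Sum_any_single:
  fixes f :: "'i \<Rightarrow> 'a::comm_monoid_add"
  assumes "\<And>j. j \<noteq> a \<Longrightarrow> f j = 0" shows "Sum_any f = f a"
proof -
  have "{j. f j \<noteq> 0} \<subseteq> {a}" using assms by auto
  then show ?thesis by (subst Sum_any.expand_superset[of "{a}"]) auto
qed

lemma Sum_any_lessThan:
  fixes f :: "nat \<Rightarrow> 'a::comm_monoid_add"
  assumes "\<And>j. j \<ge> K \<Longrightarrow> f j = 0" shows "Sum_any f = (\<Sum>j<K. f j)"
  using assms by (intro Sum_any.expand_superset) (auto simp: not_le[symmetric])

lemma gbinomial_0_left: "(0 gchoose j) = (if j = 0 then 1 else (0::complex))"
  by (cases j) simp_all

lemma gbinomial_minus_two: "(-1) ^ j * (of_int (-2) gchoose j) = (of_nat (Suc j) :: complex)"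
proof -
  have "(of_nat (Suc j) gchoose j :: complex) = of_nat (Suc j)"
    by (subst binomial_gbinomial[symmetric]) simp
  then show ?thesis using gbinomial_minus[of "2::complex" j] by (simp flip: power_mult_distrib)
qed

lemma neg_one_powi_cases: "(-1 :: complex) powi l = 1 \<or> (-1 :: complex) powi l = -1"
  by (cases "even l") (simp_all add: power_int_minus_left)


section \<open>Modules over vertex superalgebras\<close>

definition ssgn :: "bool \<Rightarrow> bool \<Rightarrow> complex" where
  "ssgn p q = (if p \<and> q then -1 else 1)"

lemma ssgn_simps [simp]:
  "ssgn False q = 1" "ssgn p False = 1" "ssgn True True = -1"
  by (simp_all add: ssgn_def)

locale va_mod =
  fixes V :: "('v::complex_vector) vosa" and Y :: "'v \<Rightarrow> int \<Rightarrow> 'm \<Rightarrow> 'm::complex_vector"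
  assumes mod: "va_module V Y"
begin

lemma lin1: "clin (\<lambda>a. Y a n m)" and lin2: "clin (Y a n)"
  and vacuum: "Y (vac V) n m = (if n = -1 then m else 0)"
  and trunc: "\<exists>N. \<forall>n\<ge>N. Y a n m = 0"
  using mod by (auto simp: va_module_def)

lemma borcherds:
  "a \<in> par V p \<Longrightarrow> b \<in> par V q \<Longrightarrow>
    Sum_any (\<lambda>j::nat. (of_int m gchoose j) *\<^sub>C Y (mode V a (l + int j) b) (m + n - int j) c)
        = Sum_any (\<lambda>j::nat. ((-1) ^ j * (of_int l gchoose j)) *\<^sub>C Y a (m + l - int j) (Y b (n + int j) c))
          - ((-1) powi l * ssgn p q) *\<^sub>C
            Sum_any (\<lambda>j::nat. ((-1) ^ j * (of_int l gchoose j)) *\<^sub>C Y b (n + l - int j) (Y a (m + int j) c))"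
  using mod unfolding va_module_def ssgn_def by blast

lemmas lin1_simps = clin_simps[OF lin1] and lin2_simps = clin_simps[OF lin2]

lemma commutator:
  assumes "a \<in> par V p" "b \<in> par V q"
  shows "Y a m (Y b n c) = ssgn p q *\<^sub>C Y b n (Y a m c)
    + Sum_any (\<lambda>j::nat. (of_int m gchoose j) *\<^sub>C Y (mode V a (int j) b) (m + n - int j) c)"
proof -
  have 1: "Sum_any (\<lambda>j::nat. ((-1) ^ j * (of_int 0 gchoose j)) *\<^sub>C Y a (m + 0 - int j) (Y b (n + int j) c))
     = Y a m (Y b n c)"
    by (subst Sum_any_single[where a=0]) (auto simp: gbinomial_0_left)
  have 2: "Sum_any (\<lambda>j::nat. ((-1) ^ j * (of_int 0 gchoose j)) *\<^sub>C Y b (n + 0 - int j) (Y a (m + int j) c))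
     = Y b n (Y a m c)"
    by (subst Sum_any_single[where a=0]) (auto simp: gbinomial_0_left)
  show ?thesis
    using borcherds[OF assms, of m 0 n c] unfolding 1 2 by simp
qed

lemma commutator0:
  assumes "a \<in> par V p" "b \<in> par V q" and "\<And>j. j \<ge> 1 \<Longrightarrow> mode V a (int j) b = 0"
  shows "Y a m (Y b n c) = ssgn p q *\<^sub>C Y b n (Y a m c) + Y (mode V a 0 b) (m + n) c"
proof -
  have "Sum_any (\<lambda>j::nat. (of_int m gchoose j) *\<^sub>C Y (mode V a (int j) b) (m + n - int j) c)
     = Y (mode V a 0 b) (m + n) c"
    by (subst Sum_any_single[where a=0]) (use assms(3) in \<open>auto simp: lin1_simps Suc_le_eq\<close>)
  then show ?thesis using commutator[OF assms(1,2)] by simp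
qed

lemma zero_mode_commutator:
  assumes "a \<in> par V p" "b \<in> par V q"
  shows "Y a 0 (Y b n c) = ssgn p q *\<^sub>C Y b n (Y a 0 c) + Y (mode V a 0 b) n c"
proof -
  have "Sum_any (\<lambda>j::nat. (of_int 0 gchoose j) *\<^sub>C Y (mode V a (int j) b) (0 + n - int j) c)
     = Y (mode V a 0 b) n c"
    by (subst Sum_any_single[where a=0]) (auto simp: gbinomial_0_left)
  then show ?thesis using commutator[OF assms, of 0] by simp
qed

lemma associativity:
  assumes "a \<in> par V p" "b \<in> par V q"
  shows "Y (mode V a l b) n c = Sum_any (\<lambda>j::nat. ((-1) ^ j * (of_int l gchoose j)) *\<^sub>C Y a (l - int j) (Y b (n + int j) c))
          - ((-1) powi l * ssgn p q) *\<^sub>C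
            Sum_any (\<lambda>j::nat. ((-1) ^ j * (of_int l gchoose j)) *\<^sub>C Y b (n + l - int j) (Y a (int j) c))"
proof -
  have "Sum_any (\<lambda>j::nat. (of_int 0 gchoose j) *\<^sub>C Y (mode V a (l + int j) b) (0 + n - int j) c)
     = Y (mode V a l b) n c"
    by (subst Sum_any_single[where a=0]) (auto simp: gbinomial_0_left)
  then show ?thesis using borcherds[OF assms, of 0 l n c] by simp
qed

lemma gbinomial_minus_one': "(of_int (-1) gchoose j) = (-1 :: complex) ^ j"
proof -
  have "(of_nat j gchoose j :: complex) = 1"
    by (subst binomial_gbinomial[symmetric]) simp
  then show ?thesis
    using gbinomial_minus[of "1::complex" j] by simp
qed

lemma gbinomial_minus_one: "(-1 :: complex) ^ j * (of_int (-1) gchoose j) = 1"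
  unfolding gbinomial_minus_one' by (simp flip: power_mult_distrib)

lemma normal_product_mode:
  assumes "a \<in> par V p" "b \<in> par V q"
  shows "Y (mode V a (-1) b) n c = Sum_any (\<lambda>j::nat. Y a (-1 - int j) (Y b (n + int j) c))
          + ssgn p q *\<^sub>C Sum_any (\<lambda>j::nat. Y b (n - 1 - int j) (Y a (int j) c))"
  unfolding associativity[OF assms] gbinomial_minus_one by (simp add: algebra_simps)

text \<open>Membership needs only the single summands of the associativity formula, so binomials and
  signs never have to be computed where this is used.\<close>

lemma mode_mem_subspace:
  assumes "a \<in> par V p" "b \<in> par V q" "cvs.subspace U"
    and "\<And>j::nat. Y a (l - int j) (Y b (n + int j) c) \<in> U"
    and "\<And>j::nat. Y b (n + l - int j) (Y a (int j) c) \<in> U"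
  shows "Y (mode V a l b) n c \<in> U"
  unfolding associativity[OF assms(1,2)]
  by (intro cvs.subspace_diff assms cvs.subspace_scale Sum_any_mem_subspace)

lemma commute_mem_subspace:
  assumes "a \<in> par V p" "b \<in> par V q" "cvs.subspace U"
    and "Y b n (Y a m c) \<in> U"
    and "\<And>j::nat. Y (mode V a (int j) b) (m + n - int j) c \<in> U"
  shows "Y a m (Y b n c) \<in> U"
  unfolding commutator[OF assms(1,2)]
  by (intro cvs.subspace_add assms cvs.subspace_scale Sum_any_mem_subspace)

end

lemma vertex_superalgebra_va_mod: "vertex_superalgebra V \<Longrightarrow> va_mod V (mode V)"
  by (simp add: va_mod_def vertex_superalgebra_def)

locale vsa =
  fixes V :: "('v::complex_vector) vosa"
  assumes vsa: "vertex_superalgebra V"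
begin

sublocale self: va_mod V "mode V"
  using vsa by (rule vertex_superalgebra_va_mod)

lemma par_subspace: "cvs.subspace (par V r)"
  using vsa by (cases r) (auto simp: vertex_superalgebra_def)

lemma par_mode: "a \<in> par V p \<Longrightarrow> b \<in> par V q \<Longrightarrow> mode V a n b \<in> par V (p \<noteq> q)"
  using vsa by (auto simp: vertex_superalgebra_def)

lemma vac_even: "vac V \<in> par V False"
  using vsa by (auto simp: vertex_superalgebra_def)

lemma par_decomp: obtains a b where "a \<in> par V False" "b \<in> par V True" "v = a + b"
proof -
  have "\<forall>v. \<exists>a\<in>par V False. \<exists>b\<in>par V True. v = a + b"
    using vsa by (simp add: vertex_superalgebra_def)
  then show thesis using that by auto
qed

lemma par_disjoint: "par V False \<inter> par V True = {0}"
  using vsa by (auto simp: vertex_superalgebra_def)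

lemma creation: "mode V a (-1) (vac V) = a" and mode_vac: "n \<ge> 0 \<Longrightarrow> mode V a n (vac V) = 0"
  using vsa by (auto simp: vertex_superalgebra_def)

lemma mode_of_vac: "mode V (vac V) n b = (if n = -1 then b else 0)"
  by (rule self.vacuum)

text \<open>Borcherds identity with m = -1 and n = 0 on the vacuum: the first sum dies because b_(j)
  kills the vacuum, and in the second only a_(-1) survives. The powers of the translation operator
  appear as modes -1 - j applied to the vacuum.\<close>

lemma skew:
  assumes "a \<in> par V p" "b \<in> par V q"
  shows "mode V b l a = - ((-1) powi l * ssgn p q) *\<^sub>C
     Sum_any (\<lambda>j::nat. (-1) ^ j *\<^sub>C mode V (mode V a (l + int j) b) (-1 - int j) (vac V))"
proof -
  have 1: "Sum_any (\<lambda>j::nat. ((-1) ^ j * (of_int l gchoose j)) *\<^sub>C mode V a (-1 + l - int j) (mode V b (0 + int j) (vac V))) = 0"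
    by (simp add: mode_vac self.lin2_simps)
  have 2: "Sum_any (\<lambda>j::nat. ((-1) ^ j * (of_int l gchoose j)) *\<^sub>C mode V b (0 + l - int j) (mode V a (-1 + int j) (vac V)))
     = mode V b l a"
    by (subst Sum_any_single[where a=0]) (auto simp: creation mode_vac self.lin2_simps)
  have 3: "((-1) powi l * ssgn p q) * ((-1) powi l * ssgn p q) = 1"
    using neg_one_powi_cases[of l] by (auto simp: ssgn_def)
  have "Sum_any (\<lambda>j::nat. (-1) ^ j *\<^sub>C mode V (mode V a (l + int j) b) (-1 - int j) (vac V))
     = - (((-1) powi l * ssgn p q) *\<^sub>C mode V b l a)"
    using self.borcherds[OF assms, of "-1" l 0 "vac V"] unfolding 1 2 self.gbinomial_minus_one' by simp
  then show ?thesis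
    by (metis (no_types, lifting) "3" cvs.scale_minus_left cvs.scale_minus_right cvs.scale_one cvs.scale_scale minus_minus)
qed

lemma ope_zero_skew:
  assumes "a \<in> par V p" "b \<in> par V q" "\<And>j. j \<ge> i \<Longrightarrow> mode V a (int j) b = 0"
  shows "j \<ge> i \<Longrightarrow> mode V b (int j) a = 0"
proof -
  assume "j \<ge> i"
  then have "mode V a (int j + int k) b = 0" for k using assms(3)[of "j + k"] by simp
  then show ?thesis unfolding skew[OF assms(1,2)] by (simp add: self.lin1_simps)
qed

lemma simple_pole_skew:
  assumes "a \<in> par V p" "b \<in> par V q" "\<And>j. j \<ge> 1 \<Longrightarrow> mode V a (int j) b = 0"
  shows "mode V b 0 a = - ssgn p q *\<^sub>C mode V a 0 b"
proof -
  have "Sum_any (\<lambda>j::nat. (-1) ^ j *\<^sub>C mode V (mode V a (0 + int j) b) (-1 - int j) (vac V)) = mode V a 0 b"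
    by (subst Sum_any_single[where a=0]) (auto simp: creation assms(3) self.lin1_simps Suc_le_eq)
  then show ?thesis using skew[OF assms(1,2), of 0] by simp
qed

end

section \<open>Eliminating annihilation operators\<close>

definition wd :: "('t \<Rightarrow> nat \<Rightarrow> 'x \<Rightarrow> 'x) \<Rightarrow> ('t \<times> nat) list \<Rightarrow> 'x \<Rightarrow> 'x" where
  "wd A ws x = foldr (\<lambda>(\<tau>, i). A \<tau> i) ws x"

abbreviation wsum :: "('t \<times> nat) list \<Rightarrow> nat" where
  "wsum ws \<equiv> sum_list (map snd ws)"

lemma wd_simps [simp]: "wd A [] x = x" "wd A ((\<tau>, i) # ws) x = A \<tau> i (wd A ws x)"
  by (simp_all add: wd_def)

lemma wd_append: "wd A (us @ ws) x = wd A us (wd A ws x)"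
  by (simp add: wd_def)

lemma wsum_update: "k < length ws \<Longrightarrow> wsum (ws[k := (\<tau>, n)]) = wsum ws + n - snd (ws ! k)"
  by (simp add: map_update sum_list_update)

lemma wsum_ge_elem: "k < length ws \<Longrightarrow> snd (ws ! k) \<le> wsum ws"
  by (metis (mono_tags, lifting) canonically_ordered_monoid_add_class.elem_le_sum_list length_map nth_map)

text \<open>The operator \<open>\<Delta> N\<close> acts on words in the letters \<open>A\<close> like \<open>- z (-1)\<close> times their number, up
  to terms that make words vanish earlier.\<close>
locale elimination =
  fixes R :: "'x::complex_vector set" and A :: "'t \<Rightarrow> nat \<Rightarrow> 'x \<Rightarrow> 'x"
    and z :: "int \<Rightarrow> 'x \<Rightarrow> 'x" and \<Delta> :: "nat \<Rightarrow> 'x \<Rightarrow> 'x"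
  assumes R: "cvs.subspace R"
    and A_lin: "clin (A \<tau> i)" and z_lin: "clin (z j)"
    and A_R: "x \<in> R \<Longrightarrow> A \<tau> i x \<in> R"
    and \<Delta>_R: "x \<in> R \<Longrightarrow> \<Delta> N x \<in> R"
    and z_R: "x \<in> R \<Longrightarrow> z (-1) x \<in> R"
    and A_z: "x \<in> R \<Longrightarrow> A \<tau> i (z j x) = z j (A \<tau> i x)"
    and A_\<Delta>: "x \<in> R \<Longrightarrow> A \<tau> i (\<Delta> N x) = \<Delta> N (A \<tau> i x) - (\<Sum>n<N. z (int i - 1 - int n) (A \<tau> n x))"
    and \<Delta>_vac: "x \<in> R \<Longrightarrow> (\<And>\<tau> i. A \<tau> i x = 0) \<Longrightarrow> \<Delta> N x = 0"
    and z_vac: "x \<in> R \<Longrightarrow> (\<And>\<tau> i. A \<tau> i x = 0) \<Longrightarrow> z (int l) x = 0"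
    and nilpotent: "x \<in> R \<Longrightarrow> \<exists>D. \<forall>ws. length ws + wsum ws > D \<longrightarrow> wd A ws x = 0"
begin

lemma wd_R: "x \<in> R \<Longrightarrow> wd A ws x \<in> R"
  by (induction ws) (auto intro: A_R)

lemma wd_lin: "clin (wd A ws)"
  by (induction ws) (auto simp: clin_simps[OF A_lin] clin_add clin_scale intro!: clinI)

lemma wd_z: "x \<in> R \<Longrightarrow> wd A ws (z j x) = z j (wd A ws x)"
proof (induction ws)
  case (Cons w ws)
  then show ?case using A_z[OF wd_R[OF Cons.prems, of ws]] by (cases w) simp
qed simp

lemma wd_\<Delta>:
  "x \<in> R \<Longrightarrow> wd A ws (\<Delta> N x) = \<Delta> N (wd A ws x)
    - (\<Sum>k<length ws. \<Sum>n<N. z (int (snd (ws ! k)) - 1 - int n) (wd A (ws[k := (fst (ws ! k), n)]) x))"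
proof (induction ws)
  case (Cons w ws)
  obtain \<tau> i where w: "w = (\<tau>, i)" by force
  let ?t = "\<lambda>ws k n. z (int (snd (ws ! k)) - 1 - int n) (wd A (ws[k := (fst (ws ! k), n)]) x)"
  have "wd A (w # ws) (\<Delta> N x) = A \<tau> i (\<Delta> N (wd A ws x)) - A \<tau> i (\<Sum>k<length ws. \<Sum>n<N. ?t ws k n)"
    using Cons by (simp add: w clin_simps[OF A_lin])
  also have "A \<tau> i (\<Sum>k<length ws. \<Sum>n<N. ?t ws k n) = (\<Sum>k<length ws. \<Sum>n<N. ?t (w # ws) (Suc k) n)"
    by (simp add: w clin_simps[OF A_lin] A_z[OF wd_R[OF Cons.prems]])
  also have "A \<tau> i (\<Delta> N (wd A ws x)) = \<Delta> N (wd A (w # ws) x) - (\<Sum>n<N. ?t (w # ws) 0 n)"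
    by (simp add: w A_\<Delta>[OF wd_R[OF Cons.prems]])
  finally show ?case by (simp add: sum.lessThan_Suc_shift del: sum.lessThan_Suc)
qed simp

text \<open>Words longer than r kill x, and so do words of length r with index sum at least s. The
  elimination descends lexicographically in (r, s).\<close>

definition K :: "nat \<Rightarrow> nat \<Rightarrow> 'x set" where
  "K r s = {x \<in> R. (\<forall>ws. length ws > r \<longrightarrow> wd A ws x = 0) \<and>
     (\<forall>ws. length ws = r \<longrightarrow> s \<le> wsum ws \<longrightarrow> wd A ws x = 0)}"

text \<open>Commuting a word of length r past \<Delta> replaces the index i of one letter by n. If n
  < i, the factor is a non-negative mode of \<open>z\<close>, which kills; if n > i, the index sum
  grows and the word kills x; n = i gives \<open>z (-1)\<close>. So \<Delta> acts as -r times
  \<open>z (-1)\<close> on the critical words, and the correction cancels it.\<close>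

lemma K_step:
  assumes x: "x \<in> K r (Suc s)" and N: "s < N"
  shows "\<Delta> N x + of_nat r *\<^sub>C z (-1) x \<in> K r s"
proof -
  have xR: "x \<in> R" and long: "\<And>ws. length ws > r \<Longrightarrow> wd A ws x = 0"
    and crit: "\<And>ws. length ws = r \<Longrightarrow> Suc s \<le> wsum ws \<Longrightarrow> wd A ws x = 0"
    using x by (auto simp: K_def)
  let ?y = "\<Delta> N x + of_nat r *\<^sub>C z (-1) x"
  have lin: "wd A ws ?y = wd A ws (\<Delta> N x) + of_nat r *\<^sub>C z (-1) (wd A ws x)" for ws
    by (simp add: clin_simps[OF wd_lin] wd_z xR)
  have vac: "A \<tau> i (wd A ws x) = 0" if "length ws \<ge> r" for \<tau> i ws
    using long[of "(\<tau>, i) # ws"] that by simp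
  have \<Delta>0: "\<Delta> N (wd A ws x) = 0" and z0: "z (int j) (wd A ws x) = 0" if "length ws \<ge> r" for ws j
    using vac[OF that] by (auto intro: \<Delta>_vac z_vac wd_R xR)
  have "wd A ws ?y = 0" if l: "length ws > r" for ws
    using l \<Delta>0[of ws] by (simp add: lin long wd_\<Delta>[OF xR] clin_simps[OF z_lin])
  moreover have "wd A ws ?y = 0" if l: "length ws = r" and s: "s \<le> wsum ws" for ws
  proof -
    have t: "z (int (snd (ws ! k)) - 1 - int n) (wd A (ws[k := (fst (ws ! k), n)]) x)
        = (if n = snd (ws ! k) then z (-1) (wd A ws x) else 0)" if k: "k < length ws" for k n
    proof -
      consider "n < snd (ws ! k)" | "n = snd (ws ! k)" | "n > snd (ws ! k)" by linarith
      then show ?thesis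
      proof cases
        case 1
        then obtain j where "int (snd (ws ! k)) - 1 - int n = int j" 
          using that[of "snd (ws ! k) - 1 - n"] by force
        then show ?thesis using 1 by (simp add: z0 l)
      next
        case 2
        then have "ws[k := (fst (ws ! k), n)] = ws" by simp
        then show ?thesis using 2 by simp
      next
        case 3
        then have "Suc s \<le> wsum (ws[k := (fst (ws ! k), n)])"
          using s k wsum_ge_elem[OF k] by (simp add: wsum_update)
        then show ?thesis using 3 l by (simp add: crit clin_simps[OF z_lin])
      qed
    qed
    have "(\<Sum>n<N. z (int (snd (ws ! k)) - 1 - int n) (wd A (ws[k := (fst (ws ! k), n)]) x)) = z (-1) (wd A ws x)"
      if k: "k < length ws" for k
    proof (cases "snd (ws ! k) < N")
      case True
      then show ?thesis using k by (simp add: t)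
    next
      \<comment> \<open>The term n = i falls outside the truncated sum only if the index sum already
        exceeds s, and then the word kills x anyway.\<close>
      case False
      then have "wd A ws x = 0" using wsum_ge_elem[OF k] N by (intro crit l) linarith
      then show ?thesis using k by (simp add: t clin_simps[OF z_lin])
    qed
    then have "wd A ws (\<Delta> N x) = - (of_nat r *\<^sub>C z (-1) (wd A ws x))"
      by (simp add: wd_\<Delta>[OF xR] \<Delta>0 l cvs.sum_constant_scale)
    then show ?thesis by (simp add: lin)
  qed
  moreover have "?y \<in> R"
    by (intro cvs.subspace_add cvs.subspace_scale R \<Delta>_R z_R xR)
  ultimately show ?thesis by (auto simp: K_def)
qed

text \<open>Applying a letter lowers r, passing to the corrected vector lowers s, and local
  nilpotency bounds s for each r. The set S carries the side condition of the application (being a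
  cocycle, lying in a submodule); r is at least 1 in the step so that it can be divided by.\<close>

lemma elim_induct [consumes 2, case_names vac step]:
  assumes S: "S \<subseteq> R" and x: "x \<in> S"
    and vac: "\<And>x. x \<in> S \<Longrightarrow> (\<And>\<tau> i. A \<tau> i x = 0) \<Longrightarrow> P x"
    and step: "\<And>x r N. x \<in> S \<Longrightarrow> r \<ge> 1 \<Longrightarrow> (\<And>\<tau> i. A \<tau> i x \<in> S \<Longrightarrow> P (A \<tau> i x)) \<Longrightarrow>
      (\<Delta> N x + of_nat r *\<^sub>C z (-1) x \<in> S \<Longrightarrow> P (\<Delta> N x + of_nat r *\<^sub>C z (-1) x)) \<Longrightarrow> P x"
  shows "P x"
proof -
  have bound: "\<exists>s. x \<in> K r s" if xR: "x \<in> R" and l: "\<And>ws. length ws > r \<Longrightarrow> wd A ws x = 0" for x r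
  proof -
    obtain D where "\<forall>ws. length ws + wsum ws > D \<longrightarrow> wd A ws x = 0" using nilpotent[OF xR] by blast
    then have "x \<in> K r (Suc D)" using xR l by (auto simp: K_def)
    then show ?thesis by blast
  qed
  have "x \<in> S \<Longrightarrow> x \<in> K r s \<Longrightarrow> P x" for r s x
  proof (induction r arbitrary: s x)
    case 0
    have "A \<tau> i x = 0" for \<tau> i
      using 0(2) by (auto simp: K_def dest: spec[of _ "[(\<tau>, i)]"])
    then show ?case using vac 0 by blast
  next
    case (Suc r)
    have prev: "P y" if "y \<in> S" "\<And>ws. length ws > r \<Longrightarrow> wd A ws y = 0" for y
      using bound[of y r] that Suc.IH S by blast
    show ?case using Suc.prems
    proof (induction s arbitrary: x)
      case 0
      have "wd A ws x = 0" if "length ws > r" for ws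
        using 0(2) that by (cases "length ws = Suc r") (auto simp: K_def)
      then show ?case using prev 0(1) by blast
    next
      case (Suc s)
      have "P (A \<tau> i x)" if "A \<tau> i x \<in> S" for \<tau> i
      proof (rule prev[OF that])
        fix ws :: "('t \<times> nat) list" assume "length ws > r"
        then show "wd A ws (A \<tau> i x) = 0"
          using Suc.prems(2) by (auto simp: K_def wd_append dest: spec[of _ "ws @ [(\<tau>, i)]"])
      qed
      then show ?case
        using step[OF Suc.prems(1), of "Suc r" "Suc s"] Suc.IH K_step[OF Suc.prems(2), of "Suc s"] by simp
    qed
  qed
  moreover obtain D where D: "\<forall>ws. length ws + wsum ws > D \<longrightarrow> wd A ws x = 0"
    using nilpotent[of x] x S by blast
  moreover obtain s where "x \<in> K D s" using bound[of x D] D x S by fastforce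
  ultimately show ?thesis using x by blast
qed

end


section \<open>Words in creation operators\<close>

text \<open>Counterpart of \<open>elimination\<close> for vectors built up from B. The constants
  record the contractions: \<epsilon> that of an annihilator with its creator, \<kappa> that of two
  creators, \<mu> the failure of \<open>z\<close> to commute with a creator. The instances are p, q
  over a space of vacuum vectors, and \<omega> over the span so obtained.\<close>

locale creation_words =
  fixes B :: "'x::complex_vector set" and b a :: "'t::finite \<Rightarrow> nat \<Rightarrow> 'x \<Rightarrow> 'x"
    and z :: "int \<Rightarrow> 'x \<Rightarrow> 'x" and \<epsilon> \<mu> :: complex and \<kappa> :: "'t \<Rightarrow> 't \<Rightarrow> complex"
  assumes B: "cvs.subspace B"
    and b_lin: "clin (b \<tau> m)" and a_lin: "clin (a \<tau> m)" and z_lin: "clin (z j)"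
    and z_B: "x \<in> B \<Longrightarrow> j < 0 \<Longrightarrow> z j x \<in> B"
    and z_B0: "x \<in> B \<Longrightarrow> j \<ge> 0 \<Longrightarrow> z j x = 0"
    and a_B0: "x \<in> B \<Longrightarrow> a \<tau> m x = 0"
    and a_b: "a \<sigma> n (b \<tau> m x) = b \<tau> m (a \<sigma> n x) + (if \<sigma> = \<tau> then \<epsilon> *\<^sub>C z (int n - 1 - int m) x else 0)"
    and b_b: "b \<sigma> n (b \<tau> m x) = b \<tau> m (b \<sigma> n x) + \<kappa> \<sigma> \<tau> *\<^sub>C z (- 2 - int n - int m) x"
    and z_b: "z j (b \<tau> m x) = b \<tau> m (z j x) - \<mu> *\<^sub>C z (j - 1 - int m) x"
    and a_z: "a \<sigma> n (z j x) = z j (a \<sigma> n x)"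
    and \<epsilon>: "\<epsilon> \<noteq> 0"
begin

text \<open>The bound is strict in the lexicographic order of length and index sum; in particular
  \<open>U r 0\<close> consists of combinations of words shorter than r.\<close>

definition U :: "nat \<Rightarrow> nat \<Rightarrow> 'x set" where
  "U r s = cvs.span {wd b ws y | ws y. y \<in> B \<and> (length ws < r \<or> length ws = r \<and> wsum ws < s)}"

lemma U_sub: "cvs.subspace (U r s)" by (simp add: U_def)

lemma wd_U: "y \<in> B \<Longrightarrow> length ws < r \<or> length ws = r \<and> wsum ws < s \<Longrightarrow> wd b ws y \<in> U r s"
  unfolding U_def by (rule cvs.span_base) blast

lemma U_induct:
  assumes "x \<in> U r s" "cvs.subspace S" "clin f"
    and "\<And>ws y. y \<in> B \<Longrightarrow> length ws < r \<or> length ws = r \<and> wsum ws < s \<Longrightarrow> f (wd b ws y) \<in> S"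
  shows "f x \<in> S"
proof -
  have "cvs.subspace {x. f x \<in> S}"
    using assms(2) by (auto simp: cvs.subspace_def clin_simps[OF assms(3)])
  then have "U r s \<subseteq> {x. f x \<in> S}" unfolding U_def
    by (rule cvs.span_minimal[rotated]) (use assms(4) in auto)
  then show ?thesis using assms(1) by auto
qed

lemma clin_id: "clin (\<lambda>x. x)" by (simp add: clinI)

lemma U_mono: "r < r' \<or> r = r' \<and> s \<le> s' \<Longrightarrow> x \<in> U r s \<Longrightarrow> x \<in> U r' s'"
  by (erule U_induct[OF _ U_sub clin_id]) (auto intro: wd_U)

lemma b_U: "x \<in> U r s \<Longrightarrow> b \<tau> m x \<in> U (Suc r) (m + s)"
proof (erule U_induct[OF _ U_sub b_lin])
  fix ws :: "('t \<times> nat) list" and y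
  assume "y \<in> B" "length ws < r \<or> length ws = r \<and> wsum ws < s"
  then show "b \<tau> m (wd b ws y) \<in> U (Suc r) (m + s)"
    using wd_U[of y "(\<tau>, m) # ws" "Suc r" "m + s"] by auto
qed

lemma b_U0: "x \<in> U r 0 \<Longrightarrow> b \<tau> m x \<in> U (Suc r) 0"
proof (erule U_induct[OF _ U_sub b_lin])
  fix ws :: "('t \<times> nat) list" and y
  assume "y \<in> B" "length ws < r \<or> length ws = r \<and> wsum ws < 0"
  then show "b \<tau> m (wd b ws y) \<in> U (Suc r) 0"
    using wd_U[of y "(\<tau>, m) # ws" "Suc r" "0"] by auto
qed

text \<open>Moving \<open>z j\<close> to the right costs a letter whenever a \<mu>-term arises. The
  term without loss ends in \<open>z j\<close> on B, which is again in B for negative j and zero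
  otherwise.\<close>

lemma z_wd:
  assumes y: "y \<in> B"
  shows "j < 0 \<Longrightarrow> z j (wd b ws y) \<in> U (length ws) (Suc (wsum ws))"
    and "j \<ge> 0 \<Longrightarrow> z j (wd b ws y) \<in> U (length ws) 0"
proof (induction ws arbitrary: j)
  case Nil
  { case 1 then show ?case using wd_U[of "z j y" "[]" 0 "Suc 0"] z_B[OF y] by simp }
  { case 2 then show ?case using z_B0[OF y] by (simp add: cvs.subspace_0 U_sub) }
next
  case (Cons w ws)
  obtain \<tau> m where w: "w = (\<tau>, m)" by force
  have any: "z j (wd b ws y) \<in> U (length ws) (Suc (wsum ws))" for j
    using Cons.IH[of j] U_mono[of "length ws" "length ws" 0 "Suc (wsum ws)"] by (cases "j < 0") auto
  have low: "\<mu> *\<^sub>C z j (wd b ws y) \<in> U (length (w # ws)) s" for j s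
    by (intro cvs.subspace_scale[OF U_sub] U_mono[OF _ any]) simp
  { case 1
    have "b \<tau> m (z j (wd b ws y)) \<in> U (length (w # ws)) (Suc (wsum (w # ws)))"
      using b_U[OF Cons.IH(1)[OF 1], of \<tau> m] by (simp add: w)
    then show ?case by (simp add: w z_b) (use low in \<open>simp add: cvs.subspace_diff[OF U_sub] w\<close>) }
  { case 2
    have "b \<tau> m (z j (wd b ws y)) \<in> U (length (w # ws)) 0"
      using b_U0[OF Cons.IH(2)[OF 2], of \<tau> m] by (simp add: w)
    then show ?case by (simp add: w z_b) (use low in \<open>simp add: cvs.subspace_diff[OF U_sub] w\<close>) }
qed

lemma z_wd_any: "y \<in> B \<Longrightarrow> z j (wd b ws y) \<in> U (length ws) (Suc (wsum ws))"
  using z_wd[of y j ws] U_mono[of "length ws" "length ws" 0 "Suc (wsum ws)"] by (cases "j < 0") auto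

lemma z_wd_low: "y \<in> B \<Longrightarrow> length ws < r \<Longrightarrow> z j (wd b ws y) \<in> U r s"
  using U_mono[OF _ z_wd_any] by blast

lemma z_U: "x \<in> U r s \<Longrightarrow> z j x \<in> U r s"
proof (erule U_induct[OF _ U_sub z_lin])
  fix ws :: "('t \<times> nat) list" and y
  assume "y \<in> B" "length ws < r \<or> length ws = r \<and> wsum ws < s"
  then show "z j (wd b ws y) \<in> U r s"
    by (auto intro: U_mono[OF _ z_wd_any])
qed

lemma a_wd: "y \<in> B \<Longrightarrow> a \<sigma> n (wd b ws y) \<in> U (length ws) 0"
proof (induction ws)
  case Nil
  then show ?case by (simp add: a_B0 cvs.subspace_0 U_sub)
next
  case (Cons w ws)
  obtain \<tau> m where w: "w = (\<tau>, m)" by force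
  have "b \<tau> m (a \<sigma> n (wd b ws y)) \<in> U (length (w # ws)) 0"
    using b_U0[OF Cons.IH[OF Cons.prems]] by simp
  moreover have "z j (wd b ws y) \<in> U (length (w # ws)) 0" for j
    by (intro z_wd_low Cons.prems) simp
  ultimately show ?case
    by (auto simp: w a_b intro!: cvs.subspace_add cvs.subspace_scale U_sub)
qed

definition \<Delta> :: "nat \<Rightarrow> 'x \<Rightarrow> 'x" where
  "\<Delta> N x = (\<Sum>\<sigma>\<in>UNIV. \<Sum>n<N. b \<sigma> n (a \<sigma> n x))"

lemma \<Delta>_lin: "clin (\<Delta> N)"
  by (rule clinI) (simp add: \<Delta>_def clin_simps[OF a_lin] clin_simps[OF b_lin] sum.distrib cvs.scale_sum_right)

lemma b_a: "b \<sigma> n (a \<sigma> n (b \<tau> m x)) = b \<tau> m (b \<sigma> n (a \<sigma> n x))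
  + \<kappa> \<sigma> \<tau> *\<^sub>C z (- 2 - int n - int m) (a \<sigma> n x) + (if \<sigma> = \<tau> then \<epsilon> *\<^sub>C b \<sigma> n (z (int n - 1 - int m) x) else 0)"
  using b_b[of \<sigma> n \<tau> m "a \<sigma> n x"] by (simp add: a_b clin_simps[OF b_lin])

lemma \<Delta>_b: "\<Delta> N (b \<tau> m x) = b \<tau> m (\<Delta> N x)
  + (\<Sum>\<sigma>\<in>UNIV. \<Sum>n<N. \<kappa> \<sigma> \<tau> *\<^sub>C z (- 2 - int n - int m) (a \<sigma> n x)) + \<epsilon> *\<^sub>C (\<Sum>n<N. b \<tau> n (z (int n - 1 - int m) x))"
proof -
  have "(\<Sum>\<sigma>\<in>UNIV. \<Sum>n<N. (if \<sigma> = \<tau> then \<epsilon> *\<^sub>C b \<sigma> n (z (int n - 1 - int m) x) else 0))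
     = \<epsilon> *\<^sub>C (\<Sum>n<N. b \<tau> n (z (int n - 1 - int m) x))"
    by (subst sum.swap) (simp add: cvs.scale_sum_right)
  then show ?thesis by (simp add: \<Delta>_def b_a sum.distrib clin_simps[OF b_lin])
qed

text \<open>Only a contraction that restores the removed letter keeps length and index sum, and it
  contributes \<epsilon> \<open>z (-1)\<close> once per letter. If n < m the index sum drops; if n >
  m a non-negative mode of \<open>z\<close> acts and a letter is lost; the \<kappa>- and \<mu>-terms
  lose a letter as well.\<close>

lemma \<Delta>_wd:
  assumes y: "y \<in> B" and N: "wsum ws < N"
  shows "\<Delta> N (wd b ws y) - (\<epsilon> * of_nat (length ws)) *\<^sub>C z (-1) (wd b ws y) \<in> U (length ws) (wsum ws)"
  using N
proof (induction ws)
  case Nil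
  then show ?case by (simp add: \<Delta>_def a_B0[OF y] clin_simps[OF b_lin] cvs.subspace_0 U_sub)
next
  case (Cons w ws)
  obtain \<tau> m where w: "w = (\<tau>, m)" by force
  let ?x = "wd b ws y" and ?r = "of_nat (length ws) :: complex"
  let ?U = "U (length (w # ws)) (wsum (w # ws))"
  note sub = cvs.subspace_add[OF U_sub] cvs.subspace_scale[OF U_sub] cvs.subspace_diff[OF U_sub]
    cvs.subspace_sum[OF U_sub]
  have 1: "b \<tau> m (\<Delta> N ?x - (\<epsilon> * ?r) *\<^sub>C z (-1) ?x) \<in> ?U"
    using b_U[OF Cons.IH] Cons.prems by (simp add: w)
  have 2: "(\<Sum>n\<in>{..<N} - {m}. b \<tau> n (z (int n - 1 - int m) ?x)) \<in> ?U"
  proof (rule sub(4))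
    fix n assume "n \<in> {..<N} - {m}"
    then consider "n < m" | "n > m" by force
    then show "b \<tau> n (z (int n - 1 - int m) ?x) \<in> ?U"
    proof cases
      case 1
      then have "b \<tau> n (z (int n - 1 - int m) ?x) \<in> U (Suc (length ws)) (n + Suc (wsum ws))"
        by (intro b_U z_wd_any y)
      then show ?thesis by (rule U_mono[rotated]) (use 1 in \<open>simp add: w\<close>)
    next
      case 2
      then have "b \<tau> n (z (int n - 1 - int m) ?x) \<in> U (Suc (length ws)) 0"
        by (intro b_U0 z_wd(2) y) simp
      then show ?thesis by (rule U_mono[rotated]) simp
    qed
  qed
  have 3: "(\<Sum>\<sigma>\<in>UNIV. \<Sum>n<N. \<kappa> \<sigma> \<tau> *\<^sub>C z (- 2 - int n - int m) (a \<sigma> n ?x)) \<in> ?U"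
    by (intro sub(4) sub(2) U_mono[OF _ z_U[OF a_wd[OF y]]]) simp
  have 4: "z (-1 - 1 - int m) ?x \<in> ?U" by (intro z_wd_low y) simp
  have split: "(\<Sum>n<N. b \<tau> n (z (int n - 1 - int m) ?x))
      = b \<tau> m (z (-1) ?x) + (\<Sum>n\<in>{..<N} - {m}. b \<tau> n (z (int n - 1 - int m) ?x))"
    using Cons.prems by (subst sum.remove[of _ m]) (auto simp: w)
  have "\<Delta> N (wd b (w # ws) y) - (\<epsilon> * of_nat (length (w # ws))) *\<^sub>C z (-1) (wd b (w # ws) y)
    = b \<tau> m (\<Delta> N ?x - (\<epsilon> * ?r) *\<^sub>C z (-1) ?x)
      + (\<Sum>\<sigma>\<in>UNIV. \<Sum>n<N. \<kappa> \<sigma> \<tau> *\<^sub>C z (- 2 - int n - int m) (a \<sigma> n ?x))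
      + \<epsilon> *\<^sub>C (\<Sum>n\<in>{..<N} - {m}. b \<tau> n (z (int n - 1 - int m) ?x))
      + (\<epsilon> * of_nat (length (w # ws)) * \<mu>) *\<^sub>C z (-1 - 1 - int m) ?x"
    by (simp add: w \<Delta>_b split z_b clin_simps[OF b_lin] cvs.scale_right_diff_distrib cvs.scale_left_distrib cvs.scale_right_distrib
        distrib_left distrib_right)
  then show ?case by (simp only:) (intro sub(1,2) 1 2 3 4)
qed

lemma \<Delta>_U:
  assumes "x \<in> U r (Suc s)"
  shows "\<Delta> (Suc s) x - (\<epsilon> * of_nat r) *\<^sub>C z (-1) x \<in> U r s"
proof (rule U_induct[OF assms U_sub])
  show "clin (\<lambda>x. \<Delta> (Suc s) x - (\<epsilon> * of_nat r) *\<^sub>C z (-1) x)"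
    by (rule clinI) (simp add: clin_simps[OF \<Delta>_lin] clin_simps[OF z_lin] algebra_simps)
  fix ws :: "('t \<times> nat) list" and y
  assume y: "y \<in> B" and "length ws < r \<or> length ws = r \<and> wsum ws < Suc s"
  then show "\<Delta> (Suc s) (wd b ws y) - (\<epsilon> * of_nat r) *\<^sub>C z (-1) (wd b ws y) \<in> U r s"
  proof (elim disjE conjE)
    assume l: "length ws < r"
    have "\<Delta> (Suc s) (wd b ws y) \<in> U r s" unfolding \<Delta>_def
      by (intro cvs.subspace_sum U_sub U_mono[OF _ b_U0[OF a_wd[OF y]]]) (use l in auto)
    then show ?thesis using z_wd_low[OF y l]
      by (intro cvs.subspace_diff U_sub cvs.subspace_scale) auto
  next
    assume "length ws = r" "wsum ws < Suc s"
    then show ?thesis using \<Delta>_wd[OF y, of ws "Suc s"] U_mono[of "length ws" r "wsum ws" s] by auto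
  qed
qed

text \<open>Words of length at most r with unbounded index sum: a single vector involves finitely
  many of them, which bounds the sum.\<close>

lemma U_Suc_0: "x \<in> U (Suc r) 0 \<Longrightarrow> \<exists>s. x \<in> U r s"
proof -
  assume x: "x \<in> U (Suc r) 0"
  let ?S = "\<Union>s. U r s"
  have "cvs.subspace ?S"
  proof (rule cvs.subspaceI)
    show "0 \<in> ?S" by (auto simp: cvs.subspace_0 U_sub)
    fix u v assume "u \<in> ?S" "v \<in> ?S"
    then obtain s t where "u \<in> U r s" "v \<in> U r t" by blast
    then have "u \<in> U r (max s t)" "v \<in> U r (max s t)" by (auto intro: U_mono[rotated])
    then show "u + v \<in> ?S" using cvs.subspace_add[OF U_sub] by blast
  qed (auto intro: cvs.subspace_scale U_sub)
  moreover have "wd b ws y \<in> ?S" if "y \<in> B" "length ws < Suc r" for ws y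
    using wd_U[OF that(1), of ws r "Suc (wsum ws)"] that by (auto simp: less_Suc_eq)
  ultimately have "x \<in> ?S" by (intro U_induct[OF x _ clin_id]) auto
  then show ?thesis by blast
qed

text \<open>On a vector killed by all annihilators the counting operator vanishes, so its leading words
  are pushed down.\<close>
lemma vacuum_vector:
  assumes "x \<in> U r s" "\<And>\<sigma> n. a \<sigma> n x = 0"
  shows "\<exists>k. (z (-1) ^^ k) x \<in> B"
  using assms
proof (induction r arbitrary: s x)
  case 0
  have "x \<in> B" by (rule U_induct[OF 0(1) B clin_id]) auto
  then show ?case by (intro exI[of _ 0]) simp
next
  case (Suc r)
  show ?case using Suc.prems
  proof (induction s arbitrary: x)
    case 0
    then show ?case using U_Suc_0 Suc.IH by blast
  next
    case (Suc s)
    have "\<Delta> (Suc s) x = 0" by (simp add: \<Delta>_def Suc.prems clin_simps[OF b_lin])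
    then have "(\<epsilon> * of_nat (Suc r)) *\<^sub>C z (-1) x \<in> U (Suc r) s"
      using \<Delta>_U[OF Suc.prems(1)] cvs.subspace_neg[OF U_sub] by fastforce
    then have "z (-1) x \<in> U (Suc r) s"
      by (rule subspace_mult_mem[OF U_sub]) (use \<epsilon> in \<open>simp del: of_nat_Suc\<close>)
    moreover have "a \<sigma> n (z (-1) x) = 0" for \<sigma> n
      by (simp add: a_z Suc.prems clin_simps[OF z_lin])
    ultimately obtain k where "(z (-1) ^^ k) (z (-1) x) \<in> B" using Suc.IH by blast
    then show ?case by (intro exI[of _ "Suc k"]) (simp add: funpow_swap1)
  qed
qed

end

section \<open>The Lie algebra\<close>

lemma scaleC_vec_nth [simp]: "(c *\<^sub>C A) $ i = c *\<^sub>C (A $ i)"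
  by (simp add: scaleC_vec_def)

lemma scaleC_complex [simp]: "c *\<^sub>C (z::complex) = c * z"
  by (simp add: scaleC_complex_def)

lemmas mat3_simps = vec_eq_iff forall_3 matrix_matrix_mult_def sum_3 lie_def munit_def diag3_def trace_def

abbreviation "eM \<equiv> munit 1 3"
abbreviation "pM \<equiv> munit 1 2"
abbreviation "qM \<equiv> munit 2 3"
abbreviation "fM \<equiv> munit 3 1"
text \<open>Chosen in the Cartan subalgebra with [\<omega>, e] = e and [\<omega>, p] = 0, so that it
  counts e and commutes with p. \<open>xM\<close> is the grading element of the reduction.\<close>

definition "wM = diag3 (1/3) (1/3) (-2/3)"
definition "xM = diag3 (1/2) 0 (-1/2)"

lemma sl3_subspace: "cvs.subspace sl3"
  by (auto simp: sl3_def cvs.subspace_def trace_def sum_3 algebra_simps)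
     (metis distrib_left mult_zero_right)+

lemma lie_sl3 [simp]: "lie A B \<in> sl3"
  by (simp add: sl3_def mat3_simps algebra_simps)

lemma mat3_in_sl3 [simp]: "eM \<in> sl3" "pM \<in> sl3" "qM \<in> sl3" "fM \<in> sl3" "wM \<in> sl3" "xM \<in> sl3"
  "munit 2 1 \<in> sl3" "munit 3 2 \<in> sl3"
  by (simp_all add: sl3_def mat3_simps wM_def xM_def)

lemma cartan_sl3: "H \<in> cartan \<Longrightarrow> H \<in> sl3"
  by (auto simp: cartan_def sl3_def mat3_simps)

lemma wx_cartan [simp]: "wM \<in> cartan" "xM \<in> cartan"
  unfolding cartan_def wM_def xM_def by fastforce+

lemma lie_table:
  "lie eM eM = 0" "lie pM pM = 0" "lie qM qM = 0" "lie wM wM = 0"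
  "lie eM pM = 0" "lie eM qM = 0" "lie pM eM = 0" "lie qM eM = 0"
  "lie pM qM = eM" "lie qM pM = - eM"
  "lie wM eM = eM" "lie eM wM = - eM" "lie wM qM = qM" "lie qM wM = - qM" "lie wM pM = 0" "lie pM wM = 0"
  "lie xM eM = eM" "lie xM pM = (1/2) *\<^sub>C pM" "lie xM qM = (1/2) *\<^sub>C qM" "lie xM wM = 0"
  by (auto simp: mat3_simps wM_def xM_def)

lemma trace_table:
  "trace (eM ** eM) = 0" "trace (pM ** pM) = 0" "trace (qM ** qM) = 0"
  "trace (eM ** pM) = 0" "trace (eM ** qM) = 0" "trace (pM ** eM) = 0" "trace (qM ** eM) = 0"
  "trace (pM ** qM) = 0" "trace (qM ** pM) = 0"
  "trace (eM ** wM) = 0" "trace (wM ** eM) = 0" "trace (pM ** wM) = 0" "trace (wM ** pM) = 0"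
  "trace (qM ** wM) = 0" "trace (wM ** qM) = 0" "trace (wM ** wM) = 2/3"
  by (auto simp: mat3_simps wM_def xM_def)

text \<open>The \<open>ad x\<close>-grading, with eigenvalues doubled.\<close>
definition gr :: "int \<Rightarrow> mat3 set" where
  "gr j = {A \<in> sl3. lie xM A = (of_int j / 2) *\<^sub>C A}"

lemma gr_sl3: "A \<in> gr j \<Longrightarrow> A \<in> sl3" by (simp add: gr_def)

lemma lie_lie: "lie A (lie B C) = lie (lie A B) C + lie B (lie A C)"
  by (simp add: mat3_simps algebra_simps)

lemma lie_scale: "lie (c *\<^sub>C A) B = c *\<^sub>C lie A B" "lie A (c *\<^sub>C B) = c *\<^sub>C lie A B"
  by (simp_all add: mat3_simps algebra_simps)

lemma lie_gr: "A \<in> gr i \<Longrightarrow> B \<in> gr j \<Longrightarrow> lie A B \<in> gr (i + j)"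
  by (auto simp: gr_def lie_lie[of xM] lie_scale add_divide_distrib cvs.scale_left_distrib)

text \<open>Invariance of the trace form under ad x gives (i + j) trace(AB) = 0.\<close>

lemma trace_gr: "A \<in> gr i \<Longrightarrow> B \<in> gr j \<Longrightarrow> i + j \<noteq> 0 \<Longrightarrow> trace (A ** B) = 0"
proof -
  assume "A \<in> gr i" "B \<in> gr j" and ij: "i + j \<noteq> 0"
  then have A: "lie xM A = (of_int i / 2) *\<^sub>C A" and B: "lie xM B = (of_int j / 2) *\<^sub>C B" by (auto simp: gr_def)
  have "trace (lie xM A ** B) + trace (A ** lie xM B) = 0"
    by (simp add: mat3_simps algebra_simps)
  moreover have "trace ((c *\<^sub>C A) ** B) = c * trace (A ** B)" "trace (A ** (c *\<^sub>C B)) = c * trace (A ** B)" for c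
    by (simp_all add: mat3_simps algebra_simps)
  ultimately have "(of_int i / 2) * trace (A ** B) + (of_int j / 2) * trace (A ** B) = 0"
    by (simp add: A B)
  then have "of_int (i + j) * trace (A ** B) = 0" by (simp add: field_simps)
  with ij show ?thesis by (metis mult_eq_0_iff of_int_eq_0_iff)
qed

lemma gr_table: "eM \<in> gr 2" "pM \<in> gr 1" "qM \<in> gr 1" "wM \<in> gr 0" "munit 2 1 \<in> gr (-1)" "munit 3 2 \<in> gr (-1)"
  "fM \<in> gr (-2)" "H \<in> cartan \<Longrightarrow> H \<in> gr 0"
  by (auto simp: gr_def cartan_sl3) (auto simp: mat3_simps wM_def xM_def cartan_def)

text \<open>Reduces claims that are linear in the matrix to homogeneous matrices, for which letters
  are defined.\<close>

lemma gr_decomp: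
  assumes "cvs.subspace U" "\<And>j A. A \<in> gr j \<Longrightarrow> f A \<in> U"
    and "\<And>c A B. A \<in> sl3 \<Longrightarrow> B \<in> sl3 \<Longrightarrow> f (c *\<^sub>C A + B) = c *\<^sub>C f A + f B" and A: "A \<in> sl3"
  shows "f A \<in> U"
proof -
  have step: "f (c *\<^sub>C B + C) \<in> U" if "B \<in> gr j" "f C \<in> U" "C \<in> sl3" for c B C j
    using that assms(2)[OF that(1)] assms(1) by (simp add: assms(3) gr_sl3 cvs.subspace_add cvs.subspace_scale)
  have st: "c *\<^sub>C B + C \<in> sl3" if "B \<in> sl3" "C \<in> sl3" for c B C
    using that sl3_subspace by (auto intro: cvs.subspace_add cvs.subspace_scale)
  have A2: "A = (A$1$3) *\<^sub>C eM + ((A$1$2) *\<^sub>C pM + ((A$2$3) *\<^sub>C qM + ((A$2$1) *\<^sub>C munit 2 1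
     + ((A$3$2) *\<^sub>C munit 3 2 + ((A$3$1) *\<^sub>C fM + diag3 (A$1$1) (A$2$2) (A$3$3))))))"
    by (simp add: mat3_simps)
  have H: "diag3 (A$1$1) (A$2$2) (A$3$3) \<in> cartan"
    using A by (auto simp: cartan_def sl3_def trace_def sum_3)
  note s0 = assms(2)[OF gr_table(8)[OF H]] and m0 = cartan_sl3[OF H]
  note s1 = step[OF gr_table(7) s0 m0] and m1 = st[OF mat3_in_sl3(4) m0]
  note s2 = step[OF gr_table(6) s1 m1] and m2 = st[OF mat3_in_sl3(8) m1]
  note s3 = step[OF gr_table(5) s2 m2] and m3 = st[OF mat3_in_sl3(7) m2]
  note s4 = step[OF gr_table(3) s3 m3] and m4 = st[OF mat3_in_sl3(3) m3]
  note s5 = step[OF gr_table(2) s4 m4] and m5 = st[OF mat3_in_sl3(2) m4]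
  show ?thesis by (subst A2) (rule step[OF gr_table(1) s5 m5])
qed

lemma gr_bound:
  assumes "A \<in> gr j" "A \<noteq> 0" shows "j \<in> {-2..2}"
proof -
  have A: "lie xM A = (of_int j / 2) *\<^sub>C A" using assms by (simp add: gr_def)
  obtain r s where rs: "A $ r $ s \<noteq> 0" using assms(2) by (auto simp: vec_eq_iff)
  obtain d :: int where d: "lie xM A $ r $ s = (of_int d / 2) * A $ r $ s" "d \<in> {-2..2}"
    using exhaust_3[of r] exhaust_3[of s]
  proof (elim disjE)
  qed (auto simp: mat3_simps xM_def intro: that[of 0] that[of 1] that[of 2] that[of "-1"] that[of "-2"])
  have "of_int d = (of_int j :: complex)" using d(1) rs unfolding A by simp
  then show ?thesis using d by simp
qed

lemma gr_pos:
  assumes "A \<in> gr j" "j > 0"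
  shows "A = (A$1$2) *\<^sub>C pM + ((A$2$3) *\<^sub>C qM + (A$1$3) *\<^sub>C eM)"
proof -
  have *: "lie xM A $ r $ s = (of_int j / 2) * A $ r $ s" for r s
    using assms by (simp add: gr_def)
  have j': "of_int j \<noteq> (of_int m :: complex)" if "m \<le> 0" for m
    using assms(2) that by simp
  have j: "of_int j \<noteq> (0::complex)" "of_int j \<noteq> (-1::complex)" "of_int j \<noteq> (-2::complex)"
    using j'[of 0] j'[of "-1"] j'[of "-2"] by simp_all
  have c: "m * y = of_int j * y \<Longrightarrow> of_int j \<noteq> m \<Longrightarrow> y = 0" for m y :: complex
    by auto
  have "A$1$1 = 0" "A$2$2 = 0" "A$3$3 = 0" "A$2$1 = 0" "A$3$2 = 0" "A$3$1 = 0"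
    using *[of 1 1] *[of 2 2] *[of 3 3] *[of 2 1] *[of 3 2] *[of 3 1] j
      c[of "-1" "A$2$1"] c[of "-1" "A$3$2"] c[of "-2" "A$3$1"]
    by (auto simp: mat3_simps xM_def field_simps)
  then show ?thesis by (simp add: mat3_simps)
qed


section \<open>Words of positive degree\<close>

definition ow :: "(('x \<Rightarrow> 'x) \<times> int) list \<Rightarrow> 'x \<Rightarrow> 'x" where
  "ow ws x = foldr fst ws x"

definition odeg :: "(('x \<Rightarrow> 'x) \<times> int) list \<Rightarrow> int" where
  "odeg ws = sum_list (map snd ws)"

lemma ow_simps [simp]: "ow [] x = x" "ow (w # ws) x = fst w (ow ws x)" "ow (us @ ws) x = ow us (ow ws x)"
  and odeg_simps [simp]: "odeg [] = 0" "odeg (w # ws) = snd w + odeg ws" "odeg (us @ ws) = odeg us + odeg ws"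
  by (simp_all add: ow_def odeg_def)

text \<open>Common frame for the current modes on M and for the current and ghost modes on the
  complex. In \<open>swap\<close> the factor c is the Koszul sign, S the commutator letter and c0
  the central term. Degrees are doubled to stay integral.\<close>

locale graded_letters =
  fixes G :: "(('x::complex_vector \<Rightarrow> 'x) \<times> int) set" and v :: 'x
  assumes lin: "w \<in> G \<Longrightarrow> clin (fst w)"
    and swap: "w \<in> G \<Longrightarrow> w' \<in> G \<Longrightarrow> \<exists>c c0 S. (S = (\<lambda>x. 0) \<or> (S, snd w + snd w') \<in> G) \<and>
      (c0 \<noteq> 0 \<longrightarrow> snd w + snd w' = 0) \<and> (\<forall>x. fst w (fst w' x) = c *\<^sub>C fst w' (fst w x) + S x + c0 *\<^sub>C x)"
    and pos: "w \<in> G \<Longrightarrow> snd w > 0 \<Longrightarrow> fst w v = 0"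
    and cyclic: "cvs.subspace U \<Longrightarrow> v \<in> U \<Longrightarrow> (\<And>w x. w \<in> G \<Longrightarrow> x \<in> U \<Longrightarrow> fst w x \<in> U) \<Longrightarrow> U = UNIV"
begin

lemma ow_lin: "set ws \<subseteq> G \<Longrightarrow> clin (ow ws)"
proof (induction ws)
  case (Cons w ws)
  then have "clin (fst w)" "clin (ow ws)" using lin by auto
  then show ?case by (intro clinI) (simp add: clin_add clin_scale)
qed (simp add: clinI)

text \<open>A letter of positive degree is moved to the right until it meets v. Every exchange
  leaves behind words of the same degree with fewer letters, which the induction on length
  covers.\<close>

lemma normal_order:
  assumes P: "cvs.subspace P"
    and nonpos: "\<And>ws. set ws \<subseteq> G \<Longrightarrow> odeg ws = d \<Longrightarrow> \<forall>w\<in>set ws. snd w \<le> 0 \<Longrightarrow> ow ws v \<in> P"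
  shows "set ws \<subseteq> G \<Longrightarrow> odeg ws = d \<Longrightarrow> ow ws v \<in> P"
proof (induction "length ws" arbitrary: ws rule: less_induct)
  case less
  have IH: "ow ws' v \<in> P" if "length ws' < length ws" "set ws' \<subseteq> G" "odeg ws' = d" for ws'
    using less.hyps that by blast
  show ?case
  proof (cases "\<exists>t\<in>set ws. snd t > 0")
    case False
    then show ?thesis using nonpos less.prems by fastforce
  next
    case True
    then obtain us t rs where ws: "ws = us @ t # rs" "snd t > 0" by (metis split_list)
    have "ow (us @ t # rs) v \<in> P"
      if "length (us @ t # rs) = length ws" "set (us @ t # rs) \<subseteq> G" "odeg (us @ t # rs) = d" for us rs
      using that
    proof (induction rs arbitrary: us)
      case Nil
      then show ?case using pos[of t] ws(2) clin_zero[OF ow_lin[of us]] cvs.subspace_0[OF P] by simp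
    next
      case (Cons r rs)
      then have G: "t \<in> G" "r \<in> G" "set us \<subseteq> G" "set rs \<subseteq> G" by auto
      obtain c c0 S where S: "S = (\<lambda>x. 0) \<or> (S, snd t + snd r) \<in> G" "c0 \<noteq> 0 \<longrightarrow> snd t + snd r = 0"
        and eq: "\<And>x. fst t (fst r x) = c *\<^sub>C fst r (fst t x) + S x + c0 *\<^sub>C x"
        using swap[OF G(1,2)] by metis
      have 1: "ow ((us @ [r]) @ t # rs) v \<in> P" by (rule Cons.IH) (use Cons.prems in auto)
      have 2: "ow us (S (ow rs v)) \<in> P"
      proof (cases "S = (\<lambda>x. 0)")
        case True
        then show ?thesis using clin_zero[OF ow_lin[OF G(3)]] cvs.subspace_0[OF P] by simp
      next
        case False
        then have "ow (us @ (S, snd t + snd r) # rs) v \<in> P"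
          using S Cons.prems by (intro IH) auto
        then show ?thesis by simp
      qed
      have 3: "c0 *\<^sub>C ow us (ow rs v) \<in> P"
      proof (cases "c0 = 0")
        case False
        then have "ow (us @ rs) v \<in> P" using S Cons.prems by (intro IH) auto
        then show ?thesis by (simp add: cvs.subspace_scale[OF P])
      qed (simp add: cvs.subspace_0[OF P])
      show ?case using 1 2 3
        by (simp add: eq clin_simps[OF ow_lin[OF G(3)]] cvs.subspace_add[OF P] cvs.subspace_scale[OF P])
    qed
    then show ?thesis using less.prems ws by blast
  qed
qed

lemma positive_word: "set ws \<subseteq> G \<Longrightarrow> odeg ws > 0 \<Longrightarrow> ow ws v = 0"
proof -
  assume ws: "set ws \<subseteq> G" "odeg ws > 0"
  have "ow ws v \<in> {0}"
  proof (rule normal_order[OF _ _ ws(1) refl])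
    fix us :: "(('x \<Rightarrow> 'x) \<times> int) list" assume "odeg us = odeg ws" "\<forall>w\<in>set us. snd w \<le> 0"
    moreover from this have "odeg us \<le> 0" unfolding odeg_def by (intro sum_list_nonpos) auto
    ultimately show "ow us v \<in> {0}" using ws(2) by simp
  qed (simp add: cvs.subspace_def)
  then show ?thesis by simp
qed

text \<open>Filtration by the degrees of the words that do not kill x. It is exhaustive, as v lies
  in \<open>Fil 0\<close> and letters shift it; this is the source of all local nilpotency
  below.\<close>

definition Fil :: "int \<Rightarrow> 'x set" where
  "Fil D = {x. \<forall>ws. set ws \<subseteq> G \<longrightarrow> odeg ws > D \<longrightarrow> ow ws x = 0}"

lemma Fil_sub: "cvs.subspace (Fil D)"
  unfolding Fil_def cvs.subspace_def
  by (auto simp: clin_simps[OF ow_lin])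

lemma Fil_mono: "D \<le> D' \<Longrightarrow> x \<in> Fil D \<Longrightarrow> x \<in> Fil D'"
  by (auto simp: Fil_def)

lemma Fil_neg: "x \<in> Fil D \<Longrightarrow> D < 0 \<Longrightarrow> x = 0"
  by (auto simp: Fil_def dest: spec[of _ "[]"])

lemma v_Fil: "v \<in> Fil 0"
  by (auto simp: Fil_def positive_word)

lemma letter_Fil: "w \<in> G \<Longrightarrow> x \<in> Fil D \<Longrightarrow> fst w x \<in> Fil (D - snd w)"
proof -
  assume w: "w \<in> G" and "x \<in> Fil D"
  then have x: "ow ws x = 0" if "set ws \<subseteq> G" "odeg ws > D" for ws
    using that by (auto simp: Fil_def)
  show ?thesis unfolding Fil_def
  proof (intro CollectI allI impI)
    fix ws assume "set ws \<subseteq> G" "D - snd w < odeg ws"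
    then show "ow ws (fst w x) = 0" using x[of "ws @ [w]"] w by simp
  qed
qed

lemma Fil_exhaustive: obtains D where "x \<in> Fil D" "D \<ge> 0"
proof -
  have sub: "cvs.subspace {x. \<exists>D. x \<in> Fil D}"
  proof (rule cvs.subspaceI)
    fix x y assume "x \<in> {x. \<exists>D. x \<in> Fil D}" "y \<in> {x. \<exists>D. x \<in> Fil D}"
    then obtain D D' where "x \<in> Fil D" "y \<in> Fil D'" by blast
    then have "x \<in> Fil (max D D')" "y \<in> Fil (max D D')" by (auto intro: Fil_mono[rotated])
    then show "x + y \<in> {x. \<exists>D. x \<in> Fil D}" using cvs.subspace_add[OF Fil_sub] by blast
  qed (auto intro: cvs.subspace_scale[OF Fil_sub] simp: cvs.subspace_0[OF Fil_sub])
  have "{x. \<exists>D. x \<in> Fil D} = UNIV"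
    by (rule cyclic[OF sub]) (use v_Fil letter_Fil in blast)+
  then obtain D where "x \<in> Fil D" by blast
  then have "x \<in> Fil (max D 0)" by (auto intro: Fil_mono[rotated])
  then show ?thesis using that by simp
qed

end

section \<open>Modules over the universal affine vertex algebra\<close>

locale affine_va =
  fixes k :: complex and V :: "('v::complex_vector) vosa" and \<iota> :: "mat3 \<Rightarrow> 'v"
  assumes ua: "universal_affine k V \<iota>"
begin

sublocale vsa V
  using ua by unfold_locales (simp add: universal_affine_def vertex_algebra_def)

lemma even [simp]: "u \<in> par V False"
proof -
  obtain a b where "a \<in> par V False" "b \<in> par V True" "u = a + b" by (rule par_decomp)
  moreover have "par V True = {0}" using ua by (simp add: universal_affine_def vertex_algebra_def)
  ultimately show ?thesis by simp
qed

lemma iota_lin: "A \<in> sl3 \<Longrightarrow> B \<in> sl3 \<Longrightarrow> \<iota> (c *\<^sub>C A + B) = c *\<^sub>C \<iota> A + \<iota> B"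
  using ua by (simp add: universal_affine_def clinear_on_def)

lemma zero_sl3 [simp]: "0 \<in> sl3"
  by (rule cvs.subspace_0[OF sl3_subspace])

lemma iota_0 [simp]: "\<iota> 0 = 0"
  using iota_lin[of 0 0 1] by simp

lemma iota_scale: "A \<in> sl3 \<Longrightarrow> \<iota> (c *\<^sub>C A) = c *\<^sub>C \<iota> A"
  using iota_lin[of A 0 c] by simp

lemma iota_uminus: "A \<in> sl3 \<Longrightarrow> \<iota> (- A) = - \<iota> A"
  using iota_scale[of A "-1"] by simp

lemma iota_add: "A \<in> sl3 \<Longrightarrow> B \<in> sl3 \<Longrightarrow> \<iota> (A + B) = \<iota> A + \<iota> B"
  using iota_lin[of A B 1] by simp

lemma iota_ope:
  assumes "A \<in> sl3" "B \<in> sl3"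
  shows "mode V (\<iota> A) 0 (\<iota> B) = \<iota> (lie A B)" "mode V (\<iota> A) 1 (\<iota> B) = (k * trace (A ** B)) *\<^sub>C vac V"
    and "j \<ge> 2 \<Longrightarrow> mode V (\<iota> A) (int j) (\<iota> B) = 0"
proof -
  have o: "mode V (\<iota> A) (int j) (\<iota> B) =
     (if j < 2 then [\<iota> (lie A B), (k * trace (A ** B)) *\<^sub>C vac V] ! j else 0)" for j
    using ua assms by (simp add: universal_affine_def ope_def)
  show "mode V (\<iota> A) 0 (\<iota> B) = \<iota> (lie A B)" "mode V (\<iota> A) 1 (\<iota> B) = (k * trace (A ** B)) *\<^sub>C vac V"
    using o[of 0] o[of 1] by simp_all
  show "j \<ge> 2 \<Longrightarrow> mode V (\<iota> A) (int j) (\<iota> B) = 0" using o[of j] by simp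
qed

lemma V_cyclic:
  assumes "cvs.subspace U" "vac V \<in> U" "\<And>A n x. A \<in> sl3 \<Longrightarrow> x \<in> U \<Longrightarrow> mode V (\<iota> A) n x \<in> U"
  shows "U = UNIV"
proof -
  let ?g = "\<lambda>w. foldr (\<lambda>(A, n). mode V (\<iota> A) n) w (vac V)"
  have "?g w \<in> U" if "w \<in> lists (sl3 \<times> UNIV)" for w
    using that by (induction w) (use assms in auto)
  then have mem: "lin_ext ?g p \<in> U" if "Poly_Mapping.keys p \<subseteq> lists (sl3 \<times> UNIV)" for p
    unfolding lin_ext_def using that by (intro cvs.subspace_sum cvs.subspace_scale assms(1)) auto
  have onto: "lin_ext ?g ` {p. Poly_Mapping.keys p \<subseteq> lists (sl3 \<times> UNIV)} = UNIV"
    using ua by (simp add: universal_affine_def presented_by_def)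
  have "x \<in> U" for x
  proof -
    have "x \<in> lin_ext ?g ` {p. Poly_Mapping.keys p \<subseteq> lists (sl3 \<times> UNIV)}" by (simp only: onto UNIV_I)
    then show ?thesis by (elim imageE) (simp add: mem)
  qed
  then show ?thesis by blast
qed

end

locale affine_vmod = affine_va k V \<iota> + va_mod V Y
  for k and V :: "('v::complex_vector) vosa" and \<iota> and Y :: "'v \<Rightarrow> int \<Rightarrow> 'm \<Rightarrow> 'm::complex_vector"
begin

lemma affine_comm:
  assumes "A \<in> sl3" "B \<in> sl3"
  shows "Y (\<iota> A) m (Y (\<iota> B) n x) = Y (\<iota> B) n (Y (\<iota> A) m x) + Y (\<iota> (lie A B)) (m + n) x
    + (if m + n = 0 then of_int m * k * trace (A ** B) else 0) *\<^sub>C x"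
proof -
  have "Sum_any (\<lambda>j::nat. (of_int m gchoose j) *\<^sub>C Y (mode V (\<iota> A) (int j) (\<iota> B)) (m + n - int j) x)
    = (\<Sum>j<2. (of_int m gchoose j) *\<^sub>C Y (mode V (\<iota> A) (int j) (\<iota> B)) (m + n - int j) x)"
    by (rule Sum_any_lessThan) (simp add: iota_ope[OF assms] lin1_simps)
  also have "\<dots> = Y (\<iota> (lie A B)) (m + n) x + (if m + n = 0 then of_int m * k * trace (A ** B) else 0) *\<^sub>C x"
    by (simp add: numeral_2_eq_2 iota_ope[OF assms] lin1_simps vacuum)
  finally show ?thesis using commutator[of "\<iota> A" False "\<iota> B" False m n x] by simp
qed

lemma iota_Y_0 [simp]: "Y 0 n x = 0" by (rule clin_zero[OF lin1])

abbreviation "E n \<equiv> Y (\<iota> eM) n"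
abbreviation "P n \<equiv> Y (\<iota> pM) n"
abbreviation "Q n \<equiv> Y (\<iota> qM) n"
abbreviation "Om n \<equiv> Y (\<iota> wM) n"

lemma epq_comm:
  "E m (E n x) = E n (E m x)" "E m (P n x) = P n (E m x)" "E m (Q n x) = Q n (E m x)"
  "P m (P n x) = P n (P m x)" "Q m (Q n x) = Q n (Q m x)"
  "P m (Q n x) = Q n (P m x) + E (m + n) x"
  "Om m (E n x) = E n (Om m x) + E (m + n) x" "Om m (Q n x) = Q n (Om m x) + Q (m + n) x"
  "Om m (P n x) = P n (Om m x)"
  "Om m (Om n x) = Om n (Om m x) + (if m + n = 0 then of_int m * k * (2/3) else 0) *\<^sub>C x"
  by (subst affine_comm, simp, simp, simp add: lie_table trace_table)+

definition \<Omega> :: "'m set" where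
  "\<Omega> = {x. \<forall>n\<ge>0. E n x = 0 \<and> P n x = 0 \<and> Q n x = 0}"

lemma \<Omega>_sub: "cvs.subspace \<Omega>"
  by (auto simp: \<Omega>_def cvs.subspace_def lin2_simps)

definition b_stable :: "'m set \<Rightarrow> bool" where
  "b_stable U \<longleftrightarrow> (\<forall>n. \<forall>x\<in>U. E n x \<in> U \<and> P n x \<in> U \<and> Q n x \<in> U \<and> Om n x \<in> U)"

definition saturated :: "'m set \<Rightarrow> bool" where
  "saturated U \<longleftrightarrow> (\<forall>x. E (-1) x \<in> U \<longrightarrow> x \<in> U)"

definition V_stable :: "'m set \<Rightarrow> bool" where
  "V_stable U \<longleftrightarrow> cvs.subspace U \<and> (\<forall>u n. \<forall>x\<in>U. Y u n x \<in> U)"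

lemma V_stable_b: "V_stable U \<Longrightarrow> b_stable U"
  by (auto simp: V_stable_def b_stable_def)

end

section \<open>Highest weight modules and the elimination of e, p and q\<close>

locale hw_mod = affine_vmod k V \<iota> Y
  for k and V :: "('v::complex_vector) vosa" and \<iota> and Y :: "'v \<Rightarrow> int \<Rightarrow> 'm \<Rightarrow> 'm::complex_vector" +
  fixes v :: 'm and a b :: nat
  assumes hw_pos: "A \<in> sl3 \<Longrightarrow> n \<ge> 1 \<Longrightarrow> Y (\<iota> A) n v = 0"
    and hw_root: "Y (\<iota> (root_vector \<alpha>)) 0 v = 0"
    and hw_cartan: "H \<in> cartan \<Longrightarrow> Y (\<iota> H) 0 v = (of_nat a * omega1 H + of_nat b * omega2 H) *\<^sub>C v"
    and hw_cyclic: "cvs.subspace U \<Longrightarrow> v \<in> U \<Longrightarrow> (\<And>A n x. A \<in> sl3 \<Longrightarrow> x \<in> U \<Longrightarrow> Y (\<iota> A) n x \<in> U) \<Longrightarrow> U = UNIV"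
begin

lemma hw_epq [simp]: "n \<ge> 0 \<Longrightarrow> E n v = 0" "n \<ge> 0 \<Longrightarrow> P n v = 0" "n \<ge> 0 \<Longrightarrow> Q n v = 0"
  using hw_root[of Theta] hw_root[of Alpha1] hw_root[of Alpha2] hw_pos[of _ n]
  by (cases "n = 0"; simp)+

text \<open>The degree 2n + j is minus twice the weight of the mode under L_0 - x_0, the conformal
  weight of the reduced module. Both e_(-1) and f_(1) have degree 0.\<close>

definition letters :: "(('m \<Rightarrow> 'm) \<times> int) set" where
  "letters = {(Y (\<iota> A) n, 2 * n + j) | A n j. A \<in> gr j}"

lemma letter: "A \<in> gr j \<Longrightarrow> d = 2 * n + j \<Longrightarrow> (Y (\<iota> A) n, d) \<in> letters"
  unfolding letters_def by blast

sublocale gl: graded_letters letters v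
proof
  fix w assume "w \<in> letters"
  then show "clin (fst w)" by (auto simp: letters_def lin2)
  { fix w' assume "w' \<in> letters"
    with \<open>w \<in> letters\<close> obtain A m i B n j where w: "w = (Y (\<iota> A) m, 2 * m + i)" "w' = (Y (\<iota> B) n, 2 * n + j)"
      and gr: "A \<in> gr i" "B \<in> gr j" unfolding letters_def by blast
    let ?c0 = "if m + n = 0 then of_int m * k * trace (A ** B) else 0"
    have eq: "fst w (fst w' x) = 1 *\<^sub>C fst w' (fst w x) + Y (\<iota> (lie A B)) (m + n) x + ?c0 *\<^sub>C x" for x
      using affine_comm[OF gr_sl3 gr_sl3, OF gr, of m n x] by (simp add: w)
    have "(Y (\<iota> (lie A B)) (m + n), snd w + snd w') \<in> letters"
      by (rule letter[OF lie_gr[OF gr]]) (simp add: w)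
    moreover have "?c0 \<noteq> 0 \<longrightarrow> snd w + snd w' = 0"
    proof
      assume "?c0 \<noteq> 0"
      then have "m + n = 0" "i + j = 0" using trace_gr[OF gr] by (auto split: if_splits)
      then show "snd w + snd w' = 0" by (simp add: w)
    qed
    ultimately show "\<exists>c c0 S. (S = (\<lambda>x. 0) \<or> (S, snd w + snd w') \<in> letters) \<and>
      (c0 \<noteq> 0 \<longrightarrow> snd w + snd w' = 0) \<and> (\<forall>x. fst w (fst w' x) = c *\<^sub>C fst w' (fst w x) + S x + c0 *\<^sub>C x)"
      using eq by blast }
  { assume "snd w > 0"
    with \<open>w \<in> letters\<close> obtain A n j where w: "w = (Y (\<iota> A) n, 2 * n + j)" "2 * n + j > 0" and gr: "A \<in> gr j"
      by (auto simp: letters_def)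
    consider "n \<ge> 1" | "n = 0" | "n < 0" by linarith
    then show "fst w v = 0"
    proof cases
      case 1
      then show ?thesis by (simp add: w hw_pos gr_sl3[OF gr])
    next
      case 2
      have m: "c *\<^sub>C qM + d *\<^sub>C eM \<in> sl3" "d *\<^sub>C eM \<in> sl3" for c d
        by (auto simp: sl3_def mat3_simps)
      have "Y (\<iota> ((A$1$2) *\<^sub>C pM + ((A$2$3) *\<^sub>C qM + (A$1$3) *\<^sub>C eM))) 0 v = 0"
        by (simp add: iota_lin m iota_scale lin1_simps)
      then show ?thesis using gr_pos[OF gr] w 2 by simp
    next
      \<comment> \<open>A negative mode of positive degree would need j > 2, beyond the range of the
        grading.\<close>
      case 3
      then have "A = 0" using gr_bound[OF gr] w by fastforce
      then show ?thesis by (simp add: w)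
    qed }
next
  fix U assume U: "cvs.subspace U" "v \<in> U" "\<And>w x. w \<in> letters \<Longrightarrow> x \<in> U \<Longrightarrow> fst w x \<in> U"
  show "U = UNIV"
  proof (rule hw_cyclic[OF U(1,2)])
    fix A n x assume A: "A \<in> sl3" and x: "x \<in> U"
    show "Y (\<iota> A) n x \<in> U"
    proof (rule gr_decomp[OF U(1) _ _ A])
      fix j B assume "B \<in> gr j"
      then show "Y (\<iota> B) n x \<in> U" using U(3)[OF letter[OF _ refl, of B j n] x] by simp
    qed (simp add: iota_lin lin1_simps)
  qed
qed

text \<open>A letter of degree at least 1 + i makes the degree of a word grow with its length and
  with its index sum, while x is killed by all words of large degree.\<close>

lemma word_zero:
  assumes "\<And>\<tau> i. \<exists>d. (A \<tau> i, d) \<in> letters \<and> d \<ge> 1 + int i"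
  shows "\<exists>D. \<forall>ws. length ws + wsum ws > D \<longrightarrow> wd A ws x = 0"
proof -
  obtain D where D: "x \<in> gl.Fil D" "D \<ge> 0" by (rule gl.Fil_exhaustive)
  obtain d where d: "(A \<tau> i, d \<tau> i) \<in> letters" "d \<tau> i \<ge> 1 + int i" for \<tau> i using assms by metis
  have "wd A ws x = 0" if "length ws + wsum ws > nat D" for ws
  proof -
    let ?ws = "map (\<lambda>(\<tau>, i). (A \<tau> i, d \<tau> i)) ws"
    have "ow ?ws x = wd A ws x" by (induction ws) auto
    moreover have "odeg ?ws \<ge> length ws + wsum ws"
    proof (induction ws)
      case (Cons w ws)
      have "d (fst w) (snd w) \<ge> 1 + int (snd w)" by (rule d(2))
      then show ?case using Cons by (cases w) simp
    qed simp
    moreover have "set ?ws \<subseteq> letters" using d(1) by auto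
    ultimately show ?thesis using D that by (auto simp: gl.Fil_def)
  qed
  then show ?thesis by blast
qed

text \<open>Since [\<omega>_(m), e_(n)] = e_(m+n), the products \<omega>_(-1-n) e_(n) count the
  modes of e, each with the factor e_(-1).\<close>

lemma elimination_e:
  "elimination UNIV (\<lambda>(_::unit) i. E (int i)) E (\<lambda>N x. \<Sum>n<N. Om (- 1 - int n) (E (int n) x))"
proof
  fix x :: 'm and i N
  have "E i (Om (- 1 - int n) (E n x)) = Om (- 1 - int n) (E n (E i x)) - E (int i - 1 - int n) (E n x)" for i n :: nat
    using epq_comm(7)[of "- 1 - int n" "int i" "E n x"] epq_comm(1)[of i n x] by (simp add: algebra_simps)
  then show "E (int i) (\<Sum>n<N. Om (- 1 - int n) (E (int n) x))
     = (\<Sum>n<N. Om (- 1 - int n) (E (int n) (E (int i) x))) - (\<Sum>n<N. E (int i - 1 - int n) (E (int n) x))"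
    by (simp add: lin2_simps sum_subtractf)
  show "\<exists>D. \<forall>ws. length ws + wsum ws > D \<longrightarrow> wd (\<lambda>(_::unit) i. E (int i)) ws x = 0"
    by (rule word_zero) (use letter[OF gr_table(1) refl] in force)
qed (auto simp: lin2 lin2_simps epq_comm(1))

definition NE :: "'m set" where "NE = {x. \<forall>n\<ge>0. E n x = 0}"

text \<open>p and q are each other's partners through [p_(m), q_(n)] = e_(m+n). The restriction to
  \<open>NE\<close> makes their non-negative modes commute, the commutator being a non-negative mode
  of e.\<close>

lemma elimination_pq:
  "elimination NE (\<lambda>\<tau> i. if \<tau> then P (int i) else Q (int i)) E
    (\<lambda>N x. \<Sum>n<N. P (- 1 - int n) (Q (int n) x) - Q (- 1 - int n) (P (int n) x))"
proof
  fix x :: 'm and i N and \<tau> :: bool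
  assume x: "x \<in> NE"
  let ?\<Delta> = "\<lambda>N x. \<Sum>n<N. P (- 1 - int n) (Q (int n) x) - Q (- 1 - int n) (P (int n) x)"
  let ?A = "\<lambda>\<tau> i. if \<tau> then P (int i) else Q (int i)"
  have z: "E n x = 0" if "n \<ge> 0" for n using x that by (simp add: NE_def)
  have pq: "P i (Q n x) = Q n (P i x)" if "i \<ge> 0" "n \<ge> 0" for i n
    using epq_comm(6)[of i n x] z that by simp
  have "P i (Q (- 1 - int n) (P n x)) = Q (- 1 - int n) (P n (P i x)) + E (int i - 1 - int n) (P n x)"
       "P i (P (- 1 - int n) (Q n x)) = P (- 1 - int n) (Q n (P i x))" for i n :: nat
    using epq_comm(6)[of i "- 1 - int n" "P n x"] epq_comm(4)[of i n x] epq_comm(4)[of i "- 1 - int n" "Q n x"] pq[of i n]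
    by (simp_all add: algebra_simps)
  moreover have "Q i (P (- 1 - int n) (Q n x)) = P (- 1 - int n) (Q n (Q i x)) - E (int i - 1 - int n) (Q n x)"
       "Q i (Q (- 1 - int n) (P n x)) = Q (- 1 - int n) (P n (Q i x))" for i n :: nat
    using epq_comm(6)[of "- 1 - int n" i "Q n x"] epq_comm(5)[of i n x] epq_comm(5)[of i "- 1 - int n" "P n x"] pq[of n i]
    by (simp_all add: algebra_simps)
  ultimately show "?A \<tau> i (?\<Delta> N x) = ?\<Delta> N (?A \<tau> i x) - (\<Sum>n<N. E (int i - 1 - int n) (?A \<tau> n x))"
    by (simp add: lin2_simps sum_subtractf sum.distrib)
  show "\<exists>D. \<forall>ws. length ws + wsum ws > D \<longrightarrow> wd ?A ws x = 0"
    by (rule word_zero) (use letter[OF gr_table(2) refl] letter[OF gr_table(3) refl] in \<open>force split: if_splits\<close>)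
  show "?A \<tau> i x \<in> NE"
    using z epq_comm(2,3) by (auto simp: NE_def lin2_simps)
  show "E (-1) x \<in> NE"
    using z by (auto simp: NE_def lin2_simps epq_comm(1)[of _ "-1"])
  show "?\<Delta> N x \<in> NE"
    using z epq_comm(2,3) by (auto simp: NE_def lin2_simps)
  show "E (int l) x = 0" for l using z by simp
  { assume "\<And>\<tau> i. ?A \<tau> i x = 0"
    from this[of True] this[of False] show "?\<Delta> N x = 0" by (simp add: lin2_simps) }
next
  show "cvs.subspace NE" by (auto simp: NE_def cvs.subspace_def lin2_simps)
qed (auto simp: lin2 epq_comm(2,3))

text \<open>In the elimination step \<Delta> x lies in U because the A x do by induction, and the
  corrected vector lies in U as well. So a non-zero multiple of e_(-1) x lies in U, and saturation
  releases x. The modes of e go before those of p and q, whose elimination lives on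
  \<open>NE\<close>.\<close>

lemma contains_if_contains_vacuum:
  assumes S: "cvs.subspace S" "b_stable S" and U: "cvs.subspace U" "b_stable U" "saturated U"
    and vac: "S \<inter> \<Omega> \<subseteq> U"
  shows "S \<subseteq> U"
proof
  interpret el: elimination UNIV "\<lambda>(_::unit) i. E (int i)" E "\<lambda>N x. \<Sum>n<N. Om (- 1 - int n) (E (int n) x)"
    by (rule elimination_e)
  interpret pq: elimination NE "\<lambda>\<tau> i. if \<tau> then P (int i) else Q (int i)" E
    "\<lambda>N x. \<Sum>n<N. P (- 1 - int n) (Q (int n) x) - Q (- 1 - int n) (P (int n) x)"
    by (rule elimination_pq)
  have st: "E n x \<in> S" "P n x \<in> S" "Q n x \<in> S" "Om n x \<in> S" if "x \<in> S" for n x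
    using S(2) that by (auto simp: b_stable_def)
  have ut: "E n x \<in> U" "P n x \<in> U" "Q n x \<in> U" "Om n x \<in> U" if "x \<in> U" for n x
    using U(2) that by (auto simp: b_stable_def)
  have fin: "x \<in> U" if "d \<in> U" "d + of_nat r *\<^sub>C E (-1) x \<in> U" "r \<ge> 1" for x d and r :: nat
  proof -
    have "of_nat r *\<^sub>C E (-1) x \<in> U" using subspace_add_cancel[OF U(1) _ that(1)] that(2) by (simp add: add.commute)
    then have "E (-1) x \<in> U" by (rule subspace_mult_mem[OF U(1)]) (use that(3) in simp)
    then show ?thesis using U(3) by (simp add: saturated_def)
  qed
  have 1: "x \<in> U" if "x \<in> S \<inter> NE" for x
    using Int_lower2[of S NE] that
  proof (induction rule: pq.elim_induct)
    case (vac x)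
    from vac(2)[of True] vac(2)[of False] have "P (int i) x = 0" "Q (int i) x = 0" for i by simp_all
    then have "x \<in> \<Omega>" using vac(1) by (auto simp: \<Omega>_def NE_def) (metis nonneg_int_cases)+
    then show ?case using vac(1) assms(6) by blast
  next
    case (step x r N)
    have xs: "x \<in> S" "x \<in> NE" using step(1) by auto
    have "P (int i) x \<in> U" "Q (int i) x \<in> U" for i
      using step(3)[of True i] step(3)[of False i] st(2,3)[OF xs(1)] pq.A_R[OF xs(2), of True i] pq.A_R[OF xs(2), of False i]
      by auto
    then have d: "(\<Sum>n<N. P (- 1 - int n) (Q (int n) x) - Q (- 1 - int n) (P (int n) x)) \<in> U"
      by (intro cvs.subspace_sum cvs.subspace_diff U(1)) (simp_all add: ut)
    show ?case
      by (rule fin[OF d _ step(2)], rule step(4))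
         (intro IntI cvs.subspace_add cvs.subspace_scale cvs.subspace_sum cvs.subspace_diff S(1) st xs pq.R pq.\<Delta>_R pq.z_R)+
  qed
  fix x assume "x \<in> S"
  with subset_UNIV[of S] show "x \<in> U"
  proof (induction rule: el.elim_induct)
    case (vac x)
    then have "x \<in> NE" by (auto simp: NE_def) (metis nonneg_int_cases)
    then show ?case using 1 vac by blast
  next
    case (step x r N)
    have "E (int i) x \<in> U" for i using step(3)[of i] st(1)[OF step(1)] by simp
    then have d: "(\<Sum>n<N. Om (- 1 - int n) (E (int n) x)) \<in> U"
      by (intro cvs.subspace_sum U(1)) (simp_all add: ut)
    show ?case
      by (rule fin[OF d _ step(2)], rule step(4))
         (intro cvs.subspace_add cvs.subspace_scale cvs.subspace_sum S(1) st step(1))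
  qed
qed

end

section \<open>The span of all creation words\<close>

context creation_words
begin

definition Wall :: "'x set" where "Wall = (\<Union>r s. U r s)"

lemma Wall_sub: "cvs.subspace Wall"
proof (rule cvs.subspaceI)
  show "0 \<in> Wall" by (auto simp: Wall_def cvs.subspace_0 U_sub)
  fix u w assume "u \<in> Wall" "w \<in> Wall"
  then obtain r s r' s' where "u \<in> U r s" "w \<in> U r' s'" by (auto simp: Wall_def)
  then have "u \<in> U (Suc (max r r')) 0" "w \<in> U (Suc (max r r')) 0" by (auto intro: U_mono[rotated])
  then show "u + w \<in> Wall" using cvs.subspace_add[OF U_sub] by (fastforce simp: Wall_def)
qed (auto simp: Wall_def intro: cvs.subspace_scale U_sub)

lemma wd_Wall: "y \<in> B \<Longrightarrow> wd b ws y \<in> Wall"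
  using wd_U[of y ws "Suc (length ws)" 0] by (auto simp: Wall_def)

lemma B_Wall: "B \<subseteq> Wall"
  using wd_Wall[of _ "[]"] by auto

lemma Wall_induct:
  assumes "x \<in> Wall" "cvs.subspace S" "clin f" "\<And>ws y. y \<in> B \<Longrightarrow> f (wd b ws y) \<in> S"
  shows "f x \<in> S"
  using assms(1) U_induct[OF _ assms(2,3)] assms(4) by (auto simp: Wall_def)

lemma b_Wall: "x \<in> Wall \<Longrightarrow> b \<tau> m x \<in> Wall"
  by (auto simp: Wall_def intro: b_U)

lemma z_Wall: "x \<in> Wall \<Longrightarrow> z j x \<in> Wall"
  by (auto simp: Wall_def intro: z_U)

lemma a_Wall: "x \<in> Wall \<Longrightarrow> a \<sigma> n x \<in> Wall"
proof (erule Wall_induct[OF _ Wall_sub a_lin])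
  fix ws y assume "y \<in> B"
  then show "a \<sigma> n (wd b ws y) \<in> Wall" using a_wd[of y \<sigma> n ws] unfolding Wall_def by blast
qed

text \<open>Stated for a family of operators, because commuting T past a creator can produce other
  members of the family.\<close>

lemma Wall_stable:
  assumes "\<And>T. T \<in> \<T> \<Longrightarrow> clin T" and base: "\<And>T y. T \<in> \<T> \<Longrightarrow> y \<in> B \<Longrightarrow> T y \<in> Wall"
    and step: "\<And>T \<tau> m x. T \<in> \<T> \<Longrightarrow> x \<in> Wall \<Longrightarrow> (\<And>T'. T' \<in> \<T> \<Longrightarrow> T' x \<in> Wall) \<Longrightarrow> T (b \<tau> m x) \<in> Wall"
    and T: "T \<in> \<T>" and x: "x \<in> Wall"
  shows "T x \<in> Wall"
proof (rule Wall_induct[OF x Wall_sub assms(1)[OF T]])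
  fix ws :: "('t \<times> nat) list" and y assume y: "y \<in> B"
  have "T \<in> \<T> \<Longrightarrow> T (wd b ws y) \<in> Wall" for T
  proof (induction ws arbitrary: T)
    case Nil
    then show ?case using base y by simp
  next
    case (Cons w ws)
    then show ?case using step[of T "wd b ws y"] wd_Wall[OF y, of ws] by (cases w) simp
  qed
  then show "T (wd b ws y) \<in> Wall" using T .
qed

end

text \<open>V is a highest weight module over itself with a = b = 0 and the vacuum as highest weight
  vector; what holds for M holds for V under the prefix \<open>adj\<close>.\<close>

sublocale affine_va \<subseteq> adj: hw_mod k V \<iota> "mode V" "vac V" 0 0
proof unfold_locales
  show "U = UNIV" if "cvs.subspace U" "vac V \<in> U" "\<And>A n x. A \<in> sl3 \<Longrightarrow> x \<in> U \<Longrightarrow> mode V (\<iota> A) n x \<in> U" for U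
    using V_cyclic that by blast
qed (auto simp: mode_vac)

section \<open>Modes of the states in \<open>adj.\<Omega>\<close>\<close>

context affine_vmod
begin

text \<open>A state in \<open>adj.\<Omega>\<close> has regular operator product with e, p and q, so
  the commutator formula has no terms.\<close>

lemma vacuum_state_comm:
  assumes "u \<in> adj.\<Omega>"
  shows "E m (Y u n x) = Y u n (E m x)" "P m (Y u n x) = Y u n (P m x)" "Q m (Y u n x) = Y u n (Q m x)"
  using assms commutator[OF even even, of "\<iota> eM" m u n x] commutator[OF even even, of "\<iota> pM" m u n x]
    commutator[OF even even, of "\<iota> qM" m u n x]
  by (simp_all add: adj.\<Omega>_def lin1_simps)

lemma Om_\<Omega>: "x \<in> \<Omega> \<Longrightarrow> n \<ge> 0 \<Longrightarrow> Om n x \<in> \<Omega>"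
proof -
  assume x: "x \<in> \<Omega>" and n: "n \<ge> 0"
  have "E i (Om n x) = Om n (E i x) - E (n + i) x" "Q i (Om n x) = Om n (Q i x) - Q (n + i) x"
    "P i (Om n x) = Om n (P i x)" for i
    using epq_comm(7)[of n i x] epq_comm(8)[of n i x] epq_comm(9)[of n i x] by (simp_all add: algebra_simps)
  then show ?thesis using x n by (simp add: \<Omega>_def lin2_simps)
qed

lemma E_\<Omega>: "x \<in> \<Omega> \<Longrightarrow> E n x \<in> \<Omega>"
proof -
  assume x: "x \<in> \<Omega>"
  have "E i (E n x) = E n (E i x)" "P i (E n x) = E n (P i x)" "Q i (E n x) = E n (Q i x)" for i
    using epq_comm(1,2,3) by metis+
  then show ?thesis using x by (simp add: \<Omega>_def lin2_simps)
qed

lemma vacuum_state_\<Omega>: "u \<in> adj.\<Omega> \<Longrightarrow> x \<in> \<Omega> \<Longrightarrow> Y u n x \<in> \<Omega>"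
  by (simp add: \<Omega>_def vacuum_state_comm lin2_simps)

lemma Om_vacuum_state:
  "Om m (Y u n x) = Y u n (Om m x) + Sum_any (\<lambda>j::nat. (of_int m gchoose j) *\<^sub>C Y (adj.Om (int j) u) (m + n - int j) x)"
  using commutator[OF even even, of "\<iota> wM" m u n x] by simp

end

context affine_vmod
begin

text \<open>\<open>T\<close> spans, together with its descendants under \<open>\<omega>\<^sub>-\<^sub>n\<close>, \<open>p\<^sub>-\<^sub>n\<close> and \<open>q\<^sub>-\<^sub>n\<close>, a subspace
  whose vacuum vectors are, up to powers of \<open>e\<^sub>-\<^sub>1\<close>, those in \<open>T\<close>.\<close>
lemma descendants:
  assumes T: "cvs.subspace T" "T \<subseteq> \<Omega>" and TE: "\<And>x j. x \<in> T \<Longrightarrow> j < 0 \<Longrightarrow> E j x \<in> T"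
    and TO: "\<And>x n. x \<in> T \<Longrightarrow> n \<ge> 0 \<Longrightarrow> Om n x \<in> T"
    and TV: "\<And>x u n. x \<in> T \<Longrightarrow> u \<in> adj.\<Omega> \<Longrightarrow> Y u n x \<in> T"
  obtains U where "cvs.subspace U" "T \<subseteq> U" "b_stable U" "\<And>u x n. u \<in> adj.\<Omega> \<Longrightarrow> x \<in> U \<Longrightarrow> Y u n x \<in> U"
    "\<And>y. y \<in> U \<Longrightarrow> y \<in> \<Omega> \<Longrightarrow> \<exists>r. (E (-1) ^^ r) y \<in> T"
proof -
  have t0: "E n x = 0" "P n x = 0" "Q n x = 0" if "x \<in> T" "n \<ge> 0" for n x
    using T(2) that by (auto simp: \<Omega>_def)
  define bp where "bp = (\<lambda>\<tau> m. if \<tau> then Q (- 1 - int m) else P (- 1 - int m))"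
  \<comment> \<open>The sign makes both contractions equal to +e: p against q, and -q against
    p.\<close>
  define ap where "ap = (\<lambda>\<tau> n x. if \<tau> then P (int n) x else - Q (int n) x)"
  define kp :: "bool \<Rightarrow> bool \<Rightarrow> complex" where "kp = (\<lambda>\<sigma> \<tau>. if \<sigma> = \<tau> then 0 else if \<sigma> then -1 else 1)"
  interpret p: creation_words T bp ap E 1 0 kp
  proof
    fix \<sigma> \<tau> :: bool and n m j x
    show "ap \<sigma> n (bp \<tau> m x) = bp \<tau> m (ap \<sigma> n x) + (if \<sigma> = \<tau> then 1 *\<^sub>C E (int n - 1 - int m) x else 0)"
      using epq_comm(6)[of "int n" "- 1 - int m" x] epq_comm(6)[of "- 1 - int m" "int n" x]
        epq_comm(4)[of "int n" "- 1 - int m" x] epq_comm(5)[of "int n" "- 1 - int m" x]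
      by (auto simp: ap_def bp_def lin2_simps algebra_simps)
    show "bp \<sigma> n (bp \<tau> m x) = bp \<tau> m (bp \<sigma> n x) + kp \<sigma> \<tau> *\<^sub>C E (- 2 - int n - int m) x"
      using epq_comm(6)[of "- 1 - int n" "- 1 - int m" x] epq_comm(6)[of "- 1 - int m" "- 1 - int n" x]
        epq_comm(4)[of "- 1 - int n" "- 1 - int m" x] epq_comm(5)[of "- 1 - int n" "- 1 - int m" x]
      by (auto simp: kp_def bp_def algebra_simps)
    show "clin (ap \<tau> m)" by (rule clinI) (simp add: ap_def lin2_simps)
  qed (auto simp: T bp_def ap_def lin2 TE t0 epq_comm(2,3) lin2_simps)
  have pE: "E j x \<in> p.Wall" if "x \<in> p.Wall" for j x using p.z_Wall that .
  have pP: "P n x \<in> p.Wall" if x: "x \<in> p.Wall" for n x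
  proof (cases "n \<ge> 0")
    case True
    then show ?thesis using p.a_Wall[OF x, of True "nat n"] by (simp add: ap_def)
  next
    case False
    then show ?thesis using p.b_Wall[OF x, of False "nat (- 1 - n)"] by (simp add: bp_def)
  qed
  have pQ: "Q n x \<in> p.Wall" if x: "x \<in> p.Wall" for n x
  proof (cases "n \<ge> 0")
    case True
    then show ?thesis using p.a_Wall[OF x, of False "nat n"] cvs.subspace_neg[OF p.Wall_sub] by (fastforce simp: ap_def)
  next
    case False
    then show ?thesis using p.b_Wall[OF x, of True "nat (- 1 - n)"] by (simp add: bp_def)
  qed
  have pO: "Om n x \<in> p.Wall" if "n \<ge> 0" "x \<in> p.Wall" for n x
  proof (rule p.Wall_stable[where \<T> = "{Om n |n. n \<ge> 0}" and T = "Om n"])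
    fix T' \<tau> m x assume T': "T' \<in> {Om n |n. n \<ge> 0}" and x: "x \<in> p.Wall" and IH: "\<And>T'. T' \<in> {Om n |n. n \<ge> 0} \<Longrightarrow> T' x \<in> p.Wall"
    then obtain n where n: "T' = Om n" "n \<ge> 0" by blast
    have "Om n x \<in> p.Wall" using IH n by blast
    moreover have "Om n (bp \<tau> m x) = bp \<tau> m (Om n x) + (if \<tau> then Q (n + (- 1 - int m)) x else 0)"
      by (simp add: bp_def epq_comm(8,9))
    ultimately show "T' (bp \<tau> m x) \<in> p.Wall"
      using pQ[OF x] by (simp add: n p.b_Wall cvs.subspace_add[OF p.Wall_sub])
  qed (use that TO p.B_Wall lin2 in auto)
  have pV: "Y u n x \<in> p.Wall" if "u \<in> adj.\<Omega>" "x \<in> p.Wall" for u n x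
  proof (rule p.Wall_stable[where \<T> = "{Y u n |u n. u \<in> adj.\<Omega>}" and T = "Y u n"])
    fix T' \<tau> m x assume T': "T' \<in> {Y u n |u n. u \<in> adj.\<Omega>}" and x: "x \<in> p.Wall"
      and IH: "\<And>T'. T' \<in> {Y u n |u n. u \<in> adj.\<Omega>} \<Longrightarrow> T' x \<in> p.Wall"
    then obtain u n where n: "T' = Y u n" "u \<in> adj.\<Omega>" by blast
    have "Y u n x \<in> p.Wall" using IH n by blast
    moreover have "Y u n (bp \<tau> m x) = bp \<tau> m (Y u n x)"
      by (simp add: bp_def vacuum_state_comm(2,3)[OF n(2), symmetric])
    ultimately show "T' (bp \<tau> m x) \<in> p.Wall"
      by (simp add: n(1) p.b_Wall)
  qed (use that TV p.B_Wall lin2 in auto)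
  \<comment> \<open>Together with stability this allows the span of p- and q-words to serve as base
    space for the \<omega>-words, whose annihilators are the e_(n) with n \<ge> 0.\<close>
  have pE0: "E n x = 0" if "n \<ge> 0" "x \<in> p.Wall" for n x
  proof -
    have "E n x \<in> {0}"
    proof (rule p.Wall_induct[OF that(2) _ lin2])
      fix ws :: "(bool \<times> nat) list" and y assume "y \<in> T"
      then show "E n (wd bp ws y) \<in> {0}"
        by (induction ws) (use that(1) t0 in \<open>auto simp: bp_def epq_comm(2,3) lin2_simps\<close>)
    qed (auto simp: cvs.subspace_def)
    then show ?thesis by simp
  qed
  define bo where "bo = (\<lambda>(_::unit) m. Om (- 1 - int m))"
  define ao where "ao = (\<lambda>(_::unit) n. E (int n))"
  \<comment> \<open>Now e is both annihilator and \<open>z\<close>, so [e, \<omega>] = -e gives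
    \<epsilon> = -1 and also \<mu> = 1. Two creation modes of \<omega> commute, their indices not
    adding up to 0.\<close>
  interpret o: creation_words p.Wall bo ao E "-1" 1 "\<lambda>_ _. 0"
  proof
    fix \<sigma> \<tau> :: unit and n m :: nat and j :: int and x
    show "ao \<sigma> n (bo \<tau> m x) = bo \<tau> m (ao \<sigma> n x) + (if \<sigma> = \<tau> then (-1) *\<^sub>C E (int n - 1 - int m) x else 0)"
      using epq_comm(7)[of "- 1 - int m" "int n" x] by (simp add: ao_def bo_def algebra_simps)
    show "bo \<sigma> n (bo \<tau> m x) = bo \<tau> m (bo \<sigma> n x) + 0 *\<^sub>C E (- 2 - int n - int m) x"
      using epq_comm(10)[of "- 1 - int n" "- 1 - int m" x] by (simp add: bo_def)
    show "E j (bo \<tau> m x) = bo \<tau> m (E j x) - 1 *\<^sub>C E (j - 1 - int m) x"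
      using epq_comm(7)[of "- 1 - int m" j x] by (simp add: bo_def algebra_simps)
    show "ao \<sigma> n (E j x) = E j (ao \<sigma> n x)" by (simp add: ao_def epq_comm(1))
  qed (auto simp: bo_def ao_def lin2 p.Wall_sub pE pE0)
  have oE: "E j x \<in> o.Wall" if "x \<in> o.Wall" for j x using o.z_Wall that .
  have oP: "P n x \<in> o.Wall" if "x \<in> o.Wall" for n x
  proof (rule o.Wall_stable[where \<T> = "{P n}" and T = "P n"])
    fix T' \<tau> m x assume "T' \<in> {P n}" "\<And>T'. T' \<in> {P n} \<Longrightarrow> T' x \<in> o.Wall"
    then show "T' (bo \<tau> m x) \<in> o.Wall"
      using o.b_Wall[of "P n x" \<tau> m] by (auto simp: bo_def epq_comm(9)[symmetric])
  qed (use that pP o.B_Wall lin2 in auto)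
  have oQ: "Q n x \<in> o.Wall" if "x \<in> o.Wall" for n x
  proof (rule o.Wall_stable[where \<T> = "range Q" and T = "Q n"])
    fix T' \<tau> m x assume "T' \<in> range Q" and IH: "\<And>T'. T' \<in> range Q \<Longrightarrow> T' x \<in> o.Wall"
    then obtain n where n: "T' = Q n" by blast
    have "Q n (bo \<tau> m x) = bo \<tau> m (Q n x) - Q (n - 1 - int m) x"
      using epq_comm(8)[of "- 1 - int m" n x] by (simp add: bo_def algebra_simps)
    moreover have "Q i x \<in> o.Wall" for i by (rule IH) simp
    ultimately show "T' (bo \<tau> m x) \<in> o.Wall"
      by (simp add: n o.b_Wall cvs.subspace_diff[OF o.Wall_sub])
  qed (use that pQ o.B_Wall lin2 in auto)
  have oO: "Om n x \<in> o.Wall" if x: "x \<in> o.Wall" for n x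
  proof (cases "n \<ge> 0")
    case True
    show ?thesis
    proof (rule o.Wall_stable[where \<T> = "{Om n}" and T = "Om n"])
      fix T' \<tau> m x assume "T' \<in> {Om n}" "x \<in> o.Wall" "\<And>T'. T' \<in> {Om n} \<Longrightarrow> T' x \<in> o.Wall"
      moreover have "Om n (bo \<tau> m x) = bo \<tau> m (Om n x)
          + (if n + (- 1 - int m) = 0 then of_int n * k * (2/3) else 0) *\<^sub>C x"
        unfolding bo_def by (rule epq_comm(10))
      ultimately show "T' (bo \<tau> m x) \<in> o.Wall"
        by (simp add: o.b_Wall cvs.subspace_add[OF o.Wall_sub] cvs.subspace_scale[OF o.Wall_sub])
    qed (use True pO o.B_Wall lin2 x in auto)
  next
    case False
    then show ?thesis using o.b_Wall[OF x, of "()" "nat (- 1 - n)"] by (simp add: bo_def)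
  qed
  have oV: "Y u n x \<in> o.Wall" if "u \<in> adj.\<Omega>" "x \<in> o.Wall" for u n x
  proof (rule o.Wall_stable[where \<T> = "{Y u n |u n. u \<in> adj.\<Omega>}" and T = "Y u n"])
    fix T' \<tau> m x assume T': "T' \<in> {Y u n |u n. u \<in> adj.\<Omega>}" and x: "x \<in> o.Wall"
      and IH: "\<And>T'. T' \<in> {Y u n |u n. u \<in> adj.\<Omega>} \<Longrightarrow> T' x \<in> o.Wall"
    then obtain u n where n: "T' = Y u n" "u \<in> adj.\<Omega>" by blast
    have "Y u n (bo \<tau> m x) = bo \<tau> m (Y u n x)
      - Sum_any (\<lambda>j::nat. (of_int (- 1 - int m) gchoose j) *\<^sub>C Y (adj.Om (int j) u) (- 1 - int m + n - int j) x)"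
      using Om_vacuum_state[of "- 1 - int m" u n x] by (simp add: bo_def)
    moreover have "Y (adj.Om (int j) u) i x \<in> o.Wall" for j i
    proof -
      have "adj.Om (int j) u \<in> adj.\<Omega>" by (rule adj.Om_\<Omega>[OF n(2)]) simp
      then show ?thesis by (intro IH) blast
    qed
    moreover have "Y u n x \<in> o.Wall" by (intro IH) (use n in blast)
    ultimately show "T' (bo \<tau> m x) \<in> o.Wall" unfolding n(1)
      by (simp add: o.b_Wall cvs.subspace_diff[OF o.Wall_sub] Sum_any_mem_subspace[OF o.Wall_sub]
          cvs.subspace_scale[OF o.Wall_sub])
  qed (use that pV o.B_Wall lin2 in auto)
  show thesis
  proof (rule that[of o.Wall])
    show "T \<subseteq> o.Wall" using p.B_Wall o.B_Wall by blast
    show "b_stable o.Wall" using oE oP oQ oO by (auto simp: b_stable_def)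
    fix y assume y: "y \<in> o.Wall" "y \<in> \<Omega>"
    have pow: "(E (-1) ^^ r) y \<in> \<Omega>" for r by (induction r) (simp_all add: y E_\<Omega>)
    \<comment> \<open>The outer \<omega>-words are stripped before the inner p- and q-words, each
      time at the price of a power of e_(-1).\<close>
    obtain r where r: "(E (-1) ^^ r) y \<in> p.Wall"
    proof -
      obtain l s where "y \<in> o.U l s" using y(1) by (auto simp: o.Wall_def)
      moreover have "ao \<sigma> n y = 0" for \<sigma> n using y(2) by (simp add: ao_def \<Omega>_def)
      ultimately show thesis using o.vacuum_vector that by blast
    qed
    have "ap \<sigma> n ((E (-1) ^^ r) y) = 0" for \<sigma> n using pow[of r] by (simp add: ap_def \<Omega>_def)
    then obtain r' where "(E (-1) ^^ r') ((E (-1) ^^ r) y) \<in> T"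
      using p.vacuum_vector[of "(E (-1) ^^ r) y"] r unfolding p.Wall_def by blast
    then show "\<exists>r. (E (-1) ^^ r) y \<in> T"
      by (intro exI[of _ "r' + r"]) (simp add: funpow_add)
  qed (use oV o.Wall_sub in auto)
qed

text \<open>Turns a claim about the action of V on modules into a claim about a subspace of V, to
  which the elimination in V applies.\<close>

definition transporter :: "'m set \<Rightarrow> 'm set \<Rightarrow> 'v set" where
  "transporter S U = {u. \<forall>n. \<forall>x\<in>S. Y u n x \<in> U}"

lemma transporter_sub: "cvs.subspace U \<Longrightarrow> cvs.subspace (transporter S U)"
  by (auto simp: transporter_def cvs.subspace_def lin1_simps)

lemma transporter_b_stable:
  "cvs.subspace U \<Longrightarrow> b_stable S \<Longrightarrow> b_stable U \<Longrightarrow> adj.b_stable (transporter S U)"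
  unfolding adj.b_stable_def transporter_def
  by (auto intro!: mode_mem_subspace[OF even even] simp: b_stable_def)

end

lemma Sum_any_split_0:
  fixes f :: "nat \<Rightarrow> 'a::complex_vector"
  assumes "cvs.subspace U" "Sum_any f \<in> U" "\<And>j. f (Suc j) \<in> U" "\<And>j. j \<ge> K \<Longrightarrow> f j = 0"
  shows "f 0 \<in> U"
proof -
  have "Sum_any f = (\<Sum>j<Suc K. f j)" by (rule Sum_any_lessThan) (use assms(4) in simp)
  then have "f 0 + (\<Sum>j<K. f (Suc j)) \<in> U" using assms(2) by (simp add: sum.lessThan_Suc_shift del: sum.lessThan_Suc)
  then show ?thesis by (rule subspace_add_cancel[OF assms(1)]) (intro cvs.subspace_sum assms)
qed

context hw_mod
begin

text \<open>Expand (e_(-1)u)_(n) x. The terms with e_(j) x, j \<ge> 0, lie in U by induction on the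
  length of e-words that x survives. Among the terms e_(-1-j) u_(n+j) x those with j > 0 are covered
  by descending induction on n from the truncation bound. What remains is e_(-1) u_(n) x, and U is
  saturated.\<close>

lemma transporter_saturated:
  assumes S: "b_stable S" and U: "cvs.subspace U" "b_stable U" "saturated U"
  shows "adj.saturated (transporter S U)"
  unfolding adj.saturated_def
proof (intro allI impI)
  fix u assume eu: "adj.E (-1) u \<in> transporter S U"
  interpret el: elimination UNIV "\<lambda>(_::unit) i. E (int i)" E "\<lambda>N x. \<Sum>n<N. Om (- 1 - int n) (E (int n) x)"
    by (rule elimination_e)
  let ?w = "wd (\<lambda>(_::unit) i. E (int i))"
  have main: "Y u n x \<in> U" if "x \<in> S" "\<forall>ws. length ws \<ge> r \<longrightarrow> ?w ws x = 0" for r n x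
    using that
  proof (induction r arbitrary: x n)
    case 0
    then have "x = 0" by (auto dest: spec[of _ "[]"])
    then show ?case by (simp add: lin2_simps cvs.subspace_0[OF U(1)])
  next
    case (Suc r)
    have lower: "Y u m (E (int j) x) \<in> U" for m j
    proof (rule Suc.IH)
      show "E (int j) x \<in> S" using S Suc.prems by (simp add: b_stable_def)
      show "\<forall>ws. length ws \<ge> r \<longrightarrow> ?w ws (E (int j) x) = 0"
      proof (intro allI impI)
        fix ws :: "(unit \<times> nat) list" assume "length ws \<ge> r"
        then have "?w (ws @ [((), j)]) x = 0" using Suc.prems(2) by simp
        then show "?w ws (E (int j) x) = 0" by (simp add: wd_append)
      qed
    qed
    obtain N where N: "\<And>n. n \<ge> N \<Longrightarrow> Y u n x = 0" using trunc by blast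
    have "Y u (N - int l) x \<in> U" for l
    proof (induction l rule: less_induct)
      case (less l)
      let ?n = "N - int l"
      let ?f = "\<lambda>j::nat. E (- 1 - int j) (Y u (?n + int j) x)"
      have "Y (adj.E (-1) u) ?n x \<in> U" using eu Suc.prems(1) by (auto simp: transporter_def)
      moreover have "Sum_any (\<lambda>j::nat. Y u (?n - 1 - int j) (E (int j) x)) \<in> U"
        by (intro Sum_any_mem_subspace U(1) lower)
      ultimately have "Sum_any ?f \<in> U"
        using normal_product_mode[OF even even, of "\<iota> eM" u ?n x] subspace_add_cancel[OF U(1)] by simp
      moreover have "?f (Suc j) \<in> U" for j
      proof (cases "Suc j \<le> l")
        case True
        then have "Y u (N - int (l - Suc j)) x \<in> U" by (intro less) simp
        moreover have i: "N - int (l - Suc j) = ?n + int (Suc j)" using True by simp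
        ultimately show ?thesis using U(2) unfolding i by (simp add: b_stable_def)
      next
        case False
        then show ?thesis using N[of "?n + int (Suc j)"] by (simp add: lin2_simps cvs.subspace_0[OF U(1)])
      qed
      moreover have "?f j = 0" if "j \<ge> l" for j
        using N[of "?n + int j"] that by (simp add: lin2_simps)
      ultimately have "?f 0 \<in> U" by (rule Sum_any_split_0[OF U(1)])
      then show ?case using U(3) by (simp add: saturated_def)
    qed
    from this[of "nat (N - n)"] show ?case using N[of n] cvs.subspace_0[OF U(1)] by (cases "n \<le> N") auto
  qed
  show "u \<in> transporter S U" unfolding transporter_def
  proof (intro CollectI allI ballI)
    fix n x assume "x \<in> S"
    obtain D where "\<forall>ws. length ws + wsum ws > D \<longrightarrow> ?w ws x = 0" using el.nilpotent by blast
    then show "Y u n x \<in> U" by (intro main[OF \<open>x \<in> S\<close>, of "Suc D"]) simp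
  qed
qed

text \<open>By the elimination in V, applied to the transporter, only the states of I in
  \<open>adj.\<Omega>\<close> have to be tested.\<close>

lemma transporter_contains:
  assumes "b_stable S" "cvs.subspace U" "b_stable U" "saturated U"
    and "cvs.subspace I" "adj.b_stable I" "\<And>u n x. u \<in> I \<Longrightarrow> u \<in> adj.\<Omega> \<Longrightarrow> x \<in> S \<Longrightarrow> Y u n x \<in> U"
  shows "I \<subseteq> transporter S U"
proof (rule adj.contains_if_contains_vacuum[OF assms(5,6) transporter_sub[OF assms(2)]
      transporter_b_stable[OF assms(2,1,3)] transporter_saturated[OF assms(1-4)]])
  show "I \<inter> adj.\<Omega> \<subseteq> transporter S U" using assms(7) by (auto simp: transporter_def)
qed

lemma E_power:
  "clin (E (-1) ^^ r)" "(E (-1) ^^ r) (E n x) = E n ((E (-1) ^^ r) x)"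
  "(E (-1) ^^ r) (P n x) = P n ((E (-1) ^^ r) x)" "(E (-1) ^^ r) (Q n x) = Q n ((E (-1) ^^ r) x)"
  "u \<in> adj.\<Omega> \<Longrightarrow> (E (-1) ^^ r) (Y u n x) = Y u n ((E (-1) ^^ r) x)"
  "x \<in> \<Omega> \<Longrightarrow> (E (-1) ^^ r) x \<in> \<Omega>"
  by (induction r) (auto intro!: clinI simp: lin2_simps clin_add clin_scale epq_comm(2,3) epq_comm(1)[of "-1" n]
      vacuum_state_comm E_\<Omega>)

definition saturation :: "'m set \<Rightarrow> 'm set" where
  "saturation U = {x. \<exists>r. (E (-1) ^^ r) x \<in> U}"

lemma saturation_superset: "U \<subseteq> saturation U"
proof
  fix x assume "x \<in> U"
  then have "(E (-1) ^^ 0) x \<in> U" by simp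
  then show "x \<in> saturation U" unfolding saturation_def by blast
qed

text \<open>e, p, q and the modes of states in \<open>adj.\<Omega>\<close> commute with e_(-1),
  while [\<omega>_(n), e_(-1)] = e_(n-1) makes \<omega> cost one more power. Stability under all of
  V then follows from \<open>transporter_contains\<close> with I the whole of V.\<close>

lemma saturation:
  assumes U0: "cvs.subspace U0" "b_stable U0" and UV: "\<And>u x n. u \<in> adj.\<Omega> \<Longrightarrow> x \<in> U0 \<Longrightarrow> Y u n x \<in> U0"
  shows "V_stable (saturation U0)" "saturated (saturation U0)"
proof -
  have st: "E n x \<in> U0" "P n x \<in> U0" "Q n x \<in> U0" "Om n x \<in> U0" if "x \<in> U0" for n x
    using U0(2) that by (auto simp: b_stable_def)
  let ?e = "E (-1)" and ?U = "saturation U0"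
  have up: "(?e ^^ (r + r')) x \<in> U0" if "(?e ^^ r) x \<in> U0" for r r' x
    using that by (induction r') (auto simp: st)
  have pO: "(?e ^^ r) x \<in> U0 \<Longrightarrow> (?e ^^ Suc r) (Om n x) \<in> U0" for r n x
  proof (induction r arbitrary: x)
    case 0
    then show ?case by (simp add: st)
  next
    case (Suc r)
    have "(?e ^^ Suc r) (Om n (?e x)) \<in> U0" by (rule Suc.IH) (use Suc.prems in \<open>simp add: funpow_swap1\<close>)
    moreover have "Om n (?e x) = ?e (Om n x) + E (n - 1) x" using epq_comm(7)[of n "-1" x] by simp
    moreover have "(?e ^^ Suc r) (E (n - 1) x) \<in> U0" unfolding E_power by (intro st Suc.prems)
    ultimately have "(?e ^^ Suc r) (?e (Om n x)) \<in> U0"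
      using subspace_add_cancel[OF U0(1)] by (simp add: clin_add[OF E_power(1)] del: funpow.simps)
    then show ?case by (simp add: funpow_swap1)
  qed
  have sub: "cvs.subspace ?U"
  proof (rule cvs.subspaceI)
    show "0 \<in> ?U" using saturation_superset cvs.subspace_0[OF U0(1)] by blast
    fix x y assume "x \<in> ?U" "y \<in> ?U"
    then obtain r r' where "(?e ^^ r) x \<in> U0" "(?e ^^ r') y \<in> U0" by (auto simp: saturation_def)
    then have "(?e ^^ (r + r')) (x + y) \<in> U0"
      using up[of r x r'] up[of r' y r] by (simp add: clin_add[OF E_power(1)] add.commute cvs.subspace_add[OF U0(1)])
    then show "x + y \<in> ?U" by (auto simp: saturation_def)
  next
    fix c x assume "x \<in> ?U"
    then show "c *\<^sub>C x \<in> ?U" using cvs.subspace_scale[OF U0(1)] by (auto simp: saturation_def clin_scale[OF E_power(1)])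
  qed
  have b: "b_stable ?U" unfolding b_stable_def
  proof safe
    fix n x assume "x \<in> ?U"
    then obtain r where r: "(?e ^^ r) x \<in> U0" by (auto simp: saturation_def)
    show "E n x \<in> ?U" "P n x \<in> ?U" "Q n x \<in> ?U" "Om n x \<in> ?U"
      unfolding saturation_def using pO[OF r, of n] st[OF r] E_power by (auto simp del: funpow.simps)
  qed
  show sat: "saturated ?U" unfolding saturated_def
  proof (intro allI impI)
    fix x assume "?e x \<in> ?U"
    then obtain r where "(?e ^^ r) (?e x) \<in> U0" by (auto simp: saturation_def)
    then have "(?e ^^ Suc r) x \<in> U0" by (simp add: funpow_swap1)
    then show "x \<in> ?U" unfolding saturation_def by blast
  qed
  have "UNIV \<subseteq> transporter ?U ?U"
  proof (rule transporter_contains[OF b sub b sat])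
    fix u n x assume "u \<in> adj.\<Omega>" "x \<in> ?U"
    then show "Y u n x \<in> ?U" using UV by (auto simp: saturation_def E_power)
  qed (auto simp: adj.b_stable_def)
  then show "V_stable ?U" using sub by (auto simp: V_stable_def transporter_def)
qed

text \<open>The saturated span of the descendants is V-stable; the powers of e_(-1) picked up by its
  vectors in \<Omega> are removed again by \<open>Tsat\<close>.\<close>

lemma generated_V_stable:
  assumes T: "cvs.subspace T" "T \<subseteq> \<Omega>" and TE: "\<And>x j. x \<in> T \<Longrightarrow> j < 0 \<Longrightarrow> E j x \<in> T"
    and TO: "\<And>x n. x \<in> T \<Longrightarrow> n \<ge> 0 \<Longrightarrow> Om n x \<in> T"
    and TV: "\<And>x u n. x \<in> T \<Longrightarrow> u \<in> adj.\<Omega> \<Longrightarrow> Y u n x \<in> T"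
    and Tsat: "\<And>x. x \<in> \<Omega> \<Longrightarrow> E (-1) x \<in> T \<Longrightarrow> x \<in> T"
  obtains U where "V_stable U" "T \<subseteq> U" "U \<inter> \<Omega> \<subseteq> T"
proof -
  obtain U0 where U0: "cvs.subspace U0" "T \<subseteq> U0" "b_stable U0"
    and UV: "\<And>u x n. u \<in> adj.\<Omega> \<Longrightarrow> x \<in> U0 \<Longrightarrow> Y u n x \<in> U0"
    and remove_modes: "\<And>y. y \<in> U0 \<Longrightarrow> y \<in> \<Omega> \<Longrightarrow> \<exists>r. (E (-1) ^^ r) y \<in> T"
    by (rule descendants[OF T TE TO TV]) blast+
  let ?e = "E (-1)"
  have "V_stable (saturation U0)" by (rule saturation(1)[OF U0(1,3)]) (rule UV)
  moreover have "T \<subseteq> saturation U0" using U0(2) saturation_superset by blast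
  moreover have "saturation U0 \<inter> \<Omega> \<subseteq> T"
  proof
    fix y assume "y \<in> saturation U0 \<inter> \<Omega>"
    then obtain r where y: "y \<in> \<Omega>" and r: "(?e ^^ r) y \<in> U0" by (auto simp: saturation_def)
    obtain r' where "(?e ^^ r') ((?e ^^ r) y) \<in> T" using remove_modes[OF r E_power(6)[OF y]] by blast
    then have "(?e ^^ (r' + r)) y \<in> T" by (simp add: funpow_add)
    then show "y \<in> T"
    proof (induction "r' + r" arbitrary: r r')
      case (Suc l)
      then have "?e ((?e ^^ l) y) \<in> T" by (metis funpow.simps(2) o_apply)
      then have "(?e ^^ (l + 0)) y \<in> T" using Tsat E_power(6)[OF y] by simp
      then show ?case using Suc.hyps(1)[of l 0] by simp
    qed simp
  qed
  ultimately show thesis by (rule that)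
qed

end

section \<open>The Sugawara vector\<close>

definition pr :: "mat3 \<Rightarrow> mat3" where "pr A = A - (trace A / 3) *\<^sub>C mat 1"

lemma pr_sl3 [simp]: "pr A \<in> sl3"
  by (simp add: pr_def sl3_def mat3_simps mat_def field_simps)

lemma pr_id: "A \<in> sl3 \<Longrightarrow> pr A = A"
  by (simp add: pr_def sl3_def)

lemma pr_lin: "pr (c *\<^sub>C A + B) = c *\<^sub>C pr A + pr B"
  by (simp add: pr_def mat3_simps mat_def algebra_simps add_divide_distrib)

lemma lie_pr: "lie (pr A) B = lie A B" "lie A (pr B) = lie A B"
  by (simp_all add: pr_def mat3_simps mat_def algebra_simps)

lemma lie_munit: "lie A (munit i j) = (\<Sum>l\<in>UNIV. A $ l $ i *\<^sub>C munit l j) - (\<Sum>l\<in>UNIV. A $ j $ l *\<^sub>C munit i l)"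
  using exhaust_3[of i] exhaust_3[of j]
  by (elim disjE) (simp_all add: mat3_simps algebra_simps)

lemma trace_munit: "trace (A ** pr (munit i j)) = (pr A) $ j $ i" "trace (pr (munit i j) ** A) = (pr A) $ j $ i"
  using exhaust_3[of i] exhaust_3[of j]
  by (elim disjE; simp add: mat3_simps pr_def mat_def field_simps)+

text \<open>The 6 is twice the dual Coxeter number, the Casimir eigenvalue on the adjoint
  representation.\<close>

lemma casimir_identities:
  "(\<Sum>i\<in>UNIV. \<Sum>j\<in>UNIV. (pr A) $ i $ j *\<^sub>C pr (munit i j)) = pr A"
  "(\<Sum>i\<in>UNIV. \<Sum>j\<in>UNIV. (pr A) $ j $ i *\<^sub>C pr (munit j i)) = pr A"
  "(\<Sum>i\<in>UNIV. \<Sum>j\<in>UNIV. lie (lie A (munit i j)) (munit j i)) = 6 *\<^sub>C pr A"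
  by (simp_all add: mat3_simps pr_def mat_def field_simps)

context affine_va
begin

definition iP :: "mat3 \<Rightarrow> 'v" where "iP A = \<iota> (pr A)"

lemma iP_lin: "clin iP"
  by (rule clinI) (simp add: iP_def pr_lin iota_lin)

lemma iP_id: "A \<in> sl3 \<Longrightarrow> iP A = \<iota> A"
  by (simp add: iP_def pr_id)

definition sug :: 'v where "sug = sugawara k V \<iota>"

lemma sug_eq: "sug = (1 / (2 * (k + 3))) *\<^sub>C
   (\<Sum>i\<in>UNIV. \<Sum>j\<in>UNIV. mode V (iP (munit i j)) (-1) (iP (munit j i)))"
  by (simp add: sug_def sugawara_def iP_def pr_def Let_def)

text \<open>Invariance of the Casimir tensor under ad A; after expansion in matrix units the four
  triple sums cancel in pairs on renaming indices.\<close>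

lemma casimir_invariant:
  "(\<Sum>i\<in>UNIV. \<Sum>j\<in>UNIV. mode V (iP (lie A (munit i j))) (-1) (iP (munit j i))
     + mode V (iP (munit i j)) (-1) (iP (lie A (munit j i)))) = 0"
proof -
  define f where "f i j l m = mode V (iP (munit i j)) (-1) (iP (munit l m))" for i j l m
  have 1: "mode V (iP (lie A (munit i j))) (-1) (iP (munit j i))
      = (\<Sum>l\<in>UNIV. A $ l $ i *\<^sub>C f l j j i) - (\<Sum>l\<in>UNIV. A $ j $ l *\<^sub>C f i l j i)" for i j
    by (simp add: lie_munit f_def clin_simps[OF iP_lin] self.lin1_simps)
  have 2: "mode V (iP (munit i j)) (-1) (iP (lie A (munit j i)))
      = (\<Sum>l\<in>UNIV. A $ l $ j *\<^sub>C f i j l i) - (\<Sum>l\<in>UNIV. A $ i $ l *\<^sub>C f i j j l)" for i j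
    by (simp add: lie_munit f_def clin_simps[OF iP_lin] self.lin2_simps)
  have 3: "(\<Sum>i\<in>UNIV. \<Sum>j\<in>UNIV. \<Sum>l\<in>UNIV. A $ l $ i *\<^sub>C f l j j i) = (\<Sum>i\<in>UNIV. \<Sum>j\<in>UNIV. \<Sum>l\<in>UNIV. A $ i $ l *\<^sub>C f i j j l)"
    by (simp add: sum_3)
  have 4: "(\<Sum>i\<in>UNIV. \<Sum>j\<in>UNIV. \<Sum>l\<in>UNIV. A $ l $ j *\<^sub>C f i j l i) = (\<Sum>i\<in>UNIV. \<Sum>j\<in>UNIV. \<Sum>l\<in>UNIV. A $ j $ l *\<^sub>C f i l j i)"
    by (simp add: sum_3)
  show ?thesis unfolding 1 2 sum.distrib sum_subtractf 3 4 by simp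
qed

end

locale affine_nc = affine_va +
  assumes noncritical: "k \<noteq> -3"
begin

text \<open>At the double pole the two contractions give 2k and the double bracket gives 6; the
  Sugawara factor cancels 2(k + 3), which is where k \<noteq> -3 enters. The simple pole vanishes by
  invariance of the Casimir tensor and the triple pole by a trace identity.\<close>

lemma current_sug:
  assumes A: "A \<in> sl3"
  shows "mode V (\<iota> A) 0 sug = 0" "mode V (\<iota> A) 1 sug = \<iota> A" "j \<ge> 2 \<Longrightarrow> mode V (\<iota> A) (int j) sug = 0"
proof -
  have c: "mode V (\<iota> A) m (mode V (iP X) (-1) (iP Y)) = mode V (iP X) (-1) (mode V (\<iota> A) m (iP Y))
    + mode V (iP (lie A X)) (m - 1) (iP Y) + (if m = 1 then k * trace (A ** pr X) else 0) *\<^sub>C iP Y" for m X Y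
    using adj.affine_comm[OF A pr_sl3, of m X "-1" "iP Y"]
    by (auto simp: iP_def lie_pr pr_id)
  have o0: "mode V (\<iota> A) 0 (iP Y) = iP (lie A Y)" for Y
    using iota_ope(1)[OF A pr_sl3, of Y] by (simp add: iP_def lie_pr pr_id)
  have o0': "mode V (iP X) 0 (iP Y) = iP (lie X Y)" for X Y
    using iota_ope(1)[OF pr_sl3 pr_sl3, of X Y] by (simp add: iP_def lie_pr pr_id)
  have o1: "mode V (\<iota> A) 1 (iP Y) = (k * trace (A ** pr Y)) *\<^sub>C vac V" for Y
    using iota_ope(2)[OF A pr_sl3, of Y] by (simp add: iP_def)
  have o1': "mode V (iP (lie A X)) 1 (iP Y) = (k * trace (lie A X ** pr Y)) *\<^sub>C vac V" for X Y
    using iota_ope(2)[OF pr_sl3 pr_sl3, of "lie A X" Y] by (simp add: iP_def pr_id)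
  have o2: "mode V (\<iota> A) (int j) (iP Y) = 0" "mode V (iP X) (int j) (iP Y) = 0" if "j \<ge> 2" for X Y j
    using iota_ope(3)[OF _ _ that] A by (simp_all add: iP_def)
  have d: "mode V (\<iota> A) m sug = (1 / (2 * (k + 3))) *\<^sub>C
   (\<Sum>i\<in>UNIV. \<Sum>j\<in>UNIV. mode V (\<iota> A) m (mode V (iP (munit i j)) (-1) (iP (munit j i))))" for m
    by (simp add: sug_eq self.lin2_simps)
  show "mode V (\<iota> A) 0 sug = 0"
    using casimir_invariant[of A] by (simp add: d c o0 add.commute)
  have l: "lie A (pr X) = lie A X" for X by (simp add: lie_pr)
  have pA: "pr A = A" using A by (rule pr_id)
  have s1: "(\<Sum>i\<in>UNIV. \<Sum>j\<in>UNIV. (A $ i $ j) *\<^sub>C iP (munit i j)) = \<iota> A"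
           "(\<Sum>i\<in>UNIV. \<Sum>j\<in>UNIV. (A $ j $ i) *\<^sub>C iP (munit j i)) = \<iota> A"
  proof -
    have "(\<Sum>i\<in>UNIV. \<Sum>j\<in>UNIV. (A $ i $ j) *\<^sub>C iP (munit i j)) = iP (\<Sum>i\<in>UNIV. \<Sum>j\<in>UNIV. (pr A) $ i $ j *\<^sub>C pr (munit i j))"
         "(\<Sum>i\<in>UNIV. \<Sum>j\<in>UNIV. (A $ j $ i) *\<^sub>C iP (munit j i)) = iP (\<Sum>i\<in>UNIV. \<Sum>j\<in>UNIV. (pr A) $ j $ i *\<^sub>C pr (munit j i))"
      by (simp_all only: clin_simps[OF iP_lin] pA) (simp_all add: iP_def pr_id)
    then show "(\<Sum>i\<in>UNIV. \<Sum>j\<in>UNIV. (A $ i $ j) *\<^sub>C iP (munit i j)) = \<iota> A"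
           "(\<Sum>i\<in>UNIV. \<Sum>j\<in>UNIV. (A $ j $ i) *\<^sub>C iP (munit j i)) = \<iota> A"
      unfolding casimir_identities by (simp_all add: iP_def pA)
  qed
  have s2: "(\<Sum>i\<in>UNIV. \<Sum>j\<in>UNIV. iP (lie (lie A (munit i j)) (munit j i))) = 6 *\<^sub>C \<iota> A"
  proof -
    have "(\<Sum>i\<in>UNIV. \<Sum>j\<in>UNIV. iP (lie (lie A (munit i j)) (munit j i))) = iP (6 *\<^sub>C pr A)"
      by (simp only: clin_simps[OF iP_lin] casimir_identities(3)[symmetric])
    then show ?thesis by (simp add: clin_simps[OF iP_lin] pA iP_id[OF A])
  qed
  have "(\<Sum>i\<in>UNIV. \<Sum>j\<in>UNIV. mode V (\<iota> A) 1 (mode V (iP (munit i j)) (-1) (iP (munit j i))))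
    = (\<Sum>i\<in>UNIV. \<Sum>j\<in>UNIV. k *\<^sub>C ((A $ i $ j) *\<^sub>C iP (munit i j)) + iP (lie (lie A (munit i j)) (munit j i))
        + k *\<^sub>C ((A $ j $ i) *\<^sub>C iP (munit j i)))"
    by (simp add: c o1 o0' trace_munit pA self.lin2_simps creation)
  also have "\<dots> = (2 * (k + 3)) *\<^sub>C \<iota> A"
    by (simp only: sum.distrib cvs.scale_sum_right[symmetric] s1 s2) (simp add: algebra_simps flip: cvs.scale_left_distrib)
  finally have s3: "(\<Sum>i\<in>UNIV. \<Sum>j\<in>UNIV. mode V (\<iota> A) 1 (mode V (iP (munit i j)) (-1) (iP (munit j i))))
    = (2 * (k + 3)) *\<^sub>C \<iota> A" .
  have "k + 3 \<noteq> 0" using noncritical by (simp add: eq_neg_iff_add_eq_0)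
  then have "2 * (k + 3) \<noteq> 0" by (metis mult_eq_0_iff zero_neq_numeral)
  then show "mode V (\<iota> A) 1 sug = \<iota> A"
    by (simp only: d s3 cvs.scale_scale times_divide_eq_left mult_1_left divide_self cvs.scale_one not_False_eq_True)
  show "mode V (\<iota> A) (int j) sug = 0" if j: "j \<ge> 2"
  proof (cases "j = 2")
    case True
    have t: "(\<Sum>i\<in>UNIV. \<Sum>j\<in>UNIV. trace (lie A (munit i j) ** pr (munit j i))) = 0"
      by (simp add: mat3_simps pr_def mat_def)
    have "mode V (\<iota> A) 2 sug = (1 / (2 * (k + 3))) *\<^sub>C (\<Sum>i\<in>UNIV. \<Sum>j\<in>UNIV. (k * trace (lie A (munit i j) ** pr (munit j i))) *\<^sub>C vac V)"
      using o2(1)[of 2] by (simp add: d c o1' self.lin2_simps)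
    also have "\<dots> = 0"
      using t by (simp add: cvs.scale_sum_left[symmetric] sum_distrib_left[symmetric])
    finally show ?thesis using True by simp
  next
    case False
    then have e: "int j - 1 = int (j - 1)" and l: "j - 1 \<ge> 2" using j by auto
    have "mode V (iP X) (int j - 1) (iP Y) = 0" for X Y unfolding e by (rule o2(2)[OF l])
    then show ?thesis using j False by (simp add: d c o2 self.lin2_simps)
  qed
qed

text \<open>L_(-1) is the translation operator: both sides vanish on the vacuum and have the same
  commutators with the currents, which generate V.\<close>

lemma sug_zero_mode: "mode V sug 0 w = mode V w (-2) (vac V)"
proof -
  let ?U = "{w. mode V sug 0 w = mode V w (-2) (vac V)}"
  have "?U = UNIV"
  proof (rule V_cyclic)
    show "cvs.subspace ?U" by (auto simp: cvs.subspace_def self.lin1_simps self.lin2_simps)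
    show "vac V \<in> ?U" by (simp add: mode_vac mode_of_vac)
    fix A n w assume A: "A \<in> sl3" and w: "w \<in> ?U"
    have "Sum_any (\<lambda>j::nat. (of_int n gchoose j) *\<^sub>C mode V (mode V (\<iota> A) (int j) sug) (n + 0 - int j) w)
      = (\<Sum>j<2. (of_int n gchoose j) *\<^sub>C mode V (mode V (\<iota> A) (int j) sug) (n + 0 - int j) w)"
      by (rule Sum_any_lessThan) (simp add: current_sug[OF A] self.lin1_simps)
    then have l: "mode V sug 0 (mode V (\<iota> A) n w) = mode V (\<iota> A) n (mode V sug 0 w) - of_int n *\<^sub>C mode V (\<iota> A) (n - 1) w"
      using self.commutator[OF even even, of "\<iota> A" n sug 0 w]
      by (simp add: numeral_2_eq_2 current_sug[OF A] self.lin1_simps)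
    have "Sum_any (\<lambda>j::nat. ((-1) ^ j * (of_int n gchoose j)) *\<^sub>C mode V w (-2 + n - int j) (mode V (\<iota> A) (int j) (vac V))) = 0"
      by (simp add: mode_vac self.lin2_simps)
    moreover have "Sum_any (\<lambda>j::nat. ((-1) ^ j * (of_int n gchoose j)) *\<^sub>C mode V (\<iota> A) (n - int j) (mode V w (-2 + int j) (vac V)))
      = (\<Sum>j<2. ((-1) ^ j * (of_int n gchoose j)) *\<^sub>C mode V (\<iota> A) (n - int j) (mode V w (-2 + int j) (vac V)))"
      by (rule Sum_any_lessThan) (simp add: mode_vac self.lin2_simps)
    ultimately have r: "mode V (mode V (\<iota> A) n w) (-2) (vac V)
       = mode V (\<iota> A) n (mode V w (-2) (vac V)) - of_int n *\<^sub>C mode V (\<iota> A) (n - 1) w"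
      using self.associativity[OF even even, of "\<iota> A" n w "-2" "vac V"]
      by (simp add: numeral_2_eq_2 creation)
    show "mode V (\<iota> A) n w \<in> ?U" using w l r by simp
  qed
  then show ?thesis by blast
qed

lemma transl_mode: "mode V (mode V w (-2) (vac V)) (-1 - int j) (vac V) = of_nat (Suc j) *\<^sub>C mode V w (-2 - int j) (vac V)"
proof -
  note g = gbinomial_minus_two[of j]
  have "Sum_any (\<lambda>i::nat. ((-1) ^ i * (of_int (-2) gchoose i)) *\<^sub>C mode V (vac V) (-1 - int j + (-2) - int i) (mode V w (int i) (vac V))) = 0"
    by (simp add: mode_vac self.lin2_simps)
  moreover have "Sum_any (\<lambda>i::nat. ((-1) ^ i * (of_int (-2) gchoose i)) *\<^sub>C mode V w (-2 - int i) (mode V (vac V) (-1 - int j + int i) (vac V)))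
     = of_nat (Suc j) *\<^sub>C mode V w (-2 - int j) (vac V)"
    by (subst Sum_any_single[where a=j]) (use g in \<open>auto simp: mode_of_vac self.lin2_simps\<close>)
  ultimately show ?thesis
    using self.associativity[OF even even, of w "-2" "vac V" "-1 - int j" "vac V"] by simp
qed

text \<open>A left ideal is stable under translation, which is \<open>L\<^sub>-\<^sub>1\<close> by Sugawara, hence two-sided.\<close>
lemma left_ideal_two_sided:
  assumes U: "adj.V_stable U" and w: "w \<in> U"
  shows "mode V w l a \<in> U"
proof -
  have sub: "cvs.subspace U" and st: "\<And>u n x. x \<in> U \<Longrightarrow> mode V u n x \<in> U"
    using U by (auto simp: adj.V_stable_def)
  have d: "w \<in> U \<Longrightarrow> mode V w (-1 - int j) (vac V) \<in> U" for w j
  proof (induction j arbitrary: w)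
    case 0
    then show ?case by (simp add: creation)
  next
    case (Suc j)
    have "mode V sug 0 w \<in> U" using Suc.prems by (rule st)
    from Suc.IH[OF this] have "of_nat (Suc j) *\<^sub>C mode V w (-2 - int j) (vac V) \<in> U"
      unfolding sug_zero_mode transl_mode .
    then have "mode V w (-2 - int j) (vac V) \<in> U"
      by (rule subspace_mult_mem[OF sub]) (simp del: of_nat_Suc)
    then show ?case by simp
  qed
  show ?thesis unfolding skew[OF even[of a] even[of w]]
    by (intro cvs.subspace_scale[OF sub] Sum_any_mem_subspace[OF sub]) (rule d, rule st, rule w)
qed

end

locale affine_vmod_nc = affine_vmod + affine_nc
begin

lemma sug_comm:
  assumes A: "A \<in> sl3"
  shows "Y sug m (Y (\<iota> A) n x) = Y (\<iota> A) n (Y sug m x) - of_int n *\<^sub>C Y (\<iota> A) (m + n - 1) x"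
proof -
  have "Sum_any (\<lambda>j::nat. (of_int n gchoose j) *\<^sub>C Y (mode V (\<iota> A) (int j) sug) (n + m - int j) x)
    = (\<Sum>j<2. (of_int n gchoose j) *\<^sub>C Y (mode V (\<iota> A) (int j) sug) (n + m - int j) x)"
    by (rule Sum_any_lessThan) (simp add: current_sug[OF A] lin1_simps)
  then show ?thesis
    using commutator[OF even even, of "\<iota> A" n sug m x]
    by (simp add: numeral_2_eq_2 current_sug[OF A] lin1_simps add.commute)
qed

end

section \<open>Eigenspace decompositions\<close>

text \<open>Applying D minus one eigenvalue removes that summand and multiplies the others by
  non-zero numbers.\<close>

lemma eigen_components:
  assumes D: "clin D" and U: "cvs.subspace U" "\<And>x. x \<in> U \<Longrightarrow> D x \<in> U"
    and F: "finite F" "\<And>d. d \<in> F \<Longrightarrow> D (x d) = \<mu> d *\<^sub>C x d" "inj_on \<mu> F" "(\<Sum>d\<in>F. x d) \<in> U" and d: "d \<in> F"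
  shows "x d \<in> U"
  using F d
proof (induction F arbitrary: x d rule: finite_induct)
  case (insert a F)
  let ?s = "\<Sum>d\<in>insert a F. x d"
  have "D ?s - \<mu> a *\<^sub>C ?s \<in> U"
    by (intro cvs.subspace_diff U cvs.subspace_scale insert.prems)
  moreover have "D ?s - \<mu> a *\<^sub>C ?s = (\<Sum>d\<in>F. (\<mu> d - \<mu> a) *\<^sub>C x d)"
    using insert by (simp add: clin_simps[OF D] cvs.scale_sum_right cvs.scale_left_diff_distrib sum_subtractf
        cvs.scale_right_distrib)
  ultimately have "(\<mu> d - \<mu> a) *\<^sub>C x d \<in> U" if "d \<in> F" for d
    by (intro insert.IH[of "\<lambda>d. (\<mu> d - \<mu> a) *\<^sub>C x d"])
       (use insert that in \<open>auto simp: clin_simps[OF D] mult.commute\<close>)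
  then have F: "x d \<in> U" if "d \<in> F" for d
    using subspace_mult_mem[OF U(1)] that insert.prems(2) insert.hyps by (metis (no_types, lifting) eq_iff_diff_eq_0 inj_on_def insertI1 insertI2)
  then have "x a \<in> U"
    using insert by (intro subspace_add_cancel[OF U(1), of "x a" "\<Sum>d\<in>F. x d"] cvs.subspace_sum[OF U(1)]) auto
  then show ?case using F insert.prems by auto
qed simp

lemma eigen_components_zero:
  assumes "clin D" "finite F" "\<And>d. d \<in> F \<Longrightarrow> D (x d) = \<mu> d *\<^sub>C x d" "inj_on \<mu> F" "(\<Sum>d\<in>F. x d) = 0" "d \<in> F"
  shows "x d = 0"
  using eigen_components[of D "{0}" F x \<mu> d] assms by (simp add: cvs.subspace_def clin_zero)

lemma span_Union_decomp:
  assumes S: "\<And>c. cvs.subspace (S c)" and x: "x \<in> cvs.span (\<Union>c\<in>K. S c)"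
  obtains F f where "finite F" "F \<subseteq> K" "\<And>c. f c \<in> S c" "x = (\<Sum>c\<in>F. f c)"
proof -
  let ?P = "\<lambda>x. \<exists>F f. finite F \<and> F \<subseteq> K \<and> (\<forall>c. f c \<in> S c) \<and> x = (\<Sum>c\<in>F. f c)"
  have "cvs.subspace {x. ?P x}"
  proof (rule cvs.subspaceI)
    show "0 \<in> {x. ?P x}"
      by (intro CollectI exI[of _ "{}"] exI[of _ "\<lambda>_. 0"]) (simp add: cvs.subspace_0[OF S])
    fix x y assume "x \<in> {x. ?P x}" "y \<in> {x. ?P x}"
    then obtain F f G h where F: "finite F" "F \<subseteq> K" "\<forall>c. f c \<in> S c" "x = (\<Sum>c\<in>F. f c)"
      and G: "finite G" "G \<subseteq> K" "\<forall>c. h c \<in> S c" "y = (\<Sum>c\<in>G. h c)" by auto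
    let ?f = "\<lambda>c. if c \<in> F then f c else 0" and ?h = "\<lambda>c. if c \<in> G then h c else 0"
    have "x = (\<Sum>c\<in>F \<union> G. ?f c)" "y = (\<Sum>c\<in>F \<union> G. ?h c)"
      using F(1) G(1) unfolding F(4) G(4) by (auto intro!: sum.mono_neutral_cong_left)
    then have "x + y = (\<Sum>c\<in>F \<union> G. ?f c + ?h c)" by (simp add: sum.distrib)
    moreover have "?f c + ?h c \<in> S c" for c
      using F(3) G(3) by (auto intro: cvs.subspace_add[OF S] simp: cvs.subspace_0[OF S])
    ultimately show "x + y \<in> {x. ?P x}"
      using F G by (intro CollectI exI[of _ "F \<union> G"] exI[of _ "\<lambda>c. ?f c + ?h c"]) auto
  next
    fix c x assume "x \<in> {x. ?P x}"
    then obtain F f where F: "finite F" "F \<subseteq> K" "\<forall>c. f c \<in> S c" "x = (\<Sum>c\<in>F. f c)" by auto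
    then show "c *\<^sub>C x \<in> {x. ?P x}"
      by (intro CollectI exI[of _ F] exI[of _ "\<lambda>d. c *\<^sub>C f d"]) (auto simp: cvs.scale_sum_right cvs.subspace_scale[OF S])
  qed
  moreover have "(\<Union>c\<in>K. S c) \<subseteq> {x. ?P x}"
  proof
    fix x assume "x \<in> (\<Union>c\<in>K. S c)"
    then obtain c where "c \<in> K" "x \<in> S c" by blast
    then show "x \<in> {x. ?P x}"
      by (intro CollectI exI[of _ "{c}"] exI[of _ "\<lambda>d. if d = c then x else 0"]) (auto simp: cvs.subspace_0[OF S])
  qed
  ultimately have "cvs.span (\<Union>c\<in>K. S c) \<subseteq> {x. ?P x}" by (rule cvs.span_minimal[rotated])
  then show thesis using x that by auto
qed


section \<open>The grading of a highest weight module\<close>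

lemma gr_even:
  "A \<in> gr 2 \<Longrightarrow> A = (A$1$3) *\<^sub>C eM" "A \<in> gr (-2) \<Longrightarrow> A = (A$3$1) *\<^sub>C fM" "A \<in> gr 0 \<Longrightarrow> A \<in> cartan"
proof -
  assume "A \<in> gr 2"
  then have "lie xM A = A" by (simp add: gr_def)
  moreover have "y = 0" if "- (y / 2) = y" for y :: complex
  proof -
    have "- y = 2 * y" using arg_cong[OF that, of "\<lambda>z. 2 * z"] by simp
    then show ?thesis by algebra
  qed
  ultimately show "A = (A$1$3) *\<^sub>C eM" by (simp add: mat3_simps xM_def)
next
  assume "A \<in> gr (-2)"
  then have "lie xM A = - A" by (simp add: gr_def)
  moreover have "y = 0" if "y / 2 = - y" for y :: complex
  proof -
    have "(1 / 2) * y = (- 1) * y" using that by simp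
    then show ?thesis by (simp only: mult_cancel_right) auto
  qed
  ultimately show "A = (A$3$1) *\<^sub>C fM" by (simp add: mat3_simps xM_def)
next
  assume A: "A \<in> gr 0"
  then have "lie xM A = 0" by (simp add: gr_def)
  then have "A = diag3 (A$1$1) (A$2$2) (A$3$3)" by (simp add: mat3_simps xM_def)
  moreover have "A$1$1 + A$2$2 + A$3$3 = 0" using A by (simp add: gr_def sl3_def mat3_simps)
  ultimately show "A \<in> cartan" unfolding cartan_def by blast
qed

locale hw_mod_nc = hw_mod k V \<iota> Y v a b + affine_vmod_nc k V \<iota> Y
  for k and V :: "('v::complex_vector) vosa" and \<iota> and Y :: "'v \<Rightarrow> int \<Rightarrow> 'm \<Rightarrow> 'm::complex_vector" and v a b
begin

abbreviation "X0 \<equiv> Y (\<iota> xM) 0"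

text \<open>The part of the Kac-Roan-Wakimoto L_0 acting on M: (\<partial>x)_(1) = -x_(0).\<close>

definition Dg :: "'m \<Rightarrow> 'm" where "Dg x = Y sug 1 x - X0 x"

lemma Dg_lin: "clin Dg"
  by (rule clinI) (simp add: Dg_def lin2_simps algebra_simps)

lemma X0_letter: "A \<in> gr j \<Longrightarrow> X0 (Y (\<iota> A) n y) = Y (\<iota> A) n (X0 y) + (of_int j / 2) *\<^sub>C Y (\<iota> A) n y"
  using affine_comm[OF mat3_in_sl3(6) gr_sl3, of A j 0 n y]
  by (simp add: gr_def iota_scale lin1_simps)

lemma Dg_letter: "A \<in> gr j \<Longrightarrow> Dg (Y (\<iota> A) n y) = Y (\<iota> A) n (Dg y) - (of_int (2 * n + j) / 2) *\<^sub>C Y (\<iota> A) n y"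
  by (simp add: Dg_def X0_letter sug_comm gr_sl3 lin2_simps add_divide_distrib cvs.scale_left_distrib)

definition wt :: "mat3 \<Rightarrow> complex" where "wt H = of_nat a * omega1 H + of_nat b * omega2 H"

lemma hw_wt: "H \<in> cartan \<Longrightarrow> Y (\<iota> H) 0 v = wt H *\<^sub>C v"
  by (simp add: hw_cartan wt_def)

lemma wt_x: "wt xM = (of_nat a + of_nat b) / 2"
  by (simp add: wt_def omega1_def omega2_def mat3_simps xM_def field_simps)

lemma X0_v: "X0 v = ((of_nat a + of_nat b) / 2) *\<^sub>C v"
  by (simp add: hw_wt wt_x)

text \<open>(\<lambda>, \<lambda> + 2\<rho>) for the highest weight \<lambda> of M.\<close>

definition casimir :: complex where
  "casimir = 2 * (of_nat a ^ 2 + of_nat a * of_nat b + of_nat b ^ 2) / 3 + 2 * (of_nat a + of_nat b)"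

text \<open>Conformal weight of the reduced highest weight vector, the Sugawara weight minus
  \<lambda>(x).\<close>

definition \<delta> :: complex where "\<delta> = casimir / (2 * (k + 3)) - (of_nat a + of_nat b) / 2"

lemma sug_v: "Y sug 1 v = (casimir / (2 * (k + 3))) *\<^sub>C v"
proof -
  have t: "Y (mode V (iP A) (-1) (iP B)) 1 v = Y (iP B) 0 (Y (iP A) 0 v)" for A B
  proof -
    have "Sum_any (\<lambda>j::nat. Y (iP A) (-1 - int j) (Y (iP B) (1 + int j) v)) = 0"
      by (simp add: iP_def hw_pos lin2_simps)
    moreover have "Sum_any (\<lambda>j::nat. Y (iP B) (1 - 1 - int j) (Y (iP A) (int j) v)) = Y (iP B) 0 (Y (iP A) 0 v)"
      by (subst Sum_any_single[where a=0]) (auto simp: iP_def hw_pos lin2_simps)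
    ultimately show ?thesis using normal_product_mode[OF even even, of "iP A" "iP B" 1 v] by simp
  qed
  have r: "Y (iP pM) 0 v = 0" "Y (iP qM) 0 v = 0" "Y (iP eM) 0 v = 0" by (simp_all add: iP_id)
  have d: "Y (iP (munit i i)) 0 v = wt (pr (munit i i)) *\<^sub>C v" for i
  proof -
    have "pr (munit i i) \<in> cartan"
      using exhaust_3[of i] unfolding cartan_def
      by (intro CollectI exI[of _ "pr (munit i i) $ 1 $ 1"] exI[of _ "pr (munit i i) $ 2 $ 2"] exI[of _ "pr (munit i i) $ 3 $ 3"])
         (auto simp: mat3_simps pr_def mat_def)
    then show ?thesis by (simp add: iP_def hw_wt)
  qed
  have o: "Y (iP (munit i j)) 0 (Y (iP (munit j i)) 0 v) = (wt (pr (munit i i)) - wt (pr (munit j j))) *\<^sub>C v"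
    if "Y (iP (munit i j)) 0 v = 0" for i j
  proof -
    have l: "lie (pr (munit i j)) (pr (munit j i)) = (-1) *\<^sub>C pr (munit j j) + pr (munit i i)"
      using exhaust_3[of i] exhaust_3[of j] unfolding lie_pr
      by (elim disjE) (simp_all add: mat3_simps pr_def mat_def)
    have "Y (iP (munit i j)) 0 (Y (iP (munit j i)) 0 v) = Y (\<iota> (lie (pr (munit i j)) (pr (munit j i)))) 0 v"
      using affine_comm[OF pr_sl3 pr_sl3, of "munit i j" 0 "munit j i" 0 v] that by (simp add: iP_def lin2_simps)
    also have "\<dots> = (wt (pr (munit i i)) - wt (pr (munit j j))) *\<^sub>C v"
      unfolding l iota_lin[OF pr_sl3 pr_sl3] lin1_simps d[unfolded iP_def] by (simp add: cvs.scale_left_diff_distrib)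
    finally show ?thesis .
  qed
  have w: "wt (pr (munit 1 1)) = (2 * of_nat a + of_nat b) / 3" "wt (pr (munit 2 2)) = (of_nat b - of_nat a) / 3"
    "wt (pr (munit 3 3)) = - (of_nat a + 2 * of_nat b) / 3"
    by (simp_all add: wt_def omega1_def omega2_def mat3_simps pr_def mat_def field_simps)
  have "(\<Sum>i\<in>UNIV. \<Sum>j\<in>UNIV. Y (mode V (iP (munit i j)) (-1) (iP (munit j i))) 1 v) = casimir *\<^sub>C v"
    unfolding t sum_3 using o[OF r(1)] o[OF r(2)] o[OF r(3)]
    by (simp add: r d lin2_simps w flip: cvs.scale_left_distrib)
       (simp add: casimir_def power2_eq_square field_simps)
  then show ?thesis by (simp add: sug_eq lin1_simps)
qed

lemma Dg_v: "Dg v = \<delta> *\<^sub>C v"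
  by (simp add: Dg_def sug_v X0_v \<delta>_def cvs.scale_left_diff_distrib)

text \<open>Spanned by words rather than defined as an eigenspace of \<open>Dg\<close>, so that
  vanishing for negative d is \<open>positive_word\<close>.\<close>

definition Wd :: "int \<Rightarrow> 'm set" where
  "Wd d = cvs.span {ow ws v | ws. set ws \<subseteq> letters \<and> odeg ws = - d}"

lemma Wd_sub: "cvs.subspace (Wd d)" by (simp add: Wd_def)

lemma ow_Wd: "set ws \<subseteq> letters \<Longrightarrow> odeg ws = - d \<Longrightarrow> ow ws v \<in> Wd d"
  unfolding Wd_def by (rule cvs.span_base) blast

lemma v_Wd: "v \<in> Wd 0" using ow_Wd[of "[]" 0] by simp

lemma Wd_induct:
  assumes "x \<in> Wd d" "cvs.subspace S" "clin f"
    "\<And>ws. set ws \<subseteq> letters \<Longrightarrow> odeg ws = - d \<Longrightarrow> f (ow ws v) \<in> S"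
  shows "f x \<in> S"
proof -
  have "cvs.subspace {x. f x \<in> S}"
    using assms(2) by (auto simp: cvs.subspace_def clin_simps[OF assms(3)])
  then have "Wd d \<subseteq> {x. f x \<in> S}" unfolding Wd_def
    by (rule cvs.span_minimal[rotated]) (use assms(4) in auto)
  then show ?thesis using assms(1) by auto
qed

lemma letter_Wd: "w \<in> letters \<Longrightarrow> x \<in> Wd d \<Longrightarrow> fst w x \<in> Wd (d - snd w)"
proof (erule Wd_induct[OF _ Wd_sub gl.lin])
  fix ws assume "w \<in> letters" "set ws \<subseteq> letters" "odeg ws = - d"
  then show "fst w (ow ws v) \<in> Wd (d - snd w)" using ow_Wd[of "w # ws" "d - snd w"] by simp
qed

lemma Wd_neg: "x \<in> Wd d \<Longrightarrow> d < 0 \<Longrightarrow> x = 0"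
proof -
  assume x: "x \<in> Wd d" and d: "d < 0"
  have "x \<in> {0}"
    by (rule Wd_induct[OF x, of "{0}" "\<lambda>x. x"]) (use d in \<open>auto simp: gl.positive_word cvs.subspace_def intro: clinI\<close>)
  then show ?thesis by simp
qed

lemma Wd_Dg: "x \<in> Wd d \<Longrightarrow> Dg x = (\<delta> + of_int d / 2) *\<^sub>C x"
proof -
  have "Dg (ow ws v) = (\<delta> - of_int (odeg ws) / 2) *\<^sub>C ow ws v" if "set ws \<subseteq> letters" for ws
    using that
  proof (induction ws)
    case (Cons w ws)
    then obtain A n j where w: "w = (Y (\<iota> A) n, 2 * n + j)" and A: "A \<in> gr j" by (auto simp: letters_def)
    then show ?case using Cons
      by (simp add: Dg_letter[OF A] lin2_simps add_divide_distrib flip: cvs.scale_left_diff_distrib)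
  qed (simp add: Dg_v)
  then have e: "Dg (ow ws v) - (\<delta> + of_int d / 2) *\<^sub>C ow ws v \<in> {0}" if "set ws \<subseteq> letters" "odeg ws = - d" for ws
    using that by simp
  assume "x \<in> Wd d"
  then have "Dg x - (\<delta> + of_int d / 2) *\<^sub>C x \<in> {0}"
  proof (rule Wd_induct)
    show "clin (\<lambda>x. Dg x - (\<delta> + of_int d / 2) *\<^sub>C x)"
      by (rule clinI) (simp add: clin_simps[OF Dg_lin] cvs.scale_right_distrib cvs.scale_right_diff_distrib mult.commute)
  qed (use e in \<open>auto simp: cvs.subspace_def\<close>)
  then show "Dg x = (\<delta> + of_int d / 2) *\<^sub>C x" by simp
qed

lemma Wd_all: "cvs.span (\<Union>d\<in>{0..}. Wd d) = UNIV"
proof (rule gl.cyclic)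
  show "v \<in> cvs.span (\<Union>d\<in>{0..}. Wd d)" using v_Wd by (auto intro: cvs.span_base)
  fix w x assume w: "w \<in> letters" and "x \<in> cvs.span (\<Union>d\<in>{0..}. Wd d)"
  moreover have "cvs.subspace {x. fst w x \<in> cvs.span (\<Union>d\<in>{0..}. Wd d)}"
    by (auto simp: cvs.subspace_def clin_simps[OF gl.lin[OF w]] cvs.span_zero intro: cvs.span_add cvs.span_scale)
  moreover have "(\<Union>d\<in>{0..}. Wd d) \<subseteq> {x. fst w x \<in> cvs.span (\<Union>d\<in>{0..}. Wd d)}"
  proof safe
    fix d x assume "x \<in> Wd d"
    then have "fst w x \<in> Wd (d - snd w)" by (rule letter_Wd[OF w])
    then show "fst w x \<in> cvs.span (\<Union>d\<in>{0..}. Wd d)"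
      using Wd_neg[of "fst w x" "d - snd w"] by (cases "d - snd w < 0") (auto simp: cvs.span_zero intro!: cvs.span_base UN_I[of "d - snd w"])
  qed
  ultimately show "fst w x \<in> cvs.span (\<Union>d\<in>{0..}. Wd d)"
    using cvs.span_minimal by blast
qed simp

lemma Wd_decomp:
  obtains F f where "finite F" "F \<subseteq> {0..}" "\<And>c. f c \<in> Wd c" "x = (\<Sum>c\<in>F. f c)"
proof (rule span_Union_decomp[OF Wd_sub, where x = x and K = "{0..}"])
  show "x \<in> cvs.span (\<Union>d\<in>{0..}. Wd d)" by (simp add: Wd_all)
qed (rule that)

section \<open>The component of lowest weight\<close>

abbreviation "Ev j \<equiv> (E (-1) ^^ j) v"

lemma cartan_Ev: "H \<in> cartan \<Longrightarrow> Y (\<iota> H) 0 (Ev j) = (wt H + of_nat j * (H$1$1 - H$3$3)) *\<^sub>C Ev j"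
proof (induction j)
  case (Suc j)
  have l: "lie H eM = (H$1$1 - H$3$3) *\<^sub>C eM" using Suc.prems by (auto simp: cartan_def mat3_simps)
  have t: "trace (H ** eM) = 0" using Suc.prems by (auto simp: cartan_def mat3_simps)
  show ?case
    using affine_comm[OF cartan_sl3[OF Suc.prems] mat3_in_sl3(1), of 0 "-1" "Ev j"] Suc
    by (simp add: l t iota_scale lin1_simps lin2_simps flip: cvs.scale_left_distrib) (simp add: algebra_simps)
qed (simp add: hw_wt)

text \<open>The standard sl2 computation for the affine simple root: f_(1) kills v, and
  [f_(1), e_(-1)] acts on v by k - a - b.\<close>

lemma f_Ev: "Y (\<iota> fM) 1 (Ev (Suc j)) = (of_nat (Suc j) * (k - of_nat a - of_nat b - of_nat j)) *\<^sub>C Ev j"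
proof (induction j)
  have H: "diag3 (-1) 0 1 \<in> cartan" unfolding cartan_def
    by (intro CollectI exI[of _ "-1"] exI[of _ 0] exI[of _ 1]) simp
  have l: "lie fM eM = diag3 (-1) 0 1" and t: "trace (fM ** eM) = 1" by (auto simp: mat3_simps)
  have step: "Y (\<iota> fM) 1 (Ev (Suc j)) = E (-1) (Y (\<iota> fM) 1 (Ev j)) + (k - of_nat a - of_nat b - 2 * of_nat j) *\<^sub>C Ev j" for j
    using affine_comm[OF mat3_in_sl3(4,1), of 1 "-1" "Ev j"] cartan_Ev[OF H, of j]
    by (simp add: l t lin1_simps wt_def omega1_def omega2_def flip: cvs.scale_left_distrib)
       (simp add: mat3_simps algebra_simps)
  { case 0 show ?case using step[of 0] by (simp add: hw_pos lin2_simps) }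
  { case (Suc j)
    show ?case unfolding step[of "Suc j"] Suc
      by (simp add: lin2_simps flip: cvs.scale_left_distrib) (simp add: algebra_simps) }
qed

definition Cst :: "'m set" where "Cst = cvs.span (range Ev)"

lemma Cst_sub: "cvs.subspace Cst" by (simp add: Cst_def)

lemma Ev_Cst: "Ev j \<in> Cst" by (auto simp: Cst_def intro: cvs.span_base)

lemma Cst_induct:
  assumes "x \<in> Cst" "cvs.subspace S" "clin f" "\<And>j. f (Ev j) \<in> S" shows "f x \<in> S"
proof -
  have "cvs.subspace {x. f x \<in> S}"
    using assms(2) by (auto simp: cvs.subspace_def clin_simps[OF assms(3)])
  then have "Cst \<subseteq> {x. f x \<in> S}" unfolding Cst_def
    by (rule cvs.span_minimal[rotated]) (use assms(4) in auto)
  then show ?thesis using assms(1) by auto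
qed

text \<open>After normal ordering a word of degree 0 has only letters of degree 0. By the bounds on
  the grading these are multiples of f_(1), Cartan zero modes and multiples of e_(-1), all of which
  preserve the span of the e_(-1)^j v.\<close>

lemma Wd_0: "Wd 0 \<subseteq> Cst"
proof -
  have letter0: "fst w x \<in> Cst" if w: "w \<in> letters" "snd w = 0" and x: "x \<in> Cst" for w x
  proof -
    obtain A n j where w': "w = (Y (\<iota> A) n, 2 * n + j)" and A: "A \<in> gr j" using w by (auto simp: letters_def)
    have nj: "2 * n + j = 0" using w w' by simp
    show ?thesis
    proof (cases "A = 0")
      case True
      then show ?thesis using w' cvs.subspace_0[OF Cst_sub] by simp
    next
      case False
      then have "-2 \<le> j" "j \<le> 2" using gr_bound[OF A] by auto
      then have "j = -2 \<and> n = 1 \<or> j = 0 \<and> n = 0 \<or> j = 2 \<and> n = -1" using nj by presburger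
      then have "Y (\<iota> A) n (Ev l) \<in> Cst" for l
      proof (elim disjE conjE)
        assume j: "j = -2" "n = 1"
        have "Y (\<iota> fM) 1 (Ev l) \<in> Cst"
          by (cases l) (auto simp: hw_pos f_Ev cvs.subspace_0[OF Cst_sub] cvs.subspace_scale[OF Cst_sub] Ev_Cst
              simp del: funpow.simps(2))
        then have "Y (\<iota> ((A$3$1) *\<^sub>C fM)) 1 (Ev l) \<in> Cst"
          by (simp add: iota_scale lin1_simps cvs.subspace_scale[OF Cst_sub])
        then show ?thesis using gr_even(2) A j by simp
      next
        assume j: "j = 0" "n = 0"
        then show ?thesis using cartan_Ev[OF gr_even(3)] A by (simp add: cvs.subspace_scale[OF Cst_sub] Ev_Cst)
      next
        assume j: "j = 2" "n = -1"
        have "E (-1) (Ev l) \<in> Cst" using Ev_Cst[of "Suc l"] by simp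
        then have "Y (\<iota> ((A$1$3) *\<^sub>C eM)) (-1) (Ev l) \<in> Cst"
          by (simp add: iota_scale lin1_simps cvs.subspace_scale[OF Cst_sub])
        then show ?thesis using gr_even(1) A j by simp
      qed
      then show ?thesis using w' Cst_induct[OF x Cst_sub lin2] by simp
    qed
  qed
  have "ow ws v \<in> Cst" if "set ws \<subseteq> letters" "odeg ws = 0" for ws
  proof (rule gl.normal_order[OF Cst_sub _ that])
    fix ws assume ws: "set ws \<subseteq> letters" "odeg ws = 0" "\<forall>w\<in>set ws. snd w \<le> 0"
    then have "set ws \<subseteq> letters \<and> (\<forall>w\<in>set ws. snd w = 0)"
    proof (intro conjI ballI)
      fix w assume "w \<in> set ws"
      then obtain us vs where "ws = us @ w # vs" by (metis split_list)
      moreover from this have "odeg us \<le> 0" "odeg vs \<le> 0" using ws(3) unfolding odeg_def by (auto intro!: sum_list_nonpos)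
      ultimately show "snd w = 0" using ws(2,3) by fastforce
    qed
    then show "ow ws v \<in> Cst"
    proof (induction ws)
      case Nil then show ?case using Ev_Cst[of 0] by simp
    qed (auto intro: letter0)
  qed
  then show ?thesis unfolding Wd_def by (intro cvs.span_minimal Cst_sub) auto
qed

definition Low :: "'m set" where "Low = cvs.span (\<Union>d\<in>{1..}. Wd d)"

lemma Low_sub: "cvs.subspace Low" by (simp add: Low_def)

lemma letter_Low:
  assumes w: "w \<in> letters" "snd w < 0" shows "fst w x \<in> Low"
proof -
  obtain F f where F: "finite F" "F \<subseteq> {0..}" "\<And>c. f c \<in> Wd c" "x = (\<Sum>c\<in>F. f c)" using Wd_decomp[of x] by blast
  have "fst w (f c) \<in> Low" if "c \<in> F" for c
  proof -
    have "fst w (f c) \<in> Wd (c - snd w)" by (rule letter_Wd[OF w(1) F(3)])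
    then show ?thesis unfolding Low_def using w(2) F(2) that by (intro cvs.span_base UN_I[of "c - snd w"]) auto
  qed
  then show ?thesis by (simp add: F(4) clin_sum[OF gl.lin[OF w(1)]] cvs.subspace_sum[OF Low_sub])
qed

lemma epq_Low: "j \<ge> 1 \<Longrightarrow> E (-1 - int j) x \<in> Low" "P (-1 - int j) x \<in> Low" "Q (-1 - int j) x \<in> Low"
  using letter_Low[OF letter[OF gr_table(1) refl, of "-1 - int j"], of x]
    letter_Low[OF letter[OF gr_table(2) refl, of "-1 - int j"], of x]
    letter_Low[OF letter[OF gr_table(3) refl, of "-1 - int j"], of x] by simp_all

text \<open>For k not in \<nat> the factors k - a - b - j in \<open>f_Ev\<close> never vanish, so
  f_(1) leads from e_(-1)^j v back to v.\<close>

lemma Ev_generates: "V_stable U \<Longrightarrow> k \<notin> \<nat> \<Longrightarrow> Ev j \<in> U \<Longrightarrow> v \<in> U"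
proof (induction j)
  case (Suc j)
  have "Y (\<iota> fM) 1 (Ev (Suc j)) \<in> U" using Suc.prems by (simp add: V_stable_def)
  then have "(of_nat (Suc j) * (k - of_nat a - of_nat b - of_nat j)) *\<^sub>C Ev j \<in> U" by (simp only: f_Ev)
  moreover have "k - of_nat a - of_nat b - of_nat j \<noteq> 0"
  proof
    assume "k - of_nat a - of_nat b - of_nat j = 0"
    then have "k = of_nat (a + b + j)" by (simp add: algebra_simps)
    with Suc.prems(2) show False by simp
  qed
  ultimately have "Ev j \<in> U"
    using Suc.prems(1) subspace_mult_mem by (metis V_stable_def mult_eq_0_iff of_nat_neq_0)
  then show ?case using Suc by blast
qed simp

lemma Cst_sum: "x \<in> Cst \<Longrightarrow> \<exists>c n. (\<forall>j\<ge>n. c j = 0) \<and> x = (\<Sum>j<n. c j *\<^sub>C Ev j)"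
proof -
  let ?P = "\<lambda>x. \<exists>c n. (\<forall>j\<ge>n. c j = 0) \<and> x = (\<Sum>j<n. c j *\<^sub>C Ev j)"
  have "cvs.subspace {x. ?P x}"
  proof (rule cvs.subspaceI)
    show "0 \<in> {x. ?P x}" by (intro CollectI exI[of _ "\<lambda>_. 0"] exI[of _ 0]) simp
    fix x y assume "x \<in> {x. ?P x}" "y \<in> {x. ?P x}"
    then obtain c n d m where c: "\<forall>j\<ge>n. c j = 0" "x = (\<Sum>j<n. c j *\<^sub>C Ev j)"
      and d: "\<forall>j\<ge>m. d j = 0" "y = (\<Sum>j<m. d j *\<^sub>C Ev j)" by auto
    have "x = (\<Sum>j<max n m. c j *\<^sub>C Ev j)" "y = (\<Sum>j<max n m. d j *\<^sub>C Ev j)"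
      unfolding c(2) d(2) by (intro sum.mono_neutral_left ballI; simp add: c(1) d(1) not_less)+
    then have "x + y = (\<Sum>j<max n m. (c j + d j) *\<^sub>C Ev j)" by (simp add: sum.distrib cvs.scale_left_distrib)
    then show "x + y \<in> {x. ?P x}"
      using c(1) d(1) by (intro CollectI exI[of _ "\<lambda>j. c j + d j"] exI[of _ "max n m"]) auto
  next
    fix r x assume "x \<in> {x. ?P x}"
    then obtain c n where c: "\<forall>j\<ge>n. c j = 0" "x = (\<Sum>j<n. c j *\<^sub>C Ev j)" by auto
    then show "r *\<^sub>C x \<in> {x. ?P x}"
      by (intro CollectI exI[of _ "\<lambda>j. r * c j"] exI[of _ n]) (simp add: cvs.scale_sum_right)
  qed
  moreover have "?P (Ev j)" for j
    by (intro exI[of _ "\<lambda>i. if i = j then 1 else 0"] exI[of _ "Suc j"]) (auto simp: if_distrib[of "\<lambda>c. c *\<^sub>C _"] cong: if_cong)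
  ultimately show "x \<in> Cst \<Longrightarrow> ?P x"
    using Cst_induct[of x "{x. ?P x}" "\<lambda>x. x"] by (auto intro: clinI)
qed

text \<open>The highest weight vector survives in the space of coinvariants for the character
  \<open>e\<^sub>-\<^sub>1 \<mapsto> -1\<close>.\<close>
lemma hw_not_exact:
  assumes I: "V_stable I" "v \<notin> I" and k: "k \<notin> \<nat>"
    and eq: "v = i + (E (-1) m0 + m0) + m1" and im: "i \<in> I" "m1 \<in> Low"
  shows False
proof -
  have I_sub: "cvs.subspace I" and I_st: "\<And>u n x. x \<in> I \<Longrightarrow> Y u n x \<in> I" using I(1) by (auto simp: V_stable_def)
  obtain F f where F: "finite F" "F \<subseteq> {0..}" "\<And>c. f c \<in> Wd c" "m0 = (\<Sum>c\<in>F. f c)" using Wd_decomp[of m0] by blast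
  obtain G g where G: "finite G" "G \<subseteq> {1..}" "\<And>c. g c \<in> Wd c" "m1 = (\<Sum>c\<in>G. g c)"
    using span_Union_decomp[OF Wd_sub im(2)[unfolded Low_def]] by blast
  define f' where "f' c = (if c \<in> F then f c else 0)" for c
  define g' where "g' c = (if c \<in> G then g c else 0)" for c
  define h where "h c = (if c = 0 then v else 0) - (E (-1) (f' c) + f' c) - g' c" for c
  let ?K = "insert 0 (F \<union> G)"
  have m: "m0 = (\<Sum>c\<in>?K. f' c)" "m1 = (\<Sum>c\<in>?K. g' c)"
    using F(1) G(1) unfolding F(4) G(4) f'_def g'_def by (auto intro!: sum.mono_neutral_cong_left)
  have fg: "f' c \<in> Wd c" "g' c \<in> Wd c" for c
    using F(3) G(3) by (auto simp: f'_def g'_def cvs.subspace_0[OF Wd_sub])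
  have e: "(E (-1), 0) \<in> letters" by (rule letter[OF gr_table(1)]) simp
  have h: "h c \<in> Wd c" for c
    using letter_Wd[OF e fg(1)[of c]] fg[of c] v_Wd
    by (auto simp: h_def intro!: cvs.subspace_diff cvs.subspace_add cvs.subspace_neg Wd_sub)
  have "(\<Sum>c\<in>?K. h c) = v - (E (-1) m0 + m0) - m1"
    using F(1) G(1) by (simp only: h_def sum_subtractf sum.distrib m lin2_simps) simp
  also have "\<dots> = i" by (simp add: eq)
  finally have "(\<Sum>c\<in>?K. h c) \<in> I" using im by simp
  then have h0: "h 0 \<in> I"
  proof (rule eigen_components[OF Dg_lin I_sub, rotated -2])
    show "Dg x \<in> I" if "x \<in> I" for x using that by (simp add: Dg_def cvs.subspace_diff[OF I_sub] I_st)
    show "Dg (h c) = (\<delta> + of_int c / 2) *\<^sub>C h c" for c by (rule Wd_Dg[OF h])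
  qed (use F G in \<open>auto simp: inj_on_def\<close>)
  obtain c n where c: "\<forall>j\<ge>n. c j = 0" "f' 0 = (\<Sum>j<n. c j *\<^sub>C Ev j)"
    using Cst_sum[of "f' 0"] fg(1)[of 0] Wd_0 by blast
  \<comment> \<open>Coefficients of v - (e_(-1) + 1) \<open>f' 0\<close> with respect to the
    e_(-1)^j v. The eigenvalues of x_(0) separate them and no e_(-1)^j v lies in I, so all of them
    vanish. This forces c 0 = 1 and c (j+1) = -c j, contradicting finiteness.\<close>
  define d where "d j = (case j of 0 \<Rightarrow> 1 - c 0 | Suc j' \<Rightarrow> - (c (Suc j') + c j'))" for j
  have g0: "g' 0 = 0" using G(2) by (auto simp: g'_def)
  have "h 0 = v - (\<Sum>j<n. c j *\<^sub>C Ev (Suc j)) - (\<Sum>j<Suc n. c j *\<^sub>C Ev j)"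
    using c(1) by (simp add: h_def g0 c(2) lin2_simps)
  also have "\<dots> = (\<Sum>j<Suc n. d j *\<^sub>C Ev j)"
    unfolding sum.lessThan_Suc_shift
    by (simp add: d_def sum_negf sum.distrib sum_subtractf cvs.scale_left_distrib cvs.scale_left_diff_distrib
        del: sum.lessThan_Suc funpow.simps)
  finally have "(\<Sum>j<Suc n. d j *\<^sub>C Ev j) \<in> I" using h0 by simp
  then have "d j *\<^sub>C Ev j \<in> I" if "j < Suc n" for j
  proof (rule eigen_components[OF lin2 I_sub, rotated -2])
    show "X0 x \<in> I" if "x \<in> I" for x using that by (rule I_st)
    show "X0 (d j *\<^sub>C Ev j) = (wt xM + of_nat j) *\<^sub>C d j *\<^sub>C Ev j" for j
      using cartan_Ev[of xM j] by (simp add: lin2_simps) (simp add: xM_def mat3_simps)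
  qed (use that in \<open>auto simp: inj_on_def\<close>)
  moreover have "Ev j \<notin> I" for j using Ev_generates[OF I(1) k] I(2) by blast
  ultimately have d0: "d j = 0" if "j < Suc n" for j
    using that subspace_mult_mem[OF I_sub] by blast
  have "j \<le> n \<Longrightarrow> c j \<noteq> 0" for j
  proof (induction j)
    case 0
    then show ?case using d0[of 0] by (simp add: d_def)
  next
    case (Suc j)
    then show ?case using d0[of "Suc j"] by (auto simp: d_def)
  qed
  then show False using c(1) by blast
qed

text \<open>e_(-1) raises the eigenvalue of x_(0) by 1, so nothing can cancel the component of x
  with the smallest eigenvalue.\<close>

lemma E_plus_one_injective:
  assumes "E (-1) x + x = 0" shows "x = 0"
proof (rule ccontr)
  assume x0: "x \<noteq> 0"
  define X where "X c = {x. X0 x = ((of_nat a + of_nat b + of_int c) / 2) *\<^sub>C x}" for c :: int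
  have X_sub: "cvs.subspace (X c)" for c
    by (auto simp: X_def cvs.subspace_def lin2_simps algebra_simps)
  have X_letter: "Y (\<iota> A) n y \<in> X (c + j)" if "A \<in> gr j" "y \<in> X c" for A n j y c
    using that by (simp add: X_def X0_letter lin2_simps add_divide_distrib cvs.scale_left_distrib)
  have all: "cvs.span (\<Union>c\<in>UNIV. X c) = UNIV"
  proof (rule gl.cyclic)
    show "v \<in> cvs.span (\<Union>c\<in>UNIV. X c)"
      by (rule cvs.span_base) (auto simp: X_def X0_v intro!: exI[of _ 0])
    fix w y assume w: "w \<in> letters" and y: "y \<in> cvs.span (\<Union>c\<in>UNIV. X c)"
    obtain A n j where w': "w = (Y (\<iota> A) n, 2 * n + j)" and A: "A \<in> gr j" using w by (auto simp: letters_def)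
    have "cvs.subspace {y. fst w y \<in> cvs.span (\<Union>c\<in>UNIV. X c)}"
      by (auto simp: cvs.subspace_def clin_simps[OF gl.lin[OF w]] cvs.span_zero intro: cvs.span_add cvs.span_scale)
    moreover have "(\<Union>c\<in>UNIV. X c) \<subseteq> {y. fst w y \<in> cvs.span (\<Union>c\<in>UNIV. X c)}"
      using X_letter[OF A] w' by (auto intro!: cvs.span_base)
    ultimately show "fst w y \<in> cvs.span (\<Union>c\<in>UNIV. X c)" using y cvs.span_minimal by blast
  qed simp
  obtain F f where F: "finite F" "\<And>c. f c \<in> X c" "x = (\<Sum>c\<in>F. f c)"
  proof -
    have "x \<in> cvs.span (\<Union>c\<in>UNIV. X c)" unfolding all by simp
    from span_Union_decomp[OF X_sub this] show thesis using that by blast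
  qed
  define f' where "f' c = (if c \<in> F then f c else 0)" for c
  have f': "f' c \<in> X c" for c using F(2) by (simp add: f'_def cvs.subspace_0[OF X_sub])
  let ?K = "F \<union> (\<lambda>c. c + 2) ` F"
  have "x = (\<Sum>c\<in>?K. f' c)" using F(1) unfolding F(3) f'_def by (auto intro!: sum.mono_neutral_cong_left)
  moreover have "E (-1) x = (\<Sum>c\<in>?K. E (-1) (f' (c - 2)))"
  proof -
    have "(\<Sum>c\<in>?K. E (-1) (f' (c - 2))) = (\<Sum>c\<in>(\<lambda>c. c + 2) ` F. E (-1) (f' (c - 2)))"
    proof (rule sum.mono_neutral_right)
      show "\<forall>c\<in>?K - (\<lambda>c. c + 2) ` F. E (-1) (f' (c - 2)) = 0"
      proof
        fix c assume c: "c \<in> ?K - (\<lambda>c. c + 2) ` F"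
        have "c - 2 \<notin> F"
        proof
          assume "c - 2 \<in> F"
          then have "c - 2 + 2 \<in> (\<lambda>c. c + 2) ` F" by (rule imageI)
          then show False using c by simp
        qed
        then show "E (-1) (f' (c - 2)) = 0" by (simp add: f'_def lin2_simps)
      qed
    qed (use F(1) in auto)
    also have "\<dots> = (\<Sum>c\<in>F. E (-1) (f c))"
      by (subst sum.reindex) (auto simp: f'_def intro!: sum.cong)
    finally show ?thesis by (simp add: F(3) lin2_simps)
  qed
  ultimately have "(\<Sum>c\<in>?K. E (-1) (f' (c - 2)) + f' c) = 0" using assms by (simp add: sum.distrib)
  then have h: "E (-1) (f' (c - 2)) + f' c = 0" if "c \<in> ?K" for c
  proof (rule eigen_components_zero[OF lin2 _ _ _ _ that, rotated 3])
    show "X0 (E (-1) (f' (c - 2)) + f' c) = ((of_nat a + of_nat b + of_int c) / 2) *\<^sub>C (E (-1) (f' (c - 2)) + f' c)" for c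
      using cvs.subspace_add[OF X_sub X_letter[OF gr_table(1) f'[of "c - 2"]], of "f' c" "-1"] f'[of c] by (simp add: X_def)
  qed (use F(1) in \<open>auto simp: inj_on_def\<close>)
  let ?N = "{c\<in>F. f c \<noteq> 0}"
  have N: "finite ?N" "?N \<noteq> {}" using F(1,3) x0 by (auto intro: ccontr)
  define c0 where "c0 = Min ?N"
  have c0: "c0 \<in> ?N" unfolding c0_def by (rule Min_in[OF N])
  have "f' (c0 - 2) = 0"
  proof (rule ccontr)
    assume "f' (c0 - 2) \<noteq> 0"
    then have "c0 - 2 \<in> ?N" by (auto simp: f'_def split: if_splits)
    then have "c0 \<le> c0 - 2" unfolding c0_def by (rule Min_le[OF N(1)])
    then show False by simp
  qed
  then show False using h[of c0] c0 by (simp add: f'_def lin2_simps)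
qed

end

section \<open>Tensor products of vector spaces\<close>

lemma lin_ext_superset:
  "finite K \<Longrightarrow> Poly_Mapping.keys p \<subseteq> K \<Longrightarrow> lin_ext h p = (\<Sum>i\<in>K. Poly_Mapping.lookup p i *\<^sub>C h i)"
  unfolding lin_ext_def by (intro sum.mono_neutral_left) (auto simp: in_keys_iff)

lemma lookup_scaleC [simp]: "Poly_Mapping.lookup (c *\<^sub>C p) i = c *\<^sub>C Poly_Mapping.lookup p i"
  by (auto simp: scaleC_poly_mapping_def Poly_Mapping.map.rep_eq when_def)

lemma lin_ext_lin: "clin (lin_ext h)"
proof (rule clinI)
  fix c and p q :: "'a \<Rightarrow>\<^sub>0 complex"
  let ?K = "Poly_Mapping.keys p \<union> Poly_Mapping.keys q"
  have K: "Poly_Mapping.keys (c *\<^sub>C p + q) \<subseteq> ?K"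
    by (auto simp: in_keys_iff lookup_add)
  have "lin_ext h (c *\<^sub>C p + q) = (\<Sum>i\<in>?K. Poly_Mapping.lookup (c *\<^sub>C p + q) i *\<^sub>C h i)"
    by (rule lin_ext_superset[OF _ K]) simp
  also have "\<dots> = c *\<^sub>C lin_ext h p + lin_ext h q"
    using lin_ext_superset[of ?K p h] lin_ext_superset[of ?K q h]
    by (simp add: lookup_add cvs.scale_left_distrib sum.distrib cvs.scale_sum_right)
  finally show "lin_ext h (c *\<^sub>C p + q) = c *\<^sub>C lin_ext h p + lin_ext h q" .
qed

lemma lin_ext_free_gen [simp]: "lin_ext h (free_gen i) = h i"
  by (simp add: lin_ext_def)

lemma tensor_bilinear:
  fixes t :: "'a::complex_vector \<Rightarrow> 'b::complex_vector \<Rightarrow> 'c::complex_vector"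
  assumes "tensor_product t"
  shows "clin (\<lambda>x. t x y)" "clin (t x)"
proof -
  let ?g = "\<lambda>(x, y). t x y"
  have "{p. lin_ext ?g p = 0} = cvs.span tensor_relations"
    using assms by (simp add: tensor_product_def presented_by_def)
  then have r: "lin_ext ?g p = 0" if "p \<in> tensor_relations" for p
    using that cvs.span_base by blast
  show "clin (\<lambda>x. t x y)"
  proof (rule clinI)
    fix c and a b :: 'a
    have "free_gen (c *\<^sub>C a + b, y) - c *\<^sub>C free_gen (a, y) - free_gen (b, y) \<in> tensor_relations"
      unfolding tensor_relations_def by blast
    from r[OF this] show "t (c *\<^sub>C a + b) y = c *\<^sub>C t a y + t b y"
      by (simp add: clin_simps[OF lin_ext_lin] diff_eq_eq add.commute)
  qed
  show "clin (t x)"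
  proof (rule clinI)
    fix c and a b :: 'b
    have "free_gen (x, c *\<^sub>C a + b) - c *\<^sub>C free_gen (x, a) - free_gen (x, b) \<in> tensor_relations"
      unfolding tensor_relations_def by blast
    from r[OF this] show "t x (c *\<^sub>C a + b) = c *\<^sub>C t x a + t x b"
      by (simp add: clin_simps[OF lin_ext_lin] diff_eq_eq add.commute)
  qed
qed

lemma tensor_induct:
  assumes "tensor_product t" "cvs.subspace U" "\<And>x y. t x y \<in> U" shows "U = UNIV"
proof -
  have onto: "range (lin_ext (\<lambda>(x, y). t x y)) = UNIV"
    using assms(1) by (simp add: tensor_product_def presented_by_def)
  have mem: "lin_ext (\<lambda>(x, y). t x y) p \<in> U" for p
    unfolding lin_ext_def by (intro cvs.subspace_sum cvs.subspace_scale assms(2)) (auto simp: assms(3))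
  have "z \<in> U" for z
  proof -
    have "z \<in> range (lin_ext (\<lambda>(x, y). t x y))" by (simp only: onto UNIV_I)
    then show ?thesis by (elim rangeE) (simp add: mem)
  qed
  then show ?thesis by blast
qed

lemma tensor_lift:
  assumes t: "tensor_product t" and b: "\<And>y. clin (\<lambda>x. \<beta> x y)" "\<And>x. clin (\<beta> x)"
  obtains L where "clin L" "\<And>x y. L (t x y) = \<beta> x y"
proof -
  let ?g = "\<lambda>(x, y). t x y" and ?b = "\<lambda>(x, y). \<beta> x y"
  have ker: "{p. lin_ext ?g p = 0} = cvs.span tensor_relations" and onto: "range (lin_ext ?g) = UNIV"
    using t by (simp_all add: tensor_product_def presented_by_def)
  have "tensor_relations \<subseteq> {p. lin_ext ?b p = 0}"
    by (auto simp: tensor_relations_def clin_simps[OF lin_ext_lin] clin_simps[OF b(1)] clin_simps[OF b(2)])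
  then have "cvs.span tensor_relations \<subseteq> {p. lin_ext ?b p = 0}"
    by (rule cvs.span_minimal) (auto simp: cvs.subspace_def clin_simps[OF lin_ext_lin])
  then have wd: "lin_ext ?b p = lin_ext ?b q" if "lin_ext ?g p = lin_ext ?g q" for p q
    using that ker clin_diff[OF lin_ext_lin, of ?g p q] clin_diff[OF lin_ext_lin, of ?b p q] by auto
  define L where "L z = lin_ext ?b (SOME p. lin_ext ?g p = z)" for z
  have L: "L (lin_ext ?g p) = lin_ext ?b p" for p
    unfolding L_def by (rule wd) (rule someI[of _ p], simp)
  have "clin L"
  proof (rule clinI)
    fix c x y
    obtain p q where p: "x = lin_ext ?g p" "y = lin_ext ?g q" using onto by (metis (no_types, lifting) UNIV_I imageE)
    have e: "c *\<^sub>C x + y = lin_ext ?g (c *\<^sub>C p + q)" by (simp add: p clin_simps[OF lin_ext_lin])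
    show "L (c *\<^sub>C x + y) = c *\<^sub>C L x + L y" unfolding e unfolding p L by (simp add: clin_simps[OF lin_ext_lin])
  qed
  moreover have "L (t x y) = \<beta> x y" for x y using L[of "free_gen (x, y)"] by simp
  ultimately show thesis by (rule that)
qed

lemma exists_functional:
  fixes w :: "'f::complex_vector"
  assumes "w \<noteq> 0" obtains \<epsilon> :: "'f \<Rightarrow> complex" where "clin \<epsilon>" "\<epsilon> w = 1"
proof -
  interpret vp: vector_space_pair "scaleC :: complex \<Rightarrow> 'f \<Rightarrow> 'f" "scaleC :: complex \<Rightarrow> complex \<Rightarrow> complex"
    by unfold_locales
  have ind: "cvs.independent {w}" using assms by simp
  obtain e where e: "Vector_Spaces.linear scaleC scaleC e" "e w = (1::complex)"
    using vp.linear_independent_extend[OF ind, of "\<lambda>_. 1"] by auto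
  interpret e: Vector_Spaces.linear "scaleC :: complex \<Rightarrow> 'f \<Rightarrow> 'f" scaleC e by (rule e(1))
  have "clin e" by (rule clinI) (simp add: e.add e.scale)
  then show thesis using that e(2) by blast
qed

text \<open>A functional with value 1 at w provides a left inverse of tensoring with w.\<close>

lemma tensor_cancel_right:
  assumes "tensor_product t" "w \<noteq> 0" "t x w = 0" shows "x = 0"
proof -
  obtain \<epsilon> :: "_ \<Rightarrow> complex" where e: "clin \<epsilon>" "\<epsilon> w = 1" using exists_functional[OF assms(2)] .
  have b: "clin (\<lambda>x. \<epsilon> y *\<^sub>C x)" "clin (\<lambda>y. \<epsilon> y *\<^sub>C x)" for x y
    by (rule clinI, simp add: cvs.scale_right_distrib mult.commute)
       (rule clinI, simp add: clin_simps[OF e(1)] cvs.scale_left_distrib)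
  obtain L where "clin L" "\<And>x y. L (t x y) = \<epsilon> y *\<^sub>C x"
    using tensor_lift[OF assms(1), of "\<lambda>x y. \<epsilon> y *\<^sub>C x"] b by blast
  from this(2)[of x w] this(1) show ?thesis by (simp add: e(2) assms(3) clin_zero)
qed


section \<open>The ghost system\<close>

context va_mod
begin

lemma normal_product_simple:
  assumes "a \<in> par V p" "b \<in> par V q" "\<And>i. i \<ge> 1 \<Longrightarrow> Y a (int i) c = 0" "\<And>i. i \<ge> 1 \<Longrightarrow> Y b (int i) c = 0"
  shows "Y (mode V a (-1) b) (int j) c
    = (if j = 0 then Y a (-1) (Y b 0 c) else 0) + ssgn p q *\<^sub>C Y b (int j - 1) (Y a 0 c)"
proof -
  have "Sum_any (\<lambda>i::nat. Y a (-1 - int i) (Y b (int j + int i) c)) = (if j = 0 then Y a (-1) (Y b 0 c) else 0)"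
  proof -
    have b: "Y b (int j + int i) c = 0" if "i \<noteq> 0 \<or> j \<noteq> 0" for i
    proof -
      have "1 \<le> j + i" using that by linarith
      from assms(4)[OF this] show ?thesis by simp
    qed
    show ?thesis
      by (subst Sum_any_single[where a=0]) (use b b[of 0] in \<open>auto simp: lin2_simps\<close>)
  qed
  moreover have "Sum_any (\<lambda>i::nat. Y b (int j - 1 - int i) (Y a (int i) c)) = Y b (int j - 1) (Y a 0 c)"
    by (subst Sum_any_single[where a=0]) (use assms(3) in \<open>auto simp: lin2_simps Suc_le_eq\<close>)
  ultimately show ?thesis by (simp only: normal_product_mode[OF assms(1,2)])
qed

end

locale ghost =
  fixes F :: "('f::complex_vector) vosa" and g :: "'f ghosts"
  assumes gs: "ghost_system F g"
begin

sublocale vsa F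
  using gs by unfold_locales (simp add: ghost_system_def)

lemma vac_nonzero: "vac F \<noteq> 0" using gs by (simp add: ghost_system_def)

lemma ghost_par [simp]:
  "phi g \<alpha> \<in> par F True" "psi g \<alpha> \<in> par F True" "Phi1 g \<in> par F False" "Phi2 g \<in> par F False" "vac F \<in> par F False"
  using gs vac_even by (auto simp: ghost_system_def)

lemma ghost_ope1:
  "mode F (phi g \<alpha>) (int j) (psi g \<beta>) = (if j = 0 \<and> \<alpha> = \<beta> then vac F else 0)"
  "mode F (phi g \<alpha>) (int j) (phi g \<beta>) = 0" "mode F (psi g \<alpha>) (int j) (psi g \<beta>) = 0"
  "mode F (Phi1 g) (int j) (Phi2 g) = (if j = 0 then vac F else 0)"
  "mode F (Phi1 g) (int j) (Phi1 g) = 0" "mode F (Phi2 g) (int j) (Phi2 g) = 0"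
  "mode F (phi g \<alpha>) (int j) (Phi1 g) = 0" "mode F (phi g \<alpha>) (int j) (Phi2 g) = 0"
  "mode F (psi g \<alpha>) (int j) (Phi1 g) = 0" "mode F (psi g \<alpha>) (int j) (Phi2 g) = 0"
  using gs by (auto simp: ghost_system_def ope_def)

lemma ghost_ope2:
  "mode F (psi g \<beta>) (int j) (phi g \<alpha>) = (if j = 0 \<and> \<alpha> = \<beta> then vac F else 0)"
  "mode F (Phi2 g) (int j) (Phi1 g) = (if j = 0 then - vac F else 0)"
  "mode F (Phi1 g) (int j) (phi g \<alpha>) = 0" "mode F (Phi1 g) (int j) (psi g \<alpha>) = 0"
  "mode F (Phi2 g) (int j) (phi g \<alpha>) = 0" "mode F (Phi2 g) (int j) (psi g \<alpha>) = 0"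
proof -
  have h: "mode F y (int j) x = (if j = 0 then - ssgn p q *\<^sub>C mode F x 0 y else 0)"
    if "x \<in> par F p" "y \<in> par F q" "\<And>j. j \<ge> 1 \<Longrightarrow> mode F x (int j) y = 0" for x y p q
    using simple_pole_skew[OF that] ope_zero_skew[OF that, of j] by (auto simp: Suc_le_eq)
  note z = ghost_ope1[where j = 0, unfolded of_nat_0]
  show "mode F (psi g \<beta>) (int j) (phi g \<alpha>) = (if j = 0 \<and> \<alpha> = \<beta> then vac F else 0)"
    by (subst h[OF ghost_par(1,2)]) (auto simp: ghost_ope1 z)
  show "mode F (Phi2 g) (int j) (Phi1 g) = (if j = 0 then - vac F else 0)"
    by (subst h[OF ghost_par(3,4)]) (auto simp: ghost_ope1 z)
  show "mode F (Phi1 g) (int j) (phi g \<alpha>) = 0" by (subst h[OF ghost_par(1,3)]) (auto simp: ghost_ope1 z)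
  show "mode F (Phi1 g) (int j) (psi g \<alpha>) = 0" by (subst h[OF ghost_par(2,3)]) (auto simp: ghost_ope1 z)
  show "mode F (Phi2 g) (int j) (phi g \<alpha>) = 0" by (subst h[OF ghost_par(1,4)]) (auto simp: ghost_ope1 z)
  show "mode F (Phi2 g) (int j) (psi g \<alpha>) = 0" by (subst h[OF ghost_par(2,4)]) (auto simp: ghost_ope1 z)
qed

lemmas ghost_ope [simp] = ghost_ope1 ghost_ope2 ghost_ope1[where j = 0, unfolded of_nat_0] ghost_ope2[where j = 0, unfolded of_nat_0]

abbreviation "vF \<equiv> vac F"
abbreviation "ph \<alpha> \<equiv> phi g \<alpha>"
abbreviation "ps \<alpha> \<equiv> psi g \<alpha>"
abbreviation "Ph1 \<equiv> Phi1 g"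
abbreviation "Ph2 \<equiv> Phi2 g"

text \<open>\<open>f1\<close> is the ghost part of the differential of \<phi>_1. In
  \<open>f2\<close> the correction by \<Phi>_2 \<phi>_\<theta> makes the ghost part of its
  differential vanish.\<close>

definition f1 :: 'f where "f1 = Ph1 + mode F (ph Theta) (-1) (ps Alpha2)"
definition f2 :: 'f where "f2 = ph Alpha2 - mode F Ph2 (-1) (ph Theta)"
definition dF :: 'f where
  "dF = - mode F (ph Theta) (-1) (mode F (ps Alpha1) (-1) (ps Alpha2)) + ps Theta
     + mode F (ps Alpha1) (-1) Ph1 + mode F (ps Alpha2) (-1) Ph2"

lemma par_np: "a \<in> par F p \<Longrightarrow> b \<in> par F q \<Longrightarrow> mode F a (-1) b \<in> par F (p \<noteq> q)"
  by (rule par_mode)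

lemma par_composites [simp]: "f1 \<in> par F False" "f2 \<in> par F True" "dF \<in> par F True"
  "mode F (ph \<alpha>) (-1) (ps \<beta>) \<in> par F False" "mode F (ps \<alpha>) (-1) (ps \<beta>) \<in> par F False" "mode F Ph2 (-1) (ph \<beta>) \<in> par F True"
proof -
  show 1: "mode F (ph \<alpha>) (-1) (ps \<beta>) \<in> par F False" "mode F (ps \<alpha>) (-1) (ps \<beta>) \<in> par F False" "mode F Ph2 (-1) (ph \<beta>) \<in> par F True" for \<alpha> \<beta>
    using par_np[OF ghost_par(1,2)] par_np[OF ghost_par(2,2)] par_np[OF ghost_par(4,1)] by simp_all
  show "f1 \<in> par F False" unfolding f1_def by (intro cvs.subspace_add[OF par_subspace] 1 ghost_par)
  show "f2 \<in> par F True" unfolding f2_def by (intro cvs.subspace_diff[OF par_subspace] 1 ghost_par)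
  have 2: "mode F (ph Theta) (-1) (mode F (ps Alpha1) (-1) (ps Alpha2)) \<in> par F True" using par_np[OF ghost_par(1) 1(2)] by simp
  have 3: "mode F (ps \<alpha>) (-1) Ph1 \<in> par F True" "mode F (ps \<alpha>) (-1) Ph2 \<in> par F True" for \<alpha>
    using par_np[OF ghost_par(2,3)] par_np[OF ghost_par(2,4)] by simp_all
  show "dF \<in> par F True" unfolding dF_def
    by (intro cvs.subspace_add[OF par_subspace] cvs.subspace_neg[OF par_subspace] 2 3 ghost_par)
qed

lemma mode_np:
  assumes "x \<in> par F p" "a \<in> par F q" "\<And>j. j \<ge> 1 \<Longrightarrow> mode F x (int j) a = 0"
  shows "mode F x (int j) (mode F a (-1) b)
    = ssgn p q *\<^sub>C mode F a (-1) (mode F x (int j) b) + mode F (mode F x 0 a) (int j - 1) b"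
  using self.commutator0[OF assms, of "int j" "-1" b] by simp

lemma gen_f:
  "mode F (ph \<alpha>) (int j) f1 = (if j = 0 \<and> \<alpha> = Alpha2 then - ph Theta else 0)"
  "mode F (ps \<alpha>) (int j) f2 = (if j = 0 then (if \<alpha> = Alpha2 then vF else if \<alpha> = Theta then - Ph2 else 0) else 0)"
  "mode F Ph1 (int j) f2 = (if j = 0 then - ph Theta else 0)"
  "mode F Ph2 (int j) f2 = 0" "mode F Ph2 (int j) f1 = (if j = 0 then - vF else 0)"
  "mode F (ph \<alpha>) (int j) f2 = 0"
  by (auto simp: f1_def f2_def self.lin2_simps self.lin1_simps mode_np[OF ghost_par(1,1)] mode_np[OF ghost_par(2,4)]
      mode_np[OF ghost_par(3,4)] mode_np[OF ghost_par(4,4)] mode_np[OF ghost_par(4,1)] mode_np[OF ghost_par(1,4)]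
      creation mode_of_vac)

lemmas gen_f_0 = gen_f[where j = 0, unfolded of_nat_0]

lemma anticommute: "mode F (ph Theta) (-1) (ps Alpha1) = - mode F (ps Alpha1) (-1) (ph Theta)"
  using self.commutator0[OF ghost_par(1,2), of Theta Alpha1 "-1" "-1" vF]
  by (simp add: creation self.lin1_simps)

lemma f_gen:
  "mode F f2 (int j) (ps \<alpha>) = (if j = 0 then (if \<alpha> = Alpha2 then vF else if \<alpha> = Theta then - Ph2 else 0) else 0)"
  "mode F f2 (int j) Ph2 = 0" "mode F f2 (int j) f1 = 0" "mode F f2 (int j) f2 = 0"
proof -
  have np: "mode F (mode F Ph2 (-1) (ph Theta)) (int j) c
    = (if j = 0 then mode F Ph2 (-1) (mode F (ph Theta) 0 c) else 0) + mode F (ph Theta) (int j - 1) (mode F Ph2 0 c)"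
    if "\<And>i. i \<ge> 1 \<Longrightarrow> mode F Ph2 (int i) c = 0" "\<And>i. i \<ge> 1 \<Longrightarrow> mode F (ph Theta) (int i) c = 0" for c
    using self.normal_product_simple[OF ghost_par(4,1) that] by simp
  have d: "mode F f2 (int j) c = mode F (ph Alpha2) (int j) c - mode F (mode F Ph2 (-1) (ph Theta)) (int j) c" for c
    by (simp add: f2_def self.lin1_simps)
  show "mode F f2 (int j) (ps \<alpha>) = (if j = 0 then (if \<alpha> = Alpha2 then vF else if \<alpha> = Theta then - Ph2 else 0) else 0)"
    unfolding d by (subst np) (auto simp: self.lin2_simps creation)
  show "mode F f2 (int j) Ph2 = 0" unfolding d by (subst np) (auto simp: self.lin2_simps)
  show "mode F f2 (int j) f1 = 0"
    unfolding d by (subst np) (auto simp: self.lin2_simps gen_f gen_f_0 mode_vac creation)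
  show "mode F f2 (int j) f2 = 0"
    unfolding d by (subst np) (auto simp: self.lin2_simps gen_f gen_f_0)
qed

lemma dF_bottom:
  "mode F dF 0 (ph Theta) = vF" "mode F dF 0 (ph Alpha1) = f1"
  "mode F dF 0 f2 = 0" "mode F dF 0 Ph2 = ps Alpha1"
proof -
  let ?b = "mode F (ps Alpha1) (-1) (ps Alpha2)"
  have b: "mode F ?b (int j) c
    = (if j = 0 then mode F (ps Alpha1) (-1) (mode F (ps Alpha2) 0 c) else 0) - mode F (ps Alpha2) (int j - 1) (mode F (ps Alpha1) 0 c)"
    if "\<And>\<alpha> i. i \<ge> 1 \<Longrightarrow> mode F (ps \<alpha>) (int i) c = 0" for c j
    using self.normal_product_simple[OF ghost_par(2,2) that that] by simp
  have t: "mode F (mode F (ph Theta) (-1) ?b) 0 c = mode F (ph Theta) (-1) (mode F ?b 0 c)"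
    if "\<And>i. i \<ge> 1 \<Longrightarrow> mode F ?b (int i) c = 0" "\<And>i. mode F (ph Theta) (int i) c = 0" for c
    using self.normal_product_simple[OF ghost_par(1) par_composites(5) that(2) that(1), of 0] that(2)[of 0]
    by (simp add: self.lin2_simps)
  have p: "mode F (mode F (ps \<alpha>) (-1) Ph1) 0 c = mode F (ps \<alpha>) (-1) (mode F Ph1 0 c) + mode F Ph1 (-1) (mode F (ps \<alpha>) 0 c)"
          "mode F (mode F (ps \<alpha>) (-1) Ph2) 0 c = mode F (ps \<alpha>) (-1) (mode F Ph2 0 c) + mode F Ph2 (-1) (mode F (ps \<alpha>) 0 c)"
    if "\<And>i. i \<ge> 1 \<Longrightarrow> mode F (ps \<alpha>) (int i) c = 0" "\<And>i. i \<ge> 1 \<Longrightarrow> mode F Ph1 (int i) c = 0" "\<And>i. i \<ge> 1 \<Longrightarrow> mode F Ph2 (int i) c = 0" for c \<alpha>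
    using self.normal_product_simple[OF ghost_par(2,3) that(1,2), of 0] self.normal_product_simple[OF ghost_par(2,4) that(1,3), of 0] by simp_all
  have d: "mode F dF 0 c = - mode F (ph Theta) (-1) (mode F (ps Alpha1) (-1) (mode F (ps Alpha2) 0 c) - mode F (ps Alpha2) (-1) (mode F (ps Alpha1) 0 c))
     + mode F (ps Theta) 0 c + mode F (ps Alpha1) (-1) (mode F Ph1 0 c) + mode F Ph1 (-1) (mode F (ps Alpha1) 0 c)
     + mode F (ps Alpha2) (-1) (mode F Ph2 0 c) + mode F Ph2 (-1) (mode F (ps Alpha2) 0 c)"
    if 1: "\<And>\<alpha> i. i \<ge> 1 \<Longrightarrow> mode F (ps \<alpha>) (int i) c = 0" and 2: "\<And>i. i \<ge> 1 \<Longrightarrow> mode F Ph1 (int i) c = 0"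
      "\<And>i. i \<ge> 1 \<Longrightarrow> mode F Ph2 (int i) c = 0" and 3: "\<And>i. mode F (ph Theta) (int i) c = 0"
      and 4: "\<And>i. mode F (ps Alpha2) (int i) (mode F (ps Alpha1) 0 c) = 0" for c
  proof -
    have "mode F ?b (int i) c = 0" if "i \<ge> 1" for i
      using b[OF 1, of i] 4[of "i - 1"] that by (simp add: of_nat_diff)
    then show ?thesis
      using t[OF _ 3] p[OF 1 2, of Alpha1] p[OF 1 2, of Alpha2] b[OF 1, of 0]
      by (simp add: dF_def self.lin1_simps)
  qed
  have v: "mode F x (int j) vF = 0" for x j by (simp add: mode_vac)
  show "mode F dF 0 (ph Theta) = vF" by (subst d) (auto simp: self.lin2_simps)
  show "mode F dF 0 (ph Alpha1) = f1"
    by (subst d) (auto simp: self.lin2_simps v creation f1_def)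
  show "mode F dF 0 Ph2 = ps Alpha1" by (subst d) (auto simp: self.lin2_simps creation)
  show "mode F dF 0 f2 = 0"
    by (subst d) (auto simp: self.lin2_simps gen_f gen_f_0 creation anticommute)
qed

end

section \<open>The BRST complex\<close>

locale tensor_mod = va_mod V YM + F: vsa F + X: va_mod C YX
  for V :: "('v::complex_vector) vosa" and YM :: "'v \<Rightarrow> int \<Rightarrow> 'm \<Rightarrow> 'm::complex_vector"
    and F :: "('f::complex_vector) vosa" and C :: "('c::complex_vector) vosa"
    and YX :: "'c \<Rightarrow> int \<Rightarrow> 'x \<Rightarrow> 'x::complex_vector"
    and t :: "'v \<Rightarrow> 'f \<Rightarrow> 'c" and s :: "'m \<Rightarrow> 'f \<Rightarrow> 'x" +
  assumes s: "tensor_product s"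
    and act: "YX (t u f) n (s m g) = Sum_any (\<lambda>i::int. s (YM u i m) (mode F f (n - 1 - i) g))"
begin

lemmas s1_simps = clin_simps[OF tensor_bilinear(1)[OF s]] and s2_simps = clin_simps[OF tensor_bilinear(2)[OF s]]

lemma act_F: "YX (t (vac V) f) n (s m h) = s m (mode F f n h)"
  unfolding act by (subst Sum_any_single[where a = "-1"]) (auto simp: vacuum s1_simps)

lemma act_V: "YX (t u (vac F)) n (s m h) = s (YM u n m) h"
  unfolding act by (subst Sum_any_single[where a = n]) (auto simp: F.mode_of_vac s2_simps)

lemma act_mem:
  "cvs.subspace U \<Longrightarrow> (\<And>i. s (YM u i m) (mode F f (n - 1 - i) h) \<in> U) \<Longrightarrow> YX (t u f) n (s m h) \<in> U"
  unfolding act by (rule Sum_any_mem_subspace)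

end

text \<open>Labels of the doublets \<open>(bot i, top i)\<close> with \<open>d\<^sub>(\<^sub>0\<^sub>) (bot i) = top i\<close>.  Up to corrections the bottoms are
  \<open>\<phi>\<^sub>\<theta>, \<phi>\<^sub>1, \<phi>\<^sub>2, \<Phi>\<^sub>2, p\<close> and \<open>\<omega> = diag(1/3, 1/3, -2/3)\<close>; \<open>br i j\<close> is the residue of \<open>bot i\<close> and \<open>top j\<close>.\<close>
datatype six = Bth | B1 | B2 | BPhi | Bp | Bw

lemma UNIV_six: "UNIV = {Bth, B1, B2, BPhi, Bp, Bw}"
  by (auto intro: six.exhaust)

locale brst = affine_nc k V \<iota> + F: ghost F g
  for k and V :: "('v::complex_vector) vosa" and \<iota>
    and F :: "('f::complex_vector) vosa" and g +
  fixes C :: "('c::complex_vector) vosa" and t :: "'v \<Rightarrow> 'f \<Rightarrow> 'c" and d :: 'c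
  assumes tva: "tensor_va V F C t" and d_eq: "d = brst_element V \<iota> F g t"
    and d_square: "mode C d 0 (mode C d 0 c) = 0"
begin

sublocale C: vsa C
  using tva by unfold_locales (simp add: tensor_va_def)

sublocale CC: tensor_mod V "mode V" F C "mode C" t t
  using tva by unfold_locales (simp_all add: tensor_va_def)

lemma t_vac: "t (vac V) (vac F) = vac C" using tva by (simp add: tensor_va_def)

lemma t_par: "f \<in> par F r \<Longrightarrow> t u f \<in> par C r"
  using tva by (auto simp: tensor_va_def intro: cvs.span_base)

abbreviation "eC \<equiv> t (\<iota> eM) (vac F)"

fun bot :: "six \<Rightarrow> 'c" where
  "bot Bth = t (vac V) (F.ph Theta)"
| "bot B1 = t (vac V) (F.ph Alpha1)"
| "bot B2 = t (vac V) F.f2"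
| "bot BPhi = t (vac V) F.Ph2"
| "bot Bp = t (\<iota> pM) (vac F)"
| "bot Bw = t (\<iota> wM) (vac F)"

fun top :: "six \<Rightarrow> 'c" where
  "top Bth = eC + vac C"
| "top B1 = t (\<iota> pM) (vac F) + t (vac V) F.f1"
| "top B2 = t (\<iota> qM) (vac F) - t (\<iota> eM) F.Ph2"
| "top BPhi = t (vac V) (F.ps Alpha1)"
| "top Bp = - t (\<iota> eM) (F.ps Alpha2)"
| "top Bw = - t (\<iota> qM) (F.ps Alpha2) - t (\<iota> eM) (F.ps Theta)"

fun od :: "six \<Rightarrow> bool" where
  "od Bth = True" | "od B1 = True" | "od B2 = True" | "od BPhi = False" | "od Bp = False" | "od Bw = False"

fun br :: "six \<Rightarrow> six \<Rightarrow> 'c" where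
  "br Bth Bw = - eC" | "br B1 BPhi = vac C" | "br B2 Bp = - eC" | "br B2 Bw = - top B2"
| "br BPhi B1 = - vac C" | "br Bp B2 = eC" | "br Bp Bw = top Bp"
| "br Bw Bth = eC" | "br Bw Bp = top Bp" | "br Bw Bw = top Bw" | "br Bw B2 = top B2"
| "br _ _ = 0"

lemma par_bot: "bot i \<in> par C (od i)"
  by (cases i) (auto intro: t_par)

lemma par_top: "top i \<in> par C (\<not> od i)"
  by (cases i) (auto intro!: cvs.subspace_add cvs.subspace_diff cvs.subspace_neg C.par_subspace t_par C.vac_even)

lemma par_eC: "eC \<in> par C False" by (intro t_par) simp

lemma simple_poles: "A \<in> {eM, pM, qM, wM} \<Longrightarrow> B \<in> {eM, pM, qM, wM} \<Longrightarrow> A \<noteq> wM \<or> B \<noteq> wM \<Longrightarrow> j \<noteq> 0 \<Longrightarrow>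
    mode V (\<iota> A) (int j) (\<iota> B) = 0"
proof -
  assume A: "A \<in> {eM, pM, qM, wM}" and B: "B \<in> {eM, pM, qM, wM}" and w: "A \<noteq> wM \<or> B \<noteq> wM" and j: "j \<noteq> 0"
  have m: "A \<in> sl3" "B \<in> sl3" using A B by auto
  have "trace (A ** B) = 0" using A B w by (auto simp: trace_table)
  then show ?thesis using iota_ope(2)[OF m] iota_ope(3)[OF m, of j] j by (cases "j = 1") auto
qed

lemma iota_0_ope:
  "mode V (\<iota> eM) 0 (\<iota> eM) = 0" "mode V (\<iota> eM) 0 (\<iota> pM) = 0" "mode V (\<iota> eM) 0 (\<iota> qM) = 0" "mode V (\<iota> eM) 0 (\<iota> wM) = - \<iota> eM"
  "mode V (\<iota> pM) 0 (\<iota> eM) = 0" "mode V (\<iota> pM) 0 (\<iota> pM) = 0" "mode V (\<iota> pM) 0 (\<iota> qM) = \<iota> eM" "mode V (\<iota> pM) 0 (\<iota> wM) = 0"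
  "mode V (\<iota> qM) 0 (\<iota> eM) = 0" "mode V (\<iota> qM) 0 (\<iota> pM) = - \<iota> eM" "mode V (\<iota> qM) 0 (\<iota> qM) = 0" "mode V (\<iota> qM) 0 (\<iota> wM) = - \<iota> qM"
  "mode V (\<iota> wM) 0 (\<iota> eM) = \<iota> eM" "mode V (\<iota> wM) 0 (\<iota> pM) = 0" "mode V (\<iota> wM) 0 (\<iota> qM) = \<iota> qM" "mode V (\<iota> wM) 0 (\<iota> wM) = 0"
  by (simp_all add: iota_ope(1) lie_table iota_uminus)

lemma wM_ne: "eM \<noteq> wM" "pM \<noteq> wM" "qM \<noteq> wM"
  by (auto simp: mat3_simps wM_def)

lemma V_ope:
  "mode V (\<iota> eM) (int j) (\<iota> eM) = 0" "mode V (\<iota> eM) (int j) (\<iota> pM) = 0" "mode V (\<iota> eM) (int j) (\<iota> qM) = 0"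
  "mode V (\<iota> eM) (int j) (\<iota> wM) = (if j = 0 then - \<iota> eM else 0)"
  "mode V (\<iota> pM) (int j) (\<iota> eM) = 0" "mode V (\<iota> pM) (int j) (\<iota> pM) = 0"
  "mode V (\<iota> pM) (int j) (\<iota> qM) = (if j = 0 then \<iota> eM else 0)" "mode V (\<iota> pM) (int j) (\<iota> wM) = 0"
  "mode V (\<iota> qM) (int j) (\<iota> eM) = 0" "mode V (\<iota> qM) (int j) (\<iota> pM) = (if j = 0 then - \<iota> eM else 0)"
  "mode V (\<iota> qM) (int j) (\<iota> qM) = 0" "mode V (\<iota> qM) (int j) (\<iota> wM) = (if j = 0 then - \<iota> qM else 0)"
  "mode V (\<iota> wM) (int j) (\<iota> eM) = (if j = 0 then \<iota> eM else 0)" "mode V (\<iota> wM) (int j) (\<iota> pM) = 0"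
  "mode V (\<iota> wM) (int j) (\<iota> qM) = (if j = 0 then \<iota> qM else 0)"
  using wM_ne by (cases "j = 0"; simp add: iota_0_ope simple_poles)+

lemmas C_lin = C.self.lin1_simps C.self.lin2_simps CC.s1_simps CC.s2_simps

lemma mode_C_vac: "mode C x (int j) (vac C) = 0" by (simp add: C.mode_vac)

lemma f2_ph: "mode F F.f2 (int j) (F.ph \<alpha>) = 0"
  using F.ope_zero_skew[OF F.ghost_par(1) F.par_composites(2), of 0 \<alpha> j] F.gen_f(6) by simp

lemma bot_bot: "i \<noteq> Bw \<or> j \<noteq> Bw \<Longrightarrow> mode C (bot i) (int l) (bot j) = 0"
  by (cases i; cases j)
     (simp_all add: CC.act_F CC.act_V C_lin V_ope F.gen_f F.f_gen f2_ph F.mode_vac mode_vac)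

lemma bot_top: "mode C (bot i) (int l) (top j) = (if l = 0 then br i j else 0)"
  by (cases i; cases j)
     (simp_all add: CC.act_F CC.act_V C_lin V_ope F.gen_f F.f_gen F.mode_vac mode_vac mode_C_vac F.creation t_vac)

lemma eC_bot: "i \<noteq> Bw \<Longrightarrow> mode C eC (int l) (bot i) = 0"
  by (cases i) (simp_all add: CC.act_F CC.act_V C_lin V_ope F.mode_vac mode_vac)

lemma eC_w: "mode C eC (int l) (bot Bw) = (if l = 0 then - eC else 0)"
  by (simp add: CC.act_V V_ope C_lin)

lemma d_decomp: "d = t (\<iota> pM) (F.ps Alpha1) + t (\<iota> qM) (F.ps Alpha2) + t (\<iota> eM) (F.ps Theta) + t (vac V) F.dF"
  by (simp add: d_eq brst_element_def F.dF_def add.assoc)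

lemma par_d: "d \<in> par C True"
  unfolding d_decomp by (intro cvs.subspace_add[OF C.par_subspace] t_par) simp_all

lemma act0_F:
  assumes "\<And>j. j \<ge> 1 \<Longrightarrow> mode F f (int j) h = 0"
  shows "mode C (t u f) 0 (t (vac V) h) = t u (mode F f 0 h)"
  unfolding CC.act
proof (subst Sum_any_single[where a = "-1"])
  fix i :: int assume i: "i \<noteq> -1"
  show "t (mode V u i (vac V)) (mode F f (0 - 1 - i) h) = 0"
  proof (cases "i \<ge> 0")
    case True
    then show ?thesis by (simp add: mode_vac C_lin)
  next
    case False
    then show ?thesis using assms[of "nat (- 1 - i)"] i by (simp add: C_lin)
  qed
qed (simp add: creation)

lemma act0_V:
  assumes "\<And>j. j \<ge> 1 \<Longrightarrow> mode V u (int j) w = 0"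
  shows "mode C (t u f) 0 (t w (vac F)) = t (mode V u 0 w) f"
  unfolding CC.act
proof (subst Sum_any_single[where a = 0])
  fix i :: int assume "i \<noteq> 0"
  then show "t (mode V u i w) (mode F f (0 - 1 - i) (vac F)) = 0"
    using assms[of "nat i"] by (cases "i > 0") (auto simp: F.mode_vac C_lin)
qed (simp add: F.creation)

lemma d_bot: "mode C d 0 (bot i) = top i"
  unfolding d_decomp
  by (cases i)
     (simp_all add: C_lin act0_F act0_V CC.act_F[of F.dF 0] F.dF_bottom F.gen_f F.gen_f_0 F.mode_vac t_vac
       simple_poles wM_ne iota_0_ope)

lemma d_top: "mode C d 0 (top i) = 0"
  using d_square[of "bot i"] by (simp add: d_bot)

lemma d_eC: "mode C d 0 eC = 0"
  using d_top[of Bth] by (simp add: C_lin C.mode_vac)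

lemma d_br: "mode C d 0 (br i j) = 0"
  by (cases i; cases j) (simp_all only: br.simps C_lin d_eC d_top C.mode_vac order_refl minus_zero)

text \<open>Apply the differential to the product of \<open>bot i\<close> with \<open>top j\<close>:
  the result \<open>br i j\<close> is closed and so is \<open>top j\<close>, which leaves only the
  product of the two tops.\<close>

lemma top_top: "mode C (top i) (int l) (top j) = 0"
proof -
  have "mode C d 0 (mode C (bot i) (int l) (top j)) = ssgn True (od i) *\<^sub>C mode C (bot i) (int l) (mode C d 0 (top j))
      + mode C (mode C d 0 (bot i)) (int l) (top j)"
    by (rule C.self.zero_mode_commutator[OF par_d par_bot])
  then show ?thesis by (simp add: bot_top d_br d_top d_bot C_lin split: if_splits)
qed

lemma top_bot: "mode C (top j) (int l) (bot i) = (if l = 0 then - ssgn (od i) (\<not> od j) *\<^sub>C br i j else 0)"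
  using C.simple_pole_skew[OF par_bot par_top, of i j] C.ope_zero_skew[OF par_bot par_top, of 1 i j l]
  by (auto simp: bot_top bot_top[where l = 0, unfolded of_nat_0] Suc_le_eq)

end

section \<open>The conformal grading of the complex\<close>

context brst
begin

fun wi :: "six \<Rightarrow> int" where
  "wi Bth = 2" | "wi B1 = 1" | "wi B2 = 1" | "wi BPhi = 1" | "wi Bp = 1" | "wi Bw = 0"

text \<open>A field of conformal weight h carries the integer 2 - 2h, so that its n-th mode has
  degree 2n plus that integer. For a current in \<open>gr j\<close> this is j, in agreement with
  \<open>letters\<close>.\<close>

definition ghosts :: "('f \<times> int) set" where
  "ghosts = {(F.ph Theta, 2), (F.ph Alpha1, 1), (F.ph Alpha2, 1), (F.ps Theta, 0), (F.ps Alpha1, 1), (F.ps Alpha2, 1),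
     (F.Ph1, 1), (F.Ph2, 1)}"

lemma ghost_pair:
  assumes "(f, w) \<in> ghosts" "(f', w') \<in> ghosts"
  obtains p q c where "f \<in> par F p" "f' \<in> par F q" "mode F f 0 f' = c *\<^sub>C vac F" "\<And>j. j \<ge> 1 \<Longrightarrow> mode F f (int j) f' = 0"
    "c \<noteq> 0 \<longrightarrow> w + w' = 2"
proof -
  have p: "\<exists>p. f \<in> par F p" if "(f, w) \<in> ghosts" for f w
    using that unfolding ghosts_def by (elim insertE emptyE) (use F.ghost_par in blast)+
  have c: "\<exists>c. mode F f 0 f' = c *\<^sub>C vac F \<and> (c \<noteq> 0 \<longrightarrow> w + w' = 2)"
    using assms unfolding ghosts_def
    by (elim insertE emptyE; simp; force intro: exI[of _ 0] exI[of _ 1] exI[of _ "-1"])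
  have z: "mode F f (int j) f' = 0" if "j \<ge> 1" for j
    using assms that unfolding ghosts_def by (elim insertE emptyE) simp_all
  show thesis using p[OF assms(1)] p[OF assms(2)] c z that by blast
qed

end

locale brst_mod = hw_mod_nc k V \<iota> YM v a b + brst k V \<iota> F g C t d + T: tensor_mod V YM F C YX t s
  for k and V :: "('v::complex_vector) vosa" and \<iota> and YM :: "'v \<Rightarrow> int \<Rightarrow> 'm \<Rightarrow> 'm::complex_vector" and v a b
    and F :: "('f::complex_vector) vosa" and g and C :: "('c::complex_vector) vosa" and t and d
    and YX :: "'c \<Rightarrow> int \<Rightarrow> 'x \<Rightarrow> 'x::complex_vector" and s +
  assumes D_square: "YX d 0 (YX d 0 x) = 0"
begin

abbreviation "D \<equiv> YX d 0"
abbreviation "eX n \<equiv> YX eC n"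
abbreviation "ob i n \<equiv> YX (bot i) n"
abbreviation "tp i n \<equiv> YX (top i) n"
abbreviation "vX \<equiv> s v (vac F)"

lemmas X1 = T.X.lin1_simps
lemmas X2 = T.X.lin2_simps

lemma X_eqI:
  assumes "clin f" "clin h" "\<And>m y. f (s m y) = h (s m y)" shows "f x = h x"
proof -
  have "{x. f x = h x} = UNIV"
    by (rule tensor_induct[OF T.s]) (use assms in \<open>auto simp: cvs.subspace_def clin_simps\<close>)
  then show ?thesis by blast
qed

definition xletters :: "(('x \<Rightarrow> 'x) \<times> int) set" where
  "xletters = {(YX (t (\<iota> A) (vac F)) n, 2 * n + j) | A n j. A \<in> gr j} \<union>
     {(YX (t (vac V) f) n, 2 * n + w) | f n w. (f, w) \<in> ghosts}"

lemma xletter_V: "A \<in> gr j \<Longrightarrow> c = 2 * n + j \<Longrightarrow> (YX (t (\<iota> A) (vac F)) n, c) \<in> xletters"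
  and xletter_F: "(f, w) \<in> ghosts \<Longrightarrow> c = 2 * n + w \<Longrightarrow> (YX (t (vac V) f) n, c) \<in> xletters"
  unfolding xletters_def by blast+

lemma X_affine_comm:
  assumes "A \<in> sl3" "B \<in> sl3"
  shows "YX (t (\<iota> A) (vac F)) m (YX (t (\<iota> B) (vac F)) n x) = YX (t (\<iota> B) (vac F)) n (YX (t (\<iota> A) (vac F)) m x)
    + YX (t (\<iota> (lie A B)) (vac F)) (m + n) x + (if m + n = 0 then of_int m * k * trace (A ** B) else 0) *\<^sub>C x"
  by (rule X_eqI[of "\<lambda>x. YX (t (\<iota> A) (vac F)) m (YX (t (\<iota> B) (vac F)) n x)"
        "\<lambda>x. YX (t (\<iota> B) (vac F)) n (YX (t (\<iota> A) (vac F)) m x) + YX (t (\<iota> (lie A B)) (vac F)) (m + n) x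
           + (if m + n = 0 then of_int m * k * trace (A ** B) else 0) *\<^sub>C x"])
     (auto intro!: clinI simp: X2 cvs.scale_right_distrib T.act_V affine_comm[OF assms, of m n] T.s1_simps mult.commute)

lemma X_ghost_comm:
  assumes "(f, w) \<in> ghosts" "(f', w') \<in> ghosts"
  shows "\<exists>c c0. (c0 \<noteq> 0 \<longrightarrow> w + w' = 2 \<and> m + n = -1) \<and>
    (\<forall>x. YX (t (vac V) f) m (YX (t (vac V) f') n x) = c *\<^sub>C YX (t (vac V) f') n (YX (t (vac V) f) m x) + c0 *\<^sub>C x)"
proof -
  obtain p q c where f: "f \<in> par F p" "f' \<in> par F q" "mode F f 0 f' = c *\<^sub>C vac F" "\<And>j. j \<ge> 1 \<Longrightarrow> mode F f (int j) f' = 0"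
    and c: "c \<noteq> 0 \<longrightarrow> w + w' = 2" using ghost_pair[OF assms] by blast
  let ?c0 = "if m + n = -1 then c else 0"
  have "mode F f m (mode F f' n y) = ssgn p q *\<^sub>C mode F f' n (mode F f m y) + ?c0 *\<^sub>C y" for y
    using F.self.commutator0[OF f(1,2,4), of m n y] by (simp add: f(3) F.self.lin1_simps F.mode_of_vac)
  then have fc: "s m' (mode F f m (mode F f' n y)) = ssgn p q *\<^sub>C s m' (mode F f' n (mode F f m y)) + ?c0 *\<^sub>C s m' y" for m' y
    by (simp only: T.s2_simps)
  have "YX (t (vac V) f) m (YX (t (vac V) f') n x) = ssgn p q *\<^sub>C YX (t (vac V) f') n (YX (t (vac V) f) m x) + ?c0 *\<^sub>C x" for x
  proof (rule X_eqI[of "\<lambda>x. YX (t (vac V) f) m (YX (t (vac V) f') n x)"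
        "\<lambda>x. ssgn p q *\<^sub>C YX (t (vac V) f') n (YX (t (vac V) f) m x) + ?c0 *\<^sub>C x"])
    show "clin (\<lambda>x. ssgn p q *\<^sub>C YX (t (vac V) f') n (YX (t (vac V) f) m x) + ?c0 *\<^sub>C x)"
      by (rule clinI) (simp_all add: X2 cvs.scale_right_distrib mult.commute)
  qed (simp_all only: T.act_F fc, simp add: X2 clinI)
  then show ?thesis using c by (intro exI[of _ "ssgn p q"] exI[of _ ?c0]) auto
qed

lemma X_mixed_comm: "YX (t u (vac F)) m (YX (t (vac V) f) n x) = YX (t (vac V) f) n (YX (t u (vac F)) m x)"
  by (rule X_eqI[of "\<lambda>x. YX (t u (vac F)) m (YX (t (vac V) f) n x)" "\<lambda>x. YX (t (vac V) f) n (YX (t u (vac F)) m x)"])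
     (auto intro!: clinI simp: X2 T.act_V T.act_F)

lemma s_span:
  assumes U: "cvs.subspace U" "s v (vac F) \<in> U"
    and 1: "\<And>A n x. A \<in> sl3 \<Longrightarrow> x \<in> U \<Longrightarrow> YX (t (\<iota> A) (vac F)) n x \<in> U"
    and 2: "\<And>f w n x. (f, w) \<in> ghosts \<Longrightarrow> x \<in> U \<Longrightarrow> YX (t (vac V) f) n x \<in> U"
  shows "U = UNIV"
proof (rule tensor_induct[OF T.s U(1)])
  have "{m. s m (vac F) \<in> U} = UNIV"
  proof (rule hw_cyclic)
    show "cvs.subspace {m. s m (vac F) \<in> U}" using U(1) by (auto simp: cvs.subspace_def T.s1_simps)
    fix A n x assume "A \<in> sl3" "x \<in> {m. s m (vac F) \<in> U}"
    then show "YM (\<iota> A) n x \<in> {m. s m (vac F) \<in> U}" using 1[of A "s x (vac F)" n] by (simp add: T.act_V)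
  qed (use U in simp)
  then have m: "s m (vac F) \<in> U" for m by blast
  let ?H = "{h. \<forall>m. s m h \<in> U}"
  have "?H = UNIV"
  proof -
    have gens: "mode F f n h \<in> ?H" if "(f, w) \<in> ghosts" "h \<in> ?H" for f w n h
      using 2[OF that(1), of "s _ h" n] that(2) by (auto simp: T.act_F)
    have sub: "cvs.subspace ?H" using U(1) by (auto simp: cvs.subspace_def T.s2_simps)
    have mem: "mode F f n h \<in> ?H" if "f \<in> range (phi g) \<union> range (psi g) \<union> {Phi1 g, Phi2 g}" "h \<in> ?H" for f n h
    proof -
      have "f = phi g \<alpha> \<or> f = psi g \<alpha> \<Longrightarrow> \<exists>w. (f, w) \<in> ghosts" for \<alpha>
        by (cases \<alpha>) (auto simp: ghosts_def)
      then have "\<exists>w. (f, w) \<in> ghosts" using that(1) by (auto simp: ghosts_def)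
      then show ?thesis using gens that(2) by blast
    qed
    have "strongly_generates F (range (phi g) \<union> range (psi g) \<union> {Phi1 g, Phi2 g})"
      using F.gs by (simp add: ghost_system_def)
    from this[unfolded strongly_generates_def, THEN spec, of ?H] show ?thesis
      by (rule mp) (intro conjI ballI allI impI sub mem, simp add: m)
  qed
  then show "s m h \<in> U" for m h by blast
qed

sublocale xl: graded_letters xletters vX
proof
  fix w assume w: "w \<in> xletters"
  then show "clin (fst w)" by (auto simp: xletters_def T.X.lin2)
  { assume "snd w > 0"
    with w show "fst w vX = 0" unfolding xletters_def
    proof (elim UnE CollectE exE conjE)
      fix A n j assume "0 < snd w" "w = (YX (t (\<iota> A) (vac F)) n, 2 * n + j)" "A \<in> gr j"
      then show "fst w vX = 0" using gl.pos[OF letter[OF _ refl], of A j n] by (simp add: T.act_V T.s1_simps)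
    next
      fix f n w' assume "0 < snd w" "w = (YX (t (vac V) f) n, 2 * n + w')" "(f, w') \<in> ghosts"
      moreover from this have "n \<ge> 0" by (auto simp: ghosts_def)
      ultimately show "fst w vX = 0" by (simp add: T.act_F F.mode_vac T.s2_simps)
    qed }
  { fix w' assume w': "w' \<in> xletters"
    let ?P = "\<exists>c c0 S. (S = (\<lambda>x. 0) \<or> (S, snd w + snd w') \<in> xletters) \<and>
      (c0 \<noteq> 0 \<longrightarrow> snd w + snd w' = 0) \<and> (\<forall>x. fst w (fst w' x) = c *\<^sub>C fst w' (fst w x) + S x + c0 *\<^sub>C x)"
    show ?P using w[unfolded xletters_def] w'[unfolded xletters_def]
    proof (elim UnE CollectE exE conjE)
      fix A n j A' n' j' assume w: "w = (YX (t (\<iota> A) (vac F)) n, 2 * n + j)" "A \<in> gr j"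
        "w' = (YX (t (\<iota> A') (vac F)) n', 2 * n' + j')" "A' \<in> gr j'"
      let ?c0 = "if n + n' = 0 then of_int n * k * trace (A ** A') else 0"
      have eq: "fst w (fst w' x) = 1 *\<^sub>C fst w' (fst w x) + YX (t (\<iota> (lie A A')) (vac F)) (n + n') x + ?c0 *\<^sub>C x" for x
        using X_affine_comm[OF gr_sl3 gr_sl3, OF w(2,4)] by (simp add: w)
      have "(YX (t (\<iota> (lie A A')) (vac F)) (n + n'), snd w + snd w') \<in> xletters"
        by (rule xletter_V[OF lie_gr[OF w(2,4)]]) (simp add: w)
      moreover have "?c0 \<noteq> 0 \<longrightarrow> snd w + snd w' = 0"
      proof
        assume "?c0 \<noteq> 0"
        then have "n + n' = 0" "j + j' = 0" using trace_gr[OF w(2,4)] by (auto split: if_splits)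
        then show "snd w + snd w' = 0" by (simp add: w)
      qed
      ultimately show ?P using eq by (intro exI[of _ 1] exI[of _ ?c0] exI[of _ "YX (t (\<iota> (lie A A')) (vac F)) (n + n')"]) blast
    next
      fix A n j f n' w'' assume w: "w = (YX (t (\<iota> A) (vac F)) n, 2 * n + j)" "w' = (YX (t (vac V) f) n', 2 * n' + w'')"
      show ?P by (rule exI[of _ 1], rule exI[of _ 0], rule exI[of _ "\<lambda>x. 0"]) (simp add: w X_mixed_comm)
    next
      fix A n j f n' w'' assume w: "w' = (YX (t (\<iota> A) (vac F)) n, 2 * n + j)" "w = (YX (t (vac V) f) n', 2 * n' + w'')"
      show ?P by (rule exI[of _ 1], rule exI[of _ 0], rule exI[of _ "\<lambda>x. 0"]) (simp add: w X_mixed_comm)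
    next
      fix f n x f' n' x' assume w: "w = (YX (t (vac V) f) n, 2 * n + x)" "(f, x) \<in> ghosts"
        "w' = (YX (t (vac V) f') n', 2 * n' + x')" "(f', x') \<in> ghosts"
      obtain c c0 where c: "c0 \<noteq> 0 \<longrightarrow> x + x' = 2 \<and> n + n' = -1"
        "\<And>x. YX (t (vac V) f) n (YX (t (vac V) f') n' x) = c *\<^sub>C YX (t (vac V) f') n' (YX (t (vac V) f) n x) + c0 *\<^sub>C x"
        using X_ghost_comm[OF w(2,4)] by blast
      show ?P by (rule exI[of _ c], rule exI[of _ c0], rule exI[of _ "\<lambda>x. 0"]) (use c in \<open>auto simp: w\<close>)
    qed }
next
  fix U assume U: "cvs.subspace U" "vX \<in> U" "\<And>w x. w \<in> xletters \<Longrightarrow> x \<in> U \<Longrightarrow> fst w x \<in> U"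
  show "U = UNIV"
  proof (rule s_span[OF U(1,2)])
    fix A n x assume A: "A \<in> sl3" and x: "x \<in> U"
    show "YX (t (\<iota> A) (vac F)) n x \<in> U"
    proof (rule gr_decomp[OF U(1) _ _ A])
      fix j B assume "B \<in> gr j"
      then show "YX (t (\<iota> B) (vac F)) n x \<in> U" using U(3)[OF xletter_V[OF _ refl, of B j n] x] by simp
    qed (simp add: iota_lin C_lin X1)
  next
    fix f w n x assume "(f, w) \<in> ghosts" "x \<in> U"
    then show "YX (t (vac V) f) n x \<in> U" using U(3)[OF xletter_F[OF _ refl, of f w n]] by simp
  qed
qed

text \<open>Expressed through the filtration because it must also cover the normal products inside
  the doublets, which are not letters.\<close>

definition has_wt :: "'c \<Rightarrow> int \<Rightarrow> bool" where
  "has_wt c w \<longleftrightarrow> (\<forall>n K x. x \<in> xl.Fil K \<longrightarrow> YX c n x \<in> xl.Fil (K - (2 * n + w)))"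

lemma wt_V: "A \<in> gr j \<Longrightarrow> has_wt (t (\<iota> A) (vac F)) j"
  unfolding has_wt_def using xl.letter_Fil[OF xletter_V[OF _ refl]] by simp

lemma wt_F: "(f, w) \<in> ghosts \<Longrightarrow> has_wt (t (vac V) f) w"
  unfolding has_wt_def using xl.letter_Fil[OF xletter_F[OF _ refl]] by simp

lemma wt_add: "has_wt c w \<Longrightarrow> has_wt c' w \<Longrightarrow> has_wt (c + c') w"
  by (simp add: has_wt_def X1 cvs.subspace_add[OF xl.Fil_sub])

lemma wt_neg: "has_wt c w \<Longrightarrow> has_wt (- c) w"
  by (simp add: has_wt_def X1 cvs.subspace_neg[OF xl.Fil_sub])

lemma wt_diff: "has_wt c w \<Longrightarrow> has_wt c' w \<Longrightarrow> has_wt (c - c') w"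
  by (simp add: has_wt_def X1 cvs.subspace_diff[OF xl.Fil_sub])

lemma wt_vac: "has_wt (vac C) 2"
  by (auto simp: has_wt_def T.X.vacuum cvs.subspace_0[OF xl.Fil_sub])

text \<open>With w = 2 - 2h this is the additivity of conformal weights.\<close>

lemma wt_np:
  assumes "has_wt c w" "has_wt c' w'" "c \<in> par C p" "c' \<in> par C q"
  shows "has_wt (mode C c (-1) c') (w + w' - 2)"
  unfolding has_wt_def
proof (intro allI impI)
  fix n K x assume x: "x \<in> xl.Fil K"
  show "YX (mode C c (-1) c') n x \<in> xl.Fil (K - (2 * n + (w + w' - 2)))"
  proof (rule T.X.mode_mem_subspace[OF assms(3,4) xl.Fil_sub])
    fix j :: nat
    have "YX c (-1 - int j) (YX c' (n + int j) x) \<in> xl.Fil (K - (2 * (n + int j) + w') - (2 * (-1 - int j) + w))"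
      using assms(1,2) x unfolding has_wt_def by blast
    then show "YX c (-1 - int j) (YX c' (n + int j) x) \<in> xl.Fil (K - (2 * n + (w + w' - 2)))"
      by (rule xl.Fil_mono[rotated]) simp
    have "YX c' (n + -1 - int j) (YX c (int j) x) \<in> xl.Fil (K - (2 * int j + w) - (2 * (n + -1 - int j) + w'))"
      using assms(1,2) x unfolding has_wt_def by blast
    then show "YX c' (n + -1 - int j) (YX c (int j) x) \<in> xl.Fil (K - (2 * n + (w + w' - 2)))"
      by (rule xl.Fil_mono[rotated]) simp
  qed
qed

lemma wt_np_F: "(f, w) \<in> ghosts \<Longrightarrow> (f', w') \<in> ghosts \<Longrightarrow> has_wt (t (vac V) (mode F f (-1) f')) (w + w' - 2)"
proof -
  assume g: "(f, w) \<in> ghosts" "(f', w') \<in> ghosts"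
  obtain p q where p: "f \<in> par F p" "f' \<in> par F q" using ghost_pair[OF g] by blast
  have "mode C (t (vac V) f) (-1) (t (vac V) f') = t (vac V) (mode F f (-1) f')" by (simp add: CC.act_F)
  then show ?thesis using wt_np[OF wt_F[OF g(1)] wt_F[OF g(2)] t_par[OF p(1)] t_par[OF p(2)]] by simp
qed

lemma wt_mixed: "A \<in> gr j \<Longrightarrow> (f, w) \<in> ghosts \<Longrightarrow> has_wt (t (\<iota> A) f) (j + w - 2)"
proof -
  assume A: "A \<in> gr j" and g: "(f, w) \<in> ghosts"
  obtain p q where p: "f \<in> par F p" using ghost_pair[OF g g] by blast
  have "mode C (t (\<iota> A) (vac F)) (-1) (t (vac V) f) = t (\<iota> A) f" by (simp add: CC.act_V creation)
  then show ?thesis using wt_np[OF wt_V[OF A] wt_F[OF g] t_par[OF F.vac_even] t_par[OF p]] by simp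
qed

lemma ghosts_mem: "(F.ph Theta, 2) \<in> ghosts" "(F.ph Alpha1, 1) \<in> ghosts" "(F.ph Alpha2, 1) \<in> ghosts"
  "(F.ps Theta, 0) \<in> ghosts" "(F.ps Alpha1, 1) \<in> ghosts" "(F.ps Alpha2, 1) \<in> ghosts" "(F.Ph1, 1) \<in> ghosts" "(F.Ph2, 1) \<in> ghosts"
  by (simp_all add: ghosts_def)

lemma wt_bot: "has_wt (bot i) (wi i)"
proof (cases i)
  case B2
  have "has_wt (t (vac V) (mode F F.Ph2 (-1) (F.ph Theta))) 1" using wt_np_F[OF ghosts_mem(8,1)] by simp
  then show ?thesis using B2 wt_diff[OF wt_F[OF ghosts_mem(3)]] by (simp add: F.f2_def CC.s2_simps)
qed (auto intro: wt_F ghosts_mem wt_V gr_table)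

lemma wt_top: "has_wt (top i) (wi i)"
proof (cases i)
  case Bth then show ?thesis by (auto intro!: wt_add wt_V gr_table wt_vac)
next
  case B1
  have "has_wt (t (vac V) (mode F (F.ph Theta) (-1) (F.ps Alpha2))) 1" using wt_np_F[OF ghosts_mem(1,6)] by simp
  then have "has_wt (t (vac V) F.f1) 1" using wt_add[OF wt_F[OF ghosts_mem(7)]] by (simp add: F.f1_def CC.s2_simps)
  then show ?thesis using B1 by (auto intro!: wt_add wt_V gr_table)
next
  case B2
  have "has_wt (t (\<iota> eM) F.Ph2) 1" using wt_mixed[OF gr_table(1) ghosts_mem(8)] by simp
  then show ?thesis using B2 by (auto intro!: wt_diff wt_V gr_table)
next
  case BPhi then show ?thesis by (auto intro: wt_F ghosts_mem)
next
  case Bp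
  have "has_wt (t (\<iota> eM) (F.ps Alpha2)) 1" using wt_mixed[OF gr_table(1) ghosts_mem(6)] by simp
  then show ?thesis using Bp by (auto intro: wt_neg)
next
  case Bw
  have "has_wt (t (\<iota> qM) (F.ps Alpha2)) 0" "has_wt (t (\<iota> eM) (F.ps Theta)) 0"
    using wt_mixed[OF gr_table(3) ghosts_mem(6)] wt_mixed[OF gr_table(1) ghosts_mem(4)] by simp_all
  then show ?thesis using Bw by (auto intro: wt_neg wt_diff)
qed

lemma xword_zero:
  assumes "\<And>\<tau> i. \<exists>c n w. A \<tau> i = YX c n \<and> has_wt c w \<and> 2 * n + w \<ge> 1 + int i"
  shows "\<exists>K. \<forall>ws. length ws + wsum ws > K \<longrightarrow> wd A ws x = 0"
proof -
  obtain K where K: "x \<in> xl.Fil K" "K \<ge> 0" by (rule xl.Fil_exhaustive)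
  have "wd A ws x \<in> xl.Fil (K - int (length ws + wsum ws))" for ws
  proof (induction ws)
    case (Cons w ws)
    obtain \<tau> i where w: "w = (\<tau>, i)" by force
    obtain c n u where c: "A \<tau> i = YX c n" "has_wt c u" "2 * n + u \<ge> 1 + int i" using assms by blast
    have "A \<tau> i (wd A ws x) \<in> xl.Fil (K - int (length ws + wsum ws) - (2 * n + u))"
      using c(1,2) Cons by (simp add: has_wt_def)
    then show ?case unfolding w wd_simps by (rule xl.Fil_mono[rotated]) (use c(3) in simp)
  qed (simp add: K)
  then have "wd A ws x = 0" if "length ws + wsum ws > nat K" for ws
    using xl.Fil_neg[of "wd A ws x"] that K(2) by fastforce
  then show ?thesis by blast
qed

section \<open>Commutation relations of the doublets\<close>

lemma bot_bot_swap: "i \<noteq> Bw \<or> j \<noteq> Bw \<Longrightarrow> ob i m (ob j n x) = ssgn (od i) (od j) *\<^sub>C ob j n (ob i m x)"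
  using T.X.commutator0[OF par_bot par_bot, of i j m n x] bot_bot[of i j] bot_bot[of i j 0] by (simp add: X1)

lemma bot_top_swap: "ob i m (tp j n x) = ssgn (od i) (\<not> od j) *\<^sub>C tp j n (ob i m x) + YX (br i j) (m + n) x"
  using T.X.commutator0[OF par_bot par_top, of i j m n x] bot_top[of i _ j] bot_top[of i 0 j] by simp

lemma top_bot_swap: "tp j m (ob i n x) = ssgn (\<not> od j) (od i) *\<^sub>C ob i n (tp j m x) - ssgn (od i) (\<not> od j) *\<^sub>C YX (br i j) (m + n) x"
  using T.X.commutator0[OF par_top par_bot, of j i m n x] top_bot[of j _ i] top_bot[of j 0 i] by (simp add: X1)

lemma top_top_swap: "tp i m (tp j n x) = ssgn (\<not> od i) (\<not> od j) *\<^sub>C tp j n (tp i m x)"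
  using T.X.commutator0[OF par_top par_top, of i j m n x] top_top[of i _ j] top_top[of i 0 j] by (simp add: X1)

lemma tp_th: "tp Bth n x = eX n x + (if n = -1 then x else 0)"
  by (simp add: X1 T.X.vacuum)

lemma e_o: "i \<noteq> Bw \<Longrightarrow> eX m (ob i n x) = ob i n (eX m x)"
  using T.X.commutator0[OF par_eC par_bot, of i m n x] eC_bot[of i] eC_bot[of i 0] by (simp add: X1)

lemma e_w: "ob Bw m (eX n x) = eX n (ob Bw m x) + eX (m + n) x"
  using T.X.commutator0[OF par_eC par_bot, of Bw n m x] eC_w eC_w[of 0] by (simp add: X1 add.commute)

text \<open>e differs from \<open>top Bth\<close> by the vacuum, and tops commute up to
  sign.\<close>

lemma e_T: "eX m (tp i n x) = tp i n (eX m x)"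
proof -
  have "tp Bth m (tp i n x) = tp i n (tp Bth m x)" using top_top_swap[of Bth m i n x] by simp
  then show ?thesis by (simp only: tp_th) (auto simp: X2 split: if_splits)
qed

lemma D_o: "D (ob i n x) = ssgn True (od i) *\<^sub>C ob i n (D x) + tp i n x"
  using T.X.zero_mode_commutator[OF par_d par_bot, of i n x] by (simp add: d_bot)

lemma D_e: "D (eX n x) = eX n (D x)"
  using T.X.zero_mode_commutator[OF par_d par_eC, of n x] by (simp add: d_eC X1)

text \<open>On a cocycle the differential of \<phi>_\<theta>(-1) x is the mode -1 of e + 1 applied
  to x, and the vacuum contributes x itself to that mode.\<close>

lemma e_cohomologous: "D x = 0 \<Longrightarrow> eX (-1) x + x \<in> range D"
  using D_o[of Bth "-1" x] tp_th[of "-1" x] by (auto simp: X2 intro!: rangeI[of D] image_eqI[of _ D "ob Bth (-1) x"])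

lemma range_D_sub: "cvs.subspace (range D)"
proof (rule cvs.subspaceI)
  show "0 \<in> range D" by (rule image_eqI[of _ _ 0]) (simp_all add: X2)
next
  fix x y assume "x \<in> range D" "y \<in> range D"
  then obtain x' y' where "x = D x'" "y = D y'" by blast
  then show "x + y \<in> range D" by (intro image_eqI[of _ _ "x' + y'"]) (simp_all add: X2)
next
  fix c x assume "x \<in> range D"
  then obtain x' where "x = D x'" by blast
  then show "c *\<^sub>C x \<in> range D" by (intro image_eqI[of _ _ "c *\<^sub>C x'"]) (simp_all add: X2)
qed

definition RL :: "six set \<Rightarrow> 'x set" where
  "RL L = {x. \<forall>c\<in>L. \<forall>n::nat. ob c (int n) x = 0 \<and> tp c (int n) x = 0}"

lemma RL_sub: "cvs.subspace (RL L)"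
  by (auto simp: RL_def cvs.subspace_def X2)

end

section \<open>Homotopies built from two doublets\<close>

context brst_mod
begin

definition coh :: "'x \<Rightarrow> 'x \<Rightarrow> bool" (infix \<open>\<simeq>\<close> 50) where
  "x \<simeq> y \<longleftrightarrow> x - y \<in> range D"

lemma coh_refl: "x \<simeq> x" by (simp add: coh_def cvs.subspace_0[OF range_D_sub])

lemma coh_trans: "x \<simeq> y \<Longrightarrow> y \<simeq> z \<Longrightarrow> x \<simeq> z"
  using cvs.subspace_add[OF range_D_sub, of "x - y" "y - z"] by (simp add: coh_def)

lemma coh_sym: "x \<simeq> y \<Longrightarrow> y \<simeq> x"
  using cvs.subspace_neg[OF range_D_sub, of "x - y"] by (simp add: coh_def)

lemma coh_add: "x \<simeq> y \<Longrightarrow> x' \<simeq> y' \<Longrightarrow> x + x' \<simeq> y + y'"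
  using cvs.subspace_add[OF range_D_sub, of "x - y" "x' - y'"] by (simp add: coh_def algebra_simps)

lemma coh_scale: "x \<simeq> y \<Longrightarrow> c *\<^sub>C x \<simeq> c *\<^sub>C y"
  using cvs.subspace_scale[OF range_D_sub, of "x - y" c] by (simp add: coh_def cvs.scale_right_diff_distrib)

lemma coh_range: "x \<in> range D \<Longrightarrow> x + y \<simeq> y"
  by (simp add: coh_def)

lemma coh_e: "D x = 0 \<Longrightarrow> eX (-1) x \<simeq> - x"
  using e_cohomologous[of x] by (simp add: coh_def)

lemma RL_I: "(\<And>c n. c \<in> L \<Longrightarrow> ob c (int n) x = 0) \<Longrightarrow> (\<And>c n. c \<in> L \<Longrightarrow> tp c (int n) x = 0) \<Longrightarrow> x \<in> RL L"
  by (simp add: RL_def)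

lemma RL_D: "x \<in> RL L \<Longrightarrow> c \<in> L \<Longrightarrow> n \<ge> 0 \<Longrightarrow> ob c n x = 0" "x \<in> RL L \<Longrightarrow> c \<in> L \<Longrightarrow> n \<ge> 0 \<Longrightarrow> tp c n x = 0"
  by (auto simp: RL_def elim!: nonneg_int_cases)

text \<open>For \<open>h = \<Sum>\<^sub>n bot j\<^sub>(\<^sub>-\<^sub>1\<^sub>-\<^sub>n\<^sub>) bot i\<^sub>(\<^sub>n\<^sub>)\<close> the operator \<open>\<Delta> = D h + h D\<close> maps cocycles to exact vectors,
  so that \<open>z (-1)\<close>, which is invertible on cohomology, can be inverted on words of maximal length.\<close>
lemma eliminate_pair:
  assumes i: "i \<noteq> Bw" "od i = (\<not> od j)" "br i i = 0" "br j i = - br i j" "br i j \<in> {eC, - eC, vac C, - vac C}"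
    and wi: "wi i \<ge> 1"
    and L: "Bw \<notin> L" "\<And>c. c \<in> L \<Longrightarrow> br c j = 0 \<and> br j c = 0"
      "\<And>c l x. c \<in> L \<Longrightarrow> x \<in> RL L \<Longrightarrow> l \<ge> 0 \<Longrightarrow> YX (br c i) l x = 0 \<and> YX (br i c) l x = 0"
    and zv: "\<And>l x. x \<in> RL (insert i L) \<Longrightarrow> l \<ge> 0 \<Longrightarrow> YX (br i j) l x = 0"
    and x: "x \<in> RL L" "D x = 0"
  shows "\<exists>y\<in>RL (insert i L). D y = 0 \<and> x \<simeq> y"
proof -
  define A where "A \<tau> n = (if \<tau> then ob i (int n) else tp i (int n))" for \<tau> and n :: nat
  define z where "z n y = - YX (br i j) n y" for n y
  define h where "h N y = (\<Sum>n<N. ob j (-1 - int n) (ob i (int n) y))" for N y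
  define \<Delta> where "\<Delta> N y = (\<Sum>n<N. tp j (-1 - int n) (ob i (int n) y) + ssgn True (od j) *\<^sub>C ob j (-1 - int n) (tp i (int n) y))" for N y
  have oj: "od j = (\<not> od i)" using i(2) by simp
  have brc: "ob c m (YX (br i j) n y) = YX (br i j) n (ob c m y)" "tp c m (YX (br i j) n y) = YX (br i j) n (tp c m y)"
    if "c \<noteq> Bw" for c m n y
    using i(5) e_o[OF that] e_T by (auto simp: X1 X2 T.X.vacuum)
  have D\<Delta>: "D (h N y) + h N (D y) = \<Delta> N y" for N y
  proof -
    have "D (ob j m (ob i n y)) + ob j m (ob i n (D y)) = tp j m (ob i n y) + ssgn True (od j) *\<^sub>C ob j m (tp i n y)" for m n
      by (cases "od i") (simp_all add: D_o oj X2)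
    then show ?thesis by (simp add: h_def \<Delta>_def X2 sum.distrib[symmetric])
  qed
  have notBw: "c \<noteq> Bw" if "c \<in> L" for c using that L(1) by blast
  have RL_o: "ob i n y \<in> RL L" if y: "y \<in> RL L" and n: "n \<ge> 0" for n y
    using RL_D[OF y] L(3)[OF _ y] n i(1) by (intro RL_I) (simp_all add: bot_bot_swap top_bot_swap X2)
  have RL_t: "tp i n y \<in> RL L" if y: "y \<in> RL L" and n: "n \<ge> 0" for n y
    using RL_D[OF y] L(3)[OF _ y] n i(1) by (intro RL_I) (simp_all add: top_top_swap bot_top_swap X2)
  have RL_oj: "ob j n y \<in> RL L" if y: "y \<in> RL L" for n y
    using RL_D[OF y] L(2) notBw by (intro RL_I) (simp_all add: bot_bot_swap top_bot_swap X1 X2)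
  have RL_tj: "tp j n y \<in> RL L" if y: "y \<in> RL L" for n y
    using RL_D[OF y] L(2) notBw by (intro RL_I) (simp_all add: top_top_swap bot_top_swap X1 X2)
  interpret elimination "RL L" A z \<Delta>
  proof
    show "cvs.subspace (RL L)" by (rule RL_sub)
    show "clin (A \<tau> n)" for \<tau> n by (auto simp: A_def T.X.lin2)
    show "clin (z n)" for n by (rule clinI) (simp add: z_def X2)
    show "A \<tau> n y \<in> RL L" if "y \<in> RL L" for \<tau> n y using that by (auto simp: A_def intro: RL_o RL_t)
    show "\<Delta> N y \<in> RL L" if "y \<in> RL L" for N y
      unfolding \<Delta>_def
      by (intro cvs.subspace_sum[OF RL_sub] cvs.subspace_add[OF RL_sub] cvs.subspace_scale[OF RL_sub] RL_tj RL_oj RL_o RL_t that) simp_all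
    show "z (-1) y \<in> RL L" if y: "y \<in> RL L" for y
      using RL_D[OF y] notBw unfolding z_def by (intro cvs.subspace_neg[OF RL_sub] RL_I) (simp_all add: brc X2)
    show "A \<tau> n (z l y) = z l (A \<tau> n y)" for \<tau> n l y
      by (simp add: A_def z_def brc[OF i(1)] X2)
    show "\<Delta> N y = 0" if "\<And>\<tau> n. A \<tau> n y = 0" for N y
      using that[of True] that[of False] by (simp add: A_def \<Delta>_def X2)
    show "z (int l) y = 0" if y: "y \<in> RL L" "\<And>\<tau> n. A \<tau> n y = 0" for y l
    proof -
      have "y \<in> RL (insert i L)" using that(2)[of True] that(2)[of False] RL_D[OF y(1)]
        by (intro RL_I) (auto simp: A_def)
      then show ?thesis using zv[of y "int l"] by (simp add: z_def)
    qed
    show "\<exists>K. \<forall>ws. length ws + wsum ws > K \<longrightarrow> wd A ws y = 0" for y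
    proof (rule xword_zero)
      fix \<tau> and n :: nat
      show "\<exists>c l w. A \<tau> n = YX c l \<and> has_wt c w \<and> 1 + int n \<le> 2 * l + w"
      proof (cases \<tau>)
        case True
        then show ?thesis using wt_bot[of i] wi by (intro exI[of _ "bot i"] exI[of _ "int n"] exI[of _ "wi i"]) (simp add: A_def)
      next
        case False
        then show ?thesis using wt_top[of i] wi by (intro exI[of _ "top i"] exI[of _ "int n"] exI[of _ "wi i"]) (simp add: A_def)
      qed
    qed
    fix \<tau> and m N :: nat and y
    show "A \<tau> m (\<Delta> N y) = \<Delta> N (A \<tau> m y) - (\<Sum>n<N. z (int m - 1 - int n) (A \<tau> n y))"
    proof -
      let ?d = "\<lambda>y n. tp j (-1 - int n) (ob i (int n) y) + ssgn True (od j) *\<^sub>C ob j (-1 - int n) (tp i (int n) y)"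
      have "A \<tau> m (?d y n) = ?d (A \<tau> m y) n - z (int m - 1 - int n) (A \<tau> n y)" for n
      proof (cases \<tau>)
        case True
        have 1: "ob i (int m) (tp j (-1 - int n) (ob i (int n) y)) = tp j (-1 - int n) (ob i (int n) (ob i (int m) y))
            + YX (br i j) (int m - 1 - int n) (ob i (int n) y)"
          using bot_top_swap[of i "int m" j "-1 - int n" "ob i (int n) y"] bot_bot_swap[of i i "int m" "int n" y] i(1)
          by (cases "od i") (simp_all add: oj X2 algebra_simps)
        have 2: "ob i (int m) (ob j (-1 - int n) (tp i (int n) y)) = ob j (-1 - int n) (tp i (int n) (ob i (int m) y))"
          using bot_bot_swap[of i j "int m" "-1 - int n" "tp i (int n) y"] bot_top_swap[of i "int m" i "int n" y] i(1)
          by (cases "od i") (simp_all add: oj X1 X2 i(3))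
        show ?thesis using True by (simp add: A_def z_def X2 1 2)
      next
        case False
        have 1: "tp i (int m) (tp j (-1 - int n) (ob i (int n) y)) = tp j (-1 - int n) (ob i (int n) (tp i (int m) y))"
          using top_top_swap[of i "int m" j "-1 - int n" "ob i (int n) y"] top_bot_swap[of i "int m" i "int n" y]
          by (cases "od i") (simp_all add: oj X1 X2 i(3))
        have 2: "ssgn True (od j) *\<^sub>C tp i (int m) (ob j (-1 - int n) (tp i (int n) y))
           = ssgn True (od j) *\<^sub>C ob j (-1 - int n) (tp i (int n) (tp i (int m) y)) + YX (br i j) (int m - 1 - int n) (tp i (int n) y)"
          using top_bot_swap[of i "int m" j "-1 - int n" "tp i (int n) y"] top_top_swap[of i "int m" i "int n" y]
          by (cases "od i") (simp_all add: oj X1 X2 i(4) algebra_simps)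
        show ?thesis using False by (simp add: A_def z_def X2 1 2)
      qed
      moreover have "A \<tau> m (\<Delta> N y) = (\<Sum>n<N. A \<tau> m (?d y n))"
        unfolding \<Delta>_def by (rule clin_sum) (auto simp: A_def T.X.lin2)
      ultimately show ?thesis by (simp add: \<Delta>_def sum_subtractf)
    qed
  qed
  \<comment> \<open>\<open>z (-1)\<close> is, up to sign, e_(-1) or the identity; modulo
    coboundaries both are non-zero scalars on cocycles.\<close>
  have zc: "\<exists>c. c \<noteq> 0 \<and> (\<forall>y. D y = 0 \<longrightarrow> z (-1) y \<simeq> c *\<^sub>C y)"
  proof -
    have n: "- (eX (-1) y) \<simeq> y" if "D y = 0" for y using coh_scale[OF coh_e[OF that], of "-1"] by (simp add: cvs.scale_minus_left)
    consider "br i j = eC" | "br i j = - eC" | "br i j = vac C" | "br i j = - vac C" using i(5) by blast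
    then show ?thesis
    proof cases
      case 1 then show ?thesis using n by (intro exI[of _ 1]) (simp add: z_def)
    next
      case 2 then show ?thesis using coh_e by (intro exI[of _ "-1"]) (simp add: z_def X1)
    next
      case 3 then show ?thesis by (intro exI[of _ "-1"]) (simp add: z_def X1 T.X.vacuum coh_refl)
    next
      case 4 then show ?thesis by (intro exI[of _ 1]) (simp add: z_def X1 T.X.vacuum coh_refl)
    qed
  qed
  then obtain c where c: "c \<noteq> 0" "\<And>y. D y = 0 \<Longrightarrow> z (-1) y \<simeq> c *\<^sub>C y" by blast
  let ?S = "{y \<in> RL L. D y = 0}"
  have "?S \<subseteq> RL L" "x \<in> ?S" using x by auto
  then show ?thesis
  proof (induction rule: elim_induct)
    case (vac y)
    have "y \<in> RL (insert i L)" using vac(1) vac(2)[of True] vac(2)[of False] RL_D[of y L]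
      by (intro RL_I) (auto simp: A_def)
    then show ?case using vac(1) coh_refl by blast
  next
    \<comment> \<open>\<Delta> y is exact, so the corrected vector is cohomologous to a non-zero
      multiple of y; its representative, rescaled, represents y.\<close>
    case (step y r N)
    have y: "y \<in> RL L" "D y = 0" using step(1) by auto
    let ?y = "\<Delta> N y + of_nat r *\<^sub>C z (-1) y"
    have h0: "h N (D y) = 0" by (simp add: y(2) h_def X2)
    have ex: "\<Delta> N y = D (h N y)" using D\<Delta>[of N y] h0 by simp
    have "YX d 0 (YX (br i j) (-1) y) = YX (br i j) (-1) (D y)"
      using i(5) D_e by (auto simp: X1 X2 T.X.vacuum)
    then have "D ?y = 0" using D_square by (simp add: X2 ex z_def y(2))
    moreover have "?y \<in> RL L"
      by (intro cvs.subspace_add[OF RL_sub] cvs.subspace_scale[OF RL_sub] \<Delta>_R z_R y)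
    ultimately obtain w where w: "w \<in> RL (insert i L)" "D w = 0" "?y \<simeq> w" using step(4) by blast
    have "?y \<simeq> of_nat r *\<^sub>C z (-1) y" unfolding ex by (rule coh_range) simp
    moreover have "of_nat r *\<^sub>C z (-1) y \<simeq> (of_nat r * c) *\<^sub>C y" using coh_scale[OF c(2)[OF y(2)], of "of_nat r"] by simp
    ultimately have "(of_nat r * c) *\<^sub>C y \<simeq> w" using w(3) coh_trans coh_sym by blast
    from coh_scale[OF this, of "1 / (of_nat r * c)"] have "y \<simeq> (1 / (of_nat r * c)) *\<^sub>C w"
      using c(1) step(2) by simp
    then show ?case using w(1,2) cvs.subspace_scale[OF RL_sub]
      by (intro bexI[of _ "(1 / (of_nat r * c)) *\<^sub>C w"]) (simp_all add: X2)
  qed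
qed

lemma eC_RL: "x \<in> RL L \<Longrightarrow> Bth \<in> L \<Longrightarrow> n \<ge> 0 \<Longrightarrow> eX n x = 0"
  using RL_D(2)[of x L Bth n] tp_th[of n x] by simp

text \<open>The doublet of \<phi>_\<theta>, with \<omega> as partner, must go before the others:
  afterwards e_(n) = 0 for n \<ge> 0, so contractions with value e or -e act trivially. Then
  \<phi>_1 and \<Phi>_2, and likewise \<open>f2\<close> and p, serve as each other's
  partners.\<close>

lemma eliminate_all_but_w:
  assumes "D x = 0" shows "\<exists>y\<in>RL (- {Bw}). D y = 0 \<and> x \<simeq> y"
proof -
  have "\<exists>y\<in>RL {Bth}. D y = 0 \<and> x \<simeq> y"
  proof (rule eliminate_pair[of Bth Bw "{}"])
    fix c :: six and l :: int and y :: 'x assume "c \<in> {}" "y \<in> RL {}" "0 \<le> l"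
    then show "YX (br c Bth) l y = 0 \<and> YX (br Bth c) l y = 0"
      using eC_RL[of y "{}" l] by (elim insertE emptyE; simp add: X1 T.X.vacuum del: top.simps)
  next
    fix l :: int and y :: 'x assume "y \<in> RL {Bth}" "0 \<le> l"
    then show "YX (br Bth Bw) l y = 0" using eC_RL[of y "{Bth}" l] by (simp add: X1 T.X.vacuum)
  next
    fix c :: six assume "c \<in> {}"
    then show "br c Bw = 0 \<and> br Bw c = 0" by (elim insertE emptyE; simp)
  qed (use assms in \<open>simp_all add: RL_def\<close>)
  then obtain x1 where x1: "x1 \<in> RL {Bth}" "D x1 = 0" "x \<simeq> x1" by blast
  have "\<exists>y\<in>RL {B1, Bth}. D y = 0 \<and> x1 \<simeq> y"
  proof (rule eliminate_pair[of B1 BPhi "{Bth}"])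
    fix c :: six and l :: int and y :: 'x assume "c \<in> {Bth}" "y \<in> RL {Bth}" "0 \<le> l"
    then show "YX (br c B1) l y = 0 \<and> YX (br B1 c) l y = 0"
      using eC_RL[of y "{Bth}" l] by (elim insertE emptyE; simp add: X1 T.X.vacuum del: top.simps)
  next
    fix l :: int and y :: 'x assume "y \<in> RL {B1, Bth}" "0 \<le> l"
    then show "YX (br B1 BPhi) l y = 0" using eC_RL[of y "{B1, Bth}" l] by (simp add: X1 T.X.vacuum)
  next
    fix c :: six assume "c \<in> {Bth}"
    then show "br c BPhi = 0 \<and> br BPhi c = 0" by (elim insertE emptyE; simp)
  qed (use x1 in simp_all)
  then obtain x2 where x2: "x2 \<in> RL {B1, Bth}" "D x2 = 0" "x1 \<simeq> x2" by blast
  have "\<exists>y\<in>RL {BPhi, B1, Bth}. D y = 0 \<and> x2 \<simeq> y"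
  proof (rule eliminate_pair[of BPhi B1 "{B1, Bth}"])
    fix c :: six and l :: int and y :: 'x assume "c \<in> {B1, Bth}" "y \<in> RL {B1, Bth}" "0 \<le> l"
    then show "YX (br c BPhi) l y = 0 \<and> YX (br BPhi c) l y = 0"
      using eC_RL[of y "{B1, Bth}" l] by (elim insertE emptyE; simp add: X1 T.X.vacuum del: top.simps)
  next
    fix l :: int and y :: 'x assume "y \<in> RL {BPhi, B1, Bth}" "0 \<le> l"
    then show "YX (br BPhi B1) l y = 0" using eC_RL[of y "{BPhi, B1, Bth}" l] by (simp add: X1 T.X.vacuum)
  next
    fix c :: six assume "c \<in> {B1, Bth}"
    then show "br c B1 = 0 \<and> br B1 c = 0" by (elim insertE emptyE; simp)
  qed (use x2 in simp_all)
  then obtain x3 where x3: "x3 \<in> RL {BPhi, B1, Bth}" "D x3 = 0" "x2 \<simeq> x3" by blast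
  have "\<exists>y\<in>RL {B2, BPhi, B1, Bth}. D y = 0 \<and> x3 \<simeq> y"
  proof (rule eliminate_pair[of B2 Bp "{BPhi, B1, Bth}"])
    fix c :: six and l :: int and y :: 'x assume "c \<in> {BPhi, B1, Bth}" "y \<in> RL {BPhi, B1, Bth}" "0 \<le> l"
    then show "YX (br c B2) l y = 0 \<and> YX (br B2 c) l y = 0"
      using eC_RL[of y "{BPhi, B1, Bth}" l] by (elim insertE emptyE; simp add: X1 T.X.vacuum del: top.simps)
  next
    fix l :: int and y :: 'x assume "y \<in> RL {B2, BPhi, B1, Bth}" "0 \<le> l"
    then show "YX (br B2 Bp) l y = 0" using eC_RL[of y "{B2, BPhi, B1, Bth}" l] by (simp add: X1 T.X.vacuum)
  next
    fix c :: six assume "c \<in> {BPhi, B1, Bth}"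
    then show "br c Bp = 0 \<and> br Bp c = 0" by (elim insertE emptyE; simp)
  qed (use x3 in simp_all)
  then obtain x4 where x4: "x4 \<in> RL {B2, BPhi, B1, Bth}" "D x4 = 0" "x3 \<simeq> x4" by blast
  have "\<exists>y\<in>RL {Bp, B2, BPhi, B1, Bth}. D y = 0 \<and> x4 \<simeq> y"
  proof (rule eliminate_pair[of Bp B2 "{B2, BPhi, B1, Bth}"])
    fix c :: six and l :: int and y :: 'x assume "c \<in> {B2, BPhi, B1, Bth}" "y \<in> RL {B2, BPhi, B1, Bth}" "0 \<le> l"
    then show "YX (br c Bp) l y = 0 \<and> YX (br Bp c) l y = 0"
      using eC_RL[of y "{B2, BPhi, B1, Bth}" l] by (elim insertE emptyE; simp add: X1 T.X.vacuum del: top.simps)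
  next
    fix l :: int and y :: 'x assume "y \<in> RL {Bp, B2, BPhi, B1, Bth}" "0 \<le> l"
    then show "YX (br Bp B2) l y = 0" using eC_RL[of y "{Bp, B2, BPhi, B1, Bth}" l] by (simp add: X1 T.X.vacuum)
  next
    fix c :: six assume "c \<in> {B2, BPhi, B1, Bth}"
    then show "br c B2 = 0 \<and> br B2 c = 0" by (elim insertE emptyE; simp)
  qed (use x4 in simp_all)
  then obtain x5 where x5: "x5 \<in> RL {Bp, B2, BPhi, B1, Bth}" "D x5 = 0" "x4 \<simeq> x5" by blast
  have "- {Bw} = {Bp, B2, BPhi, B1, Bth}" using UNIV_six by auto
  then show ?thesis using x1 x2 x3 x4 x5 coh_trans by metis
qed

end

section \<open>The doublet of \<omega>\<close>

context brst_mod
begin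

definition QL :: "nat \<Rightarrow> 'x set" where
  "QL l = {x \<in> RL (- {Bw}). \<forall>n > int l. ob Bw n x = 0 \<and> tp Bw n x = 0}"

lemma QL_sub: "cvs.subspace (QL l)"
  using RL_sub[of "- {Bw}"] by (auto simp: QL_def cvs.subspace_def X2)

lemma QL_D:
  assumes "x \<in> QL l"
  shows "c \<noteq> Bw \<Longrightarrow> n \<ge> 0 \<Longrightarrow> ob c n x = 0" "c \<noteq> Bw \<Longrightarrow> n \<ge> 0 \<Longrightarrow> tp c n x = 0"
    "n > int l \<Longrightarrow> ob Bw n x = 0" "n > int l \<Longrightarrow> tp Bw n x = 0" "n \<ge> 0 \<Longrightarrow> eX n x = 0"
  using assms RL_D[of x "- {Bw}"] eC_RL[of x "- {Bw}" n] by (auto simp: QL_def)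

lemma QL_I:
  assumes "\<And>c n. c \<noteq> Bw \<Longrightarrow> n \<ge> 0 \<Longrightarrow> ob c n x = 0 \<and> tp c n x = 0" "\<And>n. n > int l \<Longrightarrow> ob Bw n x = 0 \<and> tp Bw n x = 0"
  shows "x \<in> QL l"
  using assms by (simp add: QL_def RL_def)

lemma w_w_swap: "m + n \<noteq> 0 \<Longrightarrow> ob Bw m (ob Bw n x) = ob Bw n (ob Bw m x)"
  using X_affine_comm[of wM wM m n x] by (simp add: lie_table X1 C_lin iota_lin)

lemma QL_br: "x \<in> QL l \<Longrightarrow> n \<ge> 0 \<Longrightarrow> c \<noteq> Bw \<Longrightarrow> YX (br c Bw) n x = 0 \<and> YX (br Bw c) n x = 0"
  using QL_D(2)[of x l c n] QL_D(5)[of x l n] by (cases c) (simp_all add: X1 del: top.simps)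

lemma QL_w: assumes x: "x \<in> QL l" and l: "m = int l" "l \<ge> 1" shows "ob Bw m x \<in> QL l" "tp Bw m x \<in> QL l"
proof -
  show "ob Bw m x \<in> QL l"
  proof (rule QL_I)
    fix c n assume "c \<noteq> Bw" "n \<ge> (0 :: int)"
    then show "ob c n (ob Bw m x) = 0 \<and> tp c n (ob Bw m x) = 0"
      using bot_bot_swap[of c Bw n m x] top_bot_swap[of c n Bw m x] QL_D[OF x] QL_br[OF x, of "n + m" c] l by (simp add: X2)
  next
    fix n assume n: "n > int l"
    then show "ob Bw n (ob Bw m x) = 0 \<and> tp Bw n (ob Bw m x) = 0"
      using w_w_swap[of n m x] top_bot_swap[of Bw n Bw m x] QL_D(3,4)[OF x, of n] QL_D(4)[OF x, of "n + m"] l by (simp add: X2 del: top.simps)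
  qed
  show "tp Bw m x \<in> QL l"
  proof (rule QL_I)
    fix c n assume "c \<noteq> Bw" "n \<ge> (0 :: int)"
    then show "ob c n (tp Bw m x) = 0 \<and> tp c n (tp Bw m x) = 0"
      using bot_top_swap[of c n Bw m x] top_top_swap[of c n Bw m x] QL_D[OF x] QL_br[OF x, of "n + m" c] l by (simp add: X2 del: top.simps)
  next
    fix n assume n: "n > int l"
    then show "ob Bw n (tp Bw m x) = 0 \<and> tp Bw n (tp Bw m x) = 0"
      using top_top_swap[of Bw n Bw m x] bot_top_swap[of Bw n Bw m x] QL_D(3,4)[OF x, of n] QL_D(4)[OF x, of "n + m"] l by (simp add: X2 del: top.simps)
  qed
qed

lemma QL_th: assumes x: "x \<in> QL l" and m: "m \<ge> -1 - int l" shows "eX m x \<in> QL l" "ob Bth m x \<in> QL l"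
proof -
  have e: "eX (n + m) x = 0" if "n > int l" for n using QL_D(5)[OF x] m that by simp
  show "eX m x \<in> QL l"
    using e_o e_T e_w QL_D[OF x] e by (intro QL_I) (simp_all add: X2 flip: e_o e_T del: top.simps)
  show "ob Bth m x \<in> QL l"
  proof (rule QL_I)
    fix c n assume "c \<noteq> Bw" "n \<ge> (0 :: int)"
    then show "ob c n (ob Bth m x) = 0 \<and> tp c n (ob Bth m x) = 0"
      using bot_bot_swap[of c Bth n m x] top_bot_swap[of c n Bth m x] QL_D[OF x] by (cases c) (simp_all add: X1 X2 del: top.simps bot.simps)
  next
    fix n assume n: "n > int l"
    then show "ob Bw n (ob Bth m x) = 0 \<and> tp Bw n (ob Bth m x) = 0"
      using bot_bot_swap[of Bw Bth n m x] top_bot_swap[of Bw n Bth m x] QL_D[OF x] e[OF n] by (simp add: X1 X2 del: top.simps bot.simps)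
  qed
qed

text \<open>Because \<open>br Bw Bw \<noteq> 0\<close>, the modes of \<open>\<omega>\<close> can only be removed one at a time, from the top.\<close>
lemma eliminate_w:
  assumes x: "x \<in> QL (Suc l)" "D x = 0" shows "\<exists>y\<in>QL l. D y = 0 \<and> x \<simeq> y"
proof -
  let ?l = "Suc l"
  \<comment> \<open>Only one mode is to be removed, so the family of letters has a single non-zero
    member, placed at index 0.\<close>
  define A where "A \<tau> n y = (if n = 0 then if \<tau> then ob Bw (int ?l) y else tp Bw (int ?l) y else 0)" for \<tau> and n :: nat and y
  define z where "z n y = (if n = -1 then - eX (-1) y else 0)" for n :: int and y
  \<comment> \<open>The mode of \<phi>_\<theta> is the one for which [\<omega>_(l+1), e_(-2-l)] =
    e_(-1).\<close>
  define h where "h N y = (if N = 0 then 0 else ob Bth (-1 - int ?l) (ob Bw (int ?l) y))" for N :: nat and y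
  define \<Delta> where "\<Delta> N y = (if N = 0 then 0 else eX (-1 - int ?l) (ob Bw (int ?l) y) - ob Bth (-1 - int ?l) (tp Bw (int ?l) y))" for N :: nat and y
  have D\<Delta>: "D (h N y) + h N (D y) = \<Delta> N y" for N y
    using tp_th[of "-1 - int ?l"] by (simp add: h_def \<Delta>_def D_o X2 del: top.simps bot.simps)
  interpret elimination "QL ?l" A z \<Delta>
  proof
    show "cvs.subspace (QL ?l)" by (rule QL_sub)
    show "clin (A \<tau> n)" for \<tau> n by (rule clinI) (simp add: A_def X2)
    show "clin (z n)" for n by (rule clinI) (simp add: z_def X2)
    show "A \<tau> n y \<in> QL ?l" if "y \<in> QL ?l" for \<tau> n y
      using QL_w[OF that] cvs.subspace_0[OF QL_sub] by (simp add: A_def)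
    show "\<Delta> N y \<in> QL ?l" if "y \<in> QL ?l" for N y
      using cvs.subspace_0[OF QL_sub] QL_th(1)[OF QL_w(1)[OF that refl]] QL_th(2)[OF QL_w(2)[OF that refl]]
      by (simp add: \<Delta>_def cvs.subspace_diff[OF QL_sub] del: top.simps bot.simps)
    show "z (-1) y \<in> QL ?l" if y: "y \<in> QL ?l" for y
      unfolding z_def by (auto intro!: cvs.subspace_neg[OF QL_sub] QL_th that)
    show "A \<tau> n (z j y) = z j (A \<tau> n y)" if "y \<in> QL ?l" for \<tau> n j y
      using QL_D(5)[OF that] by (simp add: A_def z_def X2 e_w flip: e_T del: top.simps bot.simps)
    show "\<Delta> N y = 0" if "\<And>\<tau> n. A \<tau> n y = 0" for N y
      using that[of True 0] that[of False 0] by (simp add: A_def \<Delta>_def X2 del: top.simps bot.simps)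
    show "z (int j) y = 0" for y j by (simp add: z_def)
    show "\<exists>K. \<forall>ws. length ws + wsum ws > K \<longrightarrow> wd A ws y = 0" for y
    proof (rule xword_zero)
      fix \<tau> and n :: nat
      have 0: "has_wt 0 w" for w by (simp add: has_wt_def X1 cvs.subspace_0[OF xl.Fil_sub])
      show "\<exists>c l w. A \<tau> n = YX c l \<and> has_wt c w \<and> 1 + int n \<le> 2 * l + w"
      proof (cases "n = 0")
        case True
        then show ?thesis using wt_bot[of Bw] wt_top[of Bw]
          by (intro exI[of _ "if \<tau> then bot Bw else top Bw"] exI[of _ "int ?l"] exI[of _ 0]) (simp add: A_def fun_eq_iff)
      next
        case False
        then show ?thesis using 0 by (intro exI[of _ 0] exI[of _ 0] exI[of _ "1 + int n"]) (simp add: A_def fun_eq_iff X1)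
      qed
    qed
    fix \<tau> and m N :: nat and y assume y: "y \<in> QL ?l"
    let ?b = "ob Bw (int ?l)" and ?t = "tp Bw (int ?l)"
    have comm: "?b (?t y) = ?t (?b y)"
      using bot_top_swap[of Bw "int ?l" Bw "int ?l" y] QL_D(4)[OF y, of "int ?l + int ?l"] by (simp del: top.simps bot.simps)
    have tt: "?t (?t y) = 0"
    proof -
      have "2 *\<^sub>C ?t (?t y) = ?t (?t y) + ?t (?t y)" using cvs.scale_left_distrib[of 1 1 "?t (?t y)"] by simp
      also have "\<dots> = 0" using top_top_swap[of Bw "int ?l" Bw "int ?l" y] by (simp add: eq_neg_iff_add_eq_0)
      finally show ?thesis by simp
    qed
    have sum: "(\<Sum>n<N. z (int m - 1 - int n) (A \<tau> n y)) = (if m = 0 \<and> N \<noteq> 0 then - eX (-1) (A \<tau> 0 y) else 0)"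
    proof -
      have "z (int m - 1 - int n) (A \<tau> n y) = (if n = 0 then if m = 0 then - eX (-1) (A \<tau> 0 y) else 0 else 0)" for n
        by (simp add: z_def A_def X2)
      then show ?thesis by (simp add: sum.delta)
    qed
    have 1: "?b (eX (-1 - int ?l) (?b y)) = eX (-1 - int ?l) (?b (?b y)) + eX (-1) (?b y)"
      using e_w[of "int ?l" "-1 - int ?l" "?b y"] by simp
    have 2: "?b (ob Bth (-1 - int ?l) (?t y)) = ob Bth (-1 - int ?l) (?t (?b y))"
      using bot_bot_swap[of Bw Bth "int ?l" "-1 - int ?l" "?t y"] comm by (simp del: top.simps bot.simps)
    have 3: "?t (eX (-1 - int ?l) (?b y)) = eX (-1 - int ?l) (?b (?t y))"
      using e_T[of "-1 - int ?l" Bw "int ?l" "?b y"] comm by (simp del: top.simps bot.simps)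
    have 4: "?t (ob Bth (-1 - int ?l) (?t y)) = - eX (-1) (?t y)"
      using top_bot_swap[of Bw "int ?l" Bth "-1 - int ?l" "?t y"] tt by (simp add: X1 X2 del: top.simps bot.simps)
    show "A \<tau> m (\<Delta> N y) = \<Delta> N (A \<tau> m y) - (\<Sum>n<N. z (int m - 1 - int n) (A \<tau> n y))"
      unfolding sum using 1 2 3 4 tt
      by (cases "m = 0"; cases "N = 0"; cases \<tau>) (simp_all add: A_def \<Delta>_def X2 del: top.simps bot.simps)
  qed
  let ?S = "{y \<in> QL ?l. D y = 0}"
  have "?S \<subseteq> QL ?l" "x \<in> ?S" using x by auto
  then show ?thesis
  proof (induction rule: elim_induct)
    case (vac y)
    have y: "y \<in> QL ?l" "D y = 0" using vac(1) by auto
    have "y \<in> QL l"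
    proof (rule QL_I)
      fix n assume "n > int l"
      then have "n > int ?l \<or> n = int ?l" by auto
      then show "ob Bw n y = 0 \<and> tp Bw n y = 0"
        using QL_D(3,4)[OF y(1)] vac(2)[of True 0] vac(2)[of False 0] by (auto simp: A_def simp del: top.simps bot.simps)
    qed (use QL_D[OF y(1)] in simp)
    then show ?case using y coh_refl by blast
  next
    case (step y r N)
    have y: "y \<in> QL ?l" "D y = 0" using step(1) by auto
    let ?y = "\<Delta> N y + of_nat r *\<^sub>C z (-1) y"
    have h0: "h N (D y) = 0" by (simp add: y(2) h_def X2)
    have ex: "\<Delta> N y = D (h N y)" using D\<Delta>[of N y] h0 by simp
    have "D ?y = 0" using D_square by (simp add: X2 ex z_def y(2) D_e)
    moreover have "?y \<in> QL ?l"
      by (intro cvs.subspace_add[OF QL_sub] cvs.subspace_scale[OF QL_sub] \<Delta>_R z_R y)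
    ultimately obtain w where w: "w \<in> QL l" "D w = 0" "?y \<simeq> w" using step(4) by blast
    have "?y \<simeq> of_nat r *\<^sub>C z (-1) y" unfolding ex by (rule coh_range) simp
    moreover have "of_nat r *\<^sub>C z (-1) y \<simeq> of_nat r *\<^sub>C y"
      using coh_scale[OF coh_e[OF y(2)], of "- of_nat r"] by (simp add: z_def cvs.scale_minus_left)
    ultimately have "of_nat r *\<^sub>C y \<simeq> w" using w(3) coh_trans coh_sym by blast
    from coh_scale[OF this, of "1 / of_nat r"] have "y \<simeq> (1 / of_nat r) *\<^sub>C w"
      using step(2) by simp
    then show ?case using w(1,2) cvs.subspace_scale[OF QL_sub]
      by (intro bexI[of _ "(1 / of_nat r) *\<^sub>C w"]) (simp_all add: X2)
  qed
qed

text \<open>Truncation provides a first l. The descent stops before mode 0 of \<omega>: its degree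
  is 0, and the grading gives no local nilpotency there.\<close>

lemma eliminate_all:
  assumes "D x = 0" shows "\<exists>y\<in>QL 0. D y = 0 \<and> x \<simeq> y"
proof -
  obtain x' where x': "x' \<in> RL (- {Bw})" "D x' = 0" "x \<simeq> x'" using eliminate_all_but_w[OF assms] by blast
  obtain K where K: "x' \<in> xl.Fil K" "K \<ge> 0" by (rule xl.Fil_exhaustive)
  have z: "YX c n x' = 0" if "has_wt c 0" "n > K" for c n
    using that K unfolding has_wt_def by (intro xl.Fil_neg[of _ "K - (2 * n + 0)"]) auto
  have "x' \<in> QL (nat K)"
  proof (rule QL_I)
    fix n assume "n > int (nat K)"
    then show "ob Bw n x' = 0 \<and> tp Bw n x' = 0" using z wt_bot[of Bw] wt_top[of Bw] K(2) by simp
  qed (use RL_D[OF x'(1)] in simp)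
  moreover have "y \<in> QL l \<Longrightarrow> D y = 0 \<Longrightarrow> \<exists>w\<in>QL 0. D w = 0 \<and> y \<simeq> w" for y l
  proof (induction l arbitrary: y)
    case (Suc l)
    then show ?case using eliminate_w[of y l] coh_trans by blast
  qed (use coh_refl in blast)
  ultimately show ?thesis using x' coh_trans by blast
qed

end

section \<open>Counting ghost letters\<close>

datatype gh = GPh posroot | GPs posroot | GB1 | GB2

lemma UNIV_gh: "UNIV = {GPh Alpha1, GPh Alpha2, GPh Theta, GPs Alpha1, GPs Alpha2, GPs Theta, GB1, GB2}" (is "_ = ?S")
proof -
  have "i \<in> ?S" for i
  proof (cases i)
    case (GPh \<alpha>) then show ?thesis by (cases \<alpha>) simp_all
  next
    case (GPs \<alpha>) then show ?thesis by (cases \<alpha>) simp_all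
  qed simp_all
  then show ?thesis by blast
qed

instance gh :: finite by standard (simp add: UNIV_gh)

text \<open>\<open>co\<close> is the conjugate field and \<open>gsg j\<close> the value of the
  contraction of \<open>fld (co j)\<close> with \<open>fld j\<close>; only \<Phi>_2 against \<Phi>_1
  gives -1.\<close>

fun co :: "gh \<Rightarrow> gh" where "co (GPh \<alpha>) = GPs \<alpha>" | "co (GPs \<alpha>) = GPh \<alpha>" | "co GB1 = GB2" | "co GB2 = GB1"
fun gsg :: "gh \<Rightarrow> complex" where "gsg GB1 = -1" | "gsg _ = 1"
fun gpar :: "gh \<Rightarrow> bool" where "gpar (GPh _) = True" | "gpar (GPs _) = True" | "gpar _ = False"

lemma co_co [simp]: "co (co i) = i" by (cases i) simp_all
lemma gpar_co [simp]: "gpar (co i) = gpar i" by (cases i) simp_all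

context ghost
begin

fun fld :: "gh \<Rightarrow> 'f" where "fld (GPh \<alpha>) = ph \<alpha>" | "fld (GPs \<alpha>) = ps \<alpha>" | "fld GB1 = Ph1" | "fld GB2 = Ph2"

lemma fld_par: "fld i \<in> par F (gpar i)" by (cases i) simp_all

lemma fld_ope: "mode F (fld i) (int n) (fld j) = (if n = 0 \<and> j = co i then gsg j *\<^sub>C vac F else 0)"
  by (cases i; cases j) (auto simp: cvs.scale_minus_left)

lemma fld_gen:
  assumes "cvs.subspace U" "vac F \<in> U" "\<And>i n x. x \<in> U \<Longrightarrow> n < 0 \<Longrightarrow> mode F (fld i) n x \<in> U" shows "U = UNIV"
proof -
  have "strongly_generates F (range (phi g) \<union> range (psi g) \<union> {Phi1 g, Phi2 g})"
    using gs by (simp add: ghost_system_def)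
  from this[unfolded strongly_generates_def, THEN spec, of U] show ?thesis
  proof (rule mp, intro conjI ballI allI impI assms(1,2))
    fix f n x assume f: "f \<in> range (phi g) \<union> range (psi g) \<union> {Phi1 g, Phi2 g}" and n: "n < (0::int)" "x \<in> U"
    have "f \<in> range fld" using f by (auto intro: image_eqI[of _ _ "GPh _"] image_eqI[of _ _ "GPs _"] image_eqI[of _ _ GB1] image_eqI[of _ _ GB2])
    then show "mode F f n x \<in> U" using assms(3)[OF n(2,1)] by auto
  qed
qed

end

context brst_mod
begin

lemma np_mode:
  assumes "c \<in> par C p" "c' \<in> par C q" "\<And>j. j \<ge> 1 \<Longrightarrow> YX c' (n + int j) x = 0" "\<And>j. YX c (int j) x = 0"
  shows "YX (mode C c (-1) c') n x = YX c (-1) (YX c' n x)"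
proof -
  have "Sum_any (\<lambda>j::nat. YX c (-1 - int j) (YX c' (n + int j) x)) = YX c (-1) (YX c' n x)"
    by (subst Sum_any_single[where a = 0]) (use assms(3) in \<open>auto simp: X2 Suc_le_eq\<close>)
  then show ?thesis using T.X.normal_product_mode[OF assms(1,2), of n x] by (simp add: assms(4) X2)
qed

abbreviation "cur A n \<equiv> YX (t (\<iota> A) (vac F)) n"
abbreviation "gho f n \<equiv> YX (t (vac V) f) n"

lemma np_F: "mode C (t (vac V) f) (-1) (t (vac V) f') = t (vac V) (mode F f (-1) f')"
  and np_V: "mode C (t (\<iota> A) (vac F)) (-1) (t (vac V) f) = t (\<iota> A) f"
  by (simp_all add: CC.act_F CC.act_V creation)

lemma cur_gho: "cur A m (gho f n x) = gho f n (cur A m x)"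
  by (rule X_mixed_comm)

text \<open>The corrections in composite bottoms and tops are normal products of factors already
  known to annihilate x, so the plain ghosts and currents annihilate x too. \<psi>_2 and
  \<psi>_\<theta> occur only multiplied by e or q, which is all that is known about them
  here.\<close>

lemma QL_annihilated:
  assumes x: "x \<in> QL 0" and n: "n \<ge> 0"
  shows "gho (F.ph \<alpha>) n x = 0" "gho F.Ph2 n x = 0" "gho (F.ps Alpha1) n x = 0" "eX n x = 0" "cur pM n x = 0" "cur qM n x = 0"
    "n \<ge> 1 \<Longrightarrow> cur wM n x = 0" "YX (t (\<iota> eM) (F.ps Alpha2)) n x = 0" "gho F.f1 n x = 0"
    "n \<ge> 1 \<Longrightarrow> YX (t (\<iota> qM) (F.ps Alpha2)) n x + YX (t (\<iota> eM) (F.ps Theta)) n x = 0"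
proof -
  have ob: "ob c l x = 0" "tp c l x = 0" if "c \<noteq> Bw" "l \<ge> 0" for c l using QL_D[OF x] that by blast+
  have e: "eX l x = 0" if "l \<ge> 0" for l using QL_D(5)[OF x that] .
  have Ph2: "gho F.Ph2 l x = 0" if "l \<ge> 0" for l using ob(1)[of BPhi l] that by simp
  have th: "gho (F.ph Theta) l x = 0" if "l \<ge> 0" for l using ob(1)[of Bth l] that by simp
  show "gho F.Ph2 n x = 0" "eX n x = 0" using Ph2 e n by auto
  show "gho (F.ps Alpha1) n x = 0" using ob(2)[of BPhi n] n by simp
  show p: "cur pM n x = 0" using ob(1)[of Bp n] n by simp
  show "gho F.f1 n x = 0" using ob(2)[of B1 n] n p by (simp add: X1)
  have "gho (mode F F.Ph2 (-1) (F.ph Theta)) n x = 0"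
    unfolding np_F[symmetric] by (subst np_mode[OF t_par[OF F.ghost_par(4)] t_par[OF F.ghost_par(1)]]) (use Ph2 th n in \<open>auto simp: X2 intro: F.ghost_par\<close>)
  then have "gho (F.ph Alpha2) n x = 0" using ob(1)[of B2 n] n by (simp add: F.f2_def CC.s2_simps X1)
  then show "gho (F.ph \<alpha>) n x = 0" using th ob(1)[of B1 n] n by (cases \<alpha>) simp_all
  have "YX (t (\<iota> eM) F.Ph2) n x = 0"
    unfolding np_V[symmetric, of _ F.Ph2] by (subst np_mode[OF t_par[OF F.vac_even] t_par[OF F.ghost_par(4)]]) (use Ph2 e n in \<open>auto simp: X2\<close>)
  then show "cur qM n x = 0" using ob(2)[of B2 n] n by (simp add: X1)
  show "cur wM n x = 0" if "n \<ge> 1" using QL_D(3)[OF x, of n] that by simp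
  show "YX (t (\<iota> eM) (F.ps Alpha2)) n x = 0" using ob(2)[of Bp n] n by (simp add: X1)
  show "YX (t (\<iota> qM) (F.ps Alpha2)) n x + YX (t (\<iota> eM) (F.ps Theta)) n x = 0" if "n \<ge> 1"
  proof -
    have "YX (- t (\<iota> qM) (F.ps Alpha2) - t (\<iota> eM) (F.ps Theta)) n x = 0" using QL_D(4)[OF x, of n] that by simp
    then have "- (YX (t (\<iota> qM) (F.ps Alpha2)) n x + YX (t (\<iota> eM) (F.ps Theta)) n x) = 0" by (simp add: X1)
    then show ?thesis by (simp only: neg_equal_0_iff_equal)
  qed
qed

text \<open>Multiplication by \<open>e\<^sub>(\<^sub>-\<^sub>1\<^sub>)\<close>, which is \<open>-1\<close> on cohomology, removes the modes of \<open>f\<close> one at a time.\<close>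
lemma remove_modes:
  assumes S: "\<And>x. x \<in> S \<Longrightarrow> - eX (-1) x \<in> S"
    and top: "\<And>x m. x \<in> S \<Longrightarrow> m \<ge> m0 \<Longrightarrow> (\<And>n. n > m \<Longrightarrow> gho f n x = 0) \<Longrightarrow> eX (-1) (gho f m x) = 0"
    and x: "x \<in> S" "D x = 0"
  shows "\<exists>y\<in>S. D y = 0 \<and> x \<simeq> y \<and> (\<forall>n\<ge>m0. gho f n y = 0)"
proof -
  have "x \<in> S \<Longrightarrow> D x = 0 \<Longrightarrow> (\<And>n. n \<ge> m0 + int l \<Longrightarrow> gho f n x = 0) \<Longrightarrow>
      \<exists>y\<in>S. D y = 0 \<and> x \<simeq> y \<and> (\<forall>n\<ge>m0. gho f n y = 0)" for l x
  proof (induction l arbitrary: x)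
    case 0
    then show ?case using coh_refl by auto
  next
    case (Suc l)
    let ?y = "- eX (-1) x"
    have c: "x \<simeq> ?y" using coh_scale[OF coh_sym[OF coh_e[OF Suc.prems(2)]], of "-1"] by (simp add: cvs.scale_minus_left)
    have e: "eX (-1) (gho f (m0 + int l) x) = 0" using Suc.prems(1,3) by (intro top) auto
    have "gho f n ?y = 0" if "n \<ge> m0 + int l" for n
      using e Suc.prems(3)[of n] that by (cases "n = m0 + int l") (simp_all add: X2 flip: cur_gho)
    moreover have "D ?y = 0" using Suc.prems(2) by (simp add: X2 D_e)
    ultimately obtain y where "y \<in> S" "D y = 0" "?y \<simeq> y" "\<forall>n\<ge>m0. gho f n y = 0"
      using Suc.IH[OF S[OF Suc.prems(1)]] by blast
    then show ?case using coh_trans[OF c] by blast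
  qed
  moreover obtain N where N: "\<forall>n\<ge>N. gho f n x = 0" using T.X.trunc by blast
  have "gho f n x = 0" if "n \<ge> m0 + int (nat (N - m0))" for n using N that by (cases "m0 \<le> N") auto
  ultimately show ?thesis using x by blast
qed


lemma fld_comm: "gho (F.fld i) m (gho (F.fld j) n x) = ssgn (gpar i) (gpar j) *\<^sub>C gho (F.fld j) n (gho (F.fld i) m x)
    + (if j = co i \<and> m + n = -1 then gsg j *\<^sub>C x else 0)"
proof -
  have "mode C (t (vac V) (F.fld i)) (int l) (t (vac V) (F.fld j)) = (if l = 0 \<and> j = co i then gsg j *\<^sub>C vac C else 0)" for l
    by (simp add: CC.act_F F.fld_ope C_lin t_vac)
  from this this[of 0] show ?thesis
    using T.X.commutator0[OF t_par[OF F.fld_par, of "vac V" i] t_par[OF F.fld_par, of "vac V" j], of m n x]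
    by (simp add: X1 T.X.vacuum)
qed

abbreviation "cr i n \<equiv> gho (F.fld i) (-1 - int n)"
abbreviation "an i n \<equiv> gho (F.fld (co i)) (int n)"

text \<open>The factor \<open>gsg\<close> normalises every contraction to +1. The cut-off K keeps
  the sum finite and is harmless on words whose indices stay below K.\<close>

definition Num :: "nat \<Rightarrow> 'x \<Rightarrow> 'x" where
  "Num K x = (\<Sum>i\<in>UNIV. \<Sum>n<K. gsg i *\<^sub>C cr i n (an i n x))"

lemma Num_lin: "clin (Num K)"
  by (rule clinI) (simp add: Num_def X2 sum.distrib cvs.scale_right_distrib cvs.scale_sum_right mult.commute)

lemma Num_cr: "Num K (cr j m x) = cr j m (Num K x) + (if m < K then cr j m x else 0)"
proof -
  have "gsg i *\<^sub>C cr i n (an i n (cr j m x)) = cr j m (gsg i *\<^sub>C cr i n (an i n x)) + (if n = m then if i = j then cr j m x else 0 else 0)" for i n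
  proof -
    have a: "an i n (cr j m x) = ssgn (gpar i) (gpar j) *\<^sub>C cr j m (an i n x) + (if n = m then if i = j then gsg j *\<^sub>C x else 0 else 0)"
      using fld_comm[of "co i" "int n" j "-1 - int m" x] by auto
    have c: "cr i n (cr j m y) = ssgn (gpar i) (gpar j) *\<^sub>C cr j m (cr i n y)" for y
      using fld_comm[of i "-1 - int n" j "-1 - int m" y] by auto
    have s: "ssgn (gpar i) (gpar j) * ssgn (gpar i) (gpar j) = 1" by (simp add: ssgn_def)
    have s': "gsg j * gsg j = 1" by (cases j) simp_all
    show ?thesis using s s' by (auto simp: a X2 c mult.assoc[symmetric] mult.commute[of "gsg i"] cvs.scale_right_distrib)
  qed
  then show ?thesis
    by (simp add: Num_def X2 sum.distrib sum.delta)
qed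

definition SK :: "nat \<Rightarrow> nat \<Rightarrow> 'x set" where
  "SK K r = cvs.span {wd cr ws (s m (vac F)) | ws m. length ws = r \<and> (\<forall>w\<in>set ws. snd w < K)}"

lemma Num_wd: "(\<forall>w\<in>set ws. snd w < K) \<Longrightarrow> Num K (wd cr ws (s m (vac F))) = of_nat (length ws) *\<^sub>C wd cr ws (s m (vac F))"
proof (induction ws)
  case Nil
  then show ?case by (simp add: Num_def T.act_F F.mode_vac T.s2_simps X2)
next
  case (Cons w ws)
  then show ?case by (cases w) (simp add: Num_cr X2 cvs.scale_left_distrib)
qed

lemma Num_SK: "x \<in> SK K r \<Longrightarrow> Num K x = of_nat r *\<^sub>C x"
proof -
  have "cvs.subspace {x. Num K x = of_nat r *\<^sub>C x}"
    by (auto simp: cvs.subspace_def clin_simps[OF Num_lin] cvs.scale_right_distrib mult.commute)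
  then have "SK K r \<subseteq> {x. Num K x = of_nat r *\<^sub>C x}"
    unfolding SK_def by (rule cvs.span_minimal[rotated]) (auto simp: Num_wd)
  then show "x \<in> SK K r \<Longrightarrow> Num K x = of_nat r *\<^sub>C x" by blast
qed

definition tot :: "nat \<Rightarrow> nat set \<Rightarrow> 'x set" where "tot K R = cvs.span (\<Union>r\<in>R. SK K r)"

lemma SK_sub: "cvs.subspace (SK K r)" by (simp add: SK_def)
lemma tot_sub: "cvs.subspace (tot K R)" by (simp add: tot_def)

lemma tot_mono: "K \<le> K' \<Longrightarrow> R \<subseteq> R' \<Longrightarrow> tot K R \<subseteq> tot K' R'"
  unfolding tot_def SK_def by (intro cvs.span_mono UN_mono) (auto intro!: cvs.span_mono, force)

lemma tot_cr: assumes "n < K" "x \<in> tot K R" shows "cr i n x \<in> tot K {1..}"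
proof -
  have w: "cr i n (wd cr ws (s m (vac F))) \<in> SK K (Suc (length ws))" if "\<forall>w\<in>set ws. snd w < K" for ws m
    unfolding SK_def by (rule cvs.span_base) (use that assms(1) in \<open>auto intro!: exI[of _ "(i, n) # ws"]\<close>)
  have sub: "cvs.subspace {x. cr i n x \<in> tot K {1..}}"
    using tot_sub[of K "{1..}"] by (auto simp: cvs.subspace_def X2)
  have "SK K r \<subseteq> {x. cr i n x \<in> tot K {1..}}" for r
    unfolding SK_def[of K r]
  proof (rule cvs.span_minimal[OF _ sub], safe)
    fix ws :: "(gh \<times> nat) list" and m assume "\<forall>w\<in>set ws. snd w < K"
    from w[OF this] show "cr i n (wd cr ws (s m (vac F))) \<in> tot K {1..}"
      unfolding tot_def by (intro cvs.span_base UN_I[of "Suc (length ws)"]) simp_all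
  qed
  then have "tot K R \<subseteq> {x. cr i n x \<in> tot K {1..}}"
    unfolding tot_def[of K R] by (intro cvs.span_minimal sub) blast
  then show ?thesis using assms(2) by blast
qed

lemma ex_tot_sub: "cvs.subspace {x. \<exists>K. x \<in> tot K R}"
proof (rule cvs.subspaceI)
  show "0 \<in> {x. \<exists>K. x \<in> tot K R}" using cvs.subspace_0[OF tot_sub] by blast
next
  fix x y assume "x \<in> {x. \<exists>K. x \<in> tot K R}" "y \<in> {x. \<exists>K. x \<in> tot K R}"
  then obtain K K' where "x \<in> tot K R" "y \<in> tot K' R" by blast
  then have "x \<in> tot (max K K') R" "y \<in> tot (max K K') R" using tot_mono[of K "max K K'" R R] tot_mono[of K' "max K K'" R R] by auto
  then show "x + y \<in> {x. \<exists>K. x \<in> tot K R}" using cvs.subspace_add[OF tot_sub] by blast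
qed (use cvs.subspace_scale[OF tot_sub] in blast)

lemma tot_all: "\<exists>K. x \<in> tot K UNIV"
proof -
  let ?U = "{x. \<exists>K. x \<in> tot K UNIV}"
  have "{h. \<forall>m. s m h \<in> ?U} = UNIV"
  proof (rule F.fld_gen)
    show "cvs.subspace {h. \<forall>m. s m h \<in> ?U}"
      using ex_tot_sub[of UNIV] unfolding cvs.subspace_def by (simp add: T.s2_simps)
    have "s m (vac F) \<in> SK 0 0" for m unfolding SK_def by (rule cvs.span_base) (auto intro!: exI[of _ "[]"])
    then show "vac F \<in> {h. \<forall>m. s m h \<in> ?U}" unfolding tot_def by (auto intro: cvs.span_base)
    fix i n h assume h: "h \<in> {h. \<forall>m. s m h \<in> ?U}" and n: "n < (0 :: int)"
    have "s m (mode F (F.fld i) n h) \<in> ?U" for m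
    proof -
      obtain K where "s m h \<in> tot K UNIV" using h by blast
      moreover define K' where "K' = max K (Suc (nat (-1 - n)))"
      ultimately have "s m h \<in> tot K' UNIV" using tot_mono[of K K' UNIV UNIV] by auto
      then have "cr i (nat (-1 - n)) (s m h) \<in> tot K' {1..}" by (rule tot_cr[rotated]) (simp add: K'_def)
      then have "s m (mode F (F.fld i) n h) \<in> tot K' UNIV"
        using n tot_mono[of K' K' "{1..}" UNIV] by (auto simp: T.act_F)
      then show ?thesis by blast
    qed
    then show "mode F (F.fld i) n h \<in> {h. \<forall>m. s m h \<in> ?U}" by blast
  qed
  then have "?U = UNIV" by (intro tensor_induct[OF T.s ex_tot_sub]) blast
  then show ?thesis by blast
qed

lemma SK_0: "SK K 0 = range (\<lambda>m. s m (vac F))"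
proof -
  have "cvs.subspace (range (\<lambda>m. s m (vac F)))"
  proof (rule cvs.subspaceI)
    show "0 \<in> range (\<lambda>m. s m (vac F))" by (rule image_eqI[of _ _ 0]) (simp_all add: T.s1_simps)
  next
    fix x y assume "x \<in> range (\<lambda>m. s m (vac F))" "y \<in> range (\<lambda>m. s m (vac F))"
    then obtain m n where "x = s m (vac F)" "y = s n (vac F)" by blast
    then show "x + y \<in> range (\<lambda>m. s m (vac F))" by (intro image_eqI[of _ _ "m + n"]) (simp_all add: T.s1_simps)
  next
    fix c x assume "x \<in> range (\<lambda>m. s m (vac F))"
    then obtain m where "x = s m (vac F)" by blast
    then show "c *\<^sub>C x \<in> range (\<lambda>m. s m (vac F))" by (intro image_eqI[of _ _ "c *\<^sub>C m"]) (simp_all add: T.s1_simps)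
  qed
  moreover have "{wd cr ws (s m (vac F)) | ws m. length ws = 0 \<and> (\<forall>w\<in>set ws. snd w < K)} = range (\<lambda>m. s m (vac F))"
    by auto
  ultimately show ?thesis unfolding SK_def by (simp only: cvs.span_eq_iff)
qed

text \<open>The counting operator multiplies the part with r ghost letters by r but kills x, so only
  the part without ghost letters remains.\<close>

lemma vacuum_vectors:
  assumes "\<And>i n. an i n x = 0" shows "\<exists>m. x = s m (vac F)"
proof -
  obtain K where "x \<in> tot K UNIV" using tot_all by blast
  then obtain R f where f: "finite R" "\<And>r. f r \<in> SK K r" "x = (\<Sum>r\<in>R. f r)"
    unfolding tot_def by (rule span_Union_decomp[OF SK_sub]) blast
  have "(\<Sum>r\<in>R. of_nat r *\<^sub>C f r) = Num K x" by (simp add: f(3) clin_sum[OF Num_lin] Num_SK[OF f(2)])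
  also have "\<dots> = 0" by (simp add: Num_def assms X2)
  finally have z: "(\<Sum>r\<in>R. of_nat r *\<^sub>C f r) = 0" .
  have "of_nat r *\<^sub>C f r = 0" if "r \<in> R" for r
    by (rule eigen_components_zero[OF Num_lin f(1) _ _ z that, of K of_nat])
       (simp_all add: Num_SK[OF cvs.subspace_scale[OF SK_sub f(2)]] inj_on_def)
  then have "f r = 0" if "r \<in> R" "r \<noteq> 0" for r using that by auto
  then have "x = (if 0 \<in> R then f 0 else 0)"
    unfolding f(3) using f(1) by (subst sum.mono_neutral_right[of R "R \<inter> {0}"]) auto
  then have "x \<in> SK K 0" using f(2) cvs.subspace_0[OF SK_sub] by simp
  then show ?thesis unfolding SK_0 by blast
qed

definition Xp :: "'x set" where "Xp = cvs.span {gho (F.fld i) n y | i n y. n < 0}"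

lemma Xp_I: "n < 0 \<Longrightarrow> gho (F.fld i) n y \<in> Xp" unfolding Xp_def by (rule cvs.span_base) blast

lemma Xp_sub: "cvs.subspace Xp" by (simp add: Xp_def)

text \<open>Images of creation operators have at least one ghost letter, and the eigenspaces of the
  counting operator are independent.\<close>

lemma Xp_vacuum: assumes "s m (vac F) \<in> Xp" shows "m = 0"
proof -
  have "Xp \<subseteq> {x. \<exists>K. x \<in> tot K {1..}}" unfolding Xp_def
  proof (rule cvs.span_minimal[OF _ ex_tot_sub], safe)
    fix i n y assume n: "n < (0 :: int)"
    obtain K where "y \<in> tot K UNIV" using tot_all by blast
    moreover define K' where "K' = max K (Suc (nat (-1 - n)))"
    ultimately have "y \<in> tot K' UNIV" using tot_mono[of K K' UNIV UNIV] by auto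
    then have "cr i (nat (-1 - n)) y \<in> tot K' {1..}" by (rule tot_cr[rotated]) (simp add: K'_def)
    then show "\<exists>K. gho (F.fld i) n y \<in> tot K {1..}" using n by auto
  qed
  then obtain K where "s m (vac F) \<in> tot K {1..}" using assms by blast
  then obtain R f where f: "finite R" "R \<subseteq> {1..}" "\<And>r. f r \<in> SK K r" "s m (vac F) = (\<Sum>r\<in>R. f r)"
    unfolding tot_def by (rule span_Union_decomp[OF SK_sub]) blast
  have m: "s m (vac F) \<in> SK K 0" by (simp add: SK_0)
  define h where "h r = (if r = 0 then - s m (vac F) else f r)" for r
  have "(\<Sum>r\<in>insert 0 R. h r) = - s m (vac F) + (\<Sum>r\<in>R. f r)"
    using f(1,2) by (subst sum.insert) (auto simp: h_def intro!: sum.cong)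
  then have "(\<Sum>r\<in>insert 0 R. h r) = 0" by (simp add: f(4))
  then have "h 0 = 0"
    using f(1) cvs.subspace_neg[OF SK_sub m]
    by (intro eigen_components_zero[OF Num_lin, of "insert 0 R" K h of_nat]) (auto simp: h_def inj_on_def Num_SK[OF f(3)] Num_SK[OF cvs.subspace_neg[OF SK_sub m]])
  then have "s m (vac F) = 0" by (simp add: h_def)
  then show ?thesis by (rule tensor_cancel_right[OF T.s F.vac_nonzero])
qed

text \<open>In every summand of d either a non-negative mode of e, p or q hits m, or a non-negative
  ghost mode hits the vacuum.\<close>

lemma D_s: assumes "m \<in> \<Omega>" shows "D (s m (vac F)) = 0"
proof -
  have "YX (t (\<iota> A) f) 0 (s m (vac F)) = 0" if "A \<in> {eM, pM, qM}" for A f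
  proof -
    have "YX (t (\<iota> A) f) 0 (s m (vac F)) \<in> {0}"
    proof (rule T.act_mem)
      fix i :: int
      show "s (YM (\<iota> A) i m) (mode F f (0 - 1 - i) (vac F)) \<in> {0}"
        using that assms by (cases "i \<ge> 0") (auto simp: \<Omega>_def T.s1_simps T.s2_simps F.mode_vac)
    qed simp
    then show ?thesis by simp
  qed
  then show ?thesis by (simp add: d_decomp X1 T.act_F F.mode_vac T.s2_simps)
qed

text \<open>In \<open>QL 0\<close> only \<psi>_2, \<psi>_\<theta> and \<Phi>_1 may still act
  non-trivially by non-negative modes. The first is removed by means of e \<psi>_2, the second by
  means of q \<psi>_2 + e \<psi>_\<theta>, and \<Phi>_1 then follows from \<open>f1\<close>. Mode 0
  of \<psi>_\<theta> survives, since mode 0 of \<open>top Bw\<close> is not controlled; it leaves a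
  second term with \<phi>_\<theta>(-1), and closedness puts its coefficient into the kernel of
  e_(-1) + 1.\<close>

lemma cocycle_representative:
  assumes "D x = 0" shows "\<exists>m. m \<in> \<Omega> \<and> (\<forall>n\<ge>1. Om n m = 0) \<and> x \<simeq> s m (vac F)"
proof -
  obtain x0 where x0: "x0 \<in> QL 0" "D x0 = 0" "x \<simeq> x0" using eliminate_all[OF assms] by blast
  have e1: "- eX (-1) y \<in> QL 0" if "y \<in> QL 0" for y
    using cvs.subspace_neg[OF QL_sub QL_th(1)[OF that, of "-1"]] by simp
  have "\<exists>y\<in>QL 0. D y = 0 \<and> x0 \<simeq> y \<and> (\<forall>n\<ge>0. gho (F.ps Alpha2) n y = 0)"
  proof (rule remove_modes[OF _ _ x0(1,2)])
    fix y m assume y: "y \<in> QL 0" and m: "m \<ge> (0 :: int)" and "\<And>n. n > m \<Longrightarrow> gho (F.ps Alpha2) n y = 0"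
    then have "YX (mode C eC (-1) (t (vac V) (F.ps Alpha2))) m y = eX (-1) (gho (F.ps Alpha2) m y)"
      using QL_annihilated(4)[OF y] by (intro np_mode[OF par_eC t_par[OF F.ghost_par(2)]]) simp_all
    then show "eX (-1) (gho (F.ps Alpha2) m y) = 0" using QL_annihilated(8)[OF y m] by (simp add: np_V)
  qed (use e1 in simp_all)
  then obtain x1 where x1: "x1 \<in> QL 0" "D x1 = 0" "x0 \<simeq> x1" "\<And>n. n \<ge> 0 \<Longrightarrow> gho (F.ps Alpha2) n x1 = 0" by blast
  let ?S = "{y \<in> QL 0. \<forall>n\<ge>0. gho (F.ps Alpha2) n y = 0}"
  have "\<exists>y\<in>?S. D y = 0 \<and> x1 \<simeq> y \<and> (\<forall>n\<ge>1. gho (F.ps Theta) n y = 0)"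
  proof (rule remove_modes[of ?S])
    fix y m assume y: "y \<in> ?S" and m: "m \<ge> (1 :: int)" and th: "\<And>n. n > m \<Longrightarrow> gho (F.ps Theta) n y = 0"
    have "YX (mode C (t (\<iota> qM) (vac F)) (-1) (t (vac V) (F.ps Alpha2))) m y = cur qM (-1) (gho (F.ps Alpha2) m y)"
      using QL_annihilated(6)[of y] y m by (intro np_mode[OF t_par[OF F.vac_even] t_par[OF F.ghost_par(2)]]) simp_all
    then have "YX (t (\<iota> qM) (F.ps Alpha2)) m y = 0" using y m by (simp add: np_V X2)
    moreover have "YX (mode C eC (-1) (t (vac V) (F.ps Theta))) m y = eX (-1) (gho (F.ps Theta) m y)"
      using QL_annihilated(4)[of y] y th by (intro np_mode[OF par_eC t_par[OF F.ghost_par(2)]]) simp_all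
    ultimately show "eX (-1) (gho (F.ps Theta) m y) = 0" using QL_annihilated(10)[of y m] y m by (simp add: np_V)
  next
    fix y assume y: "y \<in> ?S"
    then show "- eX (-1) y \<in> ?S" using e1[of y] by (simp add: X2 flip: cur_gho)
  qed (use x1 in simp_all)
  then obtain y where y: "y \<in> QL 0" "D y = 0" "x1 \<simeq> y" "\<And>n. n \<ge> 0 \<Longrightarrow> gho (F.ps Alpha2) n y = 0"
    "\<And>n. n \<ge> 1 \<Longrightarrow> gho (F.ps Theta) n y = 0" by blast
  have "YX (mode C (t (vac V) (F.ph Theta)) (-1) (t (vac V) (F.ps Alpha2))) n y = 0" if "n \<ge> 0" for n
    using QL_annihilated(1)[OF y(1)] y(4) that by (subst np_mode[OF t_par[OF F.ghost_par(1)] t_par[OF F.ghost_par(2)]]) (auto simp: X2)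
  then have Ph1: "gho F.Ph1 n y = 0" if "n \<ge> 0" for n
    using QL_annihilated(9)[OF y(1) that] that by (simp add: F.f1_def CC.s2_simps X1 np_F)
  have ann: "gho (F.fld i) n y = 0" if "n \<ge> 0" "i \<noteq> GPs Theta \<or> n \<ge> 1" for i n
  proof (cases i)
    case (GPs \<alpha>)
    then show ?thesis using QL_annihilated(3)[OF y(1)] y(4,5) that by (cases \<alpha>) auto
  qed (use QL_annihilated(1,2)[OF y(1)] Ph1 that in auto)
  let ?\<psi> = "gho (F.ps Theta) 0" and ?\<phi> = "gho (F.ph Theta) (-1)"
  have \<psi>\<psi>: "?\<psi> (?\<psi> w) = 0" for w
  proof -
    have "2 *\<^sub>C ?\<psi> (?\<psi> w) = ?\<psi> (?\<psi> w) + ?\<psi> (?\<psi> w)" using cvs.scale_left_distrib[of 1 1 "?\<psi> (?\<psi> w)"] by simp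
    also have "\<dots> = 0" using fld_comm[of "GPs Theta" 0 "GPs Theta" 0 w] by (simp add: eq_neg_iff_add_eq_0)
    finally show ?thesis by simp
  qed
  have "gho (F.fld i) n (?\<psi> y) = 0" if "n \<ge> 0" for i n
    using fld_comm[of i n "GPs Theta" 0 y] ann[of n i] \<psi>\<psi> that
    by (cases "i = GPs Theta \<and> n = 0") (auto simp: X2)
  then obtain m1 where m1: "?\<psi> y = s m1 (vac F)" using vacuum_vectors[of "?\<psi> y"] by auto
  have "gho (F.fld i) n (?\<psi> (?\<phi> y)) = 0" if n: "n \<ge> 0" for i n
  proof (cases "i = GPs Theta \<and> n = 0")
    case False
    have "gho (F.fld i) n (?\<phi> y) = 0"
      using fld_comm[of i n "GPh Theta" "-1" y] ann[of n i] False n by (cases i) (auto simp: X2)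
    then show ?thesis using fld_comm[of i n "GPs Theta" 0 "?\<phi> y"] n by (auto simp: X2)
  qed (simp add: \<psi>\<psi>)
  then obtain m where m: "?\<psi> (?\<phi> y) = s m (vac F)" using vacuum_vectors[of "?\<psi> (?\<phi> y)"] by auto
  \<comment> \<open>The anticommutator of \<psi>_\<theta>(0) and \<phi>_\<theta>(-1) is the
    identity, which splits y into two parts.\<close>
  have dec: "y = s m (vac F) + ?\<phi> (s m1 (vac F))"
    using fld_comm[of "GPs Theta" 0 "GPh Theta" "-1" y] by (simp add: m[symmetric] m1[symmetric])
  have zero: "YM (\<iota> A) n m = 0" "YM (\<iota> A) n m1 = 0" if "cur A n y = 0" for A n
  proof -
    have "cur A n (s m (vac F)) = 0" "cur A n (s m1 (vac F)) = 0"
      using that by (simp_all add: m[symmetric] m1[symmetric] cur_gho X2)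
    then show "YM (\<iota> A) n m = 0" "YM (\<iota> A) n m1 = 0"
      using tensor_cancel_right[OF T.s F.vac_nonzero] by (simp_all add: T.act_V)
  qed
  have mO: "m \<in> \<Omega>" "m1 \<in> \<Omega>" using zero QL_annihilated(4,5,6)[OF y(1)] by (simp_all add: \<Omega>_def)
  have "D (?\<phi> (s m1 (vac F))) = s (E (-1) m1 + m1) (vac F)"
    using D_o[of Bth "-1" "s m1 (vac F)"] tp_th[of "-1" "s m1 (vac F)"] D_s[OF mO(2)]
    by (simp add: X2 T.act_V T.s1_simps)
  moreover have "D (?\<phi> (s m1 (vac F))) = 0" using y(2) D_s[OF mO(1)] unfolding dec by (simp add: X2)
  ultimately have "E (-1) m1 + m1 = 0" using tensor_cancel_right[OF T.s F.vac_nonzero] by metis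
  then have "m1 = 0" by (rule E_plus_one_injective)
  then have "x \<simeq> s m (vac F)" using dec coh_trans[OF x0(3) coh_trans[OF x1(3) y(3)]] by (simp add: T.s1_simps X2)
  moreover have "Om n m = 0" if "n \<ge> 1" for n using zero(1)[OF QL_annihilated(7)[OF y(1)], of n] that by simp
  ultimately show ?thesis using mO(1) by blast
qed

end

section \<open>Proper submodules and the weights of \<omega>_(0)\<close>

context hw_mod_nc
begin

text \<open>A component of lowest weight in U would, split by x_(0), put some e_(-1)^j v and hence v
  into U.\<close>

lemma proper_Low:
  assumes U: "V_stable U" "v \<notin> U" and k: "k \<notin> \<nat>" and u: "u \<in> U" shows "u \<in> Low"
proof -
  have U_sub: "cvs.subspace U" and U_st: "\<And>w n x. x \<in> U \<Longrightarrow> Y w n x \<in> U" using U(1) by (auto simp: V_stable_def)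
  obtain F f where F: "finite F" "F \<subseteq> {0..}" "\<And>c. f c \<in> Wd c" "u = (\<Sum>c\<in>F. f c)" using Wd_decomp[of u] by blast
  have fU: "f c \<in> U" if "c \<in> F" for c
  proof (rule eigen_components[OF Dg_lin U_sub _ F(1)])
    show "Dg x \<in> U" if "x \<in> U" for x using that by (simp add: Dg_def cvs.subspace_diff[OF U_sub] U_st)
    show "Dg (f c) = (\<delta> + of_int c / 2) *\<^sub>C f c" for c by (rule Wd_Dg[OF F(3)])
  qed (use F u that in \<open>auto simp: inj_on_def\<close>)
  have f0: "f 0 = 0" if "0 \<in> F"
  proof -
    obtain c n where c: "\<forall>j\<ge>n. c j = 0" "f 0 = (\<Sum>j<n. c j *\<^sub>C Ev j)" using Cst_sum[of "f 0"] F(3)[of 0] Wd_0 by blast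
    have "(\<Sum>j<n. c j *\<^sub>C Ev j) \<in> U" using fU[OF that] by (simp add: c(2))
    then have "c j *\<^sub>C Ev j \<in> U" if "j < n" for j
    proof (rule eigen_components[OF lin2 U_sub, rotated -2])
      show "X0 x \<in> U" if "x \<in> U" for x using that by (rule U_st)
      show "X0 (c j *\<^sub>C Ev j) = (wt xM + of_nat j) *\<^sub>C c j *\<^sub>C Ev j" for j
        using cartan_Ev[of xM j] by (simp add: lin2_simps) (simp add: xM_def mat3_simps)
    qed (use that in \<open>auto simp: inj_on_def\<close>)
    moreover have "Ev j \<notin> U" for j using Ev_generates[OF U(1) k] U(2) by blast
    ultimately have "c j = 0" if "j < n" for j using that subspace_mult_mem[OF U_sub] by blast
    then show ?thesis by (simp add: c(2))
  qed
  have "f c \<in> Low" if "c \<in> F" for c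
  proof (cases "c = 0")
    case True
    then show ?thesis using f0 that cvs.subspace_0[OF Low_sub] by simp
  next
    case False
    then have "c \<in> {1..}" using F(2) that by auto
    then show ?thesis unfolding Low_def using F(3)[of c] by (intro cvs.span_base) blast
  qed
  then show ?thesis unfolding F(4) by (intro cvs.subspace_sum Low_sub)
qed

text \<open>Takes the place of the maximal submodule: both summands lie in \<open>Low\<close>, and
  \<open>hw_not_exact\<close> with i = 0 and m0 = 0 keeps v out of \<open>Low\<close>.\<close>

lemma v_not_sum:
  assumes "V_stable U" "V_stable I" "v \<notin> U" "v \<notin> I" "k \<notin> \<nat>" "u \<in> U" "i \<in> I" shows "v \<noteq> u + i"
proof
  assume v: "v = u + i"
  have 0: "V_stable {0}" by (simp add: V_stable_def cvs.subspace_def lin2_simps)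
  have v0: "v \<notin> {0}" using assms(1,3) cvs.subspace_0 by (auto simp: V_stable_def)
  have "u + i \<in> Low" using assms by (intro cvs.subspace_add[OF Low_sub]) (auto intro: proper_Low)
  then have "v \<in> Low" by (simp only: v[symmetric])
  then show False by (intro hw_not_exact[OF 0 v0 assms(5), of 0 0 v]) (simp_all add: lin2_simps)
qed

definition OmW :: "int \<Rightarrow> 'm set" where "OmW c = {x. Om 0 x = (wt wM + of_int c) *\<^sub>C x}"

lemma OmW_sub: "cvs.subspace (OmW c)"
  by (auto simp: OmW_def cvs.subspace_def lin2_simps cvs.scale_right_distrib mult.commute)

lemma OmW_letter: assumes "A \<in> sl3" "lie wM A = of_int j *\<^sub>C A" "x \<in> OmW c" shows "Y (\<iota> A) n x \<in> OmW (c + j)"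
proof -
  have "Om 0 (Y (\<iota> A) n x) = Y (\<iota> A) n (Om 0 x) + of_int j *\<^sub>C Y (\<iota> A) n x"
    using affine_comm[of wM A 0 n x] assms(1,2) by (simp add: iota_scale lin1_simps)
  then show ?thesis using assms(3) by (simp add: OmW_def lin2_simps cvs.scale_left_distrib)
qed

lemma OmW_decomp: obtains F f where "finite F" "\<And>c. f c \<in> OmW c" "x = (\<Sum>c\<in>F. f c)"
proof -
  let ?S = "cvs.span (\<Union>c\<in>UNIV. OmW c)"
  have hom: "Y (\<iota> A) n x \<in> ?S" if A: "A \<in> sl3" "lie wM A = of_int j *\<^sub>C A" and x: "x \<in> ?S" for A n j x
  proof -
    have "cvs.subspace {y. Y (\<iota> A) n y \<in> ?S}"
      by (auto simp: cvs.subspace_def lin2_simps cvs.span_zero intro: cvs.span_add cvs.span_scale)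
    moreover have "(\<Union>c\<in>UNIV. OmW c) \<subseteq> {y. Y (\<iota> A) n y \<in> ?S}"
      using OmW_letter[OF A] by (auto intro!: cvs.span_base)
    ultimately show ?thesis using x cvs.span_minimal by blast
  qed
  have "?S = UNIV"
  proof (rule hw_cyclic)
    show "v \<in> ?S" using hw_cartan[of wM] by (intro cvs.span_base UN_I[of 0]) (simp_all add: OmW_def wt_def)
    fix A n x assume A: "A \<in> sl3" and x: "x \<in> ?S"
    \<comment> \<open>Eigenvectors of ad \<omega> for the eigenvalues 1 and -1; what is left of A
      commutes with \<omega>.\<close>
    let ?A1 = "(A$1$3) *\<^sub>C eM + (A$2$3) *\<^sub>C qM" and ?A2 = "(A$3$1) *\<^sub>C fM + (A$3$2) *\<^sub>C munit 3 2"
    define A0 where "A0 = A - ?A1 - ?A2"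
    have s1: "?A1 \<in> sl3" "?A2 \<in> sl3" by (intro cvs.subspace_add cvs.subspace_scale sl3_subspace mat3_in_sl3)+
    then have s0: "A0 \<in> sl3" unfolding A0_def by (intro cvs.subspace_diff sl3_subspace A)
    have "lie wM A0 = of_int 0 *\<^sub>C A0" by (auto simp: A0_def mat3_simps wM_def)
    moreover have "lie wM ?A1 = of_int 1 *\<^sub>C ?A1" by (auto simp: mat3_simps wM_def)
    moreover have "lie wM ?A2 = of_int (-1) *\<^sub>C ?A2" by (auto simp: mat3_simps wM_def)
    moreover have "Y (\<iota> A) n x = Y (\<iota> A0) n x + Y (\<iota> ?A1) n x + Y (\<iota> ?A2) n x"
    proof -
      have eq: "\<iota> A = \<iota> A0 + \<iota> ?A1 + \<iota> ?A2"
        using iota_add[OF s0 s1(1)] iota_add[OF cvs.subspace_add[OF sl3_subspace s0 s1(1)] s1(2)] by (simp add: A0_def)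
      show ?thesis unfolding eq by (simp add: lin1_simps)
    qed
    ultimately show "Y (\<iota> A) n x \<in> ?S" using hom s0 s1 x by (metis cvs.span_add)
  qed simp
  then have "x \<in> ?S" by simp
  from span_Union_decomp[OF OmW_sub this] show thesis using that by metis
qed

end

section \<open>The class of the highest weight vector\<close>

context ghost
begin

definition Fp :: "'f set" where "Fp = cvs.span {mode F (fld i) n h | i n h. n < 0}"

lemma Fp_sub: "cvs.subspace Fp" by (simp add: Fp_def)

lemma Fp_decomp: "\<exists>c. h - c *\<^sub>C vac F \<in> Fp"
proof -
  have "{h. \<exists>c. h - c *\<^sub>C vac F \<in> Fp} = UNIV"
  proof (rule fld_gen)
    show "cvs.subspace {h. \<exists>c. h - c *\<^sub>C vac F \<in> Fp}"
    proof (rule cvs.subspaceI)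
      show "0 \<in> {h. \<exists>c. h - c *\<^sub>C vac F \<in> Fp}" using cvs.subspace_0[OF Fp_sub] by (auto intro: exI[of _ 0])
    next
      fix x y assume "x \<in> {h. \<exists>c. h - c *\<^sub>C vac F \<in> Fp}" "y \<in> {h. \<exists>c. h - c *\<^sub>C vac F \<in> Fp}"
      then obtain c d where "x - c *\<^sub>C vac F \<in> Fp" "y - d *\<^sub>C vac F \<in> Fp" by blast
      from cvs.subspace_add[OF Fp_sub this] have "x + y - (c + d) *\<^sub>C vac F \<in> Fp" by (simp add: cvs.scale_left_distrib algebra_simps)
      then show "x + y \<in> {h. \<exists>c. h - c *\<^sub>C vac F \<in> Fp}" by blast
    next
      fix a x assume "x \<in> {h. \<exists>c. h - c *\<^sub>C vac F \<in> Fp}"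
      then obtain c where "x - c *\<^sub>C vac F \<in> Fp" by blast
      from cvs.subspace_scale[OF Fp_sub this, of a] have "a *\<^sub>C x - (a * c) *\<^sub>C vac F \<in> Fp" by (simp add: cvs.scale_right_diff_distrib)
      then show "a *\<^sub>C x \<in> {h. \<exists>c. h - c *\<^sub>C vac F \<in> Fp}" by blast
    qed
    show "vac F \<in> {h. \<exists>c. h - c *\<^sub>C vac F \<in> Fp}" using cvs.subspace_0[OF Fp_sub] by (auto intro: exI[of _ 1])
    fix i n x assume "n < (0 :: int)"
    then have "mode F (fld i) n x \<in> Fp" unfolding Fp_def by (intro cvs.span_base) blast
    then show "mode F (fld i) n x \<in> {h. \<exists>c. h - c *\<^sub>C vac F \<in> Fp}" by (auto intro: exI[of _ 0])
  qed
  then show ?thesis by blast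
qed

end

text \<open>C is the complex of the adjoint module, so the statements about X apply to C under the
  prefix \<open>CX\<close>.\<close>

sublocale brst \<subseteq> CX: brst_mod k V \<iota> "mode V" "vac V" 0 0 F g C t d "mode C" t
  by unfold_locales (rule d_square)

context brst_mod
begin

lemma s_Fp: "h \<in> F.Fp \<Longrightarrow> s m h \<in> Xp"
proof -
  have "cvs.subspace {h. s m h \<in> Xp}" using Xp_sub by (auto simp: cvs.subspace_def T.s2_simps)
  moreover have "{mode F (F.fld i) n h | i n h. n < 0} \<subseteq> {h. s m h \<in> Xp}"
    by (auto simp flip: T.act_F intro: Xp_I)
  ultimately show "h \<in> F.Fp \<Longrightarrow> s m h \<in> Xp" unfolding F.Fp_def using cvs.span_minimal by blast
qed

text \<open>Modulo \<open>Xp\<close> every vector is ghost-free; the condition is that this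
  ghost-free part can be taken in T.\<close>

definition WT :: "'m set \<Rightarrow> 'x set" where "WT T = {x. \<exists>w\<in>T. x - s w (vac F) \<in> Xp}"

lemma WT_sub: assumes T: "cvs.subspace T" shows "cvs.subspace (WT T)"
proof (rule cvs.subspaceI)
  show "0 \<in> WT T" using cvs.subspace_0[OF T] cvs.subspace_0[OF Xp_sub] unfolding WT_def
    by (auto intro!: bexI[of _ 0] simp: T.s1_simps)
next
  fix x y assume "x \<in> WT T" "y \<in> WT T"
  then obtain w w' where w: "w \<in> T" "w' \<in> T" "x - s w (vac F) \<in> Xp" "y - s w' (vac F) \<in> Xp" by (auto simp: WT_def)
  have "x + y - s (w + w') (vac F) \<in> Xp" using cvs.subspace_add[OF Xp_sub w(3,4)] by (simp add: T.s1_simps algebra_simps)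
  then show "x + y \<in> WT T" using cvs.subspace_add[OF T w(1,2)] unfolding WT_def by blast
next
  fix c x assume "x \<in> WT T"
  then obtain w where w: "w \<in> T" "x - s w (vac F) \<in> Xp" by (auto simp: WT_def)
  have "c *\<^sub>C x - s (c *\<^sub>C w) (vac F) \<in> Xp" using cvs.subspace_scale[OF Xp_sub w(2), of c] by (simp add: T.s1_simps cvs.scale_right_diff_distrib)
  then show "c *\<^sub>C x \<in> WT T" using cvs.subspace_scale[OF T w(1)] unfolding WT_def by blast
qed

lemma Xp_WT: "cvs.subspace T \<Longrightarrow> x \<in> Xp \<Longrightarrow> x \<in> WT T"
  unfolding WT_def using cvs.subspace_0 by (force simp: T.s1_simps)

lemma WT_I: assumes T: "cvs.subspace T" "w \<in> T" shows "s w h \<in> WT T"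
proof -
  obtain c where c: "h - c *\<^sub>C vac F \<in> F.Fp" using F.Fp_decomp by blast
  have "s w h - s (c *\<^sub>C w) (vac F) \<in> Xp" using s_Fp[OF c, of w] by (simp add: T.s1_simps T.s2_simps)
  then show ?thesis unfolding WT_def using cvs.subspace_scale[OF T] by blast
qed

definition cre :: "'f \<Rightarrow> bool" where "cre f \<longleftrightarrow> (\<forall>n y. n < 0 \<longrightarrow> gho f n y \<in> Xp)"

lemma cre_fld: "cre (F.ph \<alpha>)" "cre (F.ps \<alpha>)" "cre F.Ph1" "cre F.Ph2"
  using Xp_I[of _ "GPh \<alpha>"] Xp_I[of _ "GPs \<alpha>"] Xp_I[of _ GB1] Xp_I[of _ GB2] by (auto simp: cre_def)

text \<open>In both sums of the normal product the outer mode is negative as soon as n \<le> 0. The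
  value n = 0 is the one that occurs in the differential.\<close>

lemma cre_np: "f \<in> par F p \<Longrightarrow> f' \<in> par F q \<Longrightarrow> cre f \<Longrightarrow> cre f' \<Longrightarrow> n \<le> 0 \<Longrightarrow> gho (mode F f (-1) f') n y \<in> Xp"
  unfolding np_F[symmetric]
  by (rule T.X.mode_mem_subspace[OF t_par t_par Xp_sub]) (auto simp: cre_def)

text \<open>Modulo images of creation operators, only \<open>e\<^sub>(\<^sub>-\<^sub>1\<^sub>) m + m\<close> and vectors of lower degree remain in \<open>D (m \<otimes> h)\<close>.\<close>
lemma D_image:
  assumes T: "cvs.subspace T" "Low \<subseteq> T" "\<And>m. E (-1) m + m \<in> T" shows "D x \<in> WT T"
proof -
  note sub = WT_sub[OF T(1)]
  have "{x. D x \<in> WT T} = UNIV"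
  proof (rule tensor_induct[OF T.s])
    show "cvs.subspace {x. D x \<in> WT T}" using sub by (auto simp: cvs.subspace_def X2)
    fix m h
    have pos: "s m' (mode F (F.ps \<alpha>) (0 - 1 - i) h) \<in> WT T" if "i \<ge> 0" for m' \<alpha> i
      unfolding T.act_F[symmetric] using that Xp_I[of "0 - 1 - i" "GPs \<alpha>"] by (intro Xp_WT[OF T(1)]) simp
    have 1: "YX (t (\<iota> pM) (F.ps Alpha1)) 0 (s m h) \<in> WT T"
    proof (rule T.act_mem[OF sub])
      fix i :: int
      have "i < 0 \<Longrightarrow> P i m \<in> T" using epq_Low(2)[of "nat (-1 - i)" m] T(2) by auto
      then show "s (P i m) (mode F (F.ps Alpha1) (0 - 1 - i) h) \<in> WT T" using pos[of i] WT_I[OF T(1)] by (cases "i < 0") auto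
    qed
    have 2: "YX (t (\<iota> qM) (F.ps Alpha2)) 0 (s m h) \<in> WT T"
    proof (rule T.act_mem[OF sub])
      fix i :: int
      have "i < 0 \<Longrightarrow> Q i m \<in> T" using epq_Low(3)[of "nat (-1 - i)" m] T(2) by auto
      then show "s (Q i m) (mode F (F.ps Alpha2) (0 - 1 - i) h) \<in> WT T" using pos[of i] WT_I[OF T(1)] by (cases "i < 0") auto
    qed
    \<comment> \<open>The mode e_(-1) of this summand and the linear term \<psi>_\<theta> of
      \<open>dF\<close> share the ghost factor \<psi>_\<theta>(0) h, so they are taken together as
      (e_(-1) m + m) tensored with it.\<close>
    have 3: "YX (t (\<iota> eM) (F.ps Theta)) 0 (s m h) + s m (mode F (F.ps Theta) 0 h) \<in> WT T"
    proof -
      let ?f = "\<lambda>i. s (E i m) (mode F (F.ps Theta) (0 - 1 - i) h)"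
      obtain N where N: "\<forall>n\<ge>N. E n m = 0" using trunc by blast
      obtain N' where N': "\<forall>n\<ge>N'. mode F (F.ps Theta) n h = 0" using F.self.trunc by blast
      let ?S = "{-N' - 1..N}"
      have fin: "{i. ?f i \<noteq> 0} \<subseteq> insert (-1) ?S"
      proof
        fix i assume "i \<in> {i. ?f i \<noteq> 0}"
        then have "?f i \<noteq> 0" by simp
        then have "\<not> i \<ge> N" "\<not> 0 - 1 - i \<ge> N'" using N N' by (auto simp: T.s1_simps T.s2_simps)
        then show "i \<in> insert (-1) ?S" by auto
      qed
      have "Sum_any ?f = (\<Sum>i\<in>insert (-1) ?S. ?f i)" by (rule Sum_any.expand_superset[OF _ fin]) simp
      also have "\<dots> = (\<Sum>i\<in>?S - {-1}. ?f i) + ?f (-1)" by (subst sum.insert_remove) (simp_all add: add.commute)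
      finally have "YX (t (\<iota> eM) (F.ps Theta)) 0 (s m h) + s m (mode F (F.ps Theta) 0 h)
         = (\<Sum>i\<in>?S - {-1}. ?f i) + s (E (-1) m + m) (mode F (F.ps Theta) 0 h)"
        unfolding T.act by (simp add: T.s1_simps)
      moreover have "?f i \<in> WT T" if "i \<noteq> -1" for i
      proof (cases "i < 0")
        case True
        have "E i m \<in> T" using epq_Low(1)[of "nat (-1 - i)" m] T(2) that True by auto
        then show ?thesis by (rule WT_I[OF T(1)])
      qed (use pos in simp)
      ultimately show ?thesis using WT_I[OF T(1) T(3)[of m]] by (auto intro!: cvs.subspace_add[OF sub] cvs.subspace_sum[OF sub])
    qed
    have 4: "gho F.dF 0 (s m h) - s m (mode F (F.ps Theta) 0 h) \<in> WT T"
    proof -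
      have c: "cre (mode F (F.ps Alpha1) (-1) (F.ps Alpha2))"
        unfolding cre_def using cre_np[OF F.ghost_par(2,2) cre_fld(2,2)] by simp
      have "gho F.dF 0 (s m h) - s m (mode F (F.ps Theta) 0 h)
         = - gho (mode F (F.ph Theta) (-1) (mode F (F.ps Alpha1) (-1) (F.ps Alpha2))) 0 (s m h)
           + gho (mode F (F.ps Alpha1) (-1) F.Ph1) 0 (s m h) + gho (mode F (F.ps Alpha2) (-1) F.Ph2) 0 (s m h)"
        by (simp add: F.dF_def CC.s2_simps X1 T.act_F)
      moreover have "\<dots> \<in> Xp"
        by (intro cvs.subspace_add[OF Xp_sub] cvs.subspace_neg[OF Xp_sub] cre_np[OF F.ghost_par(1) F.par_composites(5) cre_fld(1) c]
            cre_np[OF F.ghost_par(2,3) cre_fld(2,3)] cre_np[OF F.ghost_par(2,4) cre_fld(2,4)] order_refl)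
      ultimately show ?thesis by (simp add: Xp_WT[OF T(1)])
    qed
    have "D (s m h) = YX (t (\<iota> pM) (F.ps Alpha1)) 0 (s m h) + YX (t (\<iota> qM) (F.ps Alpha2)) 0 (s m h)
       + (YX (t (\<iota> eM) (F.ps Theta)) 0 (s m h) + s m (mode F (F.ps Theta) 0 h)) + (gho F.dF 0 (s m h) - s m (mode F (F.ps Theta) 0 h))"
      by (simp add: d_decomp X1)
    then show "s m h \<in> {x. D x \<in> WT T}" using cvs.subspace_add[OF sub cvs.subspace_add[OF sub cvs.subspace_add[OF sub 1 2] 3] 4] by simp
  qed
  then show ?thesis by blast
qed

definition tens :: "'m set \<Rightarrow> 'x set" where "tens I = cvs.span {s i h | i h. i \<in> I}"

lemma tens_sub: "cvs.subspace (tens I)" by (simp add: tens_def)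

text \<open>On ghost-free parts a coboundary contributes (e_(-1) + 1) m0 plus lower terms and I
  tensored with F contributes I, so \<open>hw_not_exact\<close> applies. A non-zero I is what the
  comparison of the simple quotients needs.\<close>

lemma hw_not_cohomologous:
  assumes I: "V_stable I" "v \<notin> I" and k: "k \<notin> \<nat>" and j: "j \<in> tens I" shows "s v (vac F) \<noteq> D x + j"
proof
  assume eq: "s v (vac F) = D x + j"
  have I_sub: "cvs.subspace I" using I(1) by (simp add: V_stable_def)
  define T where "T = {i + (E (-1) m0 + m0) + m1 | i m0 m1. i \<in> I \<and> m1 \<in> Low}"
  have T: "cvs.subspace T"
  proof (rule cvs.subspaceI)
    show "0 \<in> T" unfolding T_def using cvs.subspace_0[OF I_sub] cvs.subspace_0[OF Low_sub]
      by (auto intro!: exI[of _ 0] simp: lin2_simps)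
  next
    fix x y assume "x \<in> T" "y \<in> T"
    then obtain i m0 m1 i' m0' m1' where "x = i + (E (-1) m0 + m0) + m1" "i \<in> I" "m1 \<in> Low"
      "y = i' + (E (-1) m0' + m0') + m1'" "i' \<in> I" "m1' \<in> Low" unfolding T_def by blast
    then show "x + y \<in> T" unfolding T_def using cvs.subspace_add[OF I_sub] cvs.subspace_add[OF Low_sub]
      by (intro CollectI exI[of _ "i + i'"] exI[of _ "m0 + m0'"] exI[of _ "m1 + m1'"]) (simp add: lin2_simps algebra_simps)
  next
    fix c x assume "x \<in> T"
    then obtain i m0 m1 where "x = i + (E (-1) m0 + m0) + m1" "i \<in> I" "m1 \<in> Low" unfolding T_def by blast
    then show "c *\<^sub>C x \<in> T" unfolding T_def using cvs.subspace_scale[OF I_sub] cvs.subspace_scale[OF Low_sub]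
      by (intro CollectI exI[of _ "c *\<^sub>C i"] exI[of _ "c *\<^sub>C m0"] exI[of _ "c *\<^sub>C m1"]) (simp add: lin2_simps cvs.scale_right_distrib)
  qed
  have mem: "i \<in> I \<Longrightarrow> i \<in> T" "m \<in> Low \<Longrightarrow> m \<in> T" "E (-1) m + m \<in> T" for i m
    unfolding T_def using cvs.subspace_0[OF I_sub] cvs.subspace_0[OF Low_sub]
    by (force simp: lin2_simps intro: exI[of _ 0])+
  have "D x \<in> WT T" using mem by (intro D_image T) auto
  moreover have "tens I \<subseteq> WT T" unfolding tens_def using mem(1) by (intro cvs.span_minimal WT_sub T) (auto intro: WT_I[OF T])
  ultimately have "s v (vac F) \<in> WT T" unfolding eq using j cvs.subspace_add[OF WT_sub[OF T]] by blast
  then obtain w where w: "w \<in> T" "s v (vac F) - s w (vac F) \<in> Xp" unfolding WT_def by blast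
  then have "v - w = 0" by (intro Xp_vacuum) (simp add: T.s1_simps)
  then have "v \<in> T" using w(1) by simp
  then obtain i m0 m1 where "v = i + (E (-1) m0 + m0) + m1" "i \<in> I" "m1 \<in> Low" unfolding T_def by blast
  then show False using hw_not_exact[OF I k] by blast
qed

end

section \<open>Submodules of the cohomology and of M\<close>

context hw_mod_nc
begin

text \<open>On these vectors every \<omega>_(n) with n \<ge> 0 acts by a scalar.\<close>

definition OmV :: "int \<Rightarrow> 'm set" where "OmV c = {x \<in> OmW c \<inter> \<Omega>. \<forall>n\<ge>1. Om n x = 0}"

lemma OmV_sub: "cvs.subspace (OmV c)"
  using OmW_sub[of c] \<Omega>_sub by (auto simp: OmV_def cvs.subspace_def lin2_simps)

lemma OmV_E: "x \<in> OmV c \<Longrightarrow> - E (-1) x \<in> OmV (c + 1)"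
proof -
  assume x: "x \<in> OmV c"
  have "E (-1) x \<in> OmW (c + 1)" using OmW_letter[of eM 1 x c "-1"] x by (simp add: OmV_def lie_table)
  moreover have "Om n (E (-1) x) = 0" if "n \<ge> 1" for n
    using epq_comm(7)[of n "-1" x] x that by (simp add: OmV_def \<Omega>_def lin2_simps)
  ultimately have "E (-1) x \<in> OmV (c + 1)" using E_\<Omega>[of x "-1"] x by (simp add: OmV_def)
  then show ?thesis by (rule cvs.subspace_neg[OF OmV_sub])
qed

lemma OmV_decomp:
  assumes "x \<in> \<Omega>" "\<And>n. n \<ge> 1 \<Longrightarrow> Om n x = 0"
  obtains F f where "finite F" "\<And>c. c \<in> F \<Longrightarrow> f c \<in> OmV c" "x = (\<Sum>c\<in>F. f c)"
proof -
  obtain F f where F: "finite F" "\<And>c. f c \<in> OmW c" "x = (\<Sum>c\<in>F. f c)" using OmW_decomp by blast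
  let ?U = "{x \<in> \<Omega>. \<forall>n\<ge>1. Om n x = 0}"
  have U: "cvs.subspace ?U" using \<Omega>_sub by (auto simp: cvs.subspace_def lin2_simps)
  have st: "Om 0 x \<in> ?U" if "x \<in> ?U" for x
    using that Om_\<Omega>[of x 0] epq_comm(10)[of _ 0 x] by (auto simp: lin2_simps)
  have "f c \<in> ?U" if "c \<in> F" for c
  proof (rule eigen_components[OF lin2 U st F(1)])
    show "Om 0 (f c) = (wt wM + of_int c) *\<^sub>C f c" for c using F(2)[of c] by (simp add: OmW_def)
    show "(\<Sum>c\<in>F. f c) \<in> ?U" unfolding F(3)[symmetric] using assms by simp
  qed (use that in \<open>auto simp: inj_on_def\<close>)
  then have "f c \<in> OmV c" if "c \<in> F" for c using F(2)[of c] that by (simp add: OmV_def)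
  then show thesis using that F(1,3) by blast
qed

end

context brst_mod
begin

lemma v_generates: "V_stable U \<Longrightarrow> v \<in> U \<Longrightarrow> U = UNIV"
  by (rule hw_cyclic) (auto simp: V_stable_def)

lemma v_OmV: "v \<in> OmV 0"
  using hw_pos[of wM] hw_wt[of wM] by (auto simp: OmV_def OmW_def \<Omega>_def)

text \<open>The inverse image, among the cocycles, of a W-submodule of the cohomology.\<close>

definition W_stable :: "'x set \<Rightarrow> bool" where
  "W_stable Z \<longleftrightarrow> cvs.subspace Z \<and> range D \<subseteq> Z \<and> (\<forall>x\<in>Z. D x = 0) \<and> (\<forall>c n. \<forall>x\<in>Z. mode C d 0 c = 0 \<longrightarrow> YX c n x \<in> Z)"

text \<open>\<omega> is not a cocycle, so Z gives no stability under \<omega>_(n). Asking for all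
  words in the \<omega>_(n) with n \<ge> 0 selects the largest part that is stable.\<close>

definition Om2 :: "'x set \<Rightarrow> 'm set" where
  "Om2 Z = {m \<in> \<Omega>. \<forall>ns. s (foldr (\<lambda>n. Om (int n)) ns m) (vac F) \<in> Z}"

lemma Om2_D: "m \<in> Om2 Z \<Longrightarrow> m \<in> \<Omega>" "m \<in> Om2 Z \<Longrightarrow> s m (vac F) \<in> Z"
  by (auto simp: Om2_def dest: spec[of _ "[]"])

lemma Om2_Om: assumes "m \<in> Om2 Z" "n \<ge> 0" shows "Om n m \<in> Om2 Z"
proof -
  have "s (foldr (\<lambda>n. Om (int n)) ns (Om n m)) (vac F) \<in> Z" for ns
  proof -
    have "s (foldr (\<lambda>n. Om (int n)) (ns @ [nat n]) m) (vac F) \<in> Z" using assms(1) unfolding Om2_def by blast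
    then show ?thesis using assms(2) by simp
  qed
  then show ?thesis using assms Om_\<Omega>[of m n] by (simp add: Om2_def)
qed

lemma Om2_max:
  assumes "T \<subseteq> \<Omega>" "\<And>x n. x \<in> T \<Longrightarrow> n \<ge> 0 \<Longrightarrow> Om n x \<in> T" "\<And>x. x \<in> T \<Longrightarrow> s x (vac F) \<in> Z" shows "T \<subseteq> Om2 Z"
proof
  fix m assume m: "m \<in> T"
  have "foldr (\<lambda>n. Om (int n)) ns m \<in> T" for ns by (induction ns) (simp_all add: m assms(2))
  then show "m \<in> Om2 Z" using assms(1,3) m by (auto simp: Om2_def)
qed

lemma Om2_sub: "cvs.subspace Z \<Longrightarrow> cvs.subspace (Om2 Z)"
proof -
  have lin: "clin (foldr (\<lambda>n. Om (int n)) ns)" for ns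
  proof (induction ns)
    case Nil then show ?case by (simp add: clinI)
  next
    case (Cons n ns) show ?case by (rule clinI) (simp add: clin_simps[OF Cons] lin2_simps)
  qed
  show "cvs.subspace Z \<Longrightarrow> cvs.subspace (Om2 Z)"
    using \<Omega>_sub by (simp add: Om2_def cvs.subspace_def clin_simps[OF lin] T.s1_simps)
qed

text \<open>All words in \<omega> act on m by scalars, so the single condition on m itself
  suffices.\<close>

lemma OmV_Om2:
  assumes Z: "cvs.subspace Z" and m: "m \<in> OmV c" "s m (vac F) \<in> Z" shows "m \<in> Om2 Z"
proof -
  have "{c *\<^sub>C m | c. True} \<subseteq> Om2 Z"
  proof (rule Om2_max)
    show "{c *\<^sub>C m |c. True} \<subseteq> \<Omega>" using m cvs.subspace_scale[OF \<Omega>_sub] by (auto simp: OmV_def)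
    fix x assume "x \<in> {c *\<^sub>C m |c. True}"
    then obtain e where x: "x = e *\<^sub>C m" by blast
    show "s x (vac F) \<in> Z" using cvs.subspace_scale[OF Z m(2)] by (simp add: x T.s1_simps)
    fix n :: int assume "n \<ge> 0"
    then have "Om n m = (if n = 0 then wt wM + of_int c else 0) *\<^sub>C m" using m(1) by (auto simp: OmV_def OmW_def)
    then show "Om n x \<in> {c *\<^sub>C m |c. True}" by (auto simp: x lin2_simps)
  qed
  moreover have "m = 1 *\<^sub>C m" by simp
  ultimately show ?thesis by blast
qed

text \<open>Verifies the hypotheses of \<open>generated_V_stable\<close>. A state u in
  \<open>adj.\<Omega>\<close> gives a cocycle, so its modes preserve Z, and e is such a state.
  Division by e_(-1) is allowed because Z contains the coboundaries and e_(-1) is cohomologous to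
  -1.\<close>

lemma Om2_generates:
  assumes Z: "W_stable Z" obtains U where "V_stable U" "Om2 Z \<subseteq> U" "U \<inter> \<Omega> \<subseteq> Om2 Z"
proof -
  have Zs: "cvs.subspace Z" and Zr: "range D \<subseteq> Z" and ZC: "\<And>c n x. x \<in> Z \<Longrightarrow> mode C d 0 c = 0 \<Longrightarrow> YX c n x \<in> Z"
    using Z by (auto simp: W_stable_def)
  note T = Om2_sub[OF Zs]
  have V: "YM u n x \<in> Om2 Z" if x: "x \<in> Om2 Z" and u: "u \<in> adj.\<Omega>" for u n x
  proof -
    \<comment> \<open>The whole span is treated at once, since commuting \<omega> past u_(n)
      replaces u by \<omega>_(j) u.\<close>
    let ?T = "cvs.span {YM u n x | u n x. u \<in> adj.\<Omega> \<and> x \<in> Om2 Z}"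
    have "?T \<subseteq> Om2 Z"
    proof (rule Om2_max)
      show "?T \<subseteq> \<Omega>" using vacuum_state_\<Omega>[OF _ Om2_D(1)] by (intro cvs.span_minimal \<Omega>_sub) blast
      fix y assume y: "y \<in> ?T"
      have "?T \<subseteq> {y. s y (vac F) \<in> Z}"
      proof (rule cvs.span_minimal)
        show "cvs.subspace {y. s y (vac F) \<in> Z}" using Zs by (auto simp: cvs.subspace_def T.s1_simps)
        have "s (YM u n x) (vac F) \<in> Z" if "u \<in> adj.\<Omega>" "x \<in> Om2 Z" for u n x
          using ZC[OF Om2_D(2)[OF that(2)] CX.D_s[OF that(1)], of n] by (simp add: T.act_V)
        then show "{YM u n x | u n x. u \<in> adj.\<Omega> \<and> x \<in> Om2 Z} \<subseteq> {y. s y (vac F) \<in> Z}" by blast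
      qed
      then show "s y (vac F) \<in> Z" using y by blast
      fix m :: int assume m: "m \<ge> 0"
      have "?T \<subseteq> {y. Om m y \<in> ?T}"
      proof (rule cvs.span_minimal)
        show "cvs.subspace {y. Om m y \<in> ?T}"
          by (auto simp: cvs.subspace_def lin2_simps cvs.span_zero intro: cvs.span_add cvs.span_scale)
        have "Om m (YM u n x) \<in> ?T" if u: "u \<in> adj.\<Omega>" "x \<in> Om2 Z" for u n x
        proof -
          have "YM (adj.Om (int j) u) l x \<in> ?T" for j l using adj.Om_\<Omega>[OF u(1), of "int j"] u(2) by (intro cvs.span_base) auto
          moreover have "YM u n (Om m x) \<in> ?T" using u Om2_Om[OF u(2) m] by (intro cvs.span_base) auto
          ultimately show ?thesis unfolding Om_vacuum_state
            by (intro cvs.span_add Sum_any_mem_subspace cvs.subspace_span cvs.span_scale)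
        qed
        then show "{YM u n x | u n x. u \<in> adj.\<Omega> \<and> x \<in> Om2 Z} \<subseteq> {y. Om m y \<in> ?T}" by blast
      qed
      then show "Om m y \<in> ?T" using y by blast
    qed
    moreover have "YM u n x \<in> ?T" using that by (intro cvs.span_base) blast
    ultimately show ?thesis by blast
  qed
  have e\<Omega>: "\<iota> eM \<in> adj.\<Omega>" by (auto simp: adj.\<Omega>_def V_ope elim!: nonneg_int_cases)
  show thesis
  proof (rule generated_V_stable[OF T])
    show "Om2 Z \<subseteq> \<Omega>" using Om2_D by blast
    show "E j x \<in> Om2 Z" if "x \<in> Om2 Z" for x j using V[OF that e\<Omega>] .
    show "x \<in> Om2 Z" if x: "x \<in> \<Omega>" "E (-1) x \<in> Om2 Z" for x
    proof -
      have "{x \<in> \<Omega>. E (-1) x \<in> Om2 Z} \<subseteq> Om2 Z"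
      proof (rule Om2_max)
        fix x assume x: "x \<in> {x \<in> \<Omega>. E (-1) x \<in> Om2 Z}"
        have "eX (-1) (s x (vac F)) + s x (vac F) \<in> Z" using e_cohomologous[OF D_s[of x]] x Zr by auto
        moreover have "eX (-1) (s x (vac F)) \<in> Z" using x Om2_D(2) by (simp add: T.act_V)
        ultimately show "s x (vac F) \<in> Z" using cvs.subspace_diff[OF Zs, of "eX (-1) (s x (vac F)) + s x (vac F)"] by force
        fix n :: int assume n: "n \<ge> 0"
        have "E (-1) (Om n x) = Om n (E (-1) x) - E (n - 1) x" using epq_comm(7)[of n "-1" x] by simp
        moreover have "E (n - 1) x \<in> Om2 Z"
          using x n cvs.subspace_0[OF T] by (cases "n = 0") (auto simp: \<Omega>_def)
        ultimately show "Om n x \<in> {x \<in> \<Omega>. E (-1) x \<in> Om2 Z}"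
          using x n Om2_Om[of "E (-1) x" Z n] Om_\<Omega>[of x n] by (auto intro: cvs.subspace_diff[OF T])
      qed auto
      then show ?thesis using x by blast
    qed
  qed (use Om2_Om V that in auto)
qed

text \<open>-e_(-1) is the identity on cohomology but raises the weight of \<omega>_(0) by 1, so a
  representative can be moved to a higher weight.\<close>

lemma s_e_power: "m \<in> OmV c \<Longrightarrow> ((\<lambda>x. - E (-1) x) ^^ r) m \<in> OmV (c + int r) \<and> s (((\<lambda>x. - E (-1) x) ^^ r) m) (vac F) \<simeq> s m (vac F)"
proof (induction r)
  case 0
  then show ?case using coh_refl by simp
next
  case (Suc r)
  let ?y = "((\<lambda>x. - E (-1) x) ^^ r) m"
  have y: "?y \<in> OmV (c + int r)" "s ?y (vac F) \<simeq> s m (vac F)" using Suc by auto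
  have "D (s ?y (vac F)) = 0" using y(1) by (intro D_s) (simp add: OmV_def)
  from coh_scale[OF coh_e[OF this], of "-1"] have "s (- E (-1) ?y) (vac F) \<simeq> s ?y (vac F)"
    by (simp add: T.act_V T.s1_simps cvs.scale_minus_left)
  then show ?case using OmV_E[OF y(1)] coh_trans[OF _ y(2)] by (simp add: algebra_simps)
qed

lemma W_stable_coh: "W_stable Z \<Longrightarrow> x \<simeq> y \<Longrightarrow> y \<in> Z \<Longrightarrow> x \<in> Z"
  unfolding W_stable_def coh_def using cvs.subspace_add[of Z "x - y" y] by auto

text \<open>The weight components of a representative need not lie in Z separately. Shifting all of
  them to one common weight K makes the representative a single eigenvector without changing its
  class, and then \<open>OmV_Om2\<close> applies.\<close>

lemma Om2_rep:
  assumes Z: "W_stable Z" and z: "z \<in> Z" shows "\<exists>m\<in>Om2 Z. z \<simeq> s m (vac F)"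
proof -
  have "D z = 0" using Z z by (simp add: W_stable_def)
  then obtain m where m: "m \<in> \<Omega>" "\<forall>n\<ge>1. Om n m = 0" "z \<simeq> s m (vac F)" using cocycle_representative by blast
  obtain F' f where f: "finite F'" "\<And>c. c \<in> F' \<Longrightarrow> f c \<in> OmV c" "m = (\<Sum>c\<in>F'. f c)" using OmV_decomp[of m] m by blast
  define K where "K = Max (insert 0 F')"
  have K: "c \<le> K" if "c \<in> F'" for c unfolding K_def using f(1) that by (intro Max_ge) auto
  let ?e = "\<lambda>c. ((\<lambda>x. - E (-1) x) ^^ nat (K - c)) (f c)"
  define m' where "m' = (\<Sum>c\<in>F'. ?e c)"
  have e: "?e c \<in> OmV K" "s (?e c) (vac F) \<simeq> s (f c) (vac F)" if "c \<in> F'" for c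
    using s_e_power[OF f(2)[OF that], of "nat (K - c)"] K[OF that] by auto
  have "m' \<in> OmV K" unfolding m'_def by (intro cvs.subspace_sum OmV_sub e)
  moreover have "s m' (vac F) \<simeq> s m (vac F)"
  proof -
    have "(\<Sum>c\<in>G. s (?e c) (vac F)) \<simeq> (\<Sum>c\<in>G. s (f c) (vac F))" if "finite G" "G \<subseteq> F'" for G
      using that by (induction G rule: finite_induct) (auto intro: coh_refl coh_add e)
    from this[OF f(1)] show ?thesis by (simp add: m'_def f(3) T.s1_simps)
  qed
  ultimately show ?thesis
    using OmV_Om2[of Z m' K] W_stable_coh[OF Z coh_trans[OF _ coh_sym[OF m(3)]] z] coh_trans[OF m(3) coh_sym] Z
    unfolding W_stable_def by blast
qed

theorem W_stable_all:
  assumes Z: "W_stable Z" "s v (vac F) \<in> Z" and x: "D x = 0" shows "x \<in> Z"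
proof -
  obtain U where U: "V_stable U" "Om2 Z \<subseteq> U" "U \<inter> \<Omega> \<subseteq> Om2 Z" by (rule Om2_generates[OF Z(1)])
  have "v \<in> Om2 Z" using OmV_Om2[OF _ v_OmV Z(2)] Z(1) by (simp add: W_stable_def)
  then have "U = UNIV" using v_generates U(1,2) by blast
  moreover obtain m where "m \<in> \<Omega>" "x \<simeq> s m (vac F)" using cocycle_representative[OF x] by blast
  ultimately show ?thesis using U(3) Om2_D(2) W_stable_coh[OF Z(1)] by blast
qed

text \<open>I is any bound for the submodules that miss v: zero for irreducible M, the kernel of the
  map to the simple quotient for the vacuum module.\<close>

theorem W_stable_proper:
  assumes Z: "W_stable Z" "s v (vac F) \<notin> Z" and I: "\<And>U. V_stable U \<Longrightarrow> v \<notin> U \<Longrightarrow> U \<subseteq> I" and z: "z \<in> Z"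
  shows "\<exists>m\<in>I \<inter> \<Omega>. z \<simeq> s m (vac F)"
proof -
  obtain U where U: "V_stable U" "Om2 Z \<subseteq> U" "U \<inter> \<Omega> \<subseteq> Om2 Z" by (rule Om2_generates[OF Z(1)])
  have "v \<notin> U" using U(3) v_OmV Z(2) Om2_D(2) by (auto simp: OmV_def)
  then have "Om2 Z \<subseteq> I" using I U(1,2) by blast
  then show ?thesis using Om2_rep[OF Z(1) z] Om2_D(1) by blast
qed

end

section \<open>The cocycles \<open>J\<close> and \<open>L\<close>\<close>

lemma (in va_mod) transl_mode_action:
  assumes "vsa V" "a \<in> par V p" shows "Y (transl V a) n x = - of_int n *\<^sub>C Y a (n - 1) x"
proof -
  interpret V: vsa V by fact
  have 1: "Sum_any (\<lambda>j::nat. ((-1) ^ j * (of_int (-2) gchoose j)) *\<^sub>C Y a (-2 - int j) (Y (vac V) (n + int j) x))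
     = (if n < 0 then - of_int n *\<^sub>C Y a (n - 1) x else 0)"
  proof (cases "n < 0")
    case True
    show ?thesis
      by (subst Sum_any_single[where a = "nat (-1 - n)"])
         (use True gbinomial_minus_two[of "nat (-1 - n)"] in \<open>auto simp: vacuum lin2_simps\<close>)
  qed (simp add: vacuum lin2_simps)
  have 2: "Sum_any (\<lambda>j::nat. ((-1) ^ j * (of_int (-2) gchoose j)) *\<^sub>C Y (vac V) (n + (-2) - int j) (Y a (int j) x))
     = (if n \<ge> 1 then of_int n *\<^sub>C Y a (n - 1) x else 0)"
  proof (cases "n \<ge> 1")
    case True
    show ?thesis
      by (subst Sum_any_single[where a = "nat (n - 1)"])
         (use True gbinomial_minus_two[of "nat (n - 1)"] in \<open>auto simp: vacuum lin2_simps\<close>)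
  qed (simp add: vacuum lin2_simps)
  show ?thesis unfolding transl_def using associativity[OF assms(2) V.vac_even, of "-2" n x] unfolding 1 2
    by (cases "n < 0"; cases "n \<ge> 1") auto
qed

context vsa
begin

lemma transl_lin: "clin (transl V)" unfolding transl_def by (rule self.lin1)

lemma transl_np:
  assumes "a \<in> par V p" "b \<in> par V q" shows "transl V (mode V a (-1) b) = mode V a (-2) b + mode V a (-1) (transl V b)"
proof -
  have "Sum_any (\<lambda>j::nat. mode V a (-1 - int j) (mode V b (-2 + int j) (vac V)))
     = (\<Sum>j<2. mode V a (-1 - int j) (mode V b (-2 + int j) (vac V)))"
    by (rule Sum_any_lessThan) (simp add: mode_vac self.lin2_simps)
  then show ?thesis unfolding transl_def
    using self.normal_product_mode[OF assms, of "-2" "vac V"] by (simp add: mode_vac self.lin2_simps numeral_2_eq_2 creation add.commute)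
qed

text \<open>Both \<open>J\<close> (with \<open>\<tau> = 0\<close>, \<open>w = 0\<close>) and \<open>L\<close> (with \<open>\<tau> = 1\<close>, \<open>c = 0\<close>) act in this way on primary fields.\<close>
definition quasi :: "'v \<Rightarrow> complex \<Rightarrow> complex \<Rightarrow> complex \<Rightarrow> 'v \<Rightarrow> bool" where
  "quasi L \<tau> c w f \<longleftrightarrow> mode V L 0 f = \<tau> *\<^sub>C transl V f + c *\<^sub>C f \<and> mode V L 1 f = w *\<^sub>C f \<and> (\<forall>j\<ge>2. mode V L (int j) f = 0)"

lemma quasi_add: "quasi L \<tau> c w f \<Longrightarrow> quasi L \<tau> c w f' \<Longrightarrow> quasi L \<tau> c w (f + f')"
  by (simp add: quasi_def self.lin2_simps clin_simps[OF transl_lin] cvs.scale_right_distrib)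

lemma quasi_neg: "quasi L \<tau> c w f \<Longrightarrow> quasi L \<tau> c w (- f)"
  by (simp add: quasi_def self.lin2_simps clin_simps[OF transl_lin])

text \<open>Leibniz rule for L on a product of two fields with regular operator product; regularity
  removes the non-negative modes that the commutator leaves at the higher poles.\<close>

lemma quasi_np:
  assumes L: "L \<in> par V False" and a: "a \<in> par V p" "b \<in> par V q" and q: "quasi L \<tau> c w a" "quasi L \<tau> c' w' b"
    and reg: "\<And>j. mode V a (int j) b = 0"
  shows "quasi L \<tau> (c + c') (w + w') (mode V a (-1) b)"
proof -
  note La = q(1)[unfolded quasi_def] and Lb = q(2)[unfolded quasi_def]
  have m: "mode V L m (mode V a (-1) b) = mode V a (-1) (mode V L m b) + \<tau> *\<^sub>C (- of_int (m - 1)) *\<^sub>C mode V a (m - 2) b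
      + c *\<^sub>C mode V a (m - 1) b + (of_int m * w) *\<^sub>C mode V a (m - 2) b" for m
  proof -
    have "Sum_any (\<lambda>j::nat. (of_int m gchoose j) *\<^sub>C mode V (mode V L (int j) a) (m + (-1) - int j) b)
       = (\<Sum>j<2. (of_int m gchoose j) *\<^sub>C mode V (mode V L (int j) a) (m + (-1) - int j) b)"
      by (rule Sum_any_lessThan) (use La in \<open>simp add: self.lin1_simps\<close>)
    then show ?thesis
      using self.commutator[OF L a(1), of m "-1" b] self.transl_mode_action[OF vsa_axioms a(1), of "m - 1" b] La
      by (simp add: numeral_2_eq_2 self.lin1_simps algebra_simps)
  qed
  have r: "mode V a (int j - 2) b = 0" "mode V a (int j - 1) b = 0" if "j \<ge> 2" for j
    using reg[of "j - 2"] reg[of "j - 1"] that by (simp_all add: of_nat_diff)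
  have r0: "mode V a 0 b = 0" using reg[of 0] by simp
  show ?thesis unfolding quasi_def
    using Lb r r0 by (simp add: m transl_np[OF a] self.lin2_simps cvs.scale_left_distrib cvs.scale_right_distrib)
qed

text \<open>Explicit computation gives the modes of f on L; skew-symmetry turns them into modes of L
  on f.\<close>

lemma quasi_skew:
  assumes "L \<in> par V False" "f \<in> par V p" "mode V f 0 L = (w - \<tau>) *\<^sub>C transl V f - c *\<^sub>C f" "mode V f 1 L = w *\<^sub>C f"
    "\<And>j. j \<ge> 2 \<Longrightarrow> mode V f (int j) L = 0"
  shows "quasi L \<tau> c w f"
proof -
  have s: "mode V L (int l) f = - ((-1) ^ l) *\<^sub>C (\<Sum>j<2. (-1) ^ j *\<^sub>C mode V (mode V f (int (l + j)) L) (-1 - int j) (vac V))" for l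
  proof -
    have "Sum_any (\<lambda>j::nat. (-1) ^ j *\<^sub>C mode V (mode V f (int l + int j) L) (-1 - int j) (vac V))
       = (\<Sum>j<2. (-1) ^ j *\<^sub>C mode V (mode V f (int l + int j) L) (-1 - int j) (vac V))"
      by (rule Sum_any_lessThan) (use assms(5) in \<open>simp flip: of_nat_add add: self.lin1_simps\<close>)
    then show ?thesis using skew[OF assms(2,1), of "int l"] by (simp add: power_int_of_nat)
  qed
  have "mode V L (int l) f = 0" if "l \<ge> 2" for l
    using assms(5)[of l] assms(5)[of "Suc l"] that unfolding s by (simp add: numeral_2_eq_2 self.lin1_simps add.commute)
  moreover have "mode V L 1 f = w *\<^sub>C f"
    using s[of 1] assms(4) assms(5)[of 2] by (simp add: numeral_2_eq_2 self.lin1_simps creation)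
  moreover have "mode V L 0 f = \<tau> *\<^sub>C transl V f + c *\<^sub>C f"
    using s[of 0] assms(3,4) by (simp add: numeral_2_eq_2 self.lin1_simps creation transl_def cvs.scale_left_diff_distrib)
  ultimately show ?thesis by (simp add: quasi_def)
qed

text \<open>By skew-symmetry f_(0)L is -L_(0)f plus the translate of L_(1)f, and for charge 0 and
  weight \<tau> these cancel.\<close>

lemma quasi_closed:
  assumes "L \<in> par V False" "f \<in> par V p" "quasi L \<tau> 0 \<tau> f" shows "mode V f 0 L = 0"
proof -
  have "Sum_any (\<lambda>j::nat. (-1) ^ j *\<^sub>C mode V (mode V L (0 + int j) f) (-1 - int j) (vac V))
     = (\<Sum>j<2. (-1) ^ j *\<^sub>C mode V (mode V L (0 + int j) f) (-1 - int j) (vac V))"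
    by (rule Sum_any_lessThan) (use assms(3) in \<open>simp add: quasi_def self.lin1_simps\<close>)
  then show ?thesis using skew[OF assms(1,2), of 0] assms(3)
    by (simp add: quasi_def numeral_2_eq_2 self.lin1_simps creation transl_def)
qed

end

context ghost
begin

definition Jgh :: 'f where
  "Jgh = - mode F (ph Alpha1) (-1) (ps Alpha1) + mode F (ph Alpha2) (-1) (ps Alpha2) + mode F Ph1 (-1) Ph2"

definition Lgh :: 'f where
  "Lgh = (\<Sum>\<alpha>\<in>{Alpha1, Alpha2}. (1/2) *\<^sub>C (mode F (transl F (ph \<alpha>)) (-1) (ps \<alpha>) - mode F (ph \<alpha>) (-1) (transl F (ps \<alpha>))))
     + mode F (transl F (ph Theta)) (-1) (ps Theta)
     + (1/2) *\<^sub>C (mode F (transl F Ph2) (-1) Ph1 - mode F Ph2 (-1) (transl F Ph1))"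

text \<open>The charge of \<psi>_\<alpha> is minus the eigenvalue of ad h on the root vector of
  \<alpha>, where h = diag(-1/3, 2/3, -1/3), so that u_\<alpha> \<psi>_\<alpha> is neutral.\<close>

fun charge :: "gh \<Rightarrow> complex" where
  "charge (GPh Alpha1) = -1" | "charge (GPs Alpha1) = 1" | "charge (GPh Alpha2) = 1" | "charge (GPs Alpha2) = -1"
| "charge (GPh Theta) = 0" | "charge (GPs Theta) = 0" | "charge GB1 = -1" | "charge GB2 = 1"

fun cwt :: "gh \<Rightarrow> complex" where
  "cwt (GPh Theta) = 0" | "cwt (GPs Theta) = 1" | "cwt _ = 1/2"

lemma fld_mode_comm:
  "mode F (fld i) m (mode F (fld j) n x) = ssgn (gpar i) (gpar j) *\<^sub>C mode F (fld j) n (mode F (fld i) m x)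
    + (if j = co i \<and> m + n = -1 then gsg j *\<^sub>C x else 0)"
  using self.commutator0[OF fld_par fld_par, of i j m n x] fld_ope[of i _ j] fld_ope[of i 0 j]
  by (simp add: self.lin1_simps mode_of_vac)

lemma Jgh_fld: "Jgh = - mode F (fld (GPh Alpha1)) (-1) (fld (GPs Alpha1)) + mode F (fld (GPh Alpha2)) (-1) (fld (GPs Alpha2))
    + mode F (fld GB1) (-1) (fld GB2)"
  by (simp add: Jgh_def)

lemma transl_fld_mode: "mode F (transl F (fld i)) (-1) x = mode F (fld i) (-2) x"
  using self.transl_mode_action[OF vsa_axioms fld_par, of i "-1" x] by simp

lemma Lgh_fld: "Lgh = (1/2) *\<^sub>C (mode F (fld (GPh Alpha1)) (-2) (fld (GPs Alpha1)) - mode F (fld (GPh Alpha1)) (-1) (mode F (fld (GPs Alpha1)) (-2) (vac F)))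
   + (1/2) *\<^sub>C (mode F (fld (GPh Alpha2)) (-2) (fld (GPs Alpha2)) - mode F (fld (GPh Alpha2)) (-1) (mode F (fld (GPs Alpha2)) (-2) (vac F)))
   + mode F (fld (GPh Theta)) (-2) (fld (GPs Theta))
   + (1/2) *\<^sub>C (mode F (fld GB2) (-2) (fld GB1) - mode F (fld GB2) (-1) (mode F (fld GB1) (-2) (vac F)))"
  unfolding Lgh_def using transl_fld_mode[of "GPh Alpha1"] transl_fld_mode[of "GPh Alpha2"] transl_fld_mode[of "GPh Theta"] transl_fld_mode[of GB2]
  by (simp add: transl_def)

lemma fld_Jgh: "mode F (fld i) (int l) Jgh = (if l = 0 then - charge i *\<^sub>C fld i else 0)"
proof -
  have v: "mode F (fld j) (-1) (vac F) = fld j" for j by (rule creation)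
  show ?thesis
    unfolding Jgh_fld
    by (cases i rule: charge.cases)
       (simp_all add: self.lin2_simps fld_mode_comm fld_ope v del: fld.simps)
qed

lemma fld_Lgh: "mode F (fld i) (int l) Lgh
   = (if l = 0 then (cwt i - 1) *\<^sub>C transl F (fld i) else if l = 1 then cwt i *\<^sub>C fld i else 0)"
  unfolding Lgh_fld
  by (cases i rule: charge.cases)
     (auto simp add: self.lin2_simps fld_mode_comm fld_ope creation mode_vac transl_def cvs.scale_right_diff_distrib
       simp del: fld.simps simp flip: cvs.scale_left_distrib)

end

context brst
begin

abbreviation "hM \<equiv> diag3 (-1/3) (2/3) (-1/3)"
abbreviation "Jc \<equiv> J_cocycle V \<iota> F g t"
abbreviation "Lc \<equiv> L_cocycle k V \<iota> F g t"

lemma hM_cartan: "hM \<in> cartan" unfolding cartan_def by (intro CollectI exI[of _ "-1/3"] exI[of _ "2/3"]) auto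

lemma hM_sl3 [simp]: "hM \<in> sl3" by (rule cartan_sl3[OF hM_cartan])

lemma Jc_eq: "Jc = t (\<iota> hM) (vac F) + t (vac V) F.Jgh"
  by (simp add: J_cocycle_def F.Jgh_def)

lemma Lc_eq: "Lc = t (sug + transl V (\<iota> xM)) (vac F) + t (vac V) F.Lgh"
  by (simp add: L_cocycle_def F.Lgh_def xM_def sug_def)

lemma transl_F: "f \<in> par F p \<Longrightarrow> transl C (t (vac V) f) = t (vac V) (transl F f)"
  using CC.act_F[of f "-2" "vac V" "vac F"] by (simp add: transl_def t_vac)

lemma transl_V: "transl C (t u (vac F)) = t (transl V u) (vac F)"
  using CC.act_V[of u "-2" "vac V" "vac F"] by (simp add: transl_def t_vac)

lemma par_Jc: "Jc \<in> par C False" and par_Lc: "Lc \<in> par C False"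
proof -
  have "F.Jgh \<in> par F False" unfolding F.Jgh_def
    using F.par_np[OF F.ghost_par(3,4)] by (intro cvs.subspace_add[OF F.par_subspace] cvs.subspace_neg[OF F.par_subspace]) simp_all
  then show "Jc \<in> par C False" unfolding Jc_eq by (intro cvs.subspace_add[OF C.par_subspace] t_par) simp_all
  have m: "mode F (F.fld i) n (mode F (F.fld (co i)) l (vac F)) \<in> par F False" for i n l
    using F.par_mode[OF F.fld_par F.par_mode[OF F.fld_par F.vac_even], of i n "co i" l] by simp
  have e: "F.fld i = mode F (F.fld i) (-1) (vac F)" for i by (simp add: F.creation)
  have "mode F (F.fld i) n (F.fld (co i)) \<in> par F False" for i n using m[of i n "-1"] by (simp flip: e)
  from this[of "GPh Alpha1" "-2"] this[of "GPh Alpha2" "-2"] this[of "GPh Theta" "-2"] this[of GB2 "-2"] m[of "GPh Alpha1" "-1" "-2"] m[of "GPh Alpha2" "-1" "-2"]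
    m[of GB2 "-1" "-2"]
  have "F.Lgh \<in> par F False" unfolding F.Lgh_fld
    by (intro cvs.subspace_add[OF F.par_subspace] cvs.subspace_diff[OF F.par_subspace] cvs.subspace_scale[OF F.par_subspace]) simp_all
  then show "Lc \<in> par C False" unfolding Lc_eq by (intro cvs.subspace_add[OF C.par_subspace] t_par) simp_all
qed

lemma Jc_fld: "C.quasi Jc 0 (F.charge i) 0 (t (vac V) (F.fld i))"
proof -
  have "mode C (t (vac V) (F.fld i)) (int l) Jc = (if l = 0 then - F.charge i *\<^sub>C t (vac V) (F.fld i) else 0)" for l
    by (simp add: Jc_eq C_lin CC.act_F F.fld_Jgh F.mode_vac)
  from this[of 0] this[of 1] this show ?thesis by (intro C.quasi_skew[OF par_Jc t_par[OF F.fld_par]]) simp_all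
qed

lemma Lc_fld: "C.quasi Lc 1 0 (F.cwt i) (t (vac V) (F.fld i))"
proof -
  have "mode C (t (vac V) (F.fld i)) (int l) Lc
     = (if l = 0 then (F.cwt i - 1) *\<^sub>C transl C (t (vac V) (F.fld i)) else if l = 1 then F.cwt i *\<^sub>C t (vac V) (F.fld i) else 0)" for l
    by (simp add: Lc_eq C_lin CC.act_F F.fld_Lgh F.mode_vac transl_F[OF F.fld_par])
  from this[of 0] this[of 1] this show ?thesis by (intro C.quasi_skew[OF par_Lc t_par[OF F.fld_par]]) simp_all
qed

lemma Jc_cur:
  assumes A: "A \<in> sl3" "lie A hM = - c *\<^sub>C A" "trace (A ** hM) = 0" shows "C.quasi Jc 0 c 0 (t (\<iota> A) (vac F))"
proof -
  have "mode V (\<iota> A) (int l) (\<iota> hM) = (if l = 0 then - c *\<^sub>C \<iota> A else 0)" for l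
  proof -
    have "\<iota> (lie A hM) = - c *\<^sub>C \<iota> A" by (simp only: A(2) iota_scale[OF A(1)])
    then show ?thesis using iota_ope(1,2)[OF A(1) hM_sl3] iota_ope(3)[OF A(1) hM_sl3, of l] A(3)
      by (cases "l = 0"; cases "l = 1") simp_all
  qed
  then have "mode C (t (\<iota> A) (vac F)) (int l) Jc = (if l = 0 then - c *\<^sub>C t (\<iota> A) (vac F) else 0)" for l
    by (simp add: Jc_eq C_lin CC.act_V mode_vac)
  from this[of 0] this[of 1] this show ?thesis by (intro C.quasi_skew[OF par_Jc t_par[OF F.vac_even]]) simp_all
qed

lemma Lc_cur:
  assumes A: "A \<in> gr j" "trace (A ** xM) = 0" shows "C.quasi Lc 1 0 (1 - of_int j / 2) (t (\<iota> A) (vac F))"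
proof -
  have A': "A \<in> sl3" by (rule gr_sl3[OF A(1)])
  have "lie A xM = - lie xM A" by (simp add: lie_def)
  then have "lie A xM = - (of_int j / 2) *\<^sub>C A" using A(1) by (simp add: gr_def)
  then have l: "\<iota> (lie A xM) = - (of_int j / 2) *\<^sub>C \<iota> A" by (simp only: iota_scale[OF A'])
  have T: "mode V (\<iota> A) (int l) (transl V (\<iota> xM)) = (if l = 0 then - (of_int j / 2) *\<^sub>C transl V (\<iota> A) else if l = 1 then - (of_int j / 2) *\<^sub>C \<iota> A else 0)" for l
    using adj.affine_comm[OF A' mat3_in_sl3(6), of "int l" "-2" "vac V"] A(2)
    by (auto simp: transl_def l self.lin1_simps self.lin2_simps mode_vac creation)
  have "mode C (t (\<iota> A) (vac F)) (int l) Lc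
     = (if l = 0 then - (of_int j / 2) *\<^sub>C transl C (t (\<iota> A) (vac F)) else if l = 1 then (1 - of_int j / 2) *\<^sub>C t (\<iota> A) (vac F) else 0)" for l
    using current_sug[OF A'] current_sug(3)[OF A', of l]
    by (auto simp: Lc_eq C_lin CC.act_V mode_vac self.lin2_simps T transl_V cvs.scale_left_diff_distrib)
  from this[of 0] this[of 1] this show ?thesis by (intro C.quasi_skew[OF par_Lc t_par[OF F.vac_even]]) simp_all
qed

text \<open>d is a sum of fields and of normal products with regular factors. The conditions on c
  and w say that each summand has charge 0 and weight \<tau>, whereupon \<open>quasi_closed\<close>
  applies to d.\<close>

lemma quasi_d:
  assumes L: "L \<in> par C False" and f: "\<And>i. C.quasi L \<tau> (c i) (w i) (t (vac V) (F.fld i))"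
    and A: "C.quasi L \<tau> (- c (GPs Alpha1)) (\<tau> - w (GPs Alpha1)) (t (\<iota> pM) (vac F))"
      "C.quasi L \<tau> (- c (GPs Alpha2)) (\<tau> - w (GPs Alpha2)) (t (\<iota> qM) (vac F))"
      "C.quasi L \<tau> (- c (GPs Theta)) (\<tau> - w (GPs Theta)) (t (\<iota> eM) (vac F))"
    and c: "c (GPs Theta) = 0" "c (GPs Alpha1) + c GB1 = 0" "c (GPs Alpha2) + c GB2 = 0" "c (GPh Theta) + (c (GPs Alpha1) + c (GPs Alpha2)) = 0"
    and w: "w (GPs Theta) = \<tau>" "w (GPs Alpha1) + w GB1 = \<tau>" "w (GPs Alpha2) + w GB2 = \<tau>" "w (GPh Theta) + (w (GPs Alpha1) + w (GPs Alpha2)) = \<tau>"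
  shows "mode C d 0 L = 0"
proof -
  have 1: "C.quasi L \<tau> 0 \<tau> (t (\<iota> B) (F.fld i))" if "C.quasi L \<tau> (- c i) (\<tau> - w i) (t (\<iota> B) (vac F))" for B i
  proof -
    have "C.quasi L \<tau> (- c i + c i) (\<tau> - w i + w i) (mode C (t (\<iota> B) (vac F)) (-1) (t (vac V) (F.fld i)))"
      by (rule C.quasi_np[OF L t_par[OF F.vac_even] t_par[OF F.fld_par] that f]) (simp add: CC.act_V mode_vac C_lin)
    then show ?thesis by (simp add: CC.act_V creation)
  qed
  have 2: "C.quasi L \<tau> (c i + c') (w i + w') (t (vac V) (mode F (F.fld i) (-1) h))"
    if "C.quasi L \<tau> c' w' (t (vac V) h)" "h \<in> par F q" "\<And>j. mode F (F.fld i) (int j) h = 0" for i h c' w' q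
  proof -
    have "C.quasi L \<tau> (c i + c') (w i + w') (mode C (t (vac V) (F.fld i)) (-1) (t (vac V) h))"
      by (rule C.quasi_np[OF L t_par[OF F.fld_par] t_par[OF that(2)] f that(1)]) (simp add: CC.act_F that(3) C_lin)
    then show ?thesis by (simp add: CC.act_F)
  qed
  have a: "C.quasi L \<tau> 0 \<tau> (t (vac V) (F.fld (GPs Theta)))" using f[of "GPs Theta"] c(1) w(1) by simp
  have b: "C.quasi L \<tau> 0 \<tau> (t (vac V) (mode F (F.fld (GPs Alpha1)) (-1) (F.fld GB1)))"
    using 2[OF f F.fld_par, of "GPs Alpha1" GB1] c(2) w(2) by (simp add: F.fld_ope del: F.fld.simps)
  have e: "C.quasi L \<tau> 0 \<tau> (t (vac V) (mode F (F.fld (GPs Alpha2)) (-1) (F.fld GB2)))"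
    using 2[OF f F.fld_par, of "GPs Alpha2" GB2] c(3) w(3) by (simp add: F.fld_ope del: F.fld.simps)
  have p: "mode F (F.fld (GPs Alpha1)) (-1) (F.fld (GPs Alpha2)) \<in> par F False"
    using F.par_mode[OF F.fld_par F.fld_par, of "GPs Alpha1" "-1" "GPs Alpha2"] by simp
  have "C.quasi L \<tau> (c (GPs Alpha1) + c (GPs Alpha2)) (w (GPs Alpha1) + w (GPs Alpha2)) (t (vac V) (mode F (F.fld (GPs Alpha1)) (-1) (F.fld (GPs Alpha2))))"
    by (rule 2[OF f F.fld_par]) (simp add: F.fld_ope del: F.fld.simps)
  moreover have r: "mode F (F.fld (GPh Theta)) (int j) (mode F (F.fld (GPs Alpha1)) (-1) (F.fld (GPs Alpha2))) = 0" for j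
    by (subst F.fld_mode_comm) (simp add: F.fld_ope F.self.lin2_simps del: F.fld.simps)
  ultimately have h: "C.quasi L \<tau> 0 \<tau> (t (vac V) (mode F (F.fld (GPh Theta)) (-1) (mode F (F.fld (GPs Alpha1)) (-1) (F.fld (GPs Alpha2)))))"
    using 2[OF _ p r] c(4) w(4) by metis
  have "C.quasi L \<tau> 0 \<tau> d"
    using C.quasi_add[OF C.quasi_add[OF C.quasi_add[OF 1[OF A(1)] 1[OF A(2)]] 1[OF A(3)]]
      C.quasi_add[OF C.quasi_add[OF C.quasi_add[OF C.quasi_neg[OF h] a] b] e]]
    by (simp add: d_decomp F.dF_def C_lin)
  then show ?thesis by (rule C.quasi_closed[OF L par_d])
qed

lemma hM_table: "lie pM hM = pM" "lie qM hM = - qM" "lie eM hM = 0"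
  "trace (pM ** hM) = 0" "trace (qM ** hM) = 0" "trace (eM ** hM) = 0"
  by (auto simp: mat3_simps)

lemma d_Jc: "mode C d 0 Jc = 0"
proof (rule quasi_d[OF par_Jc Jc_fld])
  show "C.quasi Jc 0 (- F.charge (GPs Alpha1)) (0 - 0) (t (\<iota> pM) (vac F))" using Jc_cur[of pM "-1"] hM_table by simp
  show "C.quasi Jc 0 (- F.charge (GPs Alpha2)) (0 - 0) (t (\<iota> qM) (vac F))" using Jc_cur[of qM 1] hM_table by simp
  show "C.quasi Jc 0 (- F.charge (GPs Theta)) (0 - 0) (t (\<iota> eM) (vac F))" using Jc_cur[of eM 0] hM_table by simp
qed simp_all

lemma d_Lc: "mode C d 0 Lc = 0"
proof (rule quasi_d[OF par_Lc Lc_fld])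
  show "C.quasi Lc 1 (- 0) (1 - F.cwt (GPs Alpha1)) (t (\<iota> pM) (vac F))" using Lc_cur[OF gr_table(2)] by (simp add: mat3_simps xM_def)
  show "C.quasi Lc 1 (- 0) (1 - F.cwt (GPs Alpha2)) (t (\<iota> qM) (vac F))" using Lc_cur[OF gr_table(3)] by (simp add: mat3_simps xM_def)
  show "C.quasi Lc 1 (- 0) (1 - F.cwt (GPs Theta)) (t (\<iota> eM) (vac F))" using Lc_cur[OF gr_table(1)] by (simp add: mat3_simps xM_def)
qed simp_all

end

section \<open>Highest weight modules over the Bershadsky-Polyakov algebra\<close>

text \<open>In the Borcherds identity take m = N beyond the truncation of a on v. One sum vanishes,
  the other starts with the wanted product and continues with higher modes of b, which descending
  induction on q covers.\<close>

lemma (in va_mod) mode_product_span: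
  assumes ev: "par V False = UNIV"
  shows "Y a p (Y b q v) \<in> cvs.span {Y (mode V a i b) j v | i j. True}"
proof -
  let ?S = "cvs.span {Y (mode V a i b) j v | i j. True}"
  have e: "u \<in> par V False" for u by (simp add: ev)
  obtain N where N: "\<forall>n\<ge>N. Y a n v = 0" using trunc by blast
  obtain N' where N': "\<forall>n\<ge>N'. Y b n v = 0" using trunc by blast
  have "\<forall>p. Y a p (Y b q v) \<in> ?S" if "q \<ge> N' - int l" for l q
    using that
  proof (induction l arbitrary: q)
    case 0
    then show ?case using N' by (simp add: lin2_simps cvs.span_zero)
  next
    case (Suc l)
    show ?case
    proof
      fix p
      let ?f = "\<lambda>j::nat. ((-1) ^ j * (of_int (p - N) gchoose j)) *\<^sub>C Y a (N + (p - N) - int j) (Y b (q + int j) v)"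
      have "Sum_any (\<lambda>j::nat. (of_int N gchoose j) *\<^sub>C Y (mode V a (p - N + int j) b) (N + q - int j) v) \<in> ?S"
        by (intro Sum_any_mem_subspace cvs.subspace_span cvs.span_scale cvs.span_base) blast
      moreover have "Sum_any (\<lambda>j::nat. ((-1) ^ j * (of_int (p - N) gchoose j)) *\<^sub>C Y b (q + (p - N) - int j) (Y a (N + int j) v)) = 0"
        using N by (simp add: lin2_simps)
      ultimately have "Sum_any ?f \<in> ?S" using borcherds[OF e e, of N a "p - N" b q v] by simp
      then have "?f 0 \<in> ?S"
      proof (rule Sum_any_split_0[OF cvs.subspace_span])
        show "?f (Suc j) \<in> ?S" for j using Suc.IH[of "q + int (Suc j)"] Suc.prems by (intro cvs.span_scale) simp
        show "?f j = 0" if "j \<ge> nat (N' - q)" for j using N' that by (simp add: lin2_simps)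
      qed
      then show "Y a p (Y b q v) \<in> ?S" by simp
    qed
  qed
  from this[of "nat (N' - q)" q] show ?thesis by simp
qed

lemma (in va_mod) irreducible_span:
  assumes "par V False = UNIV" "irreducible_under {Y u n | u n. True}" "v \<noteq> 0"
  shows "cvs.span {Y u n v | u n. True} = UNIV"
proof -
  let ?S = "cvs.span {Y u n v | u n. True}"
  have "Y a m x \<in> ?S" if "x \<in> ?S" for a m x
  proof -
    have "cvs.subspace {x. Y a m x \<in> ?S}" by (auto simp: cvs.subspace_def lin2_simps cvs.span_zero intro: cvs.span_add cvs.span_scale)
    moreover have "Y a m (Y b n v) \<in> ?S" for b n
      using mode_product_span[OF assms(1), of a m b n v] cvs.span_mono[of "{Y (mode V a i b) j v | i j. True}" "{Y u n v | u n. True}"] by blast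
    ultimately have "?S \<subseteq> {x. Y a m x \<in> ?S}" by (intro cvs.span_minimal) auto
    then show ?thesis using that by blast
  qed
  then have "\<forall>T\<in>{Y u n | u n. True}. T ` ?S \<subseteq> ?S" by blast
  then have "?S = {0} \<or> ?S = UNIV"
    using assms(2)[unfolded irreducible_under_def, THEN conjunct2, THEN spec, of ?S] by simp
  moreover have "Y (vac V) (-1) v \<in> ?S" by (rule cvs.span_base) blast
  ultimately show ?thesis using assms(3) by (auto simp: vacuum)
qed

locale bp_alg = vsa W for W :: "('w::complex_vector) vosa" +
  fixes k :: complex and J Gp Gm L :: 'w
  assumes bp: "bp_generators k W J Gp Gm L" and all_even: "par W False = UNIV"
begin

lemma even: "u \<in> par W False" by (simp add: all_even)

text \<open>The integers are twice the conformal weights.\<close>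

definition gens :: "('w \<times> int) set" where "gens = {(J, 2), (Gp, 3), (Gm, 3), (L, 4)}"

lemma gens_L: "(u, c) \<in> gens \<Longrightarrow> mode W L 0 u = transl W u \<and> mode W L 1 u = (of_int c / 2) *\<^sub>C u"
proof -
  have o: "ope W A B (c0 # c1 # cs) \<Longrightarrow> mode W A 0 B = c0 \<and> mode W A 1 B = c1" for A B c0 c1 cs
    unfolding ope_def by (auto dest: spec[of _ 0] spec[of _ 1])
  show "(u, c) \<in> gens \<Longrightarrow> mode W L 0 u = transl W u \<and> mode W L 1 u = (of_int c / 2) *\<^sub>C u"
    using bp[unfolded bp_generators_def] o unfolding gens_def by auto
qed

lemma gens_cases: "(u, c) \<in> gens \<Longrightarrow> u = J \<and> c = 2 \<or> u = Gp \<and> c = 3 \<or> u = Gm \<and> c = 3 \<or> u = L \<and> c = 4"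
  by (auto simp: gens_def)

definition Weig :: "int \<Rightarrow> 'w set" where "Weig c = {u. mode W L 1 u = (of_int c / 2) *\<^sub>C u}"

text \<open>Both operators vanish on the vacuum and have the same commutators with the modes of the
  strong generators.\<close>

lemma L0_transl: "mode W L 0 u = transl W u"
proof -
  have T: "transl W (mode W a n w) = mode W a n (transl W w) - of_int n *\<^sub>C mode W a (n - 1) w" for a n w
  proof -
    have "Sum_any (\<lambda>j::nat. ((-1) ^ j * (of_int n gchoose j)) *\<^sub>C mode W w (-2 + n - int j) (mode W a (int j) (vac W))) = 0"
      by (simp add: mode_vac self.lin2_simps)
    moreover have "Sum_any (\<lambda>j::nat. ((-1) ^ j * (of_int n gchoose j)) *\<^sub>C mode W a (n - int j) (mode W w (-2 + int j) (vac W)))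
      = (\<Sum>j<2. ((-1) ^ j * (of_int n gchoose j)) *\<^sub>C mode W a (n - int j) (mode W w (-2 + int j) (vac W)))"
      by (rule Sum_any_lessThan) (simp add: mode_vac self.lin2_simps)
    ultimately show ?thesis
      using self.associativity[OF even even, of a n w "-2" "vac W"] by (simp add: numeral_2_eq_2 creation transl_def)
  qed
  have "{u. mode W L 0 u = transl W u} = UNIV"
  proof -
    let ?U = "{u. mode W L 0 u = transl W u}"
    have sub: "cvs.subspace ?U" by (auto simp: cvs.subspace_def self.lin2_simps clin_simps[OF transl_lin])
    have v: "vac W \<in> ?U" by (simp add: mode_vac transl_def mode_of_vac)
    have st: "mode W a n u \<in> ?U" if a: "a \<in> {J, Gp, Gm, L}" and u: "u \<in> ?U" for a n u
    proof -
      have "\<exists>c. (a, c) \<in> gens" using a by (auto simp: gens_def)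
      then have "mode W L 0 a = transl W a" using gens_L by blast
      then show ?thesis using self.zero_mode_commutator[OF even even, of L a n u] u self.transl_mode_action[OF vsa_axioms even, of a n u]
        by (simp add: T)
    qed
    have "strongly_generates W {J, Gp, Gm, L}" using bp by (simp add: bp_generators_def)
    from this[unfolded strongly_generates_def, THEN spec, of ?U] show ?thesis
      by (rule mp) (intro conjI ballI allI impI sub v st)
  qed
  then show ?thesis by blast
qed

lemma L1_commute:
  assumes "va_module W Y" "u \<in> Weig c"
  shows "Y L 1 (Y u n x) = Y u n (Y L 1 x) + (of_int (c - 2 * (n + 1)) / 2) *\<^sub>C Y u n x"
proof -
  interpret Y: va_mod W Y by unfold_locales fact
  have b: "(1 gchoose j :: complex) = 0" if "j \<ge> 2" for j
    using binomial_gbinomial[of 1 j, where 'a = complex] that by (simp add: binomial_eq_0)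
  have "Sum_any (\<lambda>j::nat. (of_int 1 gchoose j) *\<^sub>C Y (mode W L (int j) u) (1 + n - int j) x)
     = (\<Sum>j<2. (of_int 1 gchoose j) *\<^sub>C Y (mode W L (int j) u) (1 + n - int j) x)"
    by (rule Sum_any_lessThan) (simp add: b)
  then have "Y L 1 (Y u n x) = Y u n (Y L 1 x) + (Y (mode W L 0 u) (1 + n) x + Y (mode W L 1 u) n x)"
    using Y.commutator[OF even even, of L 1 u n x] by (simp add: numeral_2_eq_2)
  moreover have "Y (mode W L 0 u) (1 + n) x + Y (mode W L 1 u) n x = (of_int (c - 2 * (n + 1)) / 2) *\<^sub>C Y u n x"
    using assms(2) Y.transl_mode_action[OF vsa_axioms even, of u "1 + n" x]
    by (simp add: Weig_def L0_transl Y.lin1_simps diff_divide_distrib add_divide_distrib flip: cvs.scale_left_distrib)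
  ultimately show ?thesis by simp
qed

lemma Weig_sub: "cvs.subspace (Weig c)"
  by (auto simp: Weig_def cvs.subspace_def self.lin2_simps cvs.scale_right_distrib mult.commute)

lemma gens_Weig: "(u, c) \<in> gens \<Longrightarrow> u \<in> Weig c" using gens_L by (simp add: Weig_def)

lemma Weig_mode: "u \<in> Weig c \<Longrightarrow> w \<in> Weig e \<Longrightarrow> mode W u n w \<in> Weig (c + e - 2 * (n + 1))"
  using L1_commute[OF self.mod, of u c n w]
  by (simp add: Weig_def self.lin2_simps diff_divide_distrib add_divide_distrib flip: cvs.scale_left_distrib)

definition word :: "(('w \<times> int) \<times> nat) list \<Rightarrow> 'w" where
  "word ws = foldr (\<lambda>((u, c), m). mode W u (-1 - int m)) ws (vac W)"

definition wwt :: "(('w \<times> int) \<times> nat) list \<Rightarrow> int" where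
  "wwt ws = sum_list (map (\<lambda>((u, c), m). c + 2 * int m) ws)"

definition Wsp :: "int \<Rightarrow> 'w set" where
  "Wsp c = cvs.span {word ws | ws. ws \<in> lists (gens \<times> UNIV) \<and> wwt ws = c}"

lemma word_simps: "word [] = vac W" "word (((u, c), m) # ws) = mode W u (-1 - int m) (word ws)"
  "wwt [] = 0" "wwt (((u, c), m) # ws) = c + 2 * int m + wwt ws"
  by (simp_all add: word_def wwt_def)

lemma word_Weig: "ws \<in> lists (gens \<times> UNIV) \<Longrightarrow> word ws \<in> Weig (wwt ws) \<and> wwt ws \<ge> 0"
proof (induction ws)
  case Nil
  then show ?case by (simp add: word_simps Weig_def mode_vac)
next
  case (Cons w ws)
  obtain u c m where w: "w = ((u, c), m)" by (metis surj_pair)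
  have u: "(u, c) \<in> gens" using Cons by (simp add: w)
  then have "c \<ge> 0" by (auto simp: gens_def)
  then show ?case using Weig_mode[OF gens_Weig[OF u], of "word ws" "wwt ws" "-1 - int m"] Cons
    by (simp add: w word_simps algebra_simps)
qed

lemma Wsp_sub: "cvs.subspace (Wsp c)" by (simp add: Wsp_def)

lemma Wsp_Weig: "Wsp c \<subseteq> Weig c"
  unfolding Wsp_def using word_Weig by (intro cvs.span_minimal Weig_sub) blast

lemma Wsp_all: "cvs.span (\<Union>c\<in>{0..}. Wsp c) = UNIV"
proof -
  let ?G = "{word ws | ws. ws \<in> lists (gens \<times> UNIV)}"
  have all: "cvs.span ?G = UNIV"
  proof -
    have st: "mode W u n x \<in> cvs.span ?G" if u: "u \<in> {J, Gp, Gm, L}" and n: "n < 0" and x: "x \<in> cvs.span ?G" for u n x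
    proof -
      obtain c where c: "(u, c) \<in> gens" using u by (auto simp: gens_def)
      have "mode W u n (word ws) \<in> cvs.span ?G" if "ws \<in> lists (gens \<times> UNIV)" for ws
      proof -
        have "mode W u n (word ws) = word (((u, c), nat (-1 - n)) # ws)" using n by (simp add: word_simps)
        then show ?thesis using that c by (intro cvs.span_base CollectI exI[of _ "((u, c), nat (-1 - n)) # ws"]) auto
      qed
      moreover have "cvs.subspace {x. mode W u n x \<in> cvs.span ?G}"
        by (auto simp: cvs.subspace_def self.lin2_simps cvs.span_zero intro: cvs.span_add cvs.span_scale)
      ultimately have "cvs.span ?G \<subseteq> {x. mode W u n x \<in> cvs.span ?G}" by (intro cvs.span_minimal) blast+
      then show ?thesis using x by blast
    qed
    have v: "vac W \<in> cvs.span ?G" by (intro cvs.span_base CollectI exI[of _ "[]"]) (simp add: word_simps)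
    have "strongly_generates W {J, Gp, Gm, L}" using bp by (simp add: bp_generators_def)
    from this[unfolded strongly_generates_def, THEN spec, of "cvs.span ?G"] show ?thesis
      by (rule mp) (intro conjI ballI allI impI cvs.subspace_span v st)
  qed
  have "?G \<subseteq> (\<Union>c\<in>{0..}. Wsp c)"
  proof
    fix u assume "u \<in> ?G"
    then obtain ws where ws: "u = word ws" "ws \<in> lists (gens \<times> UNIV)" by blast
    then have "u \<in> Wsp (wwt ws)" unfolding Wsp_def by (intro cvs.span_base) blast
    then show "u \<in> (\<Union>c\<in>{0..}. Wsp c)" using word_Weig[OF ws(2)] by auto
  qed
  from cvs.span_mono[OF this] show ?thesis unfolding all by (simp only: top.extremum_unique)
qed

lemma W_decomp: "\<exists>G f. finite G \<and> (\<forall>c. f c \<in> Wsp c) \<and> u = (\<Sum>c\<in>G. f c)"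
proof -
  have "u \<in> cvs.span (\<Union>c\<in>{0..}. Wsp c)" unfolding Wsp_all by simp
  then obtain G f where "finite G" "G \<subseteq> {0..}" "\<And>c. f c \<in> Wsp c" "u = (\<Sum>c\<in>G. f c)"
    by (rule span_Union_decomp[OF Wsp_sub]) blast
  then show ?thesis by blast
qed

lemma Weig_Wsp: "Weig c \<subseteq> Wsp c"
proof
  fix u assume u: "u \<in> Weig c"
  obtain G f where G: "finite G" "\<forall>c. f c \<in> Wsp c" "u = (\<Sum>c\<in>G. f c)" using W_decomp[of u] by auto
  define h where "h e = (if e \<in> G then f e else 0) - (if e = c then u else 0)" for e
  have "(\<Sum>e\<in>insert c G. h e) = (\<Sum>e\<in>insert c G. if e \<in> G then f e else 0) - u"
    using G(1) by (simp add: h_def sum_subtractf)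
  also have "(\<Sum>e\<in>insert c G. if e \<in> G then f e else 0) = u"
    unfolding G(3) using G(1) by (intro sum.mono_neutral_cong_right) auto
  finally have "(\<Sum>e\<in>insert c G. h e) = 0" by simp
  moreover have "h e \<in> Weig e" for e
    using spec[OF G(2), of e] Wsp_Weig[of e] u cvs.subspace_0[OF Weig_sub] unfolding h_def by (intro cvs.subspace_diff[OF Weig_sub]) auto
  ultimately have "h c = 0"
    using G(1) by (intro eigen_components_zero[OF self.lin2, of "insert c G" L 1 h "\<lambda>c. of_int c / 2"]) (auto simp: Weig_def inj_on_def)
  then have "u = (if c \<in> G then f c else 0)" by (simp add: h_def)
  then show "u \<in> Wsp c" using G(2) cvs.subspace_0[OF Wsp_sub] by simp
qed

definition hw_vector :: "('w \<Rightarrow> int \<Rightarrow> 'n \<Rightarrow> 'n) \<Rightarrow> complex \<Rightarrow> complex \<Rightarrow> 'n::complex_vector \<Rightarrow> bool" where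
  "hw_vector Y x l v \<longleftrightarrow> v \<noteq> 0 \<and> Y J 0 v = x *\<^sub>C v \<and> Y L 1 v = l *\<^sub>C v \<and>
     (\<forall>n\<ge>1. Y J n v = 0 \<and> Y Gp n v = 0 \<and> Y Gm n v = 0 \<and> Y L (n + 1) v = 0)"

text \<open>(\<partial>J)_(n) = -n J_(n-1), so L_(n) is the n-th mode of the shifted vector plus n/2
  times J_(n-1); hence the eigenvalue y + x/2.\<close>

lemma hw_vectorI:
  assumes "va_module W Y" "v \<noteq> 0" "Y J 0 v = x *\<^sub>C v" "Y (L + (1/2) *\<^sub>C transl W J) 1 v = y *\<^sub>C v"
    "\<And>n. n \<ge> 0 \<Longrightarrow> Y Gp (n + 1) v = 0 \<and> Y Gm (n + 1) v = 0 \<and> Y J (n + 1) v = 0 \<and> Y (L + (1/2) *\<^sub>C transl W J) (n + 2) v = 0"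
  shows "hw_vector Y x (y + x / 2) v"
proof -
  interpret Y: va_mod W Y by unfold_locales fact
  have L: "Y L n v = Y (L + (1/2) *\<^sub>C transl W J) n v + (of_int n / 2) *\<^sub>C Y J (n - 1) v" for n
    using Y.transl_mode_action[OF vsa_axioms even, of J n v] by (simp add: Y.lin1_simps)
  have "Y L 1 v = (y + x / 2) *\<^sub>C v" using L[of 1] assms(3,4) by (simp add: cvs.scale_left_distrib)
  moreover have "Y J n v = 0 \<and> Y Gp n v = 0 \<and> Y Gm n v = 0 \<and> Y L (n + 1) v = 0" if "n \<ge> 1" for n
    using assms(5)[of "n - 1"] L[of "n + 1"] that by (simp add: add.commute)
  ultimately show ?thesis using assms(2,3) by (simp add: hw_vector_def)
qed

end

text \<open>A mode of weight zero acts on all highest weight vectors of the same weight by the same scalar.\<close>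
locale bp_hw_pair = bp_alg W k J Gp Gm L
  for W :: "('w::complex_vector) vosa" and k J Gp Gm L +
  fixes Y1 :: "'w \<Rightarrow> int \<Rightarrow> 'n \<Rightarrow> 'n::complex_vector" and Y2 :: "'w \<Rightarrow> int \<Rightarrow> 'h \<Rightarrow> 'h::complex_vector"
    and v1 :: 'n and v2 :: 'h and x l :: complex
  assumes mod1: "va_module W Y1" and mod2: "va_module W Y2"
    and hw1: "hw_vector Y1 x l v1" and hw2: "hw_vector Y2 x l v2"
begin

sublocale Y1: va_mod W Y1 by unfold_locales (rule mod1)
sublocale Y2: va_mod W Y2 by unfold_locales (rule mod2)

text \<open>e is twice the amount by which the mode raises the weight. The scalar z must be the same
  on both modules.\<close>

definition good :: "'n \<Rightarrow> 'h \<Rightarrow> int \<Rightarrow> bool" where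
  "good h1 h2 e \<longleftrightarrow> (e < 0 \<longrightarrow> h1 = 0 \<and> h2 = 0) \<and> (e = 0 \<longrightarrow> (\<exists>z. h1 = z *\<^sub>C v1 \<and> h2 = z *\<^sub>C v2))"

lemma good_add: "good h1 h2 e \<Longrightarrow> good h1' h2' e \<Longrightarrow> good (h1 + h1') (h2 + h2') e"
  unfolding good_def by (metis add_0 cvs.scale_left_distrib)

lemma good_scale: "good h1 h2 e \<Longrightarrow> good (c *\<^sub>C h1) (c *\<^sub>C h2) e"
  unfolding good_def by (metis cvs.scale_scale cvs.scale_zero_right)

lemma good_0: "good 0 0 e"
  unfolding good_def by (auto intro!: exI[of _ 0])

lemma good_diff: "good h1 h2 e \<Longrightarrow> good h1' h2' e \<Longrightarrow> good (h1 - h1') (h2 - h2') e"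
  using good_add[of h1 h2 e "(-1) *\<^sub>C h1'" "(-1) *\<^sub>C h2'"] good_scale[of h1' h2' e "-1"] by simp

text \<open>Write u as a negative mode of a generator a on u' and induct on the weight. For e \<le>
  0 the modes of u' that would act directly on the highest weight vector vanish by weight and a_(j)
  kills it for j \<ge> 2, so associativity leaves only terms ending in a_(0) v or a_(1) v. These are
  scalars for J and L respectively, a_(1) v is zero otherwise, and the remaining a_(0) is commuted
  to the left.\<close>

lemma Weig_good: "u \<in> Weig c \<Longrightarrow> good (Y1 u n v1) (Y2 u n v2) (c - 2 * (n + 1))"
proof (induction "nat c" arbitrary: u c n rule: less_induct)
  case less
  have sub: "cvs.subspace {u. \<forall>n. good (Y1 u n v1) (Y2 u n v2) (c - 2 * (n + 1))}"
    by (auto simp: cvs.subspace_def Y1.lin1_simps Y2.lin1_simps good_0 good_add good_scale)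
  have "word ws \<in> {u. \<forall>n. good (Y1 u n v1) (Y2 u n v2) (c - 2 * (n + 1))}" if ws: "ws \<in> lists (gens \<times> UNIV)" "wwt ws = c" for ws
  proof (cases ws)
    case Nil
    then show ?thesis using ws by (auto simp: word_simps Y1.vacuum Y2.vacuum good_def intro: exI[of _ 1])
  next
    case (Cons w us)
    obtain a ca m where w: "w = ((a, ca), m)" by (metis surj_pair)
    have a: "(a, ca) \<in> gens" and us: "us \<in> lists (gens \<times> UNIV)" using ws(1) by (auto simp: Cons w)
    define u' where "u' = word us"
    define c' where "c' = wwt us"
    have u': "u' \<in> Weig c'" "c' \<ge> 0" using word_Weig[OF us] by (auto simp: u'_def c'_def)
    have c: "c = ca + 2 * int m + c'" using ws(2) by (simp add: Cons w word_simps c'_def)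
    have ca: "ca \<ge> 2" using a by (auto simp: gens_def)
    have IH: "good (Y1 w q v1) (Y2 w q v2) (e - 2 * (q + 1))" if "w \<in> Weig e" "e < c" "0 \<le> c" for w e q
    proof (cases "e \<ge> 0")
      case True
      then show ?thesis using less.hyps[of e w q] that by auto
    next
      case False
      have "w \<in> Wsp e" using Weig_Wsp that(1) by blast
      moreover have "{word ws | ws. ws \<in> lists (gens \<times> UNIV) \<and> wwt ws = e} = {}" using word_Weig False by auto
      ultimately have "w = 0" by (simp add: Wsp_def)
      then show ?thesis by (simp add: Y1.lin1_simps Y2.lin1_simps good_0)
    qed
    have c0: "0 \<le> c" "c' < c" using c ca u'(2) by auto
    have "good (Y1 (mode W a (-1 - int m) u') n v1) (Y2 (mode W a (-1 - int m) u') n v2) (c - 2 * (n + 1))" for n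
    proof (cases "c - 2 * (n + 1) \<le> 0")
      case False
      then show ?thesis by (simp add: good_def)
    next
      case n: True
      let ?l = "-1 - int m"
      let ?b = "\<lambda>j::nat. (-1) ^ j * (of_int ?l gchoose j) :: complex"
      have z: "Y1 u' (n + int j) v1 = 0" "Y2 u' (n + int j) v2 = 0" for j
        using IH[OF u'(1) c0(2,1), of "n + int j"] n c ca by (auto simp: good_def)
      have a2: "Y1 a (int j) v1 = 0" "Y2 a (int j) v2 = 0" if "j \<ge> 2" for j
      proof -
        have "int j \<ge> 1" "int j - 1 \<ge> 1" using that by auto
        then show "Y1 a (int j) v1 = 0" "Y2 a (int j) v2 = 0"
          using gens_cases[OF a] hw1 hw2 unfolding hw_vector_def
          by (auto dest: spec[of _ "int j"] spec[of _ "int j - 1"])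
      qed
      have s1: "Sum_any (\<lambda>j. ?b j *\<^sub>C Y1 u' (n + ?l - int j) (Y1 a (int j) v1)) = (\<Sum>j<2. ?b j *\<^sub>C Y1 u' (n + ?l - int j) (Y1 a (int j) v1))"
        by (rule Sum_any_lessThan) (simp add: a2 Y1.lin2_simps)
      have s2: "Sum_any (\<lambda>j. ?b j *\<^sub>C Y2 u' (n + ?l - int j) (Y2 a (int j) v2)) = (\<Sum>j<2. ?b j *\<^sub>C Y2 u' (n + ?l - int j) (Y2 a (int j) v2))"
        by (rule Sum_any_lessThan) (simp add: a2 Y2.lin2_simps)
      have 0: "good (Y1 u' (n + ?l) (Y1 a 0 v1)) (Y2 u' (n + ?l) (Y2 a 0 v2)) (c - 2 * (n + 1))"
      proof (cases "ca = 2")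
        case True
        then have "a = J" using gens_cases[OF a] by auto
        then have "Y1 a 0 v1 = x *\<^sub>C v1" "Y2 a 0 v2 = x *\<^sub>C v2" using hw1 hw2 by (auto simp: hw_vector_def)
        moreover have e: "c' - 2 * (n + ?l + 1) = c - 2 * (n + 1)" using c True by simp
        ultimately show ?thesis using good_scale[OF IH[OF u'(1) c0(2,1), of "n + ?l", unfolded e], of x]
          by (simp add: Y1.lin2_simps Y2.lin2_simps)
      next
        case False
        then have ca3: "ca \<ge> 3" using ca by simp
        \<comment> \<open>A generator of weight at least 3/2 leaves u' with a mode of negative
          degree, so the commutator with a_(0) reduces to the mode of a_(0) u', a state of smaller
          weight than u.\<close>
        have low: "Y1 u' (n + ?l) v1 = 0" "Y2 u' (n + ?l) v2 = 0"
          using IH[OF u'(1) c0(2,1), of "n + ?l"] n c ca3 by (auto simp: good_def)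
        have w: "mode W a 0 u' \<in> Weig (ca + c' - 2)" using Weig_mode[OF gens_Weig[OF a] u'(1), of 0] by simp
        have e: "ca + c' - 2 - 2 * (n + ?l + 1) = c - 2 * (n + 1)" using c by simp
        have "good (Y1 (mode W a 0 u') (n + ?l) v1) (Y2 (mode W a 0 u') (n + ?l) v2) (c - 2 * (n + 1))"
          unfolding e[symmetric] by (rule IH[OF w]) (use c c0 in auto)
        moreover have "Y1 u' (n + ?l) (Y1 a 0 v1) = 0 - Y1 (mode W a 0 u') (n + ?l) v1" "Y2 u' (n + ?l) (Y2 a 0 v2) = 0 - Y2 (mode W a 0 u') (n + ?l) v2"
          using Y1.zero_mode_commutator[OF even even, of a u' "n + ?l" v1] Y2.zero_mode_commutator[OF even even, of a u' "n + ?l" v2] low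
          by (simp_all add: Y1.lin2_simps Y2.lin2_simps eq_neg_iff_add_eq_0)
        ultimately show ?thesis using good_diff[OF good_0] by simp
      qed
      have 1: "good (Y1 u' (n + ?l - 1) (Y1 a 1 v1)) (Y2 u' (n + ?l - 1) (Y2 a 1 v2)) (c - 2 * (n + 1))"
      proof (cases "ca = 4")
        case True
        then have "a = L" using gens_cases[OF a] by auto
        then have "Y1 a 1 v1 = l *\<^sub>C v1" "Y2 a 1 v2 = l *\<^sub>C v2" using hw1 hw2 by (auto simp: hw_vector_def)
        moreover have e: "c' - 2 * (n + ?l - 1 + 1) = c - 2 * (n + 1)" using c True by simp
        ultimately show ?thesis using good_scale[OF IH[OF u'(1) c0(2,1), of "n + ?l - 1", unfolded e], of l]
          by (simp add: Y1.lin2_simps Y2.lin2_simps)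
      next
        case False
        then have "Y1 a 1 v1 = 0" "Y2 a 1 v2 = 0" using gens_cases[OF a] hw1 hw2 by (auto simp: hw_vector_def)
        then show ?thesis by (simp add: Y1.lin2_simps Y2.lin2_simps good_0)
      qed
      let ?s = "(-1) powi ?l :: complex"
      have "Y1 (mode W a ?l u') n v1 = 0 - ?s *\<^sub>C (?b 0 *\<^sub>C Y1 u' (n + ?l) (Y1 a 0 v1) + ?b 1 *\<^sub>C Y1 u' (n + ?l - 1) (Y1 a 1 v1))"
        unfolding Y1.associativity[OF even even, of a ?l u' n v1] s1 by (simp add: z Y1.lin2_simps numeral_2_eq_2)
      moreover have "Y2 (mode W a ?l u') n v2 = 0 - ?s *\<^sub>C (?b 0 *\<^sub>C Y2 u' (n + ?l) (Y2 a 0 v2) + ?b 1 *\<^sub>C Y2 u' (n + ?l - 1) (Y2 a 1 v2))"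
        unfolding Y2.associativity[OF even even, of a ?l u' n v2] s2 by (simp add: z Y2.lin2_simps numeral_2_eq_2)
      ultimately show ?thesis by (simp only:) (intro good_diff good_0 good_scale good_add 0 1)
    qed
    then show ?thesis by (simp add: Cons w word_simps u'_def)
  qed
  then have "Wsp c \<subseteq> {u. \<forall>n. good (Y1 u n v1) (Y2 u n v2) (c - 2 * (n + 1))}"
    unfolding Wsp_def by (intro cvs.span_minimal sub) blast
  then show ?case using Weig_Wsp less.prems by blast
qed

text \<open>If \<open>K\<close> acts non-trivially on an irreducible module, then \<open>v2\<close> is a combination of vectors
  \<open>u\<^sub>(\<^sub>n\<^sub>)v2\<close> with homogeneous \<open>u \<in> K\<close>, where \<open>u\<^sub>(\<^sub>n\<^sub>)\<close> has weight zero.\<close>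
lemma annihilator_transfer:
  assumes K: "cvs.subspace K" "\<And>u n w. u \<in> K \<Longrightarrow> mode W u n w \<in> K" "\<And>u n w. u \<in> K \<Longrightarrow> mode W w n u \<in> K"
    and 1: "\<And>u n h. u \<in> K \<Longrightarrow> Y1 u n h = 0" and irr: "irreducible_under {Y2 u n | u n. True}" and u: "u \<in> K"
  shows "Y2 u n h = 0"
proof (rule ccontr)
  assume nz: "Y2 u n h \<noteq> 0"
  have v: "v1 \<noteq> 0" "v2 \<noteq> 0" using hw1 hw2 by (auto simp: hw_vector_def)
  define KV where "KV = cvs.span {Y2 u n v2 | u n. u \<in> K}"
  define KH where "KH = cvs.span {Y2 u n h | u n h. u \<in> K}"
  have "Y2 a m h \<in> KH" if h: "h \<in> KH" for a m h
  proof -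
    have "cvs.subspace {x. Y2 a m x \<in> KH}"
      by (auto simp: KH_def cvs.subspace_def Y2.lin2_simps cvs.span_zero intro: cvs.span_add cvs.span_scale)
    moreover have "Y2 a m (Y2 u n h) \<in> KH" if "u \<in> K" for u n h
      unfolding KH_def
    proof (rule Y2.commute_mem_subspace[OF even even cvs.subspace_span])
      show "Y2 u n (Y2 a m h) \<in> cvs.span {Y2 u n h | u n h. u \<in> K}" by (rule cvs.span_base) (use that in blast)
      show "Y2 (mode W a (int j) u) (m + n - int j) h \<in> cvs.span {Y2 u n h | u n h. u \<in> K}" for j
        by (rule cvs.span_base) (use K(3)[OF that] in blast)
    qed
    ultimately have "KH \<subseteq> {x. Y2 a m x \<in> KH}" unfolding KH_def by (intro cvs.span_minimal) blast+
    then show ?thesis using h by blast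
  qed
  then have "\<forall>T\<in>{Y2 u n | u n. True}. T ` KH \<subseteq> KH" by blast
  then have "KH = {0} \<or> KH = UNIV"
    using irr[unfolded irreducible_under_def, THEN conjunct2, THEN spec, of KH] by (simp add: KH_def)
  moreover have "Y2 u n h \<in> KH" unfolding KH_def by (rule cvs.span_base) (use u in blast)
  ultimately have KH: "KH = UNIV" using nz by blast
  have "Y2 u n h \<in> KV" if "u \<in> K" for u n h
  proof -
    have "Y2 u n (Y2 b m v2) \<in> KV" for b m
    proof -
      have "{Y2 (mode W u i b) j v2 | i j. True} \<subseteq> {Y2 u n v2 | u n. u \<in> K}" using K(2)[OF that] by blast
      from cvs.span_mono[OF this] show ?thesis unfolding KV_def using Y2.mode_product_span[OF all_even, of u n b m v2] by blast
    qed
    moreover have "cvs.subspace {h. Y2 u n h \<in> KV}"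
      by (auto simp: KV_def cvs.subspace_def Y2.lin2_simps cvs.span_zero intro: cvs.span_add cvs.span_scale)
    ultimately have "cvs.span {Y2 u n v2 | u n. True} \<subseteq> {h. Y2 u n h \<in> KV}" by (intro cvs.span_minimal) blast+
    then show ?thesis unfolding Y2.irreducible_span[OF all_even irr v(2)] by blast
  qed
  then have "KH \<subseteq> KV" unfolding KH_def by (intro cvs.span_minimal) (auto simp: KV_def)
  then have v2: "v2 \<in> KV" using KH by blast
  define S where "S e = cvs.span {Y2 u n v2 | u n c. u \<in> K \<inter> Weig c \<and> c - 2 * (n + 1) = e}" for e
  define E where "E e = {h. Y2 L 1 h = (l + of_int e / 2) *\<^sub>C h}" for e :: int
  have S_sub: "cvs.subspace (S e)" for e by (simp add: S_def)
  have E_sub: "cvs.subspace (E e)" for e by (auto simp: E_def cvs.subspace_def Y2.lin2_simps cvs.scale_right_distrib mult.commute)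
  have vE: "v2 \<in> E 0" using hw2 by (simp add: E_def hw_vector_def)
  have SE: "S e \<subseteq> E e" for e
    unfolding S_def
  proof (rule cvs.span_minimal[OF _ E_sub], safe)
    fix u n c assume "u \<in> Weig c" "e = c - 2 * (n + 1)"
    then show "Y2 u n v2 \<in> E (c - 2 * (n + 1))"
      using L1_commute[OF mod2, of u c n v2] vE by (simp add: E_def Y2.lin2_simps flip: cvs.scale_left_distrib)
  qed
  \<comment> \<open>The scalar is common to both modules, and K acts by zero on the first.\<close>
  have S0: "S 0 = {0}"
  proof -
    have "{Y2 u n v2 | u n c. u \<in> K \<inter> Weig c \<and> c - 2 * (n + 1) = 0} \<subseteq> {0}"
    proof safe
      fix u n c assume u: "u \<in> K" "u \<in> Weig c" "c - 2 * (n + 1) = 0"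
      then obtain z where "Y1 u n v1 = z *\<^sub>C v1" "Y2 u n v2 = z *\<^sub>C v2" using Weig_good[OF u(2), of n] by (auto simp: good_def)
      then show "Y2 u n v2 = 0" using 1[OF u(1), of n v1] v(1) by simp
    qed
    from cvs.span_mono[OF this] show ?thesis using cvs.subspace_0[OF S_sub, of 0] unfolding S_def by simp blast
  qed
  have "Y2 u n v2 \<in> cvs.span (\<Union>e\<in>UNIV. S e)" if u: "u \<in> K" for u n
  proof -
    obtain G f where G: "finite G" "\<forall>c. f c \<in> Wsp c" "u = (\<Sum>c\<in>G. f c)" using W_decomp[of u] by auto
    have fW: "f c \<in> Weig c" for c using G(2) Wsp_Weig by blast
    have fK: "f c \<in> K" if "c \<in> G" for c
    proof (rule eigen_components[OF self.lin2 K(1) _ G(1)])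
      show "mode W L 1 w \<in> K" if "w \<in> K" for w by (rule K(3)[OF that])
      show "mode W L 1 (f c) = (of_int c / 2) *\<^sub>C f c" for c using fW[of c] by (simp add: Weig_def)
    qed (use G u that in \<open>auto simp: inj_on_def\<close>)
    have "Y2 (f c) n v2 \<in> S (c - 2 * (n + 1))" if "c \<in> G" for c
      unfolding S_def using fK[OF that] fW[of c] by (intro cvs.span_base) blast
    then have "Y2 (f c) n v2 \<in> cvs.span (\<Union>e\<in>UNIV. S e)" if "c \<in> G" for c using that by (intro cvs.span_base) blast
    then show ?thesis unfolding G(3) Y2.lin1_simps by (intro cvs.span_sum)
  qed
  then have "KV \<subseteq> cvs.span (\<Union>e\<in>UNIV. S e)" unfolding KV_def by (intro cvs.span_minimal) auto
  then have "v2 \<in> cvs.span (\<Union>e\<in>UNIV. S e)" using v2 by blast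
  then obtain G f where G: "finite G" "\<And>e. f e \<in> S e" "v2 = (\<Sum>e\<in>G. f e)"
    by (rule span_Union_decomp[OF S_sub]) blast
  define h where "h e = (if e \<in> G then f e else 0) - (if e = 0 then v2 else 0)" for e
  have "(\<Sum>e\<in>insert 0 G. h e) = (\<Sum>e\<in>insert 0 G. if e \<in> G then f e else 0) - v2"
    using G(1) by (simp add: h_def sum_subtractf)
  also have "(\<Sum>e\<in>insert 0 G. if e \<in> G then f e else 0) = (\<Sum>e\<in>G. f e)"
    using G(1) by (intro sum.mono_neutral_cong_right) auto
  finally have "(\<Sum>e\<in>insert 0 G. h e) = 0" using G(3) by simp
  moreover have hE: "h e \<in> E e" for e
    using G(2)[of e] SE[of e] vE cvs.subspace_0[OF E_sub] unfolding h_def by (intro cvs.subspace_diff[OF E_sub]) auto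
  ultimately have "h 0 = 0"
    using G(1) by (intro eigen_components_zero[OF Y2.lin2, of "insert 0 G" L 1 h "\<lambda>c. l + of_int c / 2"]) (auto simp: E_def inj_on_def)
  moreover have "f 0 = 0" using G(2)[of 0] S0 by simp
  ultimately show False using v(2) by (simp add: h_def split: if_splits)
qed

end

section \<open>The reduction of an irreducible module\<close>

lemma cohomology_map_eq:
  assumes \<rho>: "cohomology_map D \<rho>" and y: "D y = 0" and xy: "x - y \<in> range D" shows "\<rho> x = \<rho> y"
proof -
  have lin: "clinear_on {x. D x = 0} \<rho>" and ker: "\<And>x. D x = 0 \<Longrightarrow> \<rho> x = 0 \<longleftrightarrow> x \<in> range D" and "range D \<subseteq> {x. D x = 0}"
    using \<rho> by (auto simp: cohomology_map_def)
  then have z: "D (x - y) = 0" "\<rho> (x - y) = 0" using xy by blast+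
  have "\<rho> (1 *\<^sub>C (x - y) + y) = 1 *\<^sub>C \<rho> (x - y) + \<rho> y" using lin z(1) y unfolding clinear_on_def by blast
  then show ?thesis by (simp add: z(2))
qed

locale brst_coh = brst_mod k V \<iota> YM v a b F g C t d YX s
  for k and V :: "('v::complex_vector) vosa" and \<iota> and YM :: "'v \<Rightarrow> int \<Rightarrow> 'm \<Rightarrow> 'm::complex_vector" and v a b
    and F :: "('f::complex_vector) vosa" and g and C :: "('c::complex_vector) vosa" and t and d
    and YX :: "'c \<Rightarrow> int \<Rightarrow> 'x \<Rightarrow> 'x::complex_vector" and s +
  fixes W :: "('w::complex_vector) vosa" and \<pi> :: "'c \<Rightarrow> 'w" and \<rho> :: "'x \<Rightarrow> 'h::complex_vector"
    and YH :: "'w \<Rightarrow> int \<Rightarrow> 'h \<Rightarrow> 'h" and J Gp Gm L :: 'w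
  assumes va_coh: "va_cohomology C d W \<pi>" and mod_coh: "module_cohomology C d W \<pi> YX \<rho> YH"
    and J_def: "J = \<pi> (J_cocycle V \<iota> F g t)" and L_def: "L = \<pi> (L_cocycle k V \<iota> F g t)"
    and bp: "bp_generators k W J Gp Gm L"
    and not_nat: "k \<notin> \<nat>" and v_nonzero: "v \<noteq> 0"
begin

sublocale W: vsa W
  using va_coh by unfold_locales (simp add: va_cohomology_def Let_def)

sublocale H: va_mod W YH
  using mod_coh by unfold_locales (simp add: module_cohomology_def)

abbreviation "dC \<equiv> mode C d 0"

lemma rho:
  "D x = 0 \<Longrightarrow> D y = 0 \<Longrightarrow> \<rho> (e *\<^sub>C x + y) = e *\<^sub>C \<rho> x + \<rho> y"
  "D x = 0 \<Longrightarrow> \<rho> x = 0 \<longleftrightarrow> x \<in> range D"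
  "dC c = 0 \<Longrightarrow> D x = 0 \<Longrightarrow> YH (\<pi> c) n (\<rho> x) = \<rho> (YX c n x)"
  using mod_coh by (auto simp: module_cohomology_def cohomology_map_def clinear_on_def)

lemma rho_surj: obtains x where "D x = 0" "h = \<rho> x"
proof -
  have "\<rho> ` {x. D x = 0} = UNIV" using mod_coh by (simp add: module_cohomology_def cohomology_map_def)
  then have "h \<in> \<rho> ` {x. D x = 0}" by simp
  then show thesis using that by blast
qed

lemma pi_surj: obtains c where "dC c = 0" "w = \<pi> c"
proof -
  have "\<pi> ` {x. dC x = 0} = UNIV" using va_coh by (simp add: va_cohomology_def Let_def cohomology_map_def)
  then have "w \<in> \<pi> ` {x. dC x = 0}" by simp
  then show thesis using that by blast
qed

lemma rho_simps:
  "\<rho> 0 = 0" "D x = 0 \<Longrightarrow> D y = 0 \<Longrightarrow> \<rho> (x + y) = \<rho> x + \<rho> y" "D x = 0 \<Longrightarrow> \<rho> (c *\<^sub>C x) = c *\<^sub>C \<rho> x"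
proof -
  show 0: "\<rho> 0 = 0" using rho(2)[of 0] cvs.subspace_0[OF range_D_sub] by (simp add: X2)
  show "D x = 0 \<Longrightarrow> D y = 0 \<Longrightarrow> \<rho> (x + y) = \<rho> x + \<rho> y" using rho(1)[of x y 1] by simp
  show "D x = 0 \<Longrightarrow> \<rho> (c *\<^sub>C x) = c *\<^sub>C \<rho> x" using rho(1)[of x 0 c] by (simp add: X2 0)
qed

text \<open>The cocycle c may be inhomogeneous; since d is odd, its even and odd parts are cocycles
  separately, and the commutator formula applies to each.\<close>

lemma D_closed: "dC c = 0 \<Longrightarrow> D x = 0 \<Longrightarrow> D (YX c n x) = 0"
proof -
  assume c: "dC c = 0" and x: "D x = 0"
  obtain c0 c1 where cc: "c0 \<in> par C False" "c1 \<in> par C True" "c = c0 + c1" by (rule C.par_decomp)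
  have p: "dC c0 \<in> par C True" "dC c1 \<in> par C False" using C.par_mode[OF par_d cc(1), of 0] C.par_mode[OF par_d cc(2), of 0] by auto
  have "dC c0 = - dC c1" using c cc(3) by (simp add: C_lin eq_neg_iff_add_eq_0)
  then have "dC c0 \<in> par C False" using p(2) cvs.subspace_neg[OF C.par_subspace] by simp
  then have "dC c0 = 0" using p(1) C.par_disjoint by blast
  moreover from this have "dC c1 = 0" using \<open>dC c0 = - dC c1\<close> by simp
  ultimately have "D (YX c0 n x) = 0" "D (YX c1 n x) = 0"
    using T.X.zero_mode_commutator[OF par_d cc(1), of n x] T.X.zero_mode_commutator[OF par_d cc(2), of n x] x by (simp_all add: X1 X2)
  then show ?thesis by (simp add: cc(3) X1 X2)
qed

lemma rho_coh: "x \<simeq> y \<Longrightarrow> D y = 0 \<Longrightarrow> \<rho> x = \<rho> y"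
  unfolding coh_def using mod_coh cohomology_map_eq[of D \<rho> y x] by (simp add: module_cohomology_def)

lemma W_par: assumes "c \<in> par C p" "dC c = 0" shows "\<pi> c \<in> par W p"
  using va_coh assms by (auto simp: va_cohomology_def Let_def)

text \<open>Every class is represented by a state \<open>m \<otimes> 1\<close>, which is even.\<close>
lemma W_even: "par W False = UNIV"
proof -
  have "w \<in> par W False" for w
  proof -
    obtain c where c: "dC c = 0" "w = \<pi> c" by (rule pi_surj)
    obtain m where m: "m \<in> adj.\<Omega>" "c - t m (vac F) \<in> range dC" using CX.cocycle_representative[OF c(1)] by (auto simp: CX.coh_def)
    have "w = \<pi> (t m (vac F))" unfolding c(2)
      using va_coh by (intro cohomology_map_eq[OF _ CX.D_s[OF m(1)] m(2)]) (simp add: va_cohomology_def Let_def)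
    then show ?thesis using W_par[OF t_par[OF F.vac_even] CX.D_s[OF m(1)]] by simp
  qed
  then show ?thesis by blast
qed

end

sublocale brst_coh \<subseteq> BP: bp_alg W k J Gp Gm L
  by unfold_locales (rule bp, rule W_even)

section \<open>Weights and irreducibility of the cohomology\<close>

context brst_coh
begin

lemma W_stable_preimage:
  assumes U: "cvs.subspace U" "\<And>w n h. h \<in> U \<Longrightarrow> YH w n h \<in> U" shows "W_stable {x. D x = 0 \<and> \<rho> x \<in> U}"
  unfolding W_stable_def
proof (intro conjI allI ballI impI)
  show "cvs.subspace {x. D x = 0 \<and> \<rho> x \<in> U}"
    using U(1) by (auto simp: cvs.subspace_def X2 rho_simps)
  show "range D \<subseteq> {x. D x = 0 \<and> \<rho> x \<in> U}"
  proof
    fix x assume x: "x \<in> range D"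
    then have "D x = 0" using D_square by auto
    moreover from this have "\<rho> x = 0" using x rho(2) by blast
    ultimately show "x \<in> {x. D x = 0 \<and> \<rho> x \<in> U}" using cvs.subspace_0[OF U(1)] by simp
  qed
  fix c n x assume "x \<in> {x. D x = 0 \<and> \<rho> x \<in> U}" "dC c = 0"
  then show "YX c n x \<in> {x. D x = 0 \<and> \<rho> x \<in> U}" using D_closed rho(3) U(2) by (metis (mono_tags, lifting) mem_Collect_eq)
qed simp

definition vH :: 'h where "vH = \<rho> (s v (vac F))"

lemma v_\<Omega>: "v \<in> \<Omega>" using v_OmV by (simp add: OmV_def)

lemma D_v: "D (s v (vac F)) = 0" by (rule D_s[OF v_\<Omega>])

lemma vH_nonzero: "vH \<noteq> 0"
proof
  assume "vH = 0"
  then obtain x where x: "s v (vac F) = D x" using rho(2)[OF D_v] unfolding vH_def by blast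
  have "V_stable {0}" by (simp add: V_stable_def cvs.subspace_def lin2_simps)
  from hw_not_cohomologous[OF this _ not_nat cvs.subspace_0[OF tens_sub], of x] show False using x v_nonzero by simp
qed

lemma Jc_s: "n \<ge> 0 \<Longrightarrow> YX (J_cocycle V \<iota> F g t) n (s m (vac F)) = s (YM (\<iota> hM) n m) (vac F)"
  by (simp add: Jc_eq X1 T.act_V T.act_F F.mode_vac T.s2_simps)

lemma Lc_s: "YX (L_cocycle k V \<iota> F g t) 1 (s m (vac F)) = s (Dg m) (vac F)"
proof -
  have V: "vsa V" by unfold_locales
  show ?thesis using transl_mode_action[OF V even, of "\<iota> xM" 1 m]
    by (simp add: Lc_eq X1 T.act_V T.act_F F.mode_vac T.s2_simps T.s1_simps CC.s1_simps lin1_simps Dg_def)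
qed

definition Hd :: "int \<Rightarrow> 'h set" where "Hd c = {h. YH L 1 h = (\<delta> + of_int c / 2) *\<^sub>C h}"

lemma Hd_sub: "cvs.subspace (Hd c)"
  by (auto simp: Hd_def cvs.subspace_def H.lin2_simps cvs.scale_right_distrib mult.commute)

lemma \<Omega>_Dg: "m \<in> \<Omega> \<Longrightarrow> Dg m \<in> \<Omega>"
proof -
  have c: "Y' (\<iota> A) n (Dg m) = 0" if "YM (\<iota> A) n m = 0" "A \<in> gr j" "Y' = YM" for A n j Y'
    using Dg_letter[OF that(2), of n m] that(1,3) by (simp add: clin_simps[OF Dg_lin])
  show "m \<in> \<Omega> \<Longrightarrow> Dg m \<in> \<Omega>" unfolding \<Omega>_def using c[OF _ gr_table(1) refl] c[OF _ gr_table(2) refl] c[OF _ gr_table(3) refl] by simp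
qed

text \<open>Every class is represented by some m in \<Omega>. \<open>Dg\<close> preserves \<Omega>,
  so the homogeneous components of m again give classes, and their weights are bounded below by
  \<delta>.\<close>

lemma H_decomp: obtains G f where "finite G" "\<And>c. c \<in> G \<Longrightarrow> c \<ge> 0 \<and> f c \<in> Hd c" "h = (\<Sum>c\<in>G. f c)"
proof -
  obtain x where x: "D x = 0" "h = \<rho> x" by (rule rho_surj)
  obtain m where m: "m \<in> \<Omega>" "x \<simeq> s m (vac F)" using cocycle_representative[OF x(1)] by blast
  have h: "h = \<rho> (s m (vac F))" using rho_coh[OF m(2) D_s[OF m(1)]] x(2) by simp
  obtain G f where G: "finite G" "G \<subseteq> {0..}" "\<And>c. f c \<in> Wd c" "m = (\<Sum>c\<in>G. f c)" using Wd_decomp[of m] by blast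
  have f: "f c \<in> \<Omega>" if "c \<in> G" for c
  proof (rule eigen_components[OF Dg_lin \<Omega>_sub \<Omega>_Dg G(1)])
    show "Dg (f c) = (\<delta> + of_int c / 2) *\<^sub>C f c" for c by (rule Wd_Dg[OF G(3)])
    show "(\<Sum>c\<in>G. f c) \<in> \<Omega>" using m(1) G(4) by simp
  qed (use that in \<open>auto simp: inj_on_def\<close>)
  have Hf: "\<rho> (s (f c) (vac F)) \<in> Hd c" if "c \<in> G" for c
  proof -
    have "YH (\<pi> Lc) 1 (\<rho> (s (f c) (vac F))) = (\<delta> + of_int c / 2) *\<^sub>C \<rho> (s (f c) (vac F))"
      using rho(3)[OF d_Lc D_s[OF f[OF that]], of 1] Wd_Dg[OF G(3), of c] D_s[OF f[OF that]]
      by (simp add: Lc_s T.s1_simps rho_simps)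
    then show ?thesis unfolding Hd_def L_def[symmetric] by simp
  qed
  have "D (\<Sum>c\<in>G'. s (f c) (vac F)) = 0 \<and> \<rho> (\<Sum>c\<in>G'. s (f c) (vac F)) = (\<Sum>c\<in>G'. \<rho> (s (f c) (vac F)))" if "finite G'" "G' \<subseteq> G" for G'
    using that by (induction G' rule: finite_induct) (simp_all add: X2 D_s f rho_simps)
  from this[OF G(1) order_refl] have hs: "h = (\<Sum>c\<in>G. \<rho> (s (f c) (vac F)))" by (simp add: h G(4) T.s1_simps)
  show thesis
  proof (rule that[OF G(1) _ hs])
    fix c assume "c \<in> G"
    then show "c \<ge> 0 \<and> \<rho> (s (f c) (vac F)) \<in> Hd c" using Hf[of c] G(2) by auto
  qed
qed

lemma Hd_neg: assumes "h \<in> Hd c" "c < 0" shows "h = 0"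
proof -
  obtain G f where G: "finite G" "\<And>c. c \<in> G \<Longrightarrow> c \<ge> 0 \<and> f c \<in> Hd c" "h = (\<Sum>c\<in>G. f c)" using H_decomp by blast
  have c: "c \<notin> G" using G(2) assms(2) by force
  define f' where "f' e = (if e = c then - h else f e)" for e
  have "(\<Sum>e\<in>insert c G. f' e) = - h + (\<Sum>e\<in>G. f e)" using G(1) c by (subst sum.insert) (auto simp: f'_def intro!: sum.cong)
  then have "(\<Sum>e\<in>insert c G. f' e) = 0" by (simp add: G(3))
  then have "f' c = 0"
    using G(1,2) assms(1) cvs.subspace_neg[OF Hd_sub assms(1)]
    by (intro eigen_components_zero[OF H.lin2, of "insert c G" L 1 f' "\<lambda>c. \<delta> + of_int c / 2"])
       (auto simp: f'_def Hd_def inj_on_def)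
  then show ?thesis by (simp add: f'_def)
qed

lemma gens_Hd: "(u, c) \<in> BP.gens \<Longrightarrow> h \<in> Hd e \<Longrightarrow> YH u n h \<in> Hd (e + c - 2 * (n + 1))"
  using BP.L1_commute[OF H.mod BP.gens_Weig, of u c n h]
  by (simp add: Hd_def H.lin2_simps diff_divide_distrib add_divide_distrib flip: cvs.scale_left_distrib)

lemma vH_L: "YH L 1 vH = \<delta> *\<^sub>C vH" and vH_J: "YH J 0 vH = wt hM *\<^sub>C vH"
  using rho(3)[OF d_Lc D_v, of 1] rho(3)[OF d_Jc D_v, of 0] Dg_v hw_wt[OF hM_cartan] D_v
  by (simp_all add: vH_def L_def J_def Lc_s Jc_s T.s1_simps rho_simps)

lemma vH_Hd: "vH \<in> Hd 0" using vH_L by (simp add: Hd_def)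

text \<open>x is the highest weight evaluated at h, and y = \<delta> - x/2 because the shift of L by
  half of \<partial>J subtracts half of J_(0). The annihilation conditions hold since the modes in
  question would lower the weight below \<delta>.\<close>

lemma vH_hw:
  assumes "x = (of_nat b - of_nat a) / 3"
    and "y = ((of_nat b - of_nat a)\<^sup>2 - 3 * (of_nat a + of_nat b) * (2 * (k + 1) - of_nat a - of_nat b)) / (12 * (k + 3))
          - (of_nat b - of_nat a) / 6"
  shows "YH J 0 vH = x *\<^sub>C vH" "YH (L + (1/2) *\<^sub>C transl W J) 1 vH = y *\<^sub>C vH"
    "n \<ge> 0 \<Longrightarrow> YH Gp (n + 1) vH = 0 \<and> YH Gm (n + 1) vH = 0 \<and> YH J (n + 1) vH = 0 \<and> YH (L + (1/2) *\<^sub>C transl W J) (n + 2) vH = 0"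
proof -
  have x: "wt hM = x" by (simp add: wt_def omega1_def omega2_def assms(1) mat3_simps field_simps)
  then show Jx: "YH J 0 vH = x *\<^sub>C vH" using vH_J by simp
  have tr: "YH (transl W J) m h = - of_int m *\<^sub>C YH J (m - 1) h" for m h by (rule H.transl_mode_action[OF W.vsa_axioms BP.even])
  have "k + 3 \<noteq> 0" using noncritical by (simp add: eq_neg_iff_add_eq_0)
  moreover define K where "K = k + 3"
  ultimately have K: "k = K - 3" "K \<noteq> 0" by simp_all
  have d: "\<delta> = (2 * (of_nat a ^ 2 + of_nat a * of_nat b + of_nat b ^ 2) / 3 + 2 * (of_nat a + of_nat b)) / (2 * K) - (of_nat a + of_nat b) / 2"
    unfolding \<delta>_def casimir_def K_def ..
  have "\<delta> - x / 2 = y"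
    unfolding d assms unfolding K(1) using K(2) by (simp add: field_simps power2_eq_square)
  then show "YH (L + (1/2) *\<^sub>C transl W J) 1 vH = y *\<^sub>C vH"
    by (simp add: H.lin1_simps tr vH_L Jx flip: cvs.scale_left_distrib cvs.scale_left_diff_distrib cvs.scale_minus_left)
  assume n: "n \<ge> 0"
  have "YH Gp (n + 1) vH = 0" "YH Gm (n + 1) vH = 0" "YH J (n + 1) vH = 0" "YH L (n + 2) vH = 0"
    using gens_Hd[of Gp 3, OF _ vH_Hd, of "n + 1"] gens_Hd[of Gm 3, OF _ vH_Hd, of "n + 1"]
      gens_Hd[of J 2, OF _ vH_Hd, of "n + 1"] gens_Hd[of L 4, OF _ vH_Hd, of "n + 2"] n unfolding BP.gens_def
    by (auto intro: Hd_neg)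
  then show "YH Gp (n + 1) vH = 0 \<and> YH Gm (n + 1) vH = 0 \<and> YH J (n + 1) vH = 0 \<and> YH (L + (1/2) *\<^sub>C transl W J) (n + 2) vH = 0"
    using tr[of "n + 2" vH] by (simp add: H.lin1_simps algebra_simps)
qed

text \<open>If the preimage of U contains the highest weight vector, it contains all cocycles; if
  not, \<open>W_stable_proper\<close> with the bound zero makes every class in U zero.\<close>

lemma H_irreducible:
  assumes simple: "\<And>U. V_stable U \<Longrightarrow> v \<notin> U \<Longrightarrow> U \<subseteq> {0}"
  shows "irreducible_under {YH u n | u n. True}"
  unfolding irreducible_under_def
proof (intro conjI allI impI)
  show "\<exists>m::'h. m \<noteq> 0" using vH_nonzero by blast
  fix U :: "'h set" assume U: "cvs.subspace U \<and> (\<forall>T\<in>{YH u n | u n. True}. T ` U \<subseteq> U)"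
  then have st: "YH w n h \<in> U" if "h \<in> U" for w n h using that by blast
  let ?Z = "{x. D x = 0 \<and> \<rho> x \<in> U}"
  have Z: "W_stable ?Z" by (rule W_stable_preimage) (use U st in auto)
  show "U = {0} \<or> U = UNIV"
  proof (cases "s v (vac F) \<in> ?Z")
    case True
    have "h \<in> U" for h
    proof -
      obtain x where x: "D x = 0" "h = \<rho> x" by (rule rho_surj)
      then show ?thesis using W_stable_all[OF Z True x(1)] by simp
    qed
    then show ?thesis by blast
  next
    case False
    have "h = 0" if "h \<in> U" for h
    proof -
      obtain x where x: "D x = 0" "h = \<rho> x" by (rule rho_surj)
      then have "x \<in> ?Z" using that by simp
      then obtain m where "m \<in> {0} \<inter> \<Omega>" "x \<simeq> s m (vac F)" using W_stable_proper[OF Z False simple] by blast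
      then have "x \<simeq> 0" by (simp add: T.s1_simps)
      then show ?thesis using rho_coh[of x 0] x(2) by (simp add: X2 rho_simps)
    qed
    then show ?thesis using U cvs.subspace_0 by blast
  qed
qed

end

section \<open>Modules over the simple quotients\<close>

lemma vac_nonzero:
  fixes Q :: "('q::complex_vector) vosa"
  assumes "vertex_superalgebra Q" "va_simple Q" shows "vac Q \<noteq> 0"
proof
  assume v: "vac Q = 0"
  interpret vsa Q by unfold_locales fact
  have "q = 0" for q :: 'q using mode_of_vac[of "-1" q] by (simp add: v self.lin1_simps)
  then show False using assms(2) by (auto simp: va_simple_def)
qed

lemma quotient_module_iff:
  fixes V :: "('v::complex_vector) vosa" and Y :: "'v \<Rightarrow> int \<Rightarrow> 'm \<Rightarrow> 'm::complex_vector"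
  assumes q: "simple_quotient V Q p" and mod: "va_module V Y"
  shows "quotient_module Q p Y \<longleftrightarrow> (\<forall>u n m. p u = 0 \<longrightarrow> Y u n m = 0)"
proof
  assume "quotient_module Q p Y"
  then obtain Y' where Y': "va_module Q Y'" "\<And>u n m. Y u n m = Y' (p u) n m" unfolding quotient_module_def by blast
  interpret va_mod Q Y' by unfold_locales fact
  show "\<forall>u n m. p u = 0 \<longrightarrow> Y u n m = 0" by (simp add: Y'(2) lin1_simps)
next
  assume ker: "\<forall>u n m. p u = 0 \<longrightarrow> Y u n m = 0"
  interpret va_mod V Y by unfold_locales fact
  have p: "clin p" "surj p" "p (vac V) = vac Q" "\<And>u n v. p (mode V u n v) = mode Q (p u) n (p v)" "\<And>r. p ` par V r = par Q r"
    using q by (auto simp: simple_quotient_def)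
  define Y' where "Y' a n m = Y (inv p a) n m" for a n m
  have Yp: "Y' (p u) n m = Y u n m" for u n m
  proof -
    have "p (inv p (p u) - u) = 0" by (simp add: clin_simps[OF p(1)] surj_f_inv_f[OF p(2)])
    then have "Y (inv p (p u) - u) n m = 0" using ker by blast
    then show ?thesis by (simp add: Y'_def lin1_simps)
  qed
  have "va_module Q Y'"
    unfolding va_module_def
  proof (intro conjI allI ballI)
    fix n m
    show "clin (\<lambda>a. Y' a n m)"
    proof (rule clinI)
      fix c a b
      obtain a' b' where a: "a = p a'" "b = p b'" using p(2) by (metis surjD)
      have "Y' (p (c *\<^sub>C a' + b')) n m = c *\<^sub>C Y' (p a') n m + Y' (p b') n m" unfolding Yp by (simp add: lin1_simps)
      then show "Y' (c *\<^sub>C a + b) n m = c *\<^sub>C Y' a n m + Y' b n m" by (simp add: a clin_simps[OF p(1)])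
    qed
    show "Y' (vac Q) n m = (if n = -1 then m else 0)" using Yp[of "vac V" n m] by (simp add: p(3) vacuum)
  next
    fix a n show "clin (Y' a n)" unfolding Y'_def by (rule lin2)
  next
    fix a m show "\<exists>N. \<forall>n\<ge>N. Y' a n m = 0" unfolding Y'_def by (rule trunc)
  next
    fix r q a b l m n c assume "a \<in> par Q r" "b \<in> par Q q"
    then obtain a' b' where a: "a = p a'" "a' \<in> par V r" "b = p b'" "b' \<in> par V q" unfolding p(5)[symmetric] by blast
    show "Sum_any (\<lambda>j::nat. (of_int m gchoose j) *\<^sub>C Y' (mode Q a (l + int j) b) (m + n - int j) c)
        = Sum_any (\<lambda>j::nat. ((-1) ^ j * (of_int l gchoose j)) *\<^sub>C Y' a (m + l - int j) (Y' b (n + int j) c))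
          - ((-1) powi l * (if r \<and> q then -1 else 1)) *\<^sub>C
            Sum_any (\<lambda>j::nat. ((-1) ^ j * (of_int l gchoose j)) *\<^sub>C Y' b (n + l - int j) (Y' a (m + int j) c))"
      using borcherds[OF a(2,4), of m l n c] by (simp add: a(1,3) p(4)[symmetric] Yp ssgn_def)
  qed
  then show "quotient_module Q p Y" unfolding quotient_module_def using Yp by metis
qed

context brst_coh
begin

lemma vacV_nonzero: "vac V \<noteq> 0"
  using vacuum[of "-1" v] v_nonzero by (auto simp: lin1_simps)

end

text \<open>The reduction of the adjoint module is W acting on itself, with \<pi> in the role of
  \<rho>.\<close>

sublocale brst_coh \<subseteq> CW: brst_coh k V \<iota> "mode V" "vac V" 0 0 F g C t d "mode C" t W \<pi> \<pi> "mode W" J Gp Gm L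
proof unfold_locales
  show "module_cohomology C d W \<pi> (mode C) \<pi> (mode W)"
    using va_coh W.self.mod by (simp add: module_cohomology_def va_cohomology_def Let_def)
qed (use va_coh J_def L_def bp not_nat vacV_nonzero in auto)

section \<open>The kernels of the two simple quotients\<close>

context brst_coh
begin

context
  fixes Vk :: "('vq::complex_vector) vosa" and pV :: "'v \<Rightarrow> 'vq" and Wk :: "('wq::complex_vector) vosa" and pW :: "'w \<Rightarrow> 'wq"
  assumes qV: "simple_quotient V Vk pV" and qW: "simple_quotient W Wk pW"
    and simple: "\<And>U. V_stable U \<Longrightarrow> v \<notin> U \<Longrightarrow> U \<subseteq> {0}"
begin

lemma pV: "clin pV" "surj pV" "pV (vac V) = vac Vk" "pV (mode V u n w) = mode Vk (pV u) n (pV w)" "pV ` par V r = par Vk r"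
    "vac Vk \<noteq> 0" "va_ideal Vk I \<Longrightarrow> I = {0} \<or> I = UNIV"
  using qV vac_nonzero[of Vk] by (auto simp: simple_quotient_def va_simple_def)

lemma pW: "clin pW" "surj pW" "pW (vac W) = vac Wk" "pW (mode W u n w) = mode Wk (pW u) n (pW w)" "pW ` par W r = par Wk r"
    "vac Wk \<noteq> 0" "va_ideal Wk I' \<Longrightarrow> I' = {0} \<or> I' = UNIV"
  using qW vac_nonzero[of Wk] by (auto simp: simple_quotient_def va_simple_def)

abbreviation "IV \<equiv> {u. pV u = 0}"
abbreviation "IW \<equiv> {u. pW u = 0}"

lemma quotient_lin: "mode Vk 0 n q = 0" "mode Vk q n 0 = 0" "mode Wk 0 n r = 0" "mode Wk r n 0 = 0"
proof -
  interpret Vk: vsa Vk using qV by unfold_locales (simp add: simple_quotient_def)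
  interpret Wk: vsa Wk using qW by unfold_locales (simp add: simple_quotient_def)
  show "mode Vk 0 n q = 0" "mode Vk q n 0 = 0" "mode Wk 0 n r = 0" "mode Wk r n 0 = 0"
    by (simp_all add: Vk.self.lin1_simps Vk.self.lin2_simps Wk.self.lin1_simps Wk.self.lin2_simps)
qed

lemma IV_stable: "adj.V_stable IV" and IV_mode: "u \<in> IV \<Longrightarrow> mode V u n w \<in> IV"
  by (auto simp: adj.V_stable_def cvs.subspace_def clin_simps[OF pV(1)] pV(4) quotient_lin)

lemma IW_ideal: "cvs.subspace IW" "u \<in> IW \<Longrightarrow> mode W u n w \<in> IW" "u \<in> IW \<Longrightarrow> mode W w n u \<in> IW"
  by (auto simp: cvs.subspace_def clin_simps[OF pW(1)] pW(4) quotient_lin)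

text \<open>U is two-sided, so its image in the simple quotient is zero or everything. In the latter
  case the vacuum would be a sum of elements of two submodules that miss it, against
  \<open>v_not_sum\<close>.\<close>

lemma IV_max:
  assumes U: "adj.V_stable U" "vac V \<notin> U" shows "U \<subseteq> IV"
proof -
  have sub: "cvs.subspace U" and st: "\<And>u n x. x \<in> U \<Longrightarrow> mode V u n x \<in> U" using U(1) by (auto simp: adj.V_stable_def)
  have oddV: "par V True = {0}" using ua by (simp add: universal_affine_def vertex_algebra_def)
  have "va_ideal Vk (pV ` U)" unfolding va_ideal_def
  proof (intro conjI ballI allI impI)
    show "cvs.subspace (pV ` U)"
    proof (rule cvs.subspaceI)
      show "0 \<in> pV ` U" using cvs.subspace_0[OF sub] clin_zero[OF pV(1)] by (metis imageI)
    next
      fix x y assume "x \<in> pV ` U" "y \<in> pV ` U"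
      then obtain x' y' where "x = pV x'" "y = pV y'" "x' \<in> U" "y' \<in> U" by blast
      then show "x + y \<in> pV ` U" using cvs.subspace_add[OF sub] by (intro image_eqI[of _ _ "x' + y'"]) (simp_all add: clin_simps[OF pV(1)])
    next
      fix c x assume "x \<in> pV ` U"
      then obtain x' where "x = pV x'" "x' \<in> U" by blast
      then show "c *\<^sub>C x \<in> pV ` U" using cvs.subspace_scale[OF sub] by (intro image_eqI[of _ _ "c *\<^sub>C x'"]) (simp_all add: clin_simps[OF pV(1)])
    qed
    fix a b assume "a \<in> par Vk False" "b \<in> par Vk True" "a + b \<in> pV ` U"
    then show "a \<in> pV ` U" using pV(5)[of True, symmetric] by (simp add: oddV clin_zero[OF pV(1)])
  next
    fix a u n assume "u \<in> pV ` U"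
    moreover obtain a' where "a = pV a'" using pV(2) by (metis surjD)
    ultimately show "mode Vk a n u \<in> pV ` U" "mode Vk u n a \<in> pV ` U"
      using st left_ideal_two_sided[OF U(1)] by (auto simp flip: pV(4))
  qed
  then have "pV ` U = {0} \<or> pV ` U = UNIV" by (rule pV(7))
  moreover have "pV ` U \<noteq> UNIV"
  proof
    assume "pV ` U = UNIV"
    then have "vac Vk \<in> pV ` U" by simp
    then obtain u where u: "u \<in> U" "vac Vk = pV u" by blast
    then have "vac V - u \<in> IV" by (simp add: clin_simps[OF pV(1)] pV(3))
    then have "vac V \<noteq> u + (vac V - u)" using pV(3,6) by (intro CX.v_not_sum[OF U(1) IV_stable U(2) _ not_nat u(1)]) simp_all
    then show False by simp
  qed
  ultimately show ?thesis by blast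
qed

text \<open>\<open>W_stable_proper\<close> for the adjoint module, with the bound provided by
  \<open>IV_max\<close>.\<close>

lemma IW_rep:
  assumes "w \<in> IW" shows "\<exists>m\<in>IV \<inter> adj.\<Omega>. w = \<pi> (t m (vac F))"
proof -
  obtain c where c: "dC c = 0" "w = \<pi> c" by (rule pi_surj)
  let ?Z = "{c. dC c = 0 \<and> \<pi> c \<in> IW}"
  have Z: "CX.W_stable ?Z" by (rule CW.W_stable_preimage[OF IW_ideal(1) IW_ideal(3)])
  have "\<pi> (vac C) = vac W" using va_coh by (simp add: va_cohomology_def Let_def)
  then have "t (vac V) (vac F) \<notin> ?Z" using pW(3,6) by (simp add: t_vac)
  then obtain m where m: "m \<in> IV \<inter> adj.\<Omega>" "CX.coh c (t m (vac F))"
    using CX.W_stable_proper[OF Z _ IV_max, of c] c assms by blast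
  then have "w = \<pi> (t m (vac F))" using CW.rho_coh[OF m(2) CX.D_s] c(2) by simp
  then show ?thesis using m(1) by blast
qed

lemma IV_zero_IW_zero:
  assumes "\<And>u n m. u \<in> IV \<Longrightarrow> YM u n m = 0" and w: "w \<in> IW" shows "YH w n h = 0"
proof -
  obtain m where m: "m \<in> IV" "m \<in> adj.\<Omega>" "w = \<pi> (t m (vac F))" using IW_rep[OF w] by blast
  obtain x where x: "D x = 0" "h = \<rho> x" by (rule rho_surj)
  have "YX (t m (vac F)) n x = (\<lambda>_. 0) x"
    by (rule X_eqI) (simp_all add: T.X.lin2 clinI T.act_V assms(1)[OF m(1)] T.s1_simps)
  then show ?thesis using rho(3)[OF CX.D_s[OF m(2)] x(1), of n] by (simp add: m(3) x(2) rho_simps)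
qed

lemma tens_IV_mode: assumes "c \<in> CX.tens IV" shows "mode C c' n c \<in> CX.tens IV" "mode C c n c' \<in> CX.tens IV"
proof -
  note sub = CX.tens_sub[of IV]
  have mem: "t i f \<in> CX.tens IV" if "i \<in> IV" for i f unfolding CX.tens_def using that by (intro cvs.span_base) blast
  have "{c'. \<forall>c\<in>CX.tens IV. mode C c' n c \<in> CX.tens IV \<and> mode C c n c' \<in> CX.tens IV} = UNIV"
  proof (rule tensor_induct[OF CC.s])
    show "cvs.subspace {c'. \<forall>c\<in>CX.tens IV. mode C c' n c \<in> CX.tens IV \<and> mode C c n c' \<in> CX.tens IV}"
      using sub by (auto simp: cvs.subspace_def C_lin)
    fix u f
    have "CX.tens IV \<subseteq> {c. mode C (t u f) n c \<in> CX.tens IV \<and> mode C c n (t u f) \<in> CX.tens IV}"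
      unfolding CX.tens_def[of IV]
    proof (rule cvs.span_minimal)
      show "cvs.subspace {c. mode C (t u f) n c \<in> cvs.span {t i h | i h. i \<in> IV} \<and> mode C c n (t u f) \<in> cvs.span {t i h | i h. i \<in> IV}}"
        using sub unfolding CX.tens_def by (auto simp: cvs.subspace_def C_lin)
      have "mode C (t u f) n (t i h) \<in> CX.tens IV" "mode C (t i h) n (t u f) \<in> CX.tens IV" if "i \<in> IV" for i h
        using that IV_stable IV_mode[OF that] by (auto intro!: CC.act_mem[OF sub] mem simp: adj.V_stable_def)
      then show "{t i h | i h. i \<in> IV} \<subseteq> {c. mode C (t u f) n c \<in> cvs.span {t i h | i h. i \<in> IV} \<and> mode C c n (t u f) \<in> cvs.span {t i h | i h. i \<in> IV}}"
        unfolding CX.tens_def by blast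
    qed
    then show "t u f \<in> {c'. \<forall>c\<in>CX.tens IV. mode C c' n c \<in> CX.tens IV \<and> mode C c n c' \<in> CX.tens IV}" by blast
  qed
  then show "mode C c' n c \<in> CX.tens IV" "mode C c n c' \<in> CX.tens IV" using assms by blast+
qed

text \<open>The classes of cocycles in \<open>IV\<close> tensored with F map to an ideal of the
  simple quotient of W. It is not everything, because the vacuum is not a coboundary modulo that
  tensor product; so it is zero.\<close>

lemma tens_IV_IW:
  assumes m: "m \<in> IV" "m \<in> adj.\<Omega>" shows "\<pi> (t m (vac F)) \<in> IW"
proof -
  let ?K = "{c. dC c = 0 \<and> c \<in> CX.tens IV}"
  let ?P = "(\<lambda>c. pW (\<pi> c)) ` ?K"
  have sub: "cvs.subspace ?K" using CX.tens_sub[of IV] by (auto simp: cvs.subspace_def C_lin)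
  have P: "\<pi> (c + c') = \<pi> c + \<pi> c'" "\<pi> (e *\<^sub>C c) = e *\<^sub>C \<pi> c" if "dC c = 0" "dC c' = 0" for c c' e
    using CW.rho_simps(2)[OF that] CW.rho_simps(3)[OF that(1)] by auto
  have mem: "t i f \<in> CX.tens IV" if "i \<in> IV" for i f unfolding CX.tens_def using that by (intro cvs.span_base) blast
  have "va_ideal Wk ?P" unfolding va_ideal_def
  proof (intro conjI ballI allI impI)
    show "cvs.subspace ?P"
    proof (rule cvs.subspaceI)
      show "0 \<in> ?P" using cvs.subspace_0[OF sub] by (intro image_eqI[of _ _ 0]) (simp_all add: CW.rho_simps clin_zero[OF pW(1)])
    next
      fix x y assume "x \<in> ?P" "y \<in> ?P"
      then obtain c c' where "x = pW (\<pi> c)" "y = pW (\<pi> c')" "c \<in> ?K" "c' \<in> ?K" by blast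
      then show "x + y \<in> ?P" using cvs.subspace_add[OF sub] by (intro image_eqI[of _ _ "c + c'"]) (simp_all add: P clin_simps[OF pW(1)])
    next
      fix e x assume "x \<in> ?P"
      then obtain c where "x = pW (\<pi> c)" "c \<in> ?K" by blast
      then show "e *\<^sub>C x \<in> ?P" using cvs.subspace_scale[OF sub] P(2)[of c c] by (intro image_eqI[of _ _ "e *\<^sub>C c"]) (simp_all add: clin_simps[OF pW(1)])
    qed
    have odd: "par W True = {0}" using W.par_disjoint W_even by simp
    fix a b assume "a \<in> par Wk False" "b \<in> par Wk True" "a + b \<in> ?P"
    then show "a \<in> ?P" using pW(5)[of True, symmetric] by (simp add: odd clin_zero[OF pW(1)])
  next
    fix a u n assume "u \<in> ?P"
    then obtain c where c: "u = pW (\<pi> c)" "dC c = 0" "c \<in> CX.tens IV" by blast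
    obtain w where "a = pW w" using pW(2) by (metis surjD)
    moreover obtain c' where c': "dC c' = 0" "w = \<pi> c'" by (rule pi_surj)
    ultimately have a: "a = pW (\<pi> c')" by simp
    have "mode Wk a n u = pW (\<pi> (mode C c' n c))" "mode Wk u n a = pW (\<pi> (mode C c n c'))"
      unfolding a c(1) pW(4)[symmetric] using CW.rho(3)[OF c'(1) c(2)] CW.rho(3)[OF c(2) c'(1)] by simp_all
    then show "mode Wk a n u \<in> ?P" "mode Wk u n a \<in> ?P"
      using tens_IV_mode[OF c(3)] CW.D_closed[OF c'(1) c(2)] CW.D_closed[OF c(2) c'(1)] by blast+
  qed
  then have "?P = {0} \<or> ?P = UNIV" by (rule pW(7))
  moreover have "?P \<noteq> UNIV"
  proof
    assume "?P = UNIV"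
    then have "vac Wk \<in> ?P" by simp
    then obtain c where c: "vac Wk = pW (\<pi> c)" "dC c = 0" "c \<in> CX.tens IV" by blast
    have vac: "\<pi> (vac C) = vac W" "dC (vac C) = 0" using va_coh by (simp_all add: va_cohomology_def Let_def C.mode_vac)
    have "vac W - \<pi> c \<in> IW" by (simp add: clin_simps[OF pW(1)] pW(3) c(1))
    then obtain i where i: "i \<in> IV" "i \<in> adj.\<Omega>" "vac W - \<pi> c = \<pi> (t i (vac F))" using IW_rep by blast
    define c' where "c' = c + t i (vac F)"
    have c': "dC c' = 0" "\<pi> c' = \<pi> (vac C)"
      using c(2) CX.D_s[OF i(2)] P(1)[OF c(2) CX.D_s[OF i(2)]] i(3) vac(1) by (simp_all add: c'_def C_lin algebra_simps)
    have n: "dC ((-1) *\<^sub>C c') = 0" "\<pi> ((-1) *\<^sub>C c') = (-1) *\<^sub>C \<pi> c'" using c'(1) P(2)[OF c'(1) c'(1), of "-1"] by (simp_all only: C_lin cvs.scale_zero_right)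
    have "\<pi> (vac C + (-1) *\<^sub>C c') = 0" using P(1)[OF vac(2) n(1)] n(2) c'(2) by simp
    moreover have "dC (vac C + (-1) *\<^sub>C c') = 0" using vac(2) n(1) by (simp only: C_lin add_0)
    ultimately obtain x where "vac C + (-1) *\<^sub>C c' = dC x" using CW.rho(2) by blast
    then have "t (vac V) (vac F) = dC x + (c + t i (vac F))" by (simp add: t_vac c'_def algebra_simps)
    moreover have "c + t i (vac F) \<in> CX.tens IV" using c(3) mem[OF i(1)] cvs.subspace_add[OF CX.tens_sub] by blast
    ultimately show False using CX.hw_not_cohomologous[OF IV_stable _ not_nat, of "c + t i (vac F)" x] pV(3,6) by simp
  qed
  ultimately have "?P = {0}" by blast
  moreover have "t m (vac F) \<in> ?K" using CX.D_s[OF m(2)] mem[OF m(1)] by simp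
  ultimately have "pW (\<pi> (t m (vac F))) = 0" by blast
  then show ?thesis by simp
qed

text \<open>For i in \<open>IV\<close> and \<open>adj.\<Omega>\<close> the class of i lies in
  \<open>IW\<close>, so i_(n) m is exact for m in \<Omega>, hence zero: \<open>Om2 (range D)\<close>
  spans a submodule missing v. Elimination in M extends this to all vectors, and the transporter
  argument extends it to all of \<open>IV\<close>.\<close>

lemma IW_zero_IV_zero:
  assumes H0: "\<And>w n h. w \<in> IW \<Longrightarrow> YH w n h = 0" and u: "u \<in> IV" shows "YM u n m = 0"
proof -
  have 0: "V_stable {0}" by (simp add: V_stable_def cvs.subspace_def lin2_simps)
  have v0: "v \<notin> {0}" using v_nonzero by simp
  \<comment> \<open>The vectors killed by some power of e_(-1) form a submodule, and v is not among
    them because each e_(-1)^r v generates v.\<close>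
  have sat0: "saturated {0}"
  proof -
    have s: "V_stable (saturation {0})"
      using 0 by (intro saturation(1)) (auto simp: V_stable_def b_stable_def)
    have "v \<notin> saturation {0}"
      using Ev_generates[OF 0 not_nat] v0 by (auto simp: saturation_def)
    then have "saturation {0} \<subseteq> {0}" using simple[OF s] by blast
    moreover have "x \<in> saturation {0}" if "E (-1) x = 0" for x
      unfolding saturation_def using that by (intro CollectI exI[of _ 1]) simp
    ultimately show ?thesis unfolding saturated_def by blast
  qed
  have Zr: "W_stable (range D)"
  proof -
    have "range D = {x. D x = 0 \<and> \<rho> x \<in> {0}}" using D_square rho(2) by auto
    then show ?thesis using W_stable_preimage[of "{0}"] by (simp add: H.lin2_simps)
  qed
  obtain U where U: "V_stable U" "Om2 (range D) \<subseteq> U" "U \<inter> \<Omega> \<subseteq> Om2 (range D)" by (rule Om2_generates[OF Zr])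
  have "v \<notin> U"
  proof
    assume "v \<in> U"
    then have "s v (vac F) \<in> range D" using U(3) v_\<Omega> Om2_D(2) by blast
    then show False using vH_nonzero rho(2)[OF D_v] by (simp add: vH_def)
  qed
  then have Om20: "Om2 (range D) \<subseteq> {0}" using simple U(1,2) by blast
  have van: "YM i n m = 0" if i: "i \<in> IV" "i \<in> adj.\<Omega>" and m: "m \<in> \<Omega>" for i n m
  proof -
    let ?T = "cvs.span {YM i n m | i n m. i \<in> IV \<inter> adj.\<Omega> \<and> m \<in> \<Omega>}"
    have "?T \<subseteq> Om2 (range D)"
    proof (rule Om2_max)
      show "?T \<subseteq> \<Omega>" using vacuum_state_\<Omega> by (intro cvs.span_minimal \<Omega>_sub) blast
      fix y assume y: "y \<in> ?T"
      have "?T \<subseteq> {y. s y (vac F) \<in> range D}"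
      proof (rule cvs.span_minimal)
        show "cvs.subspace {y. s y (vac F) \<in> range D}" using range_D_sub by (auto simp: cvs.subspace_def T.s1_simps)
        have "s (YM i n m) (vac F) \<in> range D" if "i \<in> IV" "i \<in> adj.\<Omega>" "m \<in> \<Omega>" for i n m
        proof -
          have "\<rho> (YX (t i (vac F)) n (s m (vac F))) = 0"
            using rho(3)[OF CX.D_s[OF that(2)] D_s[OF that(3)], of n] H0[OF tens_IV_IW[OF that(1,2)]] by simp
          then show ?thesis using rho(2)[OF D_closed[OF CX.D_s[OF that(2)] D_s[OF that(3)], of n]] by (simp add: T.act_V)
        qed
        then show "{YM i n m | i n m. i \<in> IV \<inter> adj.\<Omega> \<and> m \<in> \<Omega>} \<subseteq> {y. s y (vac F) \<in> range D}" by blast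
      qed
      then show "s y (vac F) \<in> range D" using y by blast
      fix l :: int assume l: "l \<ge> 0"
      have "?T \<subseteq> {y. Om l y \<in> ?T}"
      proof (rule cvs.span_minimal)
        show "cvs.subspace {y. Om l y \<in> ?T}"
          by (auto simp: cvs.subspace_def lin2_simps cvs.span_zero intro: cvs.span_add cvs.span_scale)
        have "Om l (YM i n m) \<in> ?T" if i: "i \<in> IV" "i \<in> adj.\<Omega>" "m \<in> \<Omega>" for i n m
        proof -
          have "adj.Om (int j) i \<in> IV" for j using IV_stable i(1) by (simp add: adj.V_stable_def)
          then have "YM (adj.Om (int j) i) q m \<in> ?T" for j q
            using adj.Om_\<Omega>[OF i(2), of "int j"] i(3) by (intro cvs.span_base) auto
          moreover have "YM i n (Om l m) \<in> ?T" using i Om_\<Omega>[OF i(3) l] by (intro cvs.span_base) auto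
          ultimately show ?thesis unfolding Om_vacuum_state
            by (intro cvs.span_add Sum_any_mem_subspace cvs.subspace_span cvs.span_scale)
        qed
        then show "{YM i n m | i n m. i \<in> IV \<inter> adj.\<Omega> \<and> m \<in> \<Omega>} \<subseteq> {y. Om l y \<in> ?T}" by blast
      qed
      then show "Om l y \<in> ?T" using y by blast
    qed
    moreover have "YM i n m \<in> ?T" using i m by (intro cvs.span_base) blast
    ultimately show ?thesis using Om20 by blast
  qed
  let ?S = "{x. \<forall>i\<in>IV \<inter> adj.\<Omega>. \<forall>n. YM i n x = 0}"
  have S_sub: "cvs.subspace ?S" by (auto simp: cvs.subspace_def lin2_simps)
  have "UNIV \<subseteq> ?S"
  proof (rule contains_if_contains_vacuum)
    show "cvs.subspace ?S" by (rule S_sub)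
    show "b_stable ?S" unfolding b_stable_def
    proof safe
      fix n x i l assume x: "\<forall>i\<in>IV \<inter> adj.\<Omega>. \<forall>n. YM i n x = 0" and i: "pV i = 0" "i \<in> adj.\<Omega>"
      have ix: "YM i l x = 0" for l using x i by simp
      show "YM i l (E n x) = 0" "YM i l (P n x) = 0" "YM i l (Q n x) = 0"
        using vacuum_state_comm[OF i(2), of n l x] ix by (simp_all add: lin2_simps)
      \<comment> \<open>\<omega> does not commute with the modes of i. The states i_(j) \<omega>
        remain in \<open>IV\<close>, and in \<open>adj.\<Omega>\<close> because i_(j) commutes with
        e, p, q and kills the corresponding states; so they act on x by zero.\<close>
      have "Sum_any (\<lambda>j::nat. (of_int l gchoose j) *\<^sub>C YM (mode V i (int j) (\<iota> wM)) (l + n - int j) x) = 0"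
      proof -
        have "mode V i (int j) (\<iota> wM) \<in> IV" for j using IV_mode i(1) by simp
        moreover have "mode V i (int j) (\<iota> wM) \<in> adj.\<Omega>" for j
        proof -
          have c: "mode V (\<iota> A) q (mode V i (int j) (\<iota> wM)) = mode V i (int j) (mode V (\<iota> A) q (\<iota> wM))" if "A \<in> {eM, pM, qM}" for A q
            using adj.vacuum_state_comm[OF i(2), of q "int j" "\<iota> wM"] that by auto
          have iA: "mode V i (int j) (\<iota> A) = 0" if "A \<in> {eM, pM, qM}" for A
          proof -
            have "mode V (\<iota> A) (int r) i = 0" for r using i(2) that by (auto simp: adj.\<Omega>_def)
            then show ?thesis using ope_zero_skew[OF even even, of 0 "\<iota> A" i j] by simp
          qed
          show ?thesis unfolding adj.\<Omega>_def
            by (auto elim!: nonneg_int_cases simp: c V_ope self.lin2_simps iA)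
        qed
        ultimately have "YM (mode V i (int j) (\<iota> wM)) q x = 0" for j q using x by blast
        then show ?thesis by simp
      qed
      then show "YM i l (Om n x) = 0"
        using commutator[OF even even, of i l "\<iota> wM" n x] ix by (simp add: lin2_simps)
    qed
    show "saturated ?S" unfolding saturated_def
    proof safe
      fix x i l assume x: "\<forall>i\<in>IV \<inter> adj.\<Omega>. \<forall>n. YM i n (E (-1) x) = 0" and i: "pV i = 0" "i \<in> adj.\<Omega>"
      have "E (-1) (YM i l x) \<in> {0}" using vacuum_state_comm(1)[OF i(2), of "-1" l x] x i by simp
      then show "YM i l x = 0" using sat0 unfolding saturated_def by blast
    qed
    show "UNIV \<inter> \<Omega> \<subseteq> ?S" using van by auto
  qed (auto simp: b_stable_def)
  then have z: "YM i n x = 0" if "i \<in> IV" "i \<in> adj.\<Omega>" for i n x using that by blast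
  have "IV \<subseteq> transporter UNIV {0}"
  proof (rule transporter_contains[OF _ _ _ sat0])
    show "b_stable UNIV" "b_stable {0}" by (auto simp: b_stable_def lin2_simps)
    show "cvs.subspace IV" "adj.b_stable IV" using IV_stable adj.V_stable_b by (auto simp: adj.V_stable_def)
    show "cvs.subspace {0::'m}" by (simp add: cvs.subspace_def)
  qed (use z in auto)
  then show ?thesis using u by (auto simp: transporter_def)
qed

text \<open>YN is an arbitrary copy of L[x, y]. It and YH are irreducible with highest weight
  vectors of equal weights, so \<open>annihilator_transfer\<close> in both directions shows that
  \<open>IW\<close> kills one exactly if it kills the other.\<close>

lemma quotient_modules_iff:
  assumes x: "x = (of_nat b - of_nat a) / 3"
    and y: "y = ((of_nat b - of_nat a)\<^sup>2 - 3 * (of_nat a + of_nat b) * (2 * (k + 1) - of_nat a - of_nat b)) / (12 * (k + 3))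
          - (of_nat b - of_nat a) / 6"
    and N: "bp_irreducible_hw W J Gp Gm L x y YN"
  shows "quotient_module Vk pV YM \<longleftrightarrow> quotient_module Wk pW YN"
proof -
  have modN: "va_module W YN" and irrN: "irreducible_under {YN u n | u n. True}" using N by (simp_all add: bp_irreducible_hw_def)
  obtain vN where vN: "BP.hw_vector YN x (y + x / 2) vN"
    using N BP.hw_vectorI[OF modN] unfolding bp_irreducible_hw_def Let_def by blast
  have vH: "BP.hw_vector YH x (y + x / 2) vH"
    using vH_hw[OF x y] vH_nonzero by (intro BP.hw_vectorI[OF H.mod]) blast+
  have irrH: "irreducible_under {YH u n | u n. True}" by (rule H_irreducible[OF simple])
  interpret NH: bp_hw_pair W k J Gp Gm L YN YH vN vH x "y + x / 2"
    by unfold_locales (use modN H.mod vN vH in auto)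
  interpret HN: bp_hw_pair W k J Gp Gm L YH YN vH vN x "y + x / 2"
    by unfold_locales (use modN H.mod vN vH in auto)
  have "(\<forall>w n h. w \<in> IW \<longrightarrow> YN w n h = 0) \<longleftrightarrow> (\<forall>w n h. w \<in> IW \<longrightarrow> YH w n h = 0)"
    using NH.annihilator_transfer[OF IW_ideal _ irrH] HN.annihilator_transfer[OF IW_ideal _ irrN] by metis
  moreover have "(\<forall>w n h. w \<in> IW \<longrightarrow> YH w n h = 0) \<longleftrightarrow> (\<forall>u n m. u \<in> IV \<longrightarrow> YM u n m = 0)"
    using IV_zero_IW_zero IW_zero_IV_zero by blast
  ultimately show ?thesis using quotient_module_iff[OF qV mod] quotient_module_iff[OF qW modN] by simp
qed

end

end

theorem corollary6p4:
  fixes k x y :: complex and a b :: nat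
    and V :: "('v::complex_vector) vosa" and \<iota> :: "mat3 \<Rightarrow> 'v"
    and F :: "('f::complex_vector) vosa" and g :: "'f ghosts"
    and C :: "('c::complex_vector) vosa" and t :: "'v \<Rightarrow> 'f \<Rightarrow> 'c" and d :: 'c
    and W :: "('w::complex_vector) vosa" and \<pi> :: "'c \<Rightarrow> 'w"
    and J Gp Gm L :: 'w
    and YM :: "'v \<Rightarrow> int \<Rightarrow> 'm \<Rightarrow> 'm::complex_vector"
    and s :: "'m \<Rightarrow> 'f \<Rightarrow> 'x::complex_vector" and YX :: "'c \<Rightarrow> int \<Rightarrow> 'x \<Rightarrow> 'x"
    and \<rho> :: "'x \<Rightarrow> 'h::complex_vector" and YH :: "'w \<Rightarrow> int \<Rightarrow> 'h \<Rightarrow> 'h"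
    and Vk :: "('vq::complex_vector) vosa" and pV :: "'v \<Rightarrow> 'vq"
    and Wk :: "('wq::complex_vector) vosa" and pW :: "'w \<Rightarrow> 'wq"
    and YN :: "'w \<Rightarrow> int \<Rightarrow> 'n \<Rightarrow> 'n::complex_vector"
  assumes "k \<noteq> -3" and "k \<notin> \<nat>"
    and x_def: "x = (of_nat b - of_nat a) / 3"
    and y_def: "y = ((of_nat b - of_nat a)\<^sup>2
                      - 3 * (of_nat a + of_nat b) * (2 * (k + 1) - of_nat a - of_nat b))
                     / (12 * (k + 3))
                    - (of_nat b - of_nat a) / 6"
    (* V^k(sl_3) and its reduction W^k = H(V^k(sl_3)) *)
    and "universal_affine k V \<iota>"
    and "ghost_system F g"
    and "tensor_va V F C t"
    and d_def: "d = brst_element V \<iota> F g t"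
    and "va_cohomology C d W \<pi>"
    and J_def: "J = \<pi> (J_cocycle V \<iota> F g t)"
    and L_def: "L = \<pi> (L_cocycle k V \<iota> F g t)"
    and "bp_generators k W J Gp Gm L"
    (* M = L_k(a omega_1 + b omega_2), the complex X = M (x) F, and H(M) *)
    and "va_module V YM"
    and "affine_irreducible_hw k (\<lambda>H. of_nat a * omega1 H + of_nat b * omega2 H)
           (\<lambda>A. YM (\<iota> A))"
    and "tensor_module V F C t YM s YX"
    and "module_cohomology C d W \<pi> YX \<rho> YH"
  shows "bp_irreducible_hw W J Gp Gm L x y YH \<and>
         (simple_quotient V Vk pV \<and> simple_quotient W Wk pW \<and>
          bp_irreducible_hw W J Gp Gm L x y YN \<longrightarrow>
          (quotient_module Vk pV YM \<longleftrightarrow> quotient_module Wk pW YN))"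

proof -
  have mod: "va_module V YM" and irrM: "affine_irreducible_hw k (\<lambda>H. of_nat a * omega1 H + of_nat b * omega2 H) (\<lambda>A. YM (\<iota> A))"
    and tm: "tensor_module V F C t YM s YX" and va_coh: "va_cohomology C d W \<pi>" and mc: "module_cohomology C d W \<pi> YX \<rho> YH"
    and bp: "bp_generators k W J Gp Gm L" and k: "k \<noteq> -3" "k \<notin> \<nat>" and ua: "universal_affine k V \<iota>" and gs: "ghost_system F g"
    and tva: "tensor_va V F C t"
    by fact+
  obtain v where v: "v \<noteq> 0" "\<And>A n. A \<in> sl3 \<Longrightarrow> n \<ge> 1 \<Longrightarrow> YM (\<iota> A) n v = 0" "\<And>\<alpha>. YM (\<iota> (root_vector \<alpha>)) 0 v = 0"
      "\<And>H. H \<in> cartan \<Longrightarrow> YM (\<iota> H) 0 v = (of_nat a * omega1 H + of_nat b * omega2 H) *\<^sub>C v"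
    and irr: "irreducible_under {YM (\<iota> A) n | A n. A \<in> sl3}"
    using irrM unfolding affine_irreducible_hw_def by blast
  have sub: "U = {0} \<or> U = UNIV" if "cvs.subspace U" "\<And>A n x. A \<in> sl3 \<Longrightarrow> x \<in> U \<Longrightarrow> YM (\<iota> A) n x \<in> U" for U
  proof -
    have "\<forall>T\<in>{YM (\<iota> A) n | A n. A \<in> sl3}. T ` U \<subseteq> U" using that(2) by auto
    then show ?thesis using irr[unfolded irreducible_under_def, THEN conjunct2, THEN spec, of U] that(1) by simp
  qed
  interpret brst_coh k V \<iota> YM v a b F g C t d YX s W \<pi> \<rho> YH J Gp Gm L
  proof unfold_locales
    show "U = UNIV" if "cvs.subspace U" "v \<in> U" "\<And>A n x. A \<in> sl3 \<Longrightarrow> x \<in> U \<Longrightarrow> YM (\<iota> A) n x \<in> U" for U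
      using sub[OF that(1,3)] that(2) v(1) by blast
    \<comment> \<open>That the differentials square to zero is contained in the hypotheses that the
      cohomologies are given.\<close>
    show "mode C d 0 (mode C d 0 c) = 0" for c using va_coh by (auto simp: va_cohomology_def Let_def cohomology_map_def)
    show "YX d 0 (YX d 0 x) = 0" for x using mc by (auto simp: module_cohomology_def cohomology_map_def)
  qed (use k ua gs tva d_def mod v va_coh mc J_def L_def bp tm in \<open>auto simp: tensor_module_def ghost_system_def\<close>)
  have simple: "U \<subseteq> {0}" if "V_stable U" "v \<notin> U" for U
    using sub[of U] that unfolding V_stable_def by blast
  have "bp_irreducible_hw W J Gp Gm L x y YH"
    unfolding bp_irreducible_hw_def Let_def
    using H.mod H_irreducible[OF simple] vH_nonzero vH_hw[OF x_def y_def] by blast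
  then show ?thesis using quotient_modules_iff[OF _ _ simple x_def y_def] by blast
qed

end
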